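(* (a) The selfadjoint operator $t_v$ associated to $v$ is defined everywhere in $G$ (that is, $G$ is contained in the domain of $t_v$), and $t_v(x)=u(x)$ for every $x\in G$. (b) Let $(E_\lambda)_{\lambda\in\mathbb R}$ be the spectral family of $t_v$ given by $E_\lambda=\varpi(\Omega_\lambda)$, where $\Omega_\lambda=\{b\in B : \lambda_b \text{ is bounded and } {}^\circ\lambda_b\le\lambda\}$. Every $E_\lambda$ preserves the closure $\overline G$ of $G$ in ${}^eF$, and the family $(E_{\lambda|\overline G})$ of the restrictions of the $E_\lambda$ to $\overline G$ is the spectral family of projectors of the closure $\overline u$ of $u$.
   Context: Nonstandard framework. $U$ is a superstructure over a set of atoms, containing $\mathbb C$ and the spaces under consideration, and $a\mapsto{}^*a$ is an enlargement of $U$ in the usual sense of nonstandard analysis (atoms are fixed, the transfer principle holds for bounded-quantifier sentences), assumed $\aleph_1$-saturated. A set is internal if it is an element of some ${}^*a$, $a\in U$. A hypercomplex number $z\in{}^*\mathbb C$ is limited (= bounded) if $|z|<n$ for some standard natural $n$; ${}^\circ z\in\mathbb C$ is its standard part. An internal ${}^*\mathbb C$-vector space is hyperfinite-dimensional if it is internally isomorphic to an element of ${}^*(\mathrm{vss}_f(E))$, where $\mathrm{vss}_f(E)$ is the set of finite-dimensional subspaces of some complex vector space $E\in U$. A hyperhermitian space is an internal hyperfinite-dimensional ${}^*\mathbb C$-vector space with an internal positive-definite sesquilinear form $\langle\,,\rangle$ (antilinear in the first, linear in the second variable); $\|x\|=\sqrt{\langle x,x\rangle}$. An orthonormal hyperbasis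 $B$ of $F$ is an internal orthonormal subset such that $0$ is the only vector orthogonal to all of $B$; it is hyperfinite. Hull. ${}^eF$ is the complex Hilbert space of bounded elements of $F$ (those with $\|x\|$ limited) modulo $x\sim y\iff\|x-y\|$ infinitesimal, with the induced scalar product; the class ${}^\circ x$ of $x$ is its shadow. Loeb spectral measure. $\mathfrak T(B)$ is the $\sigma$-algebra generated by the hyperfinite (= internal) subsets of $B$. For $h={}^\circ x\in{}^eF$, $\nu_h$ is the unique measure on $\mathfrak T(B)$ with $\nu_h(C)={}^\circ\big(\sum_{b\in C}|\langle b,x\rangle|^2\big)$ for $C$ hyperfinite. $\varpi$ is the unique mapping from $\mathfrak T(B)$ to the orthogonal projectors of ${}^eF$ with $\nu_h(C)=\langle h,\varpi(C)h\rangle$ for all $h\in{}^eF$, $C\in\mathfrak T(B)$. The operator $t_v$. For an internal symmetric linear $v:F\to F$, $c_v=(v+iI)(v-iI)^{-1}$ is unitary and induces a unitary operator ${}^ec_v$ on ${}^eF$; ${}^eF_{v,f}$ is the orthogonal complement in ${}^eF$ of the eigenspace of ${}^ec_v$ for the eigenvalue $1$. Let $\Gamma_v\subset F\times F$ be the graph of $v$ and $G_v\subset{}^e(F\times F)={}^eF\times{}^eF$ the set of shadows of bounded elements of $\Gamma_v$. Then $t_v$ is the selfadjoint operator in ${}^eF_{v,f}$ whose graph is $G_v\cap({}^eF_{v,f}\times{}^eF_{v,f})$. The projectors $E_\lambda$ are regarded as projectors in ${}^eF_{v,f}$. Setting. $G\in U$ is a complex vector space with a locally convex topology, $\langle\,,\rangle$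 a continuous scalar product on $G$, and $u:G\to G$ a continuous linear map, symmetric ($\langle u(x),y\rangle=\langle x,u(y)\rangle$) and essentially selfadjoint: the closure of the graph of $u$ in $\widehat G\times\widehat G$ ($\widehat G$ the completion of $G$ for $\langle\,,\rangle$) is the graph of a selfadjoint operator $\overline u$. A scalar product $[\,,]$ on $G$ is nuclear relative to $\langle\,,\rangle$ if there is a constant $K$ with $\sum_{i=1}^n\langle b_i,b_i\rangle\le K$ for every finite $[\,,]$-orthonormal sequence in $G$; it is strongly nuclear relative to $\langle\,,\rangle$ if it is nuclear relative to some scalar product which is itself nuclear relative to $\langle\,,\rangle$. A continuous scalar product $[\,,]$ on $G$, strongly nuclear relative to $\langle\,,\rangle$, is assumed fixed. $F$ is a fixed hyperfinite-dimensional internal subspace of ${}^*G$ containing all ${}^*g$, $g\in G$, with the scalar product $\langle\,,\rangle$ obtained by enlargement. Identify $g\in G$ with ${}^*g\in F$ and with its shadow in ${}^eF$; the closure $\overline G$ of $G$ in ${}^eF$ is a completion of $G$ for $\langle\,,\rangle$. The map $v:F\to F$ sends $x$ to the orthogonal projection of ${}^*u(x)$ onto $F$; it is internal, linear, symmetric and extends $u$. $B$ is an orthonormal hyperbasis of $F$ consisting of eigenvectors of $v$, $\lambda_b\in{}^*\mathbb R$ the eigenvalue of $b\in B$. *)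

theory Defs
  imports "HOL-Analysis.Analysis"
begin

section \<open>Complex vector spaces, scalar products and operators on carrier sets\<close>

record 'a cvs =
  car :: "'a set"
  add :: "'a \<Rightarrow> 'a \<Rightarrow> 'a"
  zer :: 'a
  scl :: "complex \<Rightarrow> 'a \<Rightarrow> 'a"

record 'a ips = "'a cvs" +
  ip :: "'a \<Rightarrow> 'a \<Rightarrow> complex"

definition complex_vector_space :: "('a, 'z) cvs_scheme \<Rightarrow> bool" where
  "complex_vector_space V \<longleftrightarrow>
     zer V \<in> car V \<and>
     (\<forall>x\<in>car V. \<forall>y\<in>car V. add V x y \<in> car V \<and> add V x y = add V y x) \<and>
     (\<forall>x\<in>car V. \<forall>y\<in>car V. \<forall>z\<in>car V. add V (add V x y) z = add V x (add V y z)) \<and>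
     (\<forall>x\<in>car V. add V (zer V) x = x \<and> (\<exists>y\<in>car V. add V x y = zer V)) \<and>
     (\<forall>c. \<forall>x\<in>car V. scl V c x \<in> car V) \<and>
     (\<forall>c. \<forall>x\<in>car V. \<forall>y\<in>car V. scl V c (add V x y) = add V (scl V c x) (scl V c y)) \<and>
     (\<forall>c d. \<forall>x\<in>car V. scl V (c + d) x = add V (scl V c x) (scl V d x) \<and>
        scl V (c * d) x = scl V c (scl V d x)) \<and>
     (\<forall>x\<in>car V. scl V 1 x = x)"

definition sub :: "('a, 'z) cvs_scheme \<Rightarrow> 'a \<Rightarrow> 'a \<Rightarrow> 'a" where
  "sub V x y = add V x (scl V (- 1) y)"

definition subspace_of :: "('a, 'z) cvs_scheme \<Rightarrow> 'a set \<Rightarrow> bool" where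
  "subspace_of V S \<longleftrightarrow> S \<subseteq> car V \<and> zer V \<in> S \<and>
     (\<forall>x\<in>S. \<forall>y\<in>S. add V x y \<in> S) \<and> (\<forall>c. \<forall>x\<in>S. scl V c x \<in> S)"

definition findim_subspace_of :: "('a, 'z) cvs_scheme \<Rightarrow> 'a set \<Rightarrow> bool" where
  "findim_subspace_of V S \<longleftrightarrow> subspace_of V S \<and>
     (\<exists>T. finite T \<and> T \<subseteq> S \<and> (\<forall>S'. subspace_of V S' \<longrightarrow> T \<subseteq> S' \<longrightarrow> S \<subseteq> S'))"

definition linear_map :: "('a, 'y) cvs_scheme \<Rightarrow> ('b, 'z) cvs_scheme \<Rightarrow> ('a \<Rightarrow> 'b) \<Rightarrow> bool" where
  "linear_map V W f \<longleftrightarrow> f ` car V \<subseteq> car W \<and>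
     (\<forall>x\<in>car V. \<forall>y\<in>car V. f (add V x y) = add W (f x) (f y)) \<and>
     (\<forall>c. \<forall>x\<in>car V. f (scl V c x) = scl W c (f x))"

text \<open>Scalar products are antilinear in the first and linear in the second variable.\<close>

definition hermitian_product :: "('a, 'z) cvs_scheme \<Rightarrow> ('a \<Rightarrow> 'a \<Rightarrow> complex) \<Rightarrow> bool" where
  "hermitian_product V s \<longleftrightarrow>
     (\<forall>x\<in>car V. \<forall>y\<in>car V. \<forall>z\<in>car V. s x (add V y z) = s x y + s x z) \<and>
     (\<forall>c. \<forall>x\<in>car V. \<forall>y\<in>car V. s x (scl V c y) = c * s x y) \<and>
     (\<forall>x\<in>car V. \<forall>y\<in>car V. s y x = cnj (s x y)) \<and>
     (\<forall>x\<in>car V. x \<noteq> zer V \<longrightarrow> 0 < Re (s x x))"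

definition prehilbert :: "'a ips \<Rightarrow> bool" where
  "prehilbert H \<longleftrightarrow> complex_vector_space H \<and> hermitian_product H (ip H)"

definition nrm :: "'a ips \<Rightarrow> 'a \<Rightarrow> real" where
  "nrm H x = sqrt (Re (ip H x x))"

definition hilbert :: "'a ips \<Rightarrow> bool" where
  "hilbert H \<longleftrightarrow> prehilbert H \<and>
     (\<forall>x::nat \<Rightarrow> 'a. range x \<subseteq> car H \<longrightarrow>
        (\<forall>e>0. \<exists>n0. \<forall>m\<ge>n0. \<forall>n\<ge>n0. nrm H (sub H (x m) (x n)) < e) \<longrightarrow>
        (\<exists>l\<in>car H. (\<lambda>n. nrm H (sub H (x n) l)) \<longlonglongrightarrow> 0))"

definition closure_in :: "'a ips \<Rightarrow> 'a set \<Rightarrow> 'a set" where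
  "closure_in H A = {x\<in>car H. \<forall>e>0. \<exists>a\<in>A. nrm H (sub H x a) < e}"

definition hilbert_completion :: "'a ips \<Rightarrow> 'c ips \<Rightarrow> ('a \<Rightarrow> 'c) \<Rightarrow> bool" where
  "hilbert_completion V H j \<longleftrightarrow> hilbert H \<and> linear_map V H j \<and>
     (\<forall>x\<in>car V. \<forall>y\<in>car V. ip H (j x) (j y) = ip V x y) \<and>
     closure_in H (j ` car V) = car H"

text \<open>Unbounded operators are represented by their graphs.\<close>

definition closure_graph :: "'a ips \<Rightarrow> ('a \<times> 'a) set \<Rightarrow> ('a \<times> 'a) set" where
  "closure_graph H T = {(x, y). x \<in> car H \<and> y \<in> car H \<and>
     (\<forall>e>0. \<exists>(a, b)\<in>T. nrm H (sub H x a) < e \<and> nrm H (sub H y b) < e)}"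

definition linear_operator :: "'a ips \<Rightarrow> ('a \<times> 'a) set \<Rightarrow> bool" where
  "linear_operator H T \<longleftrightarrow> T \<subseteq> car H \<times> car H \<and> single_valued T \<and> (zer H, zer H) \<in> T \<and>
     (\<forall>(x, y)\<in>T. \<forall>(x', y')\<in>T. (add H x x', add H y y') \<in> T) \<and>
     (\<forall>c. \<forall>(x, y)\<in>T. (scl H c x, scl H c y) \<in> T)"

definition adjoint_graph :: "'a ips \<Rightarrow> ('a \<times> 'a) set \<Rightarrow> ('a \<times> 'a) set" where
  "adjoint_graph H T = {(y, z). y \<in> car H \<and> z \<in> car H \<and> (\<forall>(x, x')\<in>T. ip H y x' = ip H z x)}"

definition selfadjoint :: "'a ips \<Rightarrow> ('a \<times> 'a) set \<Rightarrow> bool" where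
  "selfadjoint H T \<longleftrightarrow> linear_operator H T \<and> closure_in H (Domain T) = car H \<and>
     adjoint_graph H T = T"

definition orth_projector :: "'a ips \<Rightarrow> ('a \<Rightarrow> 'a) \<Rightarrow> bool" where
  "orth_projector H P \<longleftrightarrow> linear_map H H P \<and> (\<forall>x\<in>car H. P (P x) = P x) \<and>
     (\<forall>x\<in>car H. \<forall>y\<in>car H. ip H (P x) y = ip H x (P y))"

text \<open>
  \<open>E\<close> is the right-continuous spectral family of the selfadjoint operator \<open>T\<close>, that is,
  \<open>T = \<integral> t dE\<^sub>t\<close> with its natural domain; \<open>d\<langle>x, E\<^sub>t x\<rangle>\<close> is the Stieltjes measure of
  \<open>t \<mapsto> \<langle>x, E\<^sub>t x\<rangle>\<close>. Since \<open>T\<close> is linear, its quadratic form determines its values.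
\<close>

definition spectral_family :: "'a ips \<Rightarrow> (real \<Rightarrow> 'a \<Rightarrow> 'a) \<Rightarrow> ('a \<times> 'a) set \<Rightarrow> bool" where
  "spectral_family H E T \<longleftrightarrow> selfadjoint H T \<and>
     (\<forall>t. orth_projector H (E t)) \<and>
     (\<forall>s t. s \<le> t \<longrightarrow> (\<forall>x\<in>car H. E s (E t x) = E s x \<and> E t (E s x) = E s x)) \<and>
     (\<forall>x\<in>car H.
        (\<forall>t. ((\<lambda>s. nrm H (sub H (E s x) (E t x))) \<longlongrightarrow> 0) (at_right t)) \<and>
        ((\<lambda>t. nrm H (E t x)) \<longlongrightarrow> 0) at_bot \<and>
        ((\<lambda>t. nrm H (sub H (E t x) x)) \<longlongrightarrow> 0) at_top) \<and>
     Domain T = {x\<in>car H. integrable (interval_measure (\<lambda>t. Re (ip H x (E t x)))) (\<lambda>t. t\<^sup>2)} \<and>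
     (\<forall>(x, y)\<in>T.
        ip H x y = of_real (\<integral>t. t \<partial>interval_measure (\<lambda>t. Re (ip H x (E t x)))))"

section \<open>Locally convex spaces and nuclear scalar products\<close>

definition convex_in :: "('a, 'z) cvs_scheme \<Rightarrow> 'a set \<Rightarrow> bool" where
  "convex_in V S \<longleftrightarrow> (\<forall>x\<in>S. \<forall>y\<in>S. \<forall>t::real. 0 \<le> t \<longrightarrow> t \<le> 1 \<longrightarrow>
     add V (scl V (of_real t) x) (scl V (of_real (1 - t)) y) \<in> S)"

definition locally_convex :: "('a, 'z) cvs_scheme \<Rightarrow> 'a topology \<Rightarrow> bool" where
  "locally_convex V \<tau> \<longleftrightarrow> topspace \<tau> = car V \<and>
     continuous_map (prod_topology \<tau> \<tau>) \<tau> (\<lambda>(x, y). add V x y) \<and>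
     continuous_map (prod_topology euclidean \<tau>) \<tau> (\<lambda>(c, x). scl V c x) \<and>
     (\<forall>S. openin \<tau> S \<longrightarrow> zer V \<in> S \<longrightarrow>
        (\<exists>C. openin \<tau> C \<and> convex_in V C \<and> zer V \<in> C \<and> C \<subseteq> S))"

definition continuous_form :: "'a topology \<Rightarrow> ('a \<Rightarrow> 'a \<Rightarrow> complex) \<Rightarrow> bool" where
  "continuous_form \<tau> s \<longleftrightarrow> continuous_map (prod_topology \<tau> \<tau>) euclidean (\<lambda>(x, y). s x y)"

text \<open>\<open>nuclear_rel V p q\<close>: the scalar product \<open>p\<close> is nuclear relative to \<open>q\<close>.\<close>

definition nuclear_rel ::
  "('a, 'z) cvs_scheme \<Rightarrow> ('a \<Rightarrow> 'a \<Rightarrow> complex) \<Rightarrow> ('a \<Rightarrow> 'a \<Rightarrow> complex) \<Rightarrow> bool" where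
  "nuclear_rel V p q \<longleftrightarrow> (\<exists>K::real. \<forall>n. \<forall>b::nat \<Rightarrow> 'a.
     (\<forall>i<n. b i \<in> car V) \<longrightarrow>
     (\<forall>i<n. \<forall>k<n. p (b i) (b k) = (if i = k then 1 else 0)) \<longrightarrow>
     (\<Sum>i<n. Re (q (b i) (b i))) \<le> K)"

definition strongly_nuclear_rel ::
  "('a, 'z) cvs_scheme \<Rightarrow> ('a \<Rightarrow> 'a \<Rightarrow> complex) \<Rightarrow> ('a \<Rightarrow> 'a \<Rightarrow> complex) \<Rightarrow> bool" where
  "strongly_nuclear_rel V p q \<longleftrightarrow>
     (\<exists>r. hermitian_product V r \<and> nuclear_rel V r q \<and> nuclear_rel V p r)"

section \<open>Superstructures and enlargements\<close>

text \<open>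
  The type \<open>'w\<close> is the superstructure \<open>V(Y)\<close> over a set \<open>Y\<close> (\<open>new_atoms\<close>) of atoms, with
  membership relation \<open>mem\<close>; the superstructure \<open>U = V(X)\<close> over \<open>X \<subseteq> Y\<close> (\<open>atoms\<close>) is a
  transitive part of it, so that \<open>star : V(X) \<rightarrow> V(Y)\<close>, with \<open>Y = star X\<close>, can fix the elements
  of \<open>X\<close> literally. Complex numbers are atoms, through the injection \<open>cnum\<close>.
  (Such a type must have at least \<open>beth_\<omega>\<close> elements; it is therefore described by its axioms.)
\<close>

record 'w universe =
  mem :: "'w \<Rightarrow> 'w \<Rightarrow> bool"
  atoms :: "'w set"
  new_atoms :: "'w set"
  star :: "'w \<Rightarrow> 'w"
  cnum :: "complex \<Rightarrow> 'w"

definition elts :: "'w universe \<Rightarrow> 'w \<Rightarrow> 'w set" where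
  "elts N x = {y. mem N y x}"

primrec level :: "'w universe \<Rightarrow> 'w set \<Rightarrow> nat \<Rightarrow> 'w set" where
  "level N A 0 = A"
| "level N A (Suc n) = A \<union> {x. x \<notin> new_atoms N \<and> elts N x \<subseteq> level N A n}"

definition superstructure :: "'w universe \<Rightarrow> bool" where
  "superstructure N \<longleftrightarrow>
     (\<forall>a\<in>new_atoms N. elts N a = {}) \<and>
     (\<forall>x y. x \<notin> new_atoms N \<longrightarrow> y \<notin> new_atoms N \<longrightarrow> elts N x = elts N y \<longrightarrow> x = y) \<and>
     (\<Union>n. level N (new_atoms N) n) = UNIV \<and>
     (\<forall>n S. S \<subseteq> level N (new_atoms N) n \<longrightarrow> (\<exists>x. x \<notin> new_atoms N \<and> elts N x = S))"

definition standard_universe :: "'w universe \<Rightarrow> 'w set" where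
  "standard_universe N = (\<Union>n. level N (atoms N) n)"

text \<open>The set, as an element of the superstructure, with a given collection of elements.\<close>

definition the_set :: "'w universe \<Rightarrow> 'w set \<Rightarrow> 'w" where
  "the_set N S = (THE x. x \<notin> new_atoms N \<and> elts N x = S)"

text \<open>
  Formulas with bounded quantifiers; \<open>BAll i k p\<close> is \<open>\<forall>v\<^sub>i \<in> v\<^sub>k. p\<close>. As both
  superstructures are transitive for \<open>mem\<close>, one satisfaction relation serves for both. Sentences
  with constants from \<open>U\<close> are formulas together with an environment in \<open>U\<close>.
\<close>

datatype formula = Mem nat nat | Equal nat nat | Neg formula | Conj formula formula
  | BAll nat nat formula

primrec sat :: "'w universe \<Rightarrow> formula \<Rightarrow> (nat \<Rightarrow> 'w) \<Rightarrow> bool" where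
  "sat N (Mem i k) e \<longleftrightarrow> mem N (e i) (e k)"
| "sat N (Equal i k) e \<longleftrightarrow> e i = e k"
| "sat N (Neg p) e \<longleftrightarrow> \<not> sat N p e"
| "sat N (Conj p q) e \<longleftrightarrow> sat N p e \<and> sat N q e"
| "sat N (BAll i k p) e \<longleftrightarrow> (\<forall>x. mem N x (e k) \<longrightarrow> sat N p (e(i := x)))"

definition transfer_principle :: "'w universe \<Rightarrow> bool" where
  "transfer_principle N \<longleftrightarrow>
     (\<forall>p e. range e \<subseteq> standard_universe N \<longrightarrow> (sat N p e \<longleftrightarrow> sat N p (star N \<circ> e)))"

definition internal :: "'w universe \<Rightarrow> 'w \<Rightarrow> bool" where
  "internal N x \<longleftrightarrow> (\<exists>a\<in>standard_universe N. mem N x (star N a))"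

definition enlargement :: "'w universe \<Rightarrow> bool" where
  "enlargement N \<longleftrightarrow> (\<forall>a\<in>standard_universe N.
     (\<forall>T. finite T \<longrightarrow> T \<subseteq> elts N a \<longrightarrow> (\<Inter>b\<in>T. elts N b) \<noteq> {}) \<longrightarrow>
     (\<Inter>b\<in>elts N a. elts N (star N b)) \<noteq> {})"

definition aleph1_saturated :: "'w universe \<Rightarrow> bool" where
  "aleph1_saturated N \<longleftrightarrow> (\<forall>A::nat \<Rightarrow> 'w. (\<forall>n. internal N (A n)) \<longrightarrow>
     (\<forall>n. (\<Inter>i\<le>n. elts N (A i)) \<noteq> {}) \<longrightarrow> (\<Inter>i. elts N (A i)) \<noteq> {})"

definition nonstandard_universe :: "'w universe \<Rightarrow> bool" where
  "nonstandard_universe N \<longleftrightarrow> superstructure N \<and>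
     atoms N \<subseteq> new_atoms N \<and> inj (cnum N) \<and> range (cnum N) \<subseteq> atoms N \<and>
     (\<forall>x\<in>atoms N. star N x = x) \<and> elts N (star N (the_set N (atoms N))) = new_atoms N \<and>
     transfer_principle N \<and> enlargement N \<and> aleph1_saturated N"

section \<open>Functions and hypercomplex numbers\<close>

definition pr :: "'w universe \<Rightarrow> 'w \<Rightarrow> 'w \<Rightarrow> 'w" where
  "pr N x y = the_set N {the_set N {x}, the_set N {x, y}}"

definition graph1 :: "'w universe \<Rightarrow> 'w set \<Rightarrow> ('w \<Rightarrow> 'w) \<Rightarrow> 'w" where
  "graph1 N A f = the_set N {pr N x (f x) |x. x \<in> A}"

definition graph2 :: "'w universe \<Rightarrow> 'w set \<Rightarrow> 'w set \<Rightarrow> ('w \<Rightarrow> 'w \<Rightarrow> 'w) \<Rightarrow> 'w" where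
  "graph2 N A B f = the_set N {pr N (pr N x y) (f x y) |x y. x \<in> A \<and> y \<in> B}"

definition app :: "'w universe \<Rightarrow> 'w \<Rightarrow> 'w \<Rightarrow> 'w" where
  "app N f x = (THE y. mem N (pr N x y) f)"

text \<open>The enlargements of functions \<open>f : A \<rightarrow> U\<close> and \<open>f : A \<times> B \<rightarrow> U\<close>.\<close>

definition star1 :: "'w universe \<Rightarrow> 'w set \<Rightarrow> ('w \<Rightarrow> 'w) \<Rightarrow> 'w \<Rightarrow> 'w" where
  "star1 N A f x = app N (star N (graph1 N A f)) x"

definition star2 :: "'w universe \<Rightarrow> 'w set \<Rightarrow> 'w set \<Rightarrow> ('w \<Rightarrow> 'w \<Rightarrow> 'w) \<Rightarrow> 'w \<Rightarrow> 'w \<Rightarrow> 'w" where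
  "star2 N A B f x y = app N (star N (graph2 N A B f)) (pr N x y)"

definition star_set :: "'w universe \<Rightarrow> 'w set \<Rightarrow> 'w set" where
  "star_set N A = elts N (star N (the_set N A))"

definition cset :: "'w universe \<Rightarrow> 'w set" where
  "cset N = range (cnum N)"

definition cval :: "'w universe \<Rightarrow> 'w \<Rightarrow> complex" where
  "cval N = inv (cnum N)"

definition hcomplex :: "'w universe \<Rightarrow> 'w set" where
  "hcomplex N = star_set N (cset N)"

definition hreal :: "'w universe \<Rightarrow> 'w set" where
  "hreal N = star_set N (cnum N ` \<real>)"

definition hc1 :: "'w universe \<Rightarrow> (complex \<Rightarrow> complex) \<Rightarrow> 'w \<Rightarrow> 'w" where
  "hc1 N f = star1 N (cset N) (\<lambda>z. cnum N (f (cval N z)))"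

definition hc2 :: "'w universe \<Rightarrow> (complex \<Rightarrow> complex \<Rightarrow> complex) \<Rightarrow> 'w \<Rightarrow> 'w \<Rightarrow> 'w" where
  "hc2 N f = star2 N (cset N) (cset N) (\<lambda>z w. cnum N (f (cval N z) (cval N w)))"

definition hless :: "'w universe \<Rightarrow> 'w \<Rightarrow> 'w \<Rightarrow> bool" where
  "hless N x y \<longleftrightarrow> pr N x y \<in> star_set N
     {pr N (cnum N (of_real r)) (cnum N (of_real s)) |r s::real. r < s}"

definition habs :: "'w universe \<Rightarrow> 'w \<Rightarrow> 'w" where
  "habs N = hc1 N (\<lambda>z. of_real (cmod z))"

definition limited :: "'w universe \<Rightarrow> 'w \<Rightarrow> bool" where
  "limited N z \<longleftrightarrow> z \<in> hcomplex N \<and> (\<exists>n::nat. hless N (habs N z) (cnum N (of_nat n)))"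

definition infinitesimal :: "'w universe \<Rightarrow> 'w \<Rightarrow> bool" where
  "infinitesimal N z \<longleftrightarrow> z \<in> hcomplex N \<and>
     (\<forall>e::real. 0 < e \<longrightarrow> hless N (habs N z) (cnum N (of_real e)))"

definition std_part :: "'w universe \<Rightarrow> 'w \<Rightarrow> complex" where
  "std_part N z = (THE c. infinitesimal N (hc2 N (-) z (cnum N c)))"

section \<open>The enlargement of a space and its hyperfinite-dimensional subspaces\<close>

definition vadd :: "'w universe \<Rightarrow> ('w, 'z) cvs_scheme \<Rightarrow> 'w \<Rightarrow> 'w \<Rightarrow> 'w" where
  "vadd N G = star2 N (car G) (car G) (add G)"

definition vscl :: "'w universe \<Rightarrow> ('w, 'z) cvs_scheme \<Rightarrow> 'w \<Rightarrow> 'w \<Rightarrow> 'w" where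
  "vscl N G = star2 N (cset N) (car G) (\<lambda>z x. scl G (cval N z) x)"

definition vsub :: "'w universe \<Rightarrow> ('w, 'z) cvs_scheme \<Rightarrow> 'w \<Rightarrow> 'w \<Rightarrow> 'w" where
  "vsub N G x y = vadd N G x (vscl N G (cnum N (- 1)) y)"

definition vip :: "'w universe \<Rightarrow> 'w ips \<Rightarrow> 'w \<Rightarrow> 'w \<Rightarrow> 'w" where
  "vip N G = star2 N (car G) (car G) (\<lambda>x y. cnum N (ip G x y))"

definition vnorm :: "'w universe \<Rightarrow> 'w ips \<Rightarrow> 'w \<Rightarrow> 'w" where
  "vnorm N G x = hc1 N (\<lambda>z. of_real (sqrt (Re z))) (vip N G x x)"

definition space_in_universe :: "'w universe \<Rightarrow> ('w, 'z) cvs_scheme \<Rightarrow> bool" where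
  "space_in_universe N V \<longleftrightarrow> complex_vector_space V \<and>
     (\<exists>a\<in>standard_universe N. elts N a = car V)"

definition vss_f :: "'w universe \<Rightarrow> ('w, 'z) cvs_scheme \<Rightarrow> 'w" where
  "vss_f N E = the_set N {the_set N S |S. findim_subspace_of E S}"

definition internal_subspace :: "'w universe \<Rightarrow> ('w, 'z) cvs_scheme \<Rightarrow> 'w \<Rightarrow> bool" where
  "internal_subspace N G F \<longleftrightarrow> internal N F \<and> elts N F \<subseteq> star_set N (car G) \<and>
     star N (zer G) \<in> elts N F \<and>
     (\<forall>x\<in>elts N F. \<forall>y\<in>elts N F. vadd N G x y \<in> elts N F) \<and>
     (\<forall>z\<in>hcomplex N. \<forall>x\<in>elts N F. vscl N G z x \<in> elts N F)"

definition hyperfinite_dim :: "'w universe \<Rightarrow> ('w, 'z) cvs_scheme \<Rightarrow> 'w \<Rightarrow> bool" where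
  "hyperfinite_dim N G F \<longleftrightarrow> (\<exists>(E::'w cvs) D f. space_in_universe N E \<and>
     mem N D (star N (vss_f N E)) \<and>
     internal N (graph1 N (elts N F) f) \<and> bij_betw f (elts N F) (elts N D) \<and>
     (\<forall>x\<in>elts N F. \<forall>y\<in>elts N F. f (vadd N G x y) = vadd N E (f x) (f y)) \<and>
     (\<forall>z\<in>hcomplex N. \<forall>x\<in>elts N F. f (vscl N G z x) = vscl N E z (f x)))"

definition orthonormal_hyperbasis :: "'w universe \<Rightarrow> 'w ips \<Rightarrow> 'w \<Rightarrow> 'w \<Rightarrow> bool" where
  "orthonormal_hyperbasis N G F B \<longleftrightarrow> internal N B \<and> elts N B \<subseteq> elts N F \<and>
     (\<forall>b\<in>elts N B. \<forall>c\<in>elts N B. vip N G b c = cnum N (if b = c then 1 else 0)) \<and>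
     (\<forall>x\<in>elts N F. (\<forall>b\<in>elts N B. vip N G b x = cnum N 0) \<longrightarrow> x = star N (zer G))"

text \<open>The map sending \<open>x \<in> F\<close> to the orthogonal projection of \<open>*u(x)\<close> onto \<open>F\<close>.\<close>

definition compression :: "'w universe \<Rightarrow> 'w ips \<Rightarrow> 'w \<Rightarrow> ('w \<Rightarrow> 'w) \<Rightarrow> 'w \<Rightarrow> 'w" where
  "compression N G F u x = (THE y. y \<in> elts N F \<and>
     (\<forall>z\<in>elts N F. vip N G z (vsub N G (star1 N (car G) u x) y) = cnum N 0))"

section \<open>The hull\<close>

definition bounded_elts :: "'w universe \<Rightarrow> 'w ips \<Rightarrow> 'w \<Rightarrow> 'w set" where
  "bounded_elts N G F = {x\<in>elts N F. limited N (vnorm N G x)}"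

definition shadow :: "'w universe \<Rightarrow> 'w ips \<Rightarrow> 'w \<Rightarrow> 'w \<Rightarrow> 'w set" where
  "shadow N G F x = {y\<in>bounded_elts N G F. infinitesimal N (vnorm N G (vsub N G x y))}"

definition rep :: "'w set \<Rightarrow> 'w" where
  "rep h = (SOME x. x \<in> h)"

definition hilbert_hull :: "'w universe \<Rightarrow> 'w ips \<Rightarrow> 'w \<Rightarrow> 'w set ips" where
  "hilbert_hull N G F = \<lparr>
     car = shadow N G F ` bounded_elts N G F,
     add = (\<lambda>h k. shadow N G F (vadd N G (rep h) (rep k))),
     zer = shadow N G F (star N (zer G)),
     scl = (\<lambda>c h. shadow N G F (vscl N G (cnum N c) (rep h))),
     ip = (\<lambda>h k. std_part N (vip N G (rep h) (rep k)))\<rparr>"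

definition hull_map :: "'w universe \<Rightarrow> 'w ips \<Rightarrow> 'w \<Rightarrow> ('w \<Rightarrow> 'w) \<Rightarrow> 'w set \<Rightarrow> 'w set" where
  "hull_map N G F f h = shadow N G F (f (rep h))"

text \<open>The image of \<open>g \<in> G\<close> in the hull, and the closure of \<open>G\<close> there as a Hilbert space.\<close>

definition hull_embed :: "'w universe \<Rightarrow> 'w ips \<Rightarrow> 'w \<Rightarrow> 'w \<Rightarrow> 'w set" where
  "hull_embed N G F g = shadow N G F (star N g)"

definition hull_closure :: "'w universe \<Rightarrow> 'w ips \<Rightarrow> 'w \<Rightarrow> 'w set ips" where
  "hull_closure N G F =
     (hilbert_hull N G F)\<lparr>car := closure_in (hilbert_hull N G F) (hull_embed N G F ` car G)\<rparr>"

section \<open>The selfadjoint operator associated to an internal symmetric map\<close>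

definition cayley :: "'w universe \<Rightarrow> 'w ips \<Rightarrow> 'w \<Rightarrow> ('w \<Rightarrow> 'w) \<Rightarrow> 'w \<Rightarrow> 'w" where
  "cayley N G F v y =
     (let x = (THE x. x \<in> elts N F \<and> vsub N G (v x) (vscl N G (cnum N \<i>) x) = y)
      in vadd N G (v x) (vscl N G (cnum N \<i>) x))"

definition hull_fin :: "'w universe \<Rightarrow> 'w ips \<Rightarrow> 'w \<Rightarrow> ('w \<Rightarrow> 'w) \<Rightarrow> 'w set ips" where
  "hull_fin N G F v = (hilbert_hull N G F)\<lparr>car :=
     {h\<in>car (hilbert_hull N G F). \<forall>k\<in>car (hilbert_hull N G F).
        hull_map N G F (cayley N G F v) k = k \<longrightarrow> ip (hilbert_hull N G F) k h = 0}\<rparr>"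

definition shadow_graph ::
  "'w universe \<Rightarrow> 'w ips \<Rightarrow> 'w \<Rightarrow> ('w \<Rightarrow> 'w) \<Rightarrow> ('w set \<times> 'w set) set" where
  "shadow_graph N G F v = {(shadow N G F x, shadow N G F (v x)) |x.
     x \<in> bounded_elts N G F \<and> v x \<in> bounded_elts N G F}"

definition assoc_op ::
  "'w universe \<Rightarrow> 'w ips \<Rightarrow> 'w \<Rightarrow> ('w \<Rightarrow> 'w) \<Rightarrow> ('w set \<times> 'w set) set" where
  "assoc_op N G F v =
     shadow_graph N G F v \<inter> (car (hull_fin N G F v) \<times> car (hull_fin N G F v))"

section \<open>The Loeb spectral measure\<close>

text \<open>
  The hyperfinite sum of an internal function \<open>f\<close> on a hyperfinite set \<open>C\<close> of elements of \<open>*G\<close>: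
  the value at its graph of the enlargement of ordinary summation, viewed as a map on the set
  of all functions from finite subsets of \<open>G\<close> to the complex numbers.
\<close>

definition finite_functions :: "'w universe \<Rightarrow> ('w, 'z) cvs_scheme \<Rightarrow> 'w set" where
  "finite_functions N G =
     {graph1 N T (\<lambda>a. cnum N (g a)) |T g. finite T \<and> T \<subseteq> car G}"

definition finite_sum :: "'w universe \<Rightarrow> 'w \<Rightarrow> complex" where
  "finite_sum N s = (\<Sum>a\<in>{a. \<exists>y. mem N (pr N a y) s}. cval N (app N s a))"

definition hypersum ::
  "'w universe \<Rightarrow> ('w, 'z) cvs_scheme \<Rightarrow> 'w set \<Rightarrow> ('w \<Rightarrow> 'w) \<Rightarrow> 'w" where
  "hypersum N G C f =
     star1 N (finite_functions N G) (\<lambda>s. cnum N (finite_sum N s)) (graph1 N C f)"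

definition internal_subsets :: "'w universe \<Rightarrow> 'w \<Rightarrow> 'w set set" where
  "internal_subsets N B = {elts N c |c. internal N c \<and> elts N c \<subseteq> elts N B}"

definition loeb_sets :: "'w universe \<Rightarrow> 'w \<Rightarrow> 'w set set" where
  "loeb_sets N B = sigma_sets (elts N B) (internal_subsets N B)"

definition loeb_measure :: "'w universe \<Rightarrow> 'w ips \<Rightarrow> 'w \<Rightarrow> 'w \<Rightarrow> 'w measure \<Rightarrow> bool" where
  "loeb_measure N G B x M \<longleftrightarrow> space M = elts N B \<and> sets M = loeb_sets N B \<and>
     (\<forall>C\<in>internal_subsets N B. emeasure M C = ennreal (Re (std_part N
        (hypersum N G C (\<lambda>b. hc1 N (\<lambda>z. of_real ((cmod z)\<^sup>2)) (vip N G b x))))))"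

text \<open>
  \<open>loeb_spectral_measure N G F B \<nu> varpi\<close>: \<open>\<nu>\<close> is the family of measures \<open>\<nu>\<^sub>h\<close> and \<open>varpi\<close> the
  projection-valued map on \<open>loeb_sets N B\<close>. These conditions determine \<open>\<nu>\<close> and \<open>varpi\<close> uniquely
  on the hull and on \<open>loeb_sets N B\<close>.
\<close>

definition loeb_spectral_measure :: "'w universe \<Rightarrow> 'w ips \<Rightarrow> 'w \<Rightarrow> 'w \<Rightarrow>
    ('w set \<Rightarrow> 'w measure) \<Rightarrow> ('w set \<Rightarrow> 'w set \<Rightarrow> 'w set) \<Rightarrow> bool" where
  "loeb_spectral_measure N G F B \<nu> varpi \<longleftrightarrow>
     (\<forall>x\<in>bounded_elts N G F. loeb_measure N G B x (\<nu> (shadow N G F x))) \<and>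
     (\<forall>C\<in>loeb_sets N B. orth_projector (hilbert_hull N G F) (varpi C) \<and>
        (\<forall>h\<in>car (hilbert_hull N G F). of_real (measure (\<nu> h) C) = ip (hilbert_hull N G F) h (varpi C h)))"

definition eigen_sublevel :: "'w universe \<Rightarrow> 'w \<Rightarrow> ('w \<Rightarrow> 'w) \<Rightarrow> real \<Rightarrow> 'w set" where
  "eigen_sublevel N B \<Lambda> r = {b\<in>elts N B. limited N (\<Lambda> b) \<and> Re (std_part N (\<Lambda> b)) \<le> r}"

end

theory Submission
  imports Defs "HOL-Probability.Distribution_Functions"
begin

text \<open>
  Every internal object is the value at some nonstandard index \<open>\<xi>\<close> of the enlargement of a standard family, and
  the standard sets whose enlargement contains \<open>\<xi>\<close> form an ultrafilter: by transfer, a bounded statement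
  holds for internal objects iff it holds along the ultrafilter for the families that represent them.
  Thus \<open>F\<close>, \<open>B\<close> and \<open>v\<close> are represented by finite-dimensional subspaces of \<open>G\<close> with orthonormal eigenbases
  of the compressions of \<open>u\<close>, and scalar products in the hull are limits along the ultrafilter.

  A bounded function \<open>\<phi>\<close> of the eigenvalues induces an operator \<open>M \<phi>\<close> on the hull. If \<open>\<phi>\<close> is continuous and
  vanishes at infinity, then \<open>\<langle>h, M \<phi> h\<rangle> = \<integral> \<phi> d\<mu>\<^sub>h\<close>, where \<open>\<mu>\<^sub>h\<close> is the image of the Loeb measure under
  the standard part of the limited eigenvalues. The fixed space of the Cayley transform is the kernel of \<open>M (1/(t - \<i>))\<close>,
  so this calculus lives on the orthogonal complement of that space, where \<open>E\<^sub>\<lambda>\<close> is the spectral family of \<open>t\<^sub>v\<close>.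
  Since the graph of \<open>u\<close> lies in the graph of shadows, \<open>t\<^sub>v\<close> extends \<open>u\<close>. Essential selfadjointness of \<open>u\<close>
  makes the ranges of \<open>u \<plusminus> \<i>\<close> dense in the closure of \<open>G\<close>; hence the resolvents of \<open>t\<^sub>v\<close> at \<open>\<plusminus>\<i>\<close> preserve that closure,
  by Stone--Weierstrass so does \<open>M \<phi>\<close> for \<open>\<phi>\<close> as above, and by pointwise limits so does every \<open>E\<^sub>\<lambda>\<close>.
\<close>

text \<open>Three obstacles shape the proof. Eigenvalues may be infinite: if \<open>v b\<close> is
  an infinite multiple c of b, then the point (b / c, b) of the graph has a shadow (0, k) with k
  \<noteq> 0. So the graph of shadows can be multivalued, the measures \<mu>_h can lose mass, and
  only functions vanishing at infinity are given by integrals. Unbounded and discontinuous functions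
  are therefore reached through continuous truncations, and completeness of the graph, which comes
  from saturation, returns the limits of truncated pairs to the graph. The eigenvalue map
  \<open>\<Lambda>\<close> comes without an internal graph. The quotient \<langle>b, u b\<rangle>, a
  standard function of b, replaces it, so that spectral sets can be described index by index.
  Finally, invariance of the closure K of G under the projectors does not yet identify the part of
  \<open>t_v\<close> in K: \<open>t_v\<close> x must lie in K for every x of K in the domain. It
  does, because the truncations of \<open>t_v\<close> x are compactly supported functions of
  \<open>t_v\<close> applied to x. Selfadjointness itself is known in an abstract completion and is
  carried to K by comparing scalar products with elements of G.\<close>

section \<open>Pre-Hilbert spaces on carrier sets: norms, closures, graphs and projectors\<close>

locale prehilb =
  fixes H :: "'a ips"
  assumes prehilbert: "prehilbert H"
begin

lemma zer_in [simp, intro]: "zer H \<in> car H"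
  and add_in [simp, intro]: "x \<in> car H \<Longrightarrow> y \<in> car H \<Longrightarrow> add H x y \<in> car H"
  and scl_in [simp, intro]: "x \<in> car H \<Longrightarrow> scl H c x \<in> car H"
  using prehilbert by (auto simp: prehilbert_def complex_vector_space_def)

lemma sub_in [simp, intro]: "x \<in> car H \<Longrightarrow> y \<in> car H \<Longrightarrow> sub H x y \<in> car H"
  by (simp add: sub_def)

lemma ip_add_right [simp]:
  "x \<in> car H \<Longrightarrow> y \<in> car H \<Longrightarrow> z \<in> car H \<Longrightarrow> ip H x (add H y z) = ip H x y + ip H x z"
  and ip_scl_right [simp]: "x \<in> car H \<Longrightarrow> y \<in> car H \<Longrightarrow> ip H x (scl H c y) = c * ip H x y"
  and ip_cnj: "x \<in> car H \<Longrightarrow> y \<in> car H \<Longrightarrow> ip H y x = cnj (ip H x y)"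
  and ip_pos: "x \<in> car H \<Longrightarrow> x \<noteq> zer H \<Longrightarrow> 0 < Re (ip H x x)"
  using prehilbert unfolding prehilbert_def hermitian_product_def by blast+

lemma ip_add_left [simp]:
  "x \<in> car H \<Longrightarrow> y \<in> car H \<Longrightarrow> z \<in> car H \<Longrightarrow> ip H (add H y z) x = ip H y x + ip H z x"
  and ip_scl_left [simp]: "x \<in> car H \<Longrightarrow> y \<in> car H \<Longrightarrow> ip H (scl H c y) x = cnj c * ip H y x"
  using ip_cnj[of x "add H y z"] ip_cnj[of x y] ip_cnj[of x z] ip_cnj[of x "scl H c y"] by simp_all

lemma ip_zer [simp]:
  assumes "x \<in> car H" shows "ip H x (zer H) = 0" "ip H (zer H) x = 0"
proof -
  have "add H (zer H) (zer H) = zer H"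
    using prehilbert by (auto simp: prehilbert_def complex_vector_space_def)
  then show "ip H x (zer H) = 0" using ip_add_right[OF assms zer_in zer_in] by simp
  then show "ip H (zer H) x = 0" using ip_cnj[OF assms zer_in] by simp
qed

lemma ip_sub_right [simp]:
  "x \<in> car H \<Longrightarrow> y \<in> car H \<Longrightarrow> z \<in> car H \<Longrightarrow> ip H x (sub H y z) = ip H x y - ip H x z"
  and ip_sub_left [simp]:
  "x \<in> car H \<Longrightarrow> y \<in> car H \<Longrightarrow> z \<in> car H \<Longrightarrow> ip H (sub H y z) x = ip H y x - ip H z x"
  by (simp_all add: sub_def)

lemma Re_ip_nonneg: "x \<in> car H \<Longrightarrow> 0 \<le> Re (ip H x x)"
  using ip_pos[of x] by (cases "x = zer H") auto

lemma Im_ip_self [simp]: "x \<in> car H \<Longrightarrow> Im (ip H x x) = 0"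
  using ip_cnj[of x x] by (metis cnj.simps(2) equal_neg_zero)

lemma nrm_nonneg [simp]: "x \<in> car H \<Longrightarrow> 0 \<le> nrm H x"
  by (simp add: nrm_def Re_ip_nonneg)

lemma nrm_sq: "x \<in> car H \<Longrightarrow> (nrm H x)\<^sup>2 = Re (ip H x x)"
  by (simp add: nrm_def Re_ip_nonneg)

lemma ip_self: "x \<in> car H \<Longrightarrow> ip H x x = of_real ((nrm H x)\<^sup>2)"
  by (rule complex_eqI) (simp_all add: nrm_sq)

lemma nrm_eq_0_iff: "x \<in> car H \<Longrightarrow> nrm H x = 0 \<longleftrightarrow> x = zer H"
  using ip_pos[of x] by (cases "x = zer H") (auto simp: nrm_def)

lemma nrm_zer [simp]: "nrm H (zer H) = 0"
  by (simp add: nrm_def)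

text \<open>Cancellation in the additive group, through (x - y) + y. \<open>ip_eqI\<close> rests on
  it, and from there on most identities between vectors are checked by scalar products instead of
  the vector space axioms.\<close>

lemma sub_eq_zer:
  assumes "x \<in> car H" "y \<in> car H" "sub H x y = zer H" shows "x = y"
proof -
  have V: "complex_vector_space H" using prehilbert by (simp add: prehilbert_def)
  have comm: "\<And>x y. x \<in> car H \<Longrightarrow> y \<in> car H \<Longrightarrow> add H x y = add H y x"
    and assoc: "\<And>x y z. x \<in> car H \<Longrightarrow> y \<in> car H \<Longrightarrow> z \<in> car H \<Longrightarrow>
      add H (add H x y) z = add H x (add H y z)"
    and zl: "\<And>x. x \<in> car H \<Longrightarrow> add H (zer H) x = x"
    and dist: "\<And>c d x. x \<in> car H \<Longrightarrow> scl H (c + d) x = add H (scl H c x) (scl H d x)"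
    and one: "\<And>x. x \<in> car H \<Longrightarrow> scl H 1 x = x"
    using V unfolding complex_vector_space_def by blast+
  \<comment> \<open>If it were nonzero it would have positive norm, but sesquilinearity makes that
    norm 0.\<close>
  have y0: "scl H 0 y = zer H"
  proof (rule ccontr)
    assume "scl H 0 y \<noteq> zer H"
    then have "0 < Re (ip H (scl H 0 y) (scl H 0 y))" by (intro ip_pos) (use assms in auto)
    then show False using assms by simp
  qed
  have inv: "add H (scl H (-1) y) y = zer H"
    using dist[of y "-1" 1] one[of y] assms y0 by simp
  have "x = add H x (zer H)" using comm[of x "zer H"] zl[of x] assms by simp
  also have "\<dots> = add H (sub H x y) y"
    using assoc[of x "scl H (-1) y" y] inv assms by (simp add: sub_def)
  also have "\<dots> = y" using assms zl by simp
  finally show ?thesis .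
qed

lemma nrm_sub_eq_0: "x \<in> car H \<Longrightarrow> y \<in> car H \<Longrightarrow> nrm H (sub H x y) = 0 \<Longrightarrow> x = y"
  by (metis nrm_eq_0_iff sub_eq_zer sub_in)

lemma ip_eqI:
  assumes "x \<in> car H" "y \<in> car H" "\<And>k. k \<in> car H \<Longrightarrow> ip H k x = ip H k y" shows "x = y"
proof -
  have "ip H (sub H x y) (sub H x y) = 0"
    using assms(3)[of "sub H x y"] assms(1,2) ip_sub_right[of "sub H x y" x y] by simp
  then have "nrm H (sub H x y) = 0" by (simp only: nrm_def) simp
  then show ?thesis
    using assms(1,2) nrm_sub_eq_0 by blast
qed

lemma sub_self [simp]: "x \<in> car H \<Longrightarrow> sub H x x = zer H"
  by (rule ip_eqI) auto

lemma sub_zer [simp]: "x \<in> car H \<Longrightarrow> sub H x (zer H) = x"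
  by (rule ip_eqI) auto

lemma nrm_sub_sq:
  assumes "x \<in> car H" "y \<in> car H"
  shows "(nrm H (sub H x y))\<^sup>2 = (nrm H x)\<^sup>2 - 2 * Re (ip H x y) + (nrm H y)\<^sup>2"
  using assms ip_cnj[OF assms] by (simp add: nrm_sq)

lemma cauchy_schwarz:
  assumes "x \<in> car H" "y \<in> car H" shows "cmod (ip H x y) \<le> nrm H x * nrm H y"
proof (cases "y = zer H")
  case False
  define n where "n = (nrm H y)\<^sup>2"
  have n: "n > 0" using False assms by (simp add: n_def nrm_eq_0_iff)
  have yy: "ip H y y = of_real n" using assms by (simp add: n_def ip_self)
  define c where "c = ip H y x / of_real n"
  have "0 \<le> Re (ip H (sub H x (scl H c y)) (sub H x (scl H c y)))"
    using assms by (intro Re_ip_nonneg) auto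
  also have "ip H (sub H x (scl H c y)) (sub H x (scl H c y))
     = ip H x x - of_real ((cmod (ip H x y))\<^sup>2 / n)"
  proof -
    have yx: "ip H y x = cnj (ip H x y)" using ip_cnj[OF assms] .
    have "ip H (sub H x (scl H c y)) (sub H x (scl H c y))
      = ip H x x - c * ip H x y - cnj c * (ip H y x - c * of_real n)"
      using assms by (simp add: yy algebra_simps)
    also have "ip H y x - c * of_real n = 0" using n by (simp add: c_def)
    also have "c * ip H x y = of_real ((cmod (ip H x y))\<^sup>2 / n)"
      by (simp add: c_def yx complex_norm_square [symmetric] mult.commute)
    finally show ?thesis by simp
  qed
  finally have "(cmod (ip H x y))\<^sup>2 / n \<le> (nrm H x)\<^sup>2" using assms by (simp add: nrm_sq)
  then have "(cmod (ip H x y))\<^sup>2 \<le> (nrm H x * nrm H y)\<^sup>2"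
    using n by (simp add: n_def field_simps power_mult_distrib)
  then show ?thesis by (rule power2_le_imp_le) (use assms in simp)
qed (use assms in auto)

lemma nrm_add_le:
  assumes "x \<in> car H" "y \<in> car H" shows "nrm H (add H x y) \<le> nrm H x + nrm H y"
proof -
  have "Re (ip H x y) \<le> nrm H x * nrm H y"
    using cauchy_schwarz[OF assms] complex_Re_le_cmod[of "ip H x y"] by linarith
  then have "(nrm H (add H x y))\<^sup>2 \<le> (nrm H x + nrm H y)\<^sup>2"
    using assms ip_cnj[OF assms] by (simp add: nrm_sq power2_sum)
  then show ?thesis by (rule power2_le_imp_le) (use assms in simp)
qed

lemma nrm_scl [simp]: "x \<in> car H \<Longrightarrow> nrm H (scl H c x) = cmod c * nrm H x"
proof -
  assume x: "x \<in> car H"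
  have "(nrm H (scl H c x))\<^sup>2 = (cmod c * nrm H x)\<^sup>2"
    using x by (simp add: nrm_sq power_mult_distrib cmod_power2) (simp add: power2_eq_square algebra_simps)
  then show ?thesis by (rule power2_eq_imp_eq) (use x in simp_all)
qed

lemma nrm_sub_commute: "x \<in> car H \<Longrightarrow> y \<in> car H \<Longrightarrow> nrm H (sub H x y) = nrm H (sub H y x)"
proof -
  assume a: "x \<in> car H" "y \<in> car H"
  have "sub H x y = scl H (-1) (sub H y x)" by (rule ip_eqI) (use a in auto)
  then show ?thesis using a by simp
qed

lemma nrm_triangle:
  assumes "x \<in> car H" "y \<in> car H" "z \<in> car H"
  shows "nrm H (sub H x z) \<le> nrm H (sub H x y) + nrm H (sub H y z)"
proof -
  have "sub H x z = add H (sub H x y) (sub H y z)" by (rule ip_eqI) (use assms in auto)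
  then show ?thesis using assms nrm_add_le by simp
qed

lemma nrm_diff_le:
  assumes "x \<in> car H" "y \<in> car H"
  shows "\<bar>nrm H x - nrm H y\<bar> \<le> nrm H (sub H x y)"
  using nrm_triangle[of x y "zer H"] nrm_triangle[of y x "zer H"] assms nrm_sub_commute[of x y]
  by simp

lemma nrm_sub_add_le:
  assumes "x \<in> car H" "y \<in> car H" "z \<in> car H" "w \<in> car H"
  shows "nrm H (sub H (add H x y) (add H z w)) \<le> nrm H (sub H x z) + nrm H (sub H y w)"
proof -
  have "sub H (add H x y) (add H z w) = add H (sub H x z) (sub H y w)"
    by (rule ip_eqI) (use assms in auto)
  then show ?thesis using assms nrm_add_le by simp
qed

lemma nrm_sub_scl:
  assumes "x \<in> car H" "y \<in> car H"
  shows "nrm H (sub H (scl H c x) (scl H c y)) = cmod c * nrm H (sub H x y)"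
proof -
  have "sub H (scl H c x) (scl H c y) = scl H c (sub H x y)"
    by (rule ip_eqI) (use assms in \<open>auto simp: algebra_simps\<close>)
  then show ?thesis using assms by simp
qed

lemma tendsto_ip_right:
  assumes "((\<lambda>n. nrm H (sub H (x n) l)) \<longlongrightarrow> 0) \<F>" "\<And>n. x n \<in> car H" "l \<in> car H" "k \<in> car H"
  shows "((\<lambda>n. ip H k (x n)) \<longlongrightarrow> ip H k l) \<F>"
proof -
  have lim: "((\<lambda>n. nrm H k * nrm H (sub H (x n) l)) \<longlongrightarrow> 0) \<F>"
    using tendsto_mult_left[OF assms(1), of "nrm H k"] by simp
  have le: "norm (ip H k (x n) - ip H k l) \<le> nrm H k * nrm H (sub H (x n) l)" for n
    using cauchy_schwarz[OF assms(4) sub_in[OF assms(2)[of n] assms(3)]]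
      ip_sub_right[OF assms(4) assms(2)[of n] assms(3)] by simp
  have "((\<lambda>n. ip H k (x n) - ip H k l) \<longlongrightarrow> 0) \<F>"
    by (rule Lim_null_comparison[OF always_eventually lim]) (rule allI, rule le)
  then show ?thesis by (rule LIM_zero_cancel)
qed

lemma tendsto_ip_left:
  assumes "((\<lambda>n. nrm H (sub H (x n) l)) \<longlongrightarrow> 0) \<F>" "\<And>n. x n \<in> car H" "l \<in> car H" "k \<in> car H"
  shows "((\<lambda>n. ip H (x n) k) \<longlongrightarrow> ip H l k) \<F>"
proof -
  have "((\<lambda>n. cnj (ip H k (x n))) \<longlongrightarrow> cnj (ip H k l)) \<F>"
    by (rule tendsto_cnj[OF tendsto_ip_right[OF assms]])
  then show ?thesis by (simp only: ip_cnj[OF assms(4) assms(2)] ip_cnj[OF assms(4) assms(3)])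
qed

text \<open>Choosing approximants within 1/(n+1) turns the epsilon definition into sequences, the
  form in which limits pass through scalar products and bounded operators.\<close>

lemma closure_in_iff:
  assumes "A \<subseteq> car H"
  shows "x \<in> closure_in H A \<longleftrightarrow>
    x \<in> car H \<and> (\<exists>a. (\<forall>n. a n \<in> A) \<and> (\<lambda>n. nrm H (sub H (a n) x)) \<longlonglongrightarrow> 0)" (is "_ \<longleftrightarrow> _ \<and> ?R")
proof safe
  assume x: "x \<in> closure_in H A"
  then show xc: "x \<in> car H" by (simp add: closure_in_def)
  have "\<forall>n. \<exists>a\<in>A. nrm H (sub H x a) < inverse (Suc n)"
    using x by (auto simp: closure_in_def)
  then obtain a where a: "\<And>n. a n \<in> A" "\<And>n. nrm H (sub H x (a n)) < inverse (Suc n)" by metis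
  have ac: "a n \<in> car H" for n using a(1) assms by blast
  have "norm (nrm H (sub H (a n) x)) \<le> inverse (Suc n)" for n
    using a(2)[of n] nrm_sub_commute[OF xc ac[of n]] nrm_nonneg[OF sub_in[OF xc ac[of n]]] by simp
  then have "(\<lambda>n. nrm H (sub H (a n) x)) \<longlonglongrightarrow> 0"
    by (intro Lim_null_comparison[OF always_eventually LIMSEQ_inverse_real_of_nat] allI)
  then show ?R using a by blast
next
  fix a assume xc: "x \<in> car H" and a: "\<forall>n. a n \<in> A" and l: "(\<lambda>n. nrm H (sub H (a n) x)) \<longlonglongrightarrow> 0"
  show "x \<in> closure_in H A" unfolding closure_in_def
  proof safe
    fix e :: real assume "e > 0"
    then have "eventually (\<lambda>n. nrm H (sub H (a n) x) < e) sequentially"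
      using l by (simp add: order_tendstoD)
    then obtain n where "nrm H (sub H (a n) x) < e" by (auto simp: eventually_sequentially)
    then show "\<exists>a\<in>A. nrm H (sub H x a) < e"
      using a xc assms nrm_sub_commute by (metis subsetD)
  qed (rule xc)
qed

lemma closure_in_limit:
  assumes "A \<subseteq> car H" "\<And>n. a n \<in> closure_in H A" "x \<in> car H" "(\<lambda>n. nrm H (sub H (a n) x)) \<longlonglongrightarrow> 0"
  shows "x \<in> closure_in H A"
  unfolding closure_in_def
proof safe
  fix e :: real assume e: "e > 0"
  have "eventually (\<lambda>n. nrm H (sub H (a n) x) < e/2) sequentially"
    by (rule order_tendstoD(2)[OF assms(4)]) (use e in simp)
  then obtain n where n: "nrm H (sub H (a n) x) < e/2" by (auto simp: eventually_sequentially)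
  obtain b where b: "b \<in> A" "nrm H (sub H (a n) b) < e/2"
    using assms(2)[of n] half_gt_zero[OF e] unfolding closure_in_def by blast
  have an: "a n \<in> car H" using assms(2)[of n] by (simp add: closure_in_def)
  have "nrm H (sub H x b) \<le> nrm H (sub H x (a n)) + nrm H (sub H (a n) b)"
    using assms an b by (intro nrm_triangle) auto
  then show "\<exists>a\<in>A. nrm H (sub H x a) < e"
    using n b nrm_sub_commute[OF an assms(3)] by (intro bexI[of _ b]) auto
qed (rule assms)

lemma subset_closure_in: "A \<subseteq> car H \<Longrightarrow> A \<subseteq> closure_in H A"
  by (auto simp: closure_in_def intro!: bexI)

lemma subspace_closure_in:
  assumes "subspace_of H A" shows "subspace_of H (closure_in H A)"
proof -
  have A: "A \<subseteq> car H" using assms by (simp add: subspace_of_def)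
  have 1: "add H x y \<in> closure_in H A" if xy: "x \<in> closure_in H A" "y \<in> closure_in H A" for x y
  proof -
    obtain a where a: "\<And>n. a n \<in> A" "(\<lambda>n. nrm H (sub H (a n) x)) \<longlonglongrightarrow> 0"
      using xy(1) closure_in_iff[OF A] by blast
    obtain b where b: "\<And>n. b n \<in> A" "(\<lambda>n. nrm H (sub H (b n) y)) \<longlonglongrightarrow> 0"
      using xy(2) closure_in_iff[OF A] by blast
    have c: "x \<in> car H" "y \<in> car H" "\<And>n. a n \<in> car H" "\<And>n. b n \<in> car H"
      using xy a b A by (auto simp: closure_in_def)
    have lim: "(\<lambda>n. nrm H (sub H (a n) x) + nrm H (sub H (b n) y)) \<longlonglongrightarrow> 0"
      using tendsto_add[OF a(2) b(2)] by simp
    have "(\<lambda>n. nrm H (sub H (add H (a n) (b n)) (add H x y))) \<longlonglongrightarrow> 0"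
      by (rule Lim_null_comparison[OF always_eventually lim])
         (use c nrm_sub_add_le in simp)
    then show ?thesis using closure_in_iff[OF A] c a b assms
      by (auto simp: subspace_of_def intro!: exI[of _ "\<lambda>n. add H (a n) (b n)"])
  qed
  have 2: "scl H c x \<in> closure_in H A" if x: "x \<in> closure_in H A" for c x
  proof -
    obtain a where a: "\<And>n. a n \<in> A" "(\<lambda>n. nrm H (sub H (a n) x)) \<longlonglongrightarrow> 0"
      using x closure_in_iff[OF A] by blast
    have c: "x \<in> car H" "\<And>n. a n \<in> car H" using x a A by (auto simp: closure_in_def)
    have "(\<lambda>n. cmod c * nrm H (sub H (a n) x)) \<longlonglongrightarrow> cmod c * 0"
      by (rule tendsto_mult_left[OF a(2)])
    then have "(\<lambda>n. nrm H (sub H (scl H c (a n)) (scl H c x))) \<longlonglongrightarrow> 0"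
      using c by (simp add: nrm_sub_scl)
    then show ?thesis using closure_in_iff[OF A] c a assms
      by (auto simp: subspace_of_def intro!: exI[of _ "\<lambda>n. scl H c (a n)"])
  qed
  have "zer H \<in> closure_in H A" using subset_closure_in[OF A] assms by (auto simp: subspace_of_def)
  then show ?thesis using 1 2 by (auto simp: subspace_of_def closure_in_def)
qed

text \<open>The axioms for H provide additive inverses only somewhere in the larger carrier; that
  (-1) x is one keeps them inside K.\<close>

lemma prehilbert_subspace:
  assumes "subspace_of H K" shows "prehilbert (H\<lparr>car := K\<rparr>)"
proof -
  have K: "K \<subseteq> car H" "zer H \<in> K" "\<And>x y. x \<in> K \<Longrightarrow> y \<in> K \<Longrightarrow> add H x y \<in> K"
    "\<And>c x. x \<in> K \<Longrightarrow> scl H c x \<in> K" using assms by (auto simp: subspace_of_def)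
  have V: "complex_vector_space H" using prehilbert by (simp add: prehilbert_def)
  have inv: "\<exists>y\<in>K. add H x y = zer H" if "x \<in> K" for x
  proof -
    have "add H x (scl H (-1) x) = zer H" by (rule ip_eqI) (use that K in \<open>auto\<close>)
    then show ?thesis using K that by blast
  qed
  have "complex_vector_space (H\<lparr>car := K\<rparr>)"
    unfolding complex_vector_space_def
  proof (intro conjI ballI allI)
    have mem: "x \<in> car H" if "x \<in> K" for x using K that by blast
    note V' = V[unfolded complex_vector_space_def]
    show "zer (H\<lparr>car := K\<rparr>) \<in> car (H\<lparr>car := K\<rparr>)" using K by simp
    fix x y z c d assume x: "x \<in> car (H\<lparr>car := K\<rparr>)"
    then have x': "x \<in> K" "x \<in> car H" using mem by auto
    show "add (H\<lparr>car := K\<rparr>) (zer (H\<lparr>car := K\<rparr>)) x = x"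
    proof -
      have "add H (zer H) x = x" using x' V' by blast
      then show ?thesis by simp
    qed
    show "\<exists>y\<in>car (H\<lparr>car := K\<rparr>). add (H\<lparr>car := K\<rparr>) x y = zer (H\<lparr>car := K\<rparr>)" using inv x' by simp
    show "scl (H\<lparr>car := K\<rparr>) c x \<in> car (H\<lparr>car := K\<rparr>)" using K x' by simp
    show "scl (H\<lparr>car := K\<rparr>) 1 x = x" using x' V' by simp
    show "scl (H\<lparr>car := K\<rparr>) (c + d) x = add (H\<lparr>car := K\<rparr>) (scl (H\<lparr>car := K\<rparr>) c x) (scl (H\<lparr>car := K\<rparr>) d x)"
      "scl (H\<lparr>car := K\<rparr>) (c * d) x = scl (H\<lparr>car := K\<rparr>) c (scl (H\<lparr>car := K\<rparr>) d x)"
      using x' V' by simp_all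
    assume "y \<in> car (H\<lparr>car := K\<rparr>)"
    then have y': "y \<in> K" "y \<in> car H" using mem by auto
    show "add (H\<lparr>car := K\<rparr>) x y \<in> car (H\<lparr>car := K\<rparr>)" using K x' y' by simp
    have "add H x y = add H y x" using x' y' V' by blast
    then show "add (H\<lparr>car := K\<rparr>) x y = add (H\<lparr>car := K\<rparr>) y x" by simp
    show "scl (H\<lparr>car := K\<rparr>) c (add (H\<lparr>car := K\<rparr>) x y) =
      add (H\<lparr>car := K\<rparr>) (scl (H\<lparr>car := K\<rparr>) c x) (scl (H\<lparr>car := K\<rparr>) c y)"
      using x' y' V' by simp
    assume "z \<in> car (H\<lparr>car := K\<rparr>)"
    then have "z \<in> car H" using mem by auto
    then have "add H (add H x y) z = add H x (add H y z)" using x' y' V' by blast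
    then show "add (H\<lparr>car := K\<rparr>) (add (H\<lparr>car := K\<rparr>) x y) z =
      add (H\<lparr>car := K\<rparr>) x (add (H\<lparr>car := K\<rparr>) y z)" by simp
  qed
  moreover have "hermitian_product (H\<lparr>car := K\<rparr>) (ip H)"
    unfolding hermitian_product_def
  proof (intro conjI ballI allI impI)
    have mem: "x \<in> car H" if "x \<in> K" for x using K that by blast
    fix x y assume "x \<in> car (H\<lparr>car := K\<rparr>)" "y \<in> car (H\<lparr>car := K\<rparr>)"
    then have xy: "x \<in> car H" "y \<in> car H" using mem by auto
    then show "ip H y x = cnj (ip H x y)" by (rule ip_cnj)
    show "ip H x (scl (H\<lparr>car := K\<rparr>) c y) = c * ip H x y" for c using xy by simp
    show "ip H x (add (H\<lparr>car := K\<rparr>) y z) = ip H x y + ip H x z" if "z \<in> car (H\<lparr>car := K\<rparr>)" for z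
      using xy mem that by simp
  next
    fix x assume "x \<in> car (H\<lparr>car := K\<rparr>)" "x \<noteq> zer (H\<lparr>car := K\<rparr>)"
    then show "0 < Re (ip H x x)" using ip_pos K by auto
  qed
  ultimately show ?thesis by (simp add: prehilbert_def)
qed

text \<open>Measures give only the quadratic forms \<langle>h, A h\<rangle>; polarization recovers
  the sesquilinear form from them. The signs of the imaginary terms reflect antilinearity in the
  first variable.\<close>

lemma Re_ip_polarization:
  assumes "x \<in> car H" "y \<in> car H" "\<And>z. z \<in> car H \<Longrightarrow> A z \<in> car H"
    "\<And>z w. z \<in> car H \<Longrightarrow> w \<in> car H \<Longrightarrow> A (add H z w) = add H (A z) (A w)"
    "\<And>c z. z \<in> car H \<Longrightarrow> A (scl H c z) = scl H c (A z)"
  defines "q \<equiv> \<lambda>z. ip H z (A z)"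
  shows "4 * ip H x (A y) = q (add H x y) - q (add H x (scl H (-1) y))
     - \<i> * q (add H x (scl H \<i> y)) + \<i> * q (add H x (scl H (-\<i>) y))"
  using assms(1-3) unfolding q_def by (simp add: assms(4,5) algebra_simps)

end

lemma subspace_cong [simp]:
  "nrm (H\<lparr>car := K\<rparr>) = nrm H" "sub (H\<lparr>car := K\<rparr>) = sub H"
  by (auto simp: fun_eq_iff nrm_def sub_def)

text \<open>A subspace of a Hilbert space with trivial orthogonal complement is dense: the limit of a
  minimizing sequence for the distance from \<open>y\<close> is the orthogonal projection of \<open>y\<close>.\<close>

lemma hilbert_dense_subspace:
  assumes "hilbert H" "subspace_of H L"
    and triv: "\<And>w. w \<in> car H \<Longrightarrow> (\<forall>l\<in>L. ip H l w = 0) \<Longrightarrow> w = zer H"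
  shows "closure_in H L = car H"
proof -
  interpret prehilb H using assms(1) by (simp add: prehilb_def hilbert_def)
  have L: "L \<subseteq> car H" "zer H \<in> L" "\<And>x y. x \<in> L \<Longrightarrow> y \<in> L \<Longrightarrow> add H x y \<in> L"
    "\<And>c x. x \<in> L \<Longrightarrow> scl H c x \<in> L" using assms(2) by (auto simp: subspace_of_def)
  have "y \<in> closure_in H L" if y: "y \<in> car H" for y
  proof -
    define S where "S = (\<lambda>l. (nrm H (sub H y l))\<^sup>2) ` L"
    define d where "d = Inf S"
    have S: "S \<noteq> {}" "bdd_below S" using L by (auto simp: S_def intro: bdd_belowI2[of _ 0])
    have d_le: "d \<le> (nrm H (sub H y l))\<^sup>2" if "l \<in> L" for l
      using S that by (auto simp: d_def S_def intro: cInf_lower)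
    have "\<exists>l\<in>L. (nrm H (sub H y l))\<^sup>2 < d + inverse (Suc n)" for n
      using cInf_lessD[OF S(1), of "d + inverse (Suc n)"] by (auto simp: d_def S_def)
    then obtain l where l: "\<And>n. l n \<in> L" "\<And>n. (nrm H (sub H y (l n)))\<^sup>2 < d + inverse (Suc n)"
      by metis
    have lc: "\<And>n. l n \<in> car H" using l L by auto
    \<comment> \<open>Parallelogram law: the midpoint p lies in L, so its distance from y is at
      least the infimum, which forces the minimizing sequence to be Cauchy.\<close>
    have par: "(nrm H (sub H (l m) (l n)))\<^sup>2 \<le> 2 * inverse (Suc m) + 2 * inverse (Suc n)" for m n
    proof -
      define p where "p = scl H (1/2) (add H (l m) (l n))"
      have "p \<in> L" using L l by (auto simp: p_def)
      have "(nrm H (sub H (l m) (l n)))\<^sup>2 =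
         2 * (nrm H (sub H y (l m)))\<^sup>2 + 2 * (nrm H (sub H y (l n)))\<^sup>2 - 4 * (nrm H (sub H y p))\<^sup>2"
        using y lc[of m] lc[of n] by (simp add: nrm_sq p_def algebra_simps)
      then show ?thesis using d_le[OF \<open>p \<in> L\<close>] l(2)[of m] l(2)[of n] by linarith
    qed
    have "\<exists>n0. \<forall>m\<ge>n0. \<forall>n\<ge>n0. nrm H (sub H (l m) (l n)) < e" if e: "e > 0" for e :: real
    proof -
      obtain n0 where n0: "inverse (real (Suc n0)) < e\<^sup>2 / 4"
        using reals_Archimedean[of "e\<^sup>2/4"] e by auto
      have "nrm H (sub H (l m) (l n)) < e" if mn: "m \<ge> n0" "n \<ge> n0" for m n
      proof -
        have "inverse (real (Suc m)) \<le> inverse (real (Suc n0))"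
             "inverse (real (Suc n)) \<le> inverse (real (Suc n0))"
          using mn by (auto intro!: le_imp_inverse_le)
        then have "(nrm H (sub H (l m) (l n)))\<^sup>2 < e\<^sup>2" using par[of m n] n0 by linarith
        then show ?thesis by (rule power_less_imp_less_base) (use e in simp)
      qed
      then show ?thesis by blast
    qed
    then obtain z where z: "z \<in> car H" "(\<lambda>n. nrm H (sub H (l n) z)) \<longlonglongrightarrow> 0"
      using assms(1) lc unfolding hilbert_def by (metis image_subset_iff)
    define w where "w = sub H y z"
    have w: "w \<in> car H" using y z by (simp add: w_def)
    have w_lim: "(\<lambda>n. (nrm H (sub H y (l n)))\<^sup>2) \<longlonglongrightarrow> (nrm H w)\<^sup>2"
    proof -
      have "(\<lambda>n. nrm H (sub H y (l n)) - nrm H w) \<longlonglongrightarrow> 0"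
      proof (rule Lim_null_comparison[OF _ z(2)], rule always_eventually, rule allI)
        fix n
        have "sub H (sub H y (l n)) w = sub H z (l n)"
          by (rule ip_eqI) (use y z lc[of n] in \<open>auto simp: w_def\<close>)
        then show "norm (nrm H (sub H y (l n)) - nrm H w) \<le> nrm H (sub H (l n) z)"
          using nrm_diff_le[of "sub H y (l n)" w] y z lc[of n] w nrm_sub_commute[OF lc[of n] z(1)] by simp
      qed
      then show ?thesis by (intro tendsto_power) (rule LIM_zero_cancel)
    qed
    have d_eq: "(nrm H w)\<^sup>2 \<le> d"
    proof (rule LIMSEQ_le[OF w_lim])
      show "(\<lambda>n. d + inverse (real (Suc n))) \<longlonglongrightarrow> d"
        using tendsto_add[OF tendsto_const LIMSEQ_inverse_real_of_nat] by simp
    qed (use l(2) less_imp_le in blast)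
    \<comment> \<open>Translating the minimizing sequence by k stays in L, so w has the least norm
      in its coset modulo L.\<close>
    have ge: "(nrm H w)\<^sup>2 \<le> (nrm H (sub H w k))\<^sup>2" if k: "k \<in> L" for k
    proof -
      have "(nrm H w)\<^sup>2 \<le> (nrm H (sub H y (add H (l n) k)))\<^sup>2" for n
        using d_le[of "add H (l n) k"] L l k d_eq by force
      moreover have "(\<lambda>n. (nrm H (sub H y (add H (l n) k)))\<^sup>2) \<longlonglongrightarrow> (nrm H (sub H w k))\<^sup>2"
      proof -
        have kc: "k \<in> car H" using k L by auto
        have "(\<lambda>n. nrm H (sub H y (add H (l n) k)) - nrm H (sub H w k)) \<longlonglongrightarrow> 0"
        proof (rule Lim_null_comparison[OF _ z(2)], rule always_eventually, rule allI)
          fix n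
          have "sub H (sub H y (add H (l n) k)) (sub H w k) = sub H z (l n)"
            by (rule ip_eqI) (use y z lc[of n] kc in \<open>auto simp: w_def\<close>)
          then show "norm (nrm H (sub H y (add H (l n) k)) - nrm H (sub H w k)) \<le> nrm H (sub H (l n) z)"
            using nrm_diff_le[of "sub H y (add H (l n) k)" "sub H w k"] y z lc[of n] w kc
              nrm_sub_commute[OF lc[of n] z(1)]
            by simp
        qed
        then show ?thesis by (intro tendsto_power) (rule LIM_zero_cancel)
      qed
      ultimately show ?thesis by (meson LIMSEQ_le_const)
    qed
    have "ip H k w = 0" if k: "k \<in> L" for k
    proof (cases "k = zer H")
      case False
      have kc: "k \<in> car H" using k L by auto
      define n where "n = (nrm H k)\<^sup>2"
      have n: "n > 0" using False kc by (simp add: n_def nrm_eq_0_iff)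
      \<comment> \<open>The Fourier coefficient of w along k: removing c k lowers the squared norm
        by |\<langle>k, w\<rangle>|^2 / |k|^2, which minimality forbids unless \<langle>k,
        w\<rangle> = 0.\<close>
      define c where "c = ip H k w / of_real n"
      have "(nrm H (sub H w (scl H c k)))\<^sup>2 = (nrm H w)\<^sup>2 - (cmod (ip H k w))\<^sup>2 / n"
      proof -
        have wk: "ip H w k = cnj (ip H k w)" using ip_cnj[OF kc w] .
        have kk: "(nrm H (scl H c k))\<^sup>2 = (cmod (ip H k w))\<^sup>2 / n"
          using n kc by (simp add: c_def n_def[symmetric] power_mult_distrib norm_divide power_divide power2_eq_square field_simps)
            (simp add: n_def power2_eq_square)
        have "ip H w (scl H c k) = of_real ((cmod (ip H k w))\<^sup>2 / n)"
          using w kc by (simp add: c_def wk complex_norm_square [symmetric])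
        then show ?thesis using nrm_sub_sq[OF w scl_in[OF kc, of c]] kk by simp
      qed
      then have "(cmod (ip H k w))\<^sup>2 / n \<le> 0" using ge[of "scl H c k"] L k by force
      then show ?thesis using n by (simp add: divide_le_0_iff)
    qed (use w in auto)
    then have "w = zer H" using triv w by blast
    then have "y = z" using sub_eq_zer y z by (simp add: w_def)
    then show ?thesis using closure_in_iff[OF L(1)] y z l by blast
  qed
  then show ?thesis by (auto simp: closure_in_def)
qed

definition cauchy_seq :: "'a ips \<Rightarrow> (nat \<Rightarrow> 'a) \<Rightarrow> bool" where
  "cauchy_seq H x \<longleftrightarrow> (\<forall>e>0. \<exists>n0. \<forall>m\<ge>n0. \<forall>n\<ge>n0. nrm H (sub H (x m) (x n)) < e)"

context prehilb begin

lemma tendsto_cauchy_seq: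
  assumes "\<And>n. x n \<in> car H" "l \<in> car H" "(\<lambda>n. nrm H (sub H (x n) l)) \<longlonglongrightarrow> 0"
  shows "cauchy_seq H x"
  unfolding cauchy_seq_def
proof safe
  fix e :: real assume "e > 0"
  then have "eventually (\<lambda>n. nrm H (sub H (x n) l) < e/2) sequentially"
    by (intro order_tendstoD(2)[OF assms(3)]) simp
  then obtain n0 where n0: "\<And>n. n \<ge> n0 \<Longrightarrow> nrm H (sub H (x n) l) < e/2"
    by (auto simp: eventually_sequentially)
  have "nrm H (sub H (x m) (x n)) < e" if "m \<ge> n0" "n \<ge> n0" for m n
    using nrm_triangle[OF assms(1)[of m] assms(2) assms(1)[of n]] n0[OF that(1)] n0[OF that(2)]
      nrm_sub_commute[OF assms(1)[of n] assms(2)] by linarith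
  then show "\<exists>n0. \<forall>m\<ge>n0. \<forall>n\<ge>n0. nrm H (sub H (x m) (x n)) < e" by blast
qed

lemma limit_unique:
  assumes "\<And>n. x n \<in> car H" "l \<in> car H" "l' \<in> car H"
    and "(\<lambda>n. nrm H (sub H (x n) l)) \<longlonglongrightarrow> 0" "(\<lambda>n. nrm H (sub H (x n) l')) \<longlonglongrightarrow> 0"
  shows "l = l'"
proof (rule ip_eqI[OF assms(2,3)])
  fix k assume "k \<in> car H"
  then show "ip H k l = ip H k l'"
    by (intro LIMSEQ_unique[OF tendsto_ip_right[OF assms(4,1,2)] tendsto_ip_right[OF assms(5,1,3)]])
qed

lemma orth_projector_in: "orth_projector H P \<Longrightarrow> x \<in> car H \<Longrightarrow> P x \<in> car H"
  by (auto simp: orth_projector_def linear_map_def)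

lemma orth_projector_ip:
  assumes "orth_projector H P" "x \<in> car H" shows "ip H (P x) (P x) = ip H x (P x)"
  using assms orth_projector_in[OF assms] unfolding orth_projector_def by metis

text \<open>For projectors the order of the quadratic forms is the order of the ranges:
  \<open>\<parallel>(1 - Q) P x\<parallel>\<^sup>2 = \<parallel>P x\<parallel>\<^sup>2 - \<langle>P x, Q P x\<rangle> \<le> 0\<close>.\<close>

lemma orth_projector_mono:
  assumes P: "orth_projector H P" and Q: "orth_projector H Q"
    and le: "\<And>h. h \<in> car H \<Longrightarrow> Re (ip H h (P h)) \<le> Re (ip H h (Q h))"
    and x: "x \<in> car H"
  shows "Q (P x) = P x" "P (Q x) = P x"
proof -
  have QP: "Q (P x) = P x" if x: "x \<in> car H" for x
  proof -
    have Px: "P x \<in> car H" and QPx: "Q (P x) \<in> car H"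
      using P Q x orth_projector_in by blast+
    have "(nrm H (sub H (P x) (Q (P x))))\<^sup>2 = Re (ip H (P x) (P x)) - Re (ip H (P x) (Q (P x)))"
      using nrm_sub_sq[OF Px QPx] nrm_sq[OF QPx] orth_projector_ip[OF Q Px] nrm_sq[OF Px] by simp
    also have "P x = P (P x)" using P x by (simp add: orth_projector_def)
    then have "Re (ip H (P x) (P x)) - Re (ip H (P x) (Q (P x))) \<le> 0" using le[OF Px] by simp
    finally have "nrm H (sub H (P x) (Q (P x))) = 0" by simp
    then show ?thesis using nrm_sub_eq_0[OF Px QPx] by simp
  qed
  show "Q (P x) = P x" using QP x .
  show "P (Q x) = P x"
  proof (rule ip_eqI)
    fix k assume k: "k \<in> car H"
    have "ip H k (P (Q x)) = ip H (Q (P k)) x"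
      using P Q x k orth_projector_in unfolding orth_projector_def by metis
    then show "ip H k (P (Q x)) = ip H k (P x)"
      using QP[OF k] P x k by (simp add: orth_projector_def)
  qed (use P Q x orth_projector_in in blast)+
qed

lemma closure_graph_iff:
  assumes "T \<subseteq> car H \<times> car H"
  shows "(x, y) \<in> closure_graph H T \<longleftrightarrow> x \<in> car H \<and> y \<in> car H \<and>
    (\<exists>a b. (\<forall>n. (a n, b n) \<in> T) \<and> (\<lambda>n. nrm H (sub H (a n) x)) \<longlonglongrightarrow> 0 \<and>
       (\<lambda>n. nrm H (sub H (b n) y)) \<longlonglongrightarrow> 0)" (is "_ \<longleftrightarrow> _ \<and> _ \<and> ?R")
proof safe
  assume xy: "(x, y) \<in> closure_graph H T"
  then show xc: "x \<in> car H" and yc: "y \<in> car H" by (auto simp: closure_graph_def)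
  have "\<forall>n. \<exists>a b. (a, b) \<in> T \<and> nrm H (sub H x a) < inverse (Suc n) \<and> nrm H (sub H y b) < inverse (Suc n)"
  proof
    fix n
    have "inverse (real (Suc n)) > 0" by simp
    then show "\<exists>a b. (a, b) \<in> T \<and> nrm H (sub H x a) < inverse (Suc n) \<and> nrm H (sub H y b) < inverse (Suc n)"
      using xy unfolding closure_graph_def by blast
  qed
  then obtain a b where ab: "\<And>n. (a n, b n) \<in> T" "\<And>n. nrm H (sub H x (a n)) < inverse (Suc n)"
    "\<And>n. nrm H (sub H y (b n)) < inverse (Suc n)" by metis
  have c: "a n \<in> car H" "b n \<in> car H" for n using ab(1) assms by blast+
  have "norm (nrm H (sub H (a n) x)) \<le> inverse (Suc n)" for n
    using ab(2)[of n] nrm_sub_commute[OF xc c(1)[of n]] nrm_nonneg[OF sub_in[OF xc c(1)[of n]]] by simp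
  then have 1: "(\<lambda>n. nrm H (sub H (a n) x)) \<longlonglongrightarrow> 0"
    by (intro Lim_null_comparison[OF always_eventually LIMSEQ_inverse_real_of_nat] allI)
  have "norm (nrm H (sub H (b n) y)) \<le> inverse (Suc n)" for n
    using ab(3)[of n] nrm_sub_commute[OF yc c(2)[of n]] nrm_nonneg[OF sub_in[OF yc c(2)[of n]]] by simp
  then have 2: "(\<lambda>n. nrm H (sub H (b n) y)) \<longlonglongrightarrow> 0"
    by (intro Lim_null_comparison[OF always_eventually LIMSEQ_inverse_real_of_nat] allI)
  show ?R using ab(1) 1 2 by blast
next
  fix a b assume xc: "x \<in> car H" and yc: "y \<in> car H" and ab: "\<forall>n. (a n, b n) \<in> T"
    and l: "(\<lambda>n. nrm H (sub H (a n) x)) \<longlonglongrightarrow> 0" "(\<lambda>n. nrm H (sub H (b n) y)) \<longlonglongrightarrow> 0"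
  have c: "a n \<in> car H" "b n \<in> car H" for n using ab assms by blast+
  have "\<exists>(a, b)\<in>T. nrm H (sub H x a) < e \<and> nrm H (sub H y b) < e" if "e > 0" for e :: real
  proof -
    have "eventually (\<lambda>n. nrm H (sub H (a n) x) < e \<and> nrm H (sub H (b n) y) < e) sequentially"
      using order_tendstoD(2)[OF l(1) that] order_tendstoD(2)[OF l(2) that] by (rule eventually_conj)
    then obtain n where "nrm H (sub H (a n) x) < e \<and> nrm H (sub H (b n) y) < e"
      by (auto simp: eventually_sequentially)
    then show ?thesis
      using ab nrm_sub_commute[OF xc c(1)[of n]] nrm_sub_commute[OF yc c(2)[of n]]
      by (intro bexI[of _ "(a n, b n)"]) auto
  qed
  then show "(x, y) \<in> closure_graph H T" using xc yc by (auto simp: closure_graph_def)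
qed

text \<open>The relation \<langle>y, b\<rangle> = \<langle>z, a\<rangle> is preserved by limits in
  (a, b). Hence selfadjointness of the closure can be exploited by testing on the original graph
  alone.\<close>

lemma adjoint_closure_graph:
  assumes T: "T \<subseteq> car H \<times> car H"
  shows "adjoint_graph H (closure_graph H T) = adjoint_graph H T"
proof -
  have sub: "(x, x') \<in> closure_graph H T" if t: "(x, x') \<in> T" for x x'
  proof -
    have c: "x \<in> car H" "x' \<in> car H" using T t by auto
    show ?thesis
      unfolding closure_graph_iff[OF T]
      by (intro conjI c, rule exI[of _ "\<lambda>_. x"], rule exI[of _ "\<lambda>_. x'"]) (use t c in simp)
  qed
  have 1: "(y, z) \<in> adjoint_graph H T" if yz: "(y, z) \<in> adjoint_graph H (closure_graph H T)" for y z
    using yz sub unfolding adjoint_graph_def by blast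
  have 2: "(y, z) \<in> adjoint_graph H (closure_graph H T)" if yz: "(y, z) \<in> adjoint_graph H T" for y z
  proof -
  have c: "y \<in> car H" "z \<in> car H" using yz by (auto simp: adjoint_graph_def)
  have "ip H y x' = ip H z x" if xx: "(x, x') \<in> closure_graph H T" for x x'
  proof -
    obtain a b where x: "x \<in> car H" "x' \<in> car H" and ab: "\<And>n. (a n, b n) \<in> T"
      and l: "(\<lambda>n. nrm H (sub H (a n) x)) \<longlonglongrightarrow> 0" "(\<lambda>n. nrm H (sub H (b n) x')) \<longlonglongrightarrow> 0"
      using xx unfolding closure_graph_iff[OF T] by blast
    have abc: "a n \<in> car H" "b n \<in> car H" for n using ab T by blast+
    have eq: "ip H y (b n) = ip H z (a n)" for n using yz ab[of n] by (auto simp: adjoint_graph_def)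
    show ?thesis
      using LIMSEQ_unique[OF tendsto_ip_right[OF l(2) abc(2) x(2) c(1), unfolded eq]
        tendsto_ip_right[OF l(1) abc(1) x(1) c(2)]] .
  qed
  then show ?thesis using c by (auto simp: adjoint_graph_def)
  qed
  show ?thesis using 1 2 by auto
qed

end

section \<open>Stieltjes measures and test functions on the real line\<close>

text \<open>Links the Stieltjes measures in the definition of \<open>spectral_family\<close> with
  the image of the Loeb measure. The two sides agree on half-open intervals, an intersection-stable
  generator of the Borel sets.\<close>

lemma interval_measure_cdf:
  assumes "finite_borel_measure M" shows "interval_measure (cdf M) = M"
proof (rule sym, rule measure_eqI_generator_eq[where \<Omega>=UNIV])
  interpret finite_borel_measure M by fact
  fix X assume "X \<in> range (\<lambda>(a, b). {a<..b::real})"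
  then obtain a b where X: "X = {a<..b}" by auto
  show "emeasure M X = emeasure (interval_measure (cdf M)) X"
  proof (cases "a \<le> b")
    case True
    have "emeasure (interval_measure (cdf M)) {a<..b} = ennreal (cdf M b - cdf M a)"
      by (rule emeasure_interval_measure_Ioc[OF True])
        (auto intro: cdf_nondecreasing cdf_is_right_cont)
    then show ?thesis using emeasure_Ioc[OF True] by (simp add: X)
  qed (simp add: X)
next
  show "(\<Union>i. {- real (i::nat)<..real i}) = UNIV" by (rule UN_Ioc_eq_UNIV)
qed (auto simp: finite_borel_measure.emeasure_Ioc[OF assms] finite_borel_measure.M_is_borel[OF assms]
  borel_sigma_sets_Ioc Int_stable_def)

definition resolvent :: "complex \<Rightarrow> real \<Rightarrow> complex" where
  "resolvent s t = 1 / (of_real t - s)"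

text \<open>A trapezoid: 1 on [-n, n], 0 outside [-n-1, n+1], linear between. It replaces the
  indicator of [-n, n] because the integral formula for operators covers only continuous
  functions.\<close>

definition plateau :: "nat \<Rightarrow> real \<Rightarrow> real" where
  "plateau n t = max 0 (min 1 (real n + 1 - \<bar>t\<bar>))"

lemma plateau_bounds [simp]: "0 \<le> plateau n t" "plateau n t \<le> 1"
  by (auto simp: plateau_def)

lemma plateau_eq_0: "real n + 1 \<le> \<bar>t\<bar> \<Longrightarrow> plateau n t = 0"
  and plateau_eq_1: "\<bar>t\<bar> \<le> real n \<Longrightarrow> plateau n t = 1"
  by (auto simp: plateau_def)

lemma plateau_mono: "m \<le> n \<Longrightarrow> plateau m t \<le> plateau n t"
  by (auto simp: plateau_def)

lemma continuous_plateau [continuous_intros]: "continuous_on S (plateau n)"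
  unfolding plateau_def by (intro continuous_intros)

lemma plateau_tendsto: "(\<lambda>n. plateau n t) \<longlonglongrightarrow> 1"
proof (rule tendsto_eventually)
  obtain N :: nat where "\<bar>t\<bar> \<le> N" using real_arch_simple by blast
  then have "plateau n t = 1" if "n \<ge> N" for n
    using that by (intro plateau_eq_1) linarith
  then show "\<forall>\<^sub>F n in sequentially. plateau n t = 1" by (auto simp: eventually_sequentially)
qed

text \<open>Vanishing at infinity makes such a function blind to infinite eigenvalues, where its
  values are infinitesimal; so its operator is determined by the measure of the limited
  eigenvalues.\<close>

definition C0 :: "(real \<Rightarrow> real) \<Rightarrow> bool" where
  "C0 f \<longleftrightarrow> continuous_on UNIV f \<and> (f \<longlongrightarrow> 0) at_infinity"

lemma C0_bounded: assumes "C0 f" shows "bounded (range f)"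
proof -
  have c: "continuous_on UNIV f" using assms by (simp add: C0_def)
  have "eventually (\<lambda>x. norm (f x) < 1) at_infinity"
    using tendstoD[of f 0 at_infinity 1] assms by (simp add: C0_def)
  then obtain b where b: "\<And>x. norm x \<ge> b \<Longrightarrow> norm (f x) < 1" by (auto simp: eventually_at_infinity)
  have "bounded (f ` cball 0 b)"
    using compact_imp_bounded[OF compact_continuous_image[OF continuous_on_subset[OF c] compact_cball]] by simp
  then obtain B where B': "\<And>y. y \<in> f ` cball 0 b \<Longrightarrow> norm y \<le> B" unfolding bounded_iff by blast
  have B: "norm x \<le> b \<Longrightarrow> norm (f x) \<le> B" for x by (rule B') simp
  have "norm (f x) \<le> max B 1" for x using b[of x] B[of x] by (cases "norm x \<le> b") auto
  then show ?thesis by (auto simp: bounded_iff)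
qed

lemma C0_mult: assumes "C0 f" "continuous_on UNIV g" "bounded (range g)" shows "C0 (\<lambda>t. g t * f t)"
proof -
  obtain B where B: "\<And>x. norm (g x) \<le> B" using assms(3) by (auto simp: bounded_iff)
  have lim: "((\<lambda>t. B * norm (f t)) \<longlongrightarrow> 0) at_infinity"
    using tendsto_mult_right_zero[OF tendsto_norm_zero[of f]] assms(1) by (auto simp: C0_def)
  have "((\<lambda>t. g t * f t) \<longlongrightarrow> 0) at_infinity"
    by (rule Lim_null_comparison[OF always_eventually lim])
       (use B in \<open>auto simp: abs_mult intro: mult_right_mono\<close>)
  then show ?thesis using assms by (auto simp: C0_def intro: continuous_intros)
qed

lemma C0_compact_support:
  assumes "continuous_on UNIV f" "\<And>t. R \<le> \<bar>t\<bar> \<Longrightarrow> f t = 0" shows "C0 f"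
  unfolding C0_def
  by (intro conjI assms(1) tendsto_eventually)
     (use assms(2) in \<open>auto simp: eventually_at_infinity\<close>)

lemma C0_plateau: "C0 (plateau n)"
  by (rule C0_compact_support[of _ "real n + 1"]) (auto intro: continuous_intros plateau_eq_0)

lemma C0_t_plateau: "C0 (\<lambda>t. t * plateau n t)"
  by (rule C0_compact_support[of _ "real n + 1"]) (auto intro!: continuous_intros plateau_eq_0)

lemma bounded_range_of_real: "bounded (range f) \<Longrightarrow> bounded (range (\<lambda>t. complex_of_real (f t)))"
  by (auto simp: bounded_iff)

lemma bounded_range_cnj: "bounded (range f) \<Longrightarrow> bounded (range (\<lambda>t. cnj (f t)))"
  by (auto simp: bounded_iff)

lemma bounded_range_mult:
  fixes f g :: "'a \<Rightarrow> complex"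
  assumes "bounded (range f)" "bounded (range g)" shows "bounded (range (\<lambda>t. f t * g t))"
proof -
  obtain B C where "\<And>x. cmod (f x) \<le> B" "\<And>x. cmod (g x) \<le> C" using assms by (auto simp: bounded_iff)
  then have "cmod (f x * g x) \<le> B * C" for x
    unfolding norm_mult by (intro mult_mono) (auto intro: order_trans[OF norm_ge_zero])
  then show ?thesis by (auto simp: bounded_iff)
qed

lemma bounded_range_const [simp]: "bounded (range (\<lambda>_::'a. c::complex))"
  by (auto simp: bounded_iff)

text \<open>A real t has distance at least |Im s| = 1 from s. The second bound comes from t / (t -
  s) = 1 + s / (t - s).\<close>

lemma bounded_resolvent:
  assumes "\<bar>Im s\<bar> = 1"
  shows "cmod (resolvent s t) \<le> 1" "cmod (of_real t * resolvent s t) \<le> 1 + cmod s"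
    "(of_real t - s) * resolvent s t = 1"
proof -
  have "1 \<le> cmod (of_real t - s)" using abs_Im_le_cmod[of "of_real t - s"] assms by simp
  then show 1: "cmod (resolvent s t) \<le> 1" by (simp add: resolvent_def norm_divide divide_le_eq)
  have nz: "of_real t - s \<noteq> 0" using assms by (auto simp: complex_eq_iff)
  then show 2: "(of_real t - s) * resolvent s t = 1" by (simp add: resolvent_def)
  then have "of_real t * resolvent s t = 1 + s * resolvent s t" by (simp add: algebra_simps)
  moreover have "cmod (s * resolvent s t) \<le> cmod s * 1" unfolding norm_mult by (intro mult_left_mono 1) simp
  ultimately show "cmod (of_real t * resolvent s t) \<le> 1 + cmod s"
    using norm_triangle_ineq[of 1 "s * resolvent s t"] by simp
qed

section \<open>Functional calculus\<close>

text \<open>The part of the proof that concerns Hilbert spaces only. M is a *-representation of the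
  bounded functions that also sees spectrum at infinity, while \<mu> sees finite spectrum only;
  hence \<open>M_int\<close> is restricted to \<open>C0\<close>, and P, whose quadratic form is the
  total mass, may differ from the identity. \<Gamma> stands for multiplication by t and may be
  multivalued. \<open>\<Gamma>_complete\<close> supplies the limits of Cauchy sequences of graph
  points along with their membership, in place of completeness of H.\<close>

locale spectral_calculus =
  fixes H :: "'a ips" and M :: "(real \<Rightarrow> complex) \<Rightarrow> 'a \<Rightarrow> 'a" and \<Gamma> :: "('a \<times> 'a) set"
    and \<mu> :: "'a \<Rightarrow> real measure" and E :: "real \<Rightarrow> 'a \<Rightarrow> 'a" and P :: "'a \<Rightarrow> 'a"
  assumes pre: "prehilbert H"
    and M_in: "\<And>\<phi> x. bounded (range \<phi>) \<Longrightarrow> x \<in> car H \<Longrightarrow> M \<phi> x \<in> car H"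
    and M_adj: "\<And>\<phi> x y. bounded (range \<phi>) \<Longrightarrow> x \<in> car H \<Longrightarrow> y \<in> car H \<Longrightarrow>
       ip H x (M \<phi> y) = ip H (M (\<lambda>t. cnj (\<phi> t)) x) y"
    and M_mult: "\<And>\<phi> \<psi> x. bounded (range \<phi>) \<Longrightarrow> bounded (range \<psi>) \<Longrightarrow> x \<in> car H \<Longrightarrow>
       M \<phi> (M \<psi> x) = M (\<lambda>t. \<phi> t * \<psi> t) x"
    and M_add_fun: "\<And>\<phi> \<psi> x. bounded (range \<phi>) \<Longrightarrow> bounded (range \<psi>) \<Longrightarrow> x \<in> car H \<Longrightarrow>
       M (\<lambda>t. \<phi> t + \<psi> t) x = add H (M \<phi> x) (M \<psi> x)"
    and M_const: "\<And>c x. x \<in> car H \<Longrightarrow> M (\<lambda>_. c) x = scl H c x"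
    and M_bound: "\<And>\<phi> C x. (\<And>t. cmod (\<phi> t) \<le> C) \<Longrightarrow> x \<in> car H \<Longrightarrow> nrm H (M \<phi> x) \<le> C * nrm H x"
    and \<mu>: "\<And>h. h \<in> car H \<Longrightarrow> finite_borel_measure (\<mu> h)"
    and M_int: "\<And>f h. C0 f \<Longrightarrow> h \<in> car H \<Longrightarrow>
       ip H h (M (\<lambda>t. of_real (f t)) h) = of_real (\<integral>t. f t \<partial>\<mu> h)"
    and E: "\<And>t. orth_projector H (E t)"
    and E_int: "\<And>t h. h \<in> car H \<Longrightarrow> ip H h (E t h) = of_real (measure (\<mu> h) {..t})"
    and P: "orth_projector H P"
    and P_int: "\<And>h. h \<in> car H \<Longrightarrow> ip H h (P h) = of_real (measure (\<mu> h) UNIV)"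
    and \<Gamma>_sub: "\<Gamma> \<subseteq> car H \<times> car H"
    and \<Gamma>_M: "\<And>x y \<phi>. (x, y) \<in> \<Gamma> \<Longrightarrow> bounded (range \<phi>) \<Longrightarrow> bounded (range (\<lambda>t. of_real t * \<phi> t)) \<Longrightarrow>
       M \<phi> y = M (\<lambda>t. of_real t * \<phi> t) x"
    and M_\<Gamma>: "\<And>x \<phi>. x \<in> car H \<Longrightarrow> bounded (range \<phi>) \<Longrightarrow> bounded (range (\<lambda>t. of_real t * \<phi> t)) \<Longrightarrow>
       (M \<phi> x, M (\<lambda>t. of_real t * \<phi> t) x) \<in> \<Gamma>"
    and \<Gamma>_complete: "\<And>x y. (\<And>n. (x n, y n) \<in> \<Gamma>) \<Longrightarrow> cauchy_seq H x \<Longrightarrow> cauchy_seq H y \<Longrightarrow>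
       \<exists>a b. (a, b) \<in> \<Gamma> \<and> (\<lambda>n. nrm H (sub H (x n) a)) \<longlonglongrightarrow> 0 \<and> (\<lambda>n. nrm H (sub H (y n) b)) \<longlonglongrightarrow> 0"
begin

sublocale prehilb H by unfold_locales (rule pre)

definition Hf :: "'a set" where
  "Hf = {h \<in> car H. \<forall>k\<in>car H. M (resolvent \<i>) k = zer H \<longrightarrow> ip H k h = 0}"

definition T :: "('a \<times> 'a) set" where "T = \<Gamma> \<inter> (Hf \<times> Hf)"

abbreviation Mr :: "(real \<Rightarrow> real) \<Rightarrow> 'a \<Rightarrow> 'a" where "Mr f \<equiv> M (\<lambda>t. of_real (f t))"

lemma bdd_resolvent:
  assumes "\<bar>Im s\<bar> = 1"
  shows "bounded (range (resolvent s))" "bounded (range (\<lambda>t. of_real t * resolvent s t))"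
  using bounded_resolvent[OF assms] by (auto simp: bounded_iff)

lemma bdd_C0: "C0 f \<Longrightarrow> bounded (range (\<lambda>t. complex_of_real (f t)))"
  by (intro bounded_range_of_real C0_bounded)

lemma bdd_plateau: "bounded (range (\<lambda>t. complex_of_real (plateau n t)))"
    "bounded (range (\<lambda>t. complex_of_real t * complex_of_real (plateau n t)))"
  using bdd_C0[OF C0_plateau] bdd_C0[OF C0_t_plateau] by simp_all

text \<open>An operator with an everywhere defined adjoint is linear: test against k and move the
  operator to the other side.\<close>

lemma M_add:
  assumes "bounded (range \<phi>)" "x \<in> car H" "y \<in> car H"
  shows "M \<phi> (add H x y) = add H (M \<phi> x) (M \<phi> y)"
proof (rule ip_eqI)
  fix k assume k: "k \<in> car H"
  have b: "bounded (range (\<lambda>t. cnj (\<phi> t)))" using assms by (intro bounded_range_cnj)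
  show "ip H k (M \<phi> (add H x y)) = ip H k (add H (M \<phi> x) (M \<phi> y))"
    using assms k M_in[OF assms(1)] M_in[OF b] by (simp add: M_adj)
qed (use assms M_in in auto)

lemma M_scl:
  assumes "bounded (range \<phi>)" "x \<in> car H"
  shows "M \<phi> (scl H c x) = scl H c (M \<phi> x)"
proof (rule ip_eqI)
  fix k assume k: "k \<in> car H"
  have b: "bounded (range (\<lambda>t. cnj (\<phi> t)))" using assms by (intro bounded_range_cnj)
  show "ip H k (M \<phi> (scl H c x)) = ip H k (scl H c (M \<phi> x))"
    using assms k M_in[OF assms(1)] M_in[OF b] by (simp add: M_adj)
qed (use assms M_in in auto)

lemma M_sub: "bounded (range \<phi>) \<Longrightarrow> x \<in> car H \<Longrightarrow> y \<in> car H \<Longrightarrow> M \<phi> (sub H x y) = sub H (M \<phi> x) (M \<phi> y)"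
  by (simp add: sub_def M_add M_scl)

lemma M_diff_fun:
  assumes "bounded (range \<phi>)" "bounded (range \<psi>)" "x \<in> car H"
  shows "M (\<lambda>t. \<phi> t - \<psi> t) x = sub H (M \<phi> x) (M \<psi> x)"
proof -
  have "M (\<lambda>t. \<phi> t + (- 1) * \<psi> t) x = add H (M \<phi> x) (M (\<lambda>t. (-1) * \<psi> t) x)"
    using assms by (intro M_add_fun bounded_range_mult) auto
  also have "M (\<lambda>t. (-1) * \<psi> t) x = scl H (-1) (M \<psi> x)"
    using M_mult[of "\<lambda>_. -1" \<psi> x] M_const[of "M \<psi> x" "-1"] assms M_in by simp
  finally show ?thesis by (simp add: sub_def)
qed

lemma M_one: "x \<in> car H \<Longrightarrow> M (\<lambda>_. 1) x = x"
  by (rule ip_eqI) (auto simp: M_const)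

lemma \<mu>_props:
  assumes "h \<in> car H"
  shows "finite_measure (\<mu> h)" "sets (\<mu> h) = sets borel" "space (\<mu> h) = UNIV"
  using \<mu>[OF assms] finite_borel_measure.borel_UNIV
  by (auto simp: finite_borel_measure_def finite_borel_measure_axioms_def)

lemma borel_measurable_\<mu>:
  fixes f :: "real \<Rightarrow> real"
  assumes "h \<in> car H" "f \<in> borel_measurable borel" shows "f \<in> borel_measurable (\<mu> h)"
  using assms(2) unfolding measurable_cong_sets[OF \<mu>_props(2)[OF assms(1)] refl] .

lemma integrable_C0:
  assumes "C0 f" "h \<in> car H" shows "integrable (\<mu> h) f"
proof -
  interpret finite_borel_measure "\<mu> h" by (rule \<mu>) fact
  obtain B where "\<And>x. norm (f x) \<le> B" using C0_bounded[OF assms(1)] by (auto simp: bounded_iff)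
  moreover have "f \<in> borel_measurable (\<mu> h)"
    using assms(1) borel_measurable_continuous_onI[of f] measurable_cong_sets[OF M_is_borel refl]
    by (auto simp: C0_def)
  ultimately show ?thesis by (intro integrable_const_bound[of _ B]) auto
qed

text \<open>A real symbol gives a symmetric operator, so the squared norm is the quadratic form of
  the operator of f^2, which is again in \<open>C0\<close>.\<close>

lemma Mr_self:
  assumes "C0 f" "h \<in> car H"
  shows "(nrm H (Mr f h))\<^sup>2 = (\<integral>t. (f t)\<^sup>2 \<partial>\<mu> h)"
proof -
  have b: "bounded (range (\<lambda>t. complex_of_real (f t)))" using bdd_C0[OF assms(1)] .
  have "ip H (Mr f h) (Mr f h) = ip H h (Mr f (Mr f h))"
    using M_adj[OF b assms(2) M_in[OF b assms(2)]] by simp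
  also have "\<dots> = ip H h (Mr (\<lambda>t. f t * f t) h)" using M_mult[OF b b assms(2)] by simp
  also have "\<dots> = of_real (\<integral>t. f t * f t \<partial>\<mu> h)"
    using assms C0_bounded by (intro M_int C0_mult) (auto simp: C0_def)
  finally show ?thesis using nrm_sq[OF M_in[OF b assms(2)]] by (simp add: power2_eq_square)
qed

lemma Mr_dist:
  assumes "C0 f" "C0 g" "h \<in> car H"
  shows "(nrm H (sub H (Mr f h) (Mr g h)))\<^sup>2 = (\<integral>t. (f t - g t)\<^sup>2 \<partial>\<mu> h)"
proof -
  have "C0 (\<lambda>t. f t - g t)"
    using assms tendsto_diff[of f 0 at_infinity g 0] by (auto simp: C0_def intro: continuous_intros)
  from Mr_self[OF this assms(3)] show ?thesis
    using M_diff_fun[OF bdd_C0[OF assms(1)] bdd_C0[OF assms(2)] assms(3)] by simp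
qed

lemma P_nrm: "h \<in> car H \<Longrightarrow> (nrm H (P h))\<^sup>2 = measure (\<mu> h) UNIV"
  using orth_projector_ip[OF P] P_int nrm_sq[OF orth_projector_in[OF P]] by simp

lemma E_nrm: "h \<in> car H \<Longrightarrow> (nrm H (E t h))\<^sup>2 = measure (\<mu> h) {..t}"
  using orth_projector_ip[OF E] E_int nrm_sq[OF orth_projector_in[OF E]] by simp

text \<open>|1 / (t - \<i>)|^2 = 1 / (1 + t^2) lies in \<open>C0\<close> and is strictly positive.
  The squared norm of the resolvent at k is its integral against \<mu> k, so it vanishes iff \<mu> k
  = 0, that is, iff P k has norm 0.\<close>

lemma resolvent_kernel:
  assumes k: "k \<in> car H" shows "M (resolvent \<i>) k = zer H \<longleftrightarrow> P k = zer H"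
proof -
  define f where "f t = 1 / (1 + t\<^sup>2)" for t :: real
  have f_eq: "cnj (resolvent \<i> t) * resolvent \<i> t = of_real (f t)" for t
  proof -
    have "cnj (resolvent \<i> t) * resolvent \<i> t = of_real ((cmod (resolvent \<i> t))\<^sup>2)"
      using complex_norm_square[of "resolvent \<i> t"] by (simp add: mult.commute)
    also have "(cmod (resolvent \<i> t))\<^sup>2 = f t"
      by (simp add: resolvent_def f_def norm_divide power_divide cmod_power2 add.commute)
    finally show ?thesis .
  qed
  have nz': "1 + t\<^sup>2 > 0" for t :: real by (simp add: add_pos_nonneg)
  have C0f: "C0 f"
    unfolding C0_def
  proof
    show "continuous_on UNIV f"
      unfolding f_def using nz' by (intro continuous_intros ballI) (metis less_irrefl)
    show "(f \<longlongrightarrow> 0) at_infinity"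
    proof (rule Lim_null_comparison)
      show "((\<lambda>t::real. norm (inverse t)) \<longlongrightarrow> 0) at_infinity" by (intro tendsto_norm_zero tendsto_inverse_0)
      have "norm (f t) \<le> norm (inverse t)" if "1 \<le> norm t" for t
      proof -
        have "\<bar>t\<bar> * 1 \<le> \<bar>t\<bar> * \<bar>t\<bar>" using that by (intro mult_left_mono) auto
        then have "\<bar>t\<bar> \<le> 1 + t\<^sup>2" by (simp add: power2_eq_square)
        then show ?thesis using that nz'[of t] by (simp add: f_def inverse_eq_divide frac_le)
      qed
      then show "\<forall>\<^sub>F t in at_infinity. norm (f t) \<le> norm (inverse t)"
        by (auto simp: eventually_at_infinity)
    qed
  qed
  have nz: "f t > 0" for t by (simp add: f_def add_pos_nonneg)
  have b: "bounded (range (resolvent \<i>))" using bdd_resolvent[of \<i>] by simp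
  have "ip H (M (resolvent \<i>) k) (M (resolvent \<i>) k) = ip H k (M (\<lambda>t. cnj (resolvent \<i> t)) (M (resolvent \<i>) k))"
    using M_adj[OF bounded_range_cnj[OF b] k M_in[OF b k]] by simp
  also have "\<dots> = ip H k (Mr f k)" using M_mult[OF bounded_range_cnj[OF b] b k] by (simp add: f_eq)
  also have "\<dots> = of_real (\<integral>t. f t \<partial>\<mu> k)" by (rule M_int[OF C0f k])
  finally have eq: "(nrm H (M (resolvent \<i>) k))\<^sup>2 = (\<integral>t. f t \<partial>\<mu> k)" using nrm_sq[OF M_in[OF b k]] by simp
  interpret finite_borel_measure "\<mu> k" by (rule \<mu>[OF k])
  have "M (resolvent \<i>) k = zer H \<longleftrightarrow> (\<integral>t. f t \<partial>\<mu> k) = 0"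
    using eq nrm_eq_0_iff[OF M_in[OF b k]] by (metis zero_eq_power2)
  also have "\<dots> \<longleftrightarrow> (AE t in \<mu> k. f t = 0)"
    using integrable_C0[OF C0f k] nz by (intro integral_nonneg_eq_0_iff_AE) (auto intro: less_imp_le)
  also have "\<dots> \<longleftrightarrow> (AE t in \<mu> k. False)" using nz by (intro AE_cong) (metis less_irrefl)
  also have "\<dots> \<longleftrightarrow> measure (\<mu> k) UNIV = 0"
    using \<mu>_props[OF k] by (simp add: AE_iff_measurable[OF _ refl] emeasure_eq_measure)
  also have "\<dots> \<longleftrightarrow> P k = zer H"
    using P_nrm[OF k] nrm_eq_0_iff[OF orth_projector_in[OF P k]] by (metis zero_eq_power2)
  finally show ?thesis .
qed

text \<open>By \<open>resolvent_kernel\<close>, \<open>Hf\<close> is the orthogonal complement of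
  the kernel of P, which is the range of P; the test vector is h - P h. This links the fixed space
  of the Cayley transform with the projector of the limited eigenvalues.\<close>

lemma Hf_eq: "Hf = {h \<in> car H. P h = h}"
proof (intro equalityI subsetI CollectI conjI)
  fix h assume h: "h \<in> Hf"
  then show hc: "h \<in> car H" by (simp add: Hf_def)
  have Ph: "P h \<in> car H" using orth_projector_in[OF P hc] .
  have PPh: "P (P h) = P h" using P hc by (simp add: orth_projector_def)
  define k where "k = sub H h (P h)"
  have k: "k \<in> car H" using hc Ph by (simp add: k_def)
  have Pk: "P k = zer H"
  proof (rule ip_eqI)
    fix z assume z: "z \<in> car H"
    have "ip H z (P k) = ip H (P z) k" using P z k by (simp add: orth_projector_def)
    also have "\<dots> = ip H (P z) h - ip H (P z) (P h)"
      using orth_projector_in[OF P z] hc Ph by (simp add: k_def)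
    also have "ip H (P z) (P h) = ip H z (P (P h))" using P z Ph by (simp add: orth_projector_def)
    also have "\<dots> = ip H (P z) h" using P z hc by (simp add: orth_projector_def PPh)
    finally show "ip H z (P k) = ip H z (zer H)" using z by simp
  qed (use k orth_projector_in[OF P] in auto)
  then have "ip H k h = 0" using h k by (simp add: Hf_def resolvent_kernel)
  moreover have "ip H k (P h) = 0"
  proof -
    have "ip H k (P h) = ip H (P k) h" using P k hc by (simp add: orth_projector_def)
    then show ?thesis using Pk hc by simp
  qed
  ultimately have "ip H k k = 0" using k hc Ph ip_sub_right[of k h "P h"] by (simp add: k_def)
  then have "nrm H (sub H h (P h)) = 0" by (simp add: nrm_def k_def)
  then show "P h = h" using nrm_sub_eq_0[OF hc Ph] by simp
next
  fix h assume h: "h \<in> {h \<in> car H. P h = h}"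
  have "ip H k h = 0" if "k \<in> car H" "P k = zer H" for k
  proof -
    have "ip H k (P h) = ip H (P k) h" using P that(1) h unfolding orth_projector_def by fastforce
    then show ?thesis using h that by simp
  qed
  then show "h \<in> Hf" using h by (simp add: Hf_def resolvent_kernel)
qed

lemma Hf_in: "h \<in> Hf \<Longrightarrow> h \<in> car H"
  by (simp add: Hf_def)

lemma Hf_subspace: "subspace_of H Hf"
proof -
  have l: "linear_map H H P" using P by (simp add: orth_projector_def)
  have "zer H \<in> Hf" by (simp add: Hf_def)
  then show ?thesis using l unfolding Hf_eq subspace_of_def linear_map_def by auto
qed

lemma Hf_closed:
  assumes "\<And>n. x n \<in> Hf" "l \<in> car H" "((\<lambda>n. nrm H (sub H (x n) l)) \<longlonglongrightarrow> 0)"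
  shows "l \<in> Hf"
proof -
  have "ip H k l = 0" if k: "k \<in> car H" "M (resolvent \<i>) k = zer H" for k
  proof -
    have "(\<lambda>n. ip H k (x n)) \<longlonglongrightarrow> ip H k l" using tendsto_ip_right[OF assms(3) Hf_in[OF assms(1)] assms(2) k(1)] .
    moreover have "ip H k (x n) = 0" for n using assms(1)[of n] k by (simp add: Hf_def)
    ultimately show ?thesis by (simp add: LIMSEQ_const_iff)
  qed
  then show ?thesis using assms(2) by (simp add: Hf_def)
qed

text \<open>The adjoint operator commutes with the resolvent and so preserves its kernel; hence the
  operator preserves the orthogonal complement of that kernel.\<close>

lemma M_Hf:
  assumes b: "bounded (range \<phi>)" and h: "h \<in> Hf" shows "M \<phi> h \<in> Hf"
proof -
  have hc: "h \<in> car H" using h by (rule Hf_in)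
  have r: "bounded (range (resolvent \<i>))" using bdd_resolvent[of \<i>] by simp
  have c: "bounded (range (\<lambda>t. cnj (\<phi> t)))" using b by (rule bounded_range_cnj)
  have "ip H k (M \<phi> h) = 0" if k: "k \<in> car H" "M (resolvent \<i>) k = zer H" for k
  proof -
    have "M (resolvent \<i>) (M (\<lambda>t. cnj (\<phi> t)) k) = M (\<lambda>t. cnj (\<phi> t)) (M (resolvent \<i>) k)"
      using M_mult[OF r c k(1)] M_mult[OF c r k(1)] by (simp add: mult.commute)
    also have "\<dots> = zer H"
      using M_sub[OF c zer_in zer_in] M_in[OF c zer_in] by (simp add: k)
    finally show ?thesis using h M_in[OF c k(1)] M_adj[OF b k(1) hc] by (simp add: Hf_def)
  qed
  then show ?thesis using M_in[OF b hc] by (simp add: Hf_def)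
qed

text \<open>On \<open>Hf\<close> no mass escapes to infinite eigenvalues. This is what makes
  truncations converge to the identity there.\<close>

lemma measure_Hf:
  assumes "h \<in> Hf" shows "measure (\<mu> h) UNIV = (nrm H h)\<^sup>2"
  using P_nrm[OF Hf_in[OF assms]] assms by (simp add: Hf_eq)

lemma dominated:
  fixes w g :: "real \<Rightarrow> real" and f :: "nat \<Rightarrow> real \<Rightarrow> real"
  assumes h: "h \<in> car H" and w: "integrable (\<mu> h) w"
    and f: "\<And>n. continuous_on UNIV (f n)" and g: "g \<in> borel_measurable borel"
    and lim: "\<And>t. (\<lambda>n. f n t) \<longlonglongrightarrow> g t" and bd: "\<And>n t. \<bar>f n t\<bar> \<le> w t"
  shows "(\<lambda>n. \<integral>t. f n t \<partial>\<mu> h) \<longlonglongrightarrow> (\<integral>t. g t \<partial>\<mu> h)"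
proof (rule integral_dominated_convergence[OF _ _ w])
  show "g \<in> borel_measurable (\<mu> h)" by (rule borel_measurable_\<mu>[OF h g])
  show "f n \<in> borel_measurable (\<mu> h)" for n
    by (rule borel_measurable_\<mu>[OF h borel_measurable_continuous_onI[OF f]])
qed (use lim bd in auto)

lemma integrable_one: "h \<in> car H \<Longrightarrow> integrable (\<mu> h) (\<lambda>_. c::real)"
  using \<mu>_props(1) by (simp add: finite_measure.integrable_const)

text \<open>The constant 1 is not in \<open>C0\<close>, so \<open>Mr_dist\<close> does not apply.
  The square is expanded instead: both integrals tend to the total mass of \<mu> h, which equals
  |h|^2 on \<open>Hf\<close>, and the three terms cancel.\<close>

lemma plateau_tendsto_id:
  assumes h: "h \<in> Hf"
  shows "(\<lambda>n. nrm H (sub H (Mr (plateau n) h) h)) \<longlonglongrightarrow> 0"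
proof -
  have hc: "h \<in> car H" using h by (rule Hf_in)
  note c = M_in[OF bdd_plateau(1) hc]
  have eq: "(nrm H (sub H (Mr (plateau n) h) h))\<^sup>2 =
     (\<integral>t. (plateau n t)\<^sup>2 \<partial>\<mu> h) - 2 * (\<integral>t. plateau n t \<partial>\<mu> h) + measure (\<mu> h) UNIV" for n
  proof -
    have "ip H (Mr (plateau n) h) h = cnj (ip H h (Mr (plateau n) h))" by (rule ip_cnj[OF hc c])
    then show ?thesis
      using nrm_sub_sq[OF c hc] M_int[OF C0_plateau hc] Mr_self[OF C0_plateau hc] measure_Hf[OF h] by simp
  qed
  have 1: "(\<lambda>n. \<integral>t. (plateau n t)\<^sup>2 \<partial>\<mu> h) \<longlonglongrightarrow> (\<integral>t. 1 \<partial>\<mu> h)"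
  proof (rule dominated[OF hc integrable_one[OF hc, of 1]])
    show "(\<lambda>n. (plateau n t)\<^sup>2) \<longlonglongrightarrow> 1" for t using tendsto_power[OF plateau_tendsto, of t 2] by simp
  qed (auto intro!: continuous_intros simp: abs_le_square_iff power_le_one)
  have 2: "(\<lambda>n. \<integral>t. plateau n t \<partial>\<mu> h) \<longlonglongrightarrow> (\<integral>t. 1 \<partial>\<mu> h)"
    by (rule dominated[OF hc integrable_one[OF hc, of 1]]) (auto intro!: continuous_intros plateau_tendsto)
  have int1: "(\<integral>t. 1 \<partial>\<mu> h) = measure (\<mu> h) UNIV" using \<mu>_props[OF hc] by simp
  have "(\<lambda>n. (nrm H (sub H (Mr (plateau n) h) h))\<^sup>2) \<longlonglongrightarrow>
     measure (\<mu> h) UNIV - 2 * measure (\<mu> h) UNIV + measure (\<mu> h) UNIV"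
    unfolding eq using 1 2 unfolding int1 by (intro tendsto_intros)
  then have "(\<lambda>n. (nrm H (sub H (Mr (plateau n) h) h))\<^sup>2) \<longlonglongrightarrow> 0" by simp
  from tendsto_real_sqrt[OF this] show ?thesis using c hc by simp
qed

text \<open>Reduces the unbounded T to equations between bounded operators, from which
  single-valuedness, linearity and symmetry are read off. For the converse, the truncations of x and
  y form a point of \<Gamma> by \<open>M_\<Gamma>\<close>; these points converge to (x, y), and
  \<open>\<Gamma>_complete\<close> puts the limit in \<Gamma>.\<close>

lemma T_iff: "(x, y) \<in> T \<longleftrightarrow> x \<in> Hf \<and> y \<in> Hf \<and>
   (\<forall>n. Mr (plateau n) y = M (\<lambda>t. of_real t * of_real (plateau n t)) x)"
proof (intro iffI conjI allI; (elim conjE)?)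
  assume xy: "(x, y) \<in> T"
  then show "x \<in> Hf" "y \<in> Hf" by (auto simp: T_def)
  show "Mr (plateau n) y = M (\<lambda>t. of_real t * of_real (plateau n t)) x" for n
    using xy by (intro \<Gamma>_M bdd_plateau) (simp add: T_def)
next
  assume x: "x \<in> Hf" and y: "y \<in> Hf"
    and eq: "\<forall>n. Mr (plateau n) y = M (\<lambda>t. of_real t * of_real (plateau n t)) x"
  have xc: "x \<in> car H" and yc: "y \<in> car H" using x y Hf_in by auto
  have ev: "(Mr (plateau n) x, Mr (plateau n) y) \<in> \<Gamma>" for n
    using M_\<Gamma>[OF xc bdd_plateau(1) bdd_plateau(2)] eq by simp
  note lx = plateau_tendsto_id[OF x] and ly = plateau_tendsto_id[OF y]
  note cx = M_in[OF bdd_plateau(1) xc] and cy = M_in[OF bdd_plateau(1) yc]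
  obtain a b where ab: "(a, b) \<in> \<Gamma>" "(\<lambda>n. nrm H (sub H (Mr (plateau n) x) a)) \<longlonglongrightarrow> 0"
    "(\<lambda>n. nrm H (sub H (Mr (plateau n) y) b)) \<longlonglongrightarrow> 0"
    using \<Gamma>_complete[OF ev tendsto_cauchy_seq[OF cx xc lx] tendsto_cauchy_seq[OF cy yc ly]] by blast
  have "a \<in> car H" "b \<in> car H" using ab(1) \<Gamma>_sub by auto
  then have "a = x" "b = y"
    using limit_unique[OF cx _ xc ab(2) lx] limit_unique[OF cy _ yc ab(3) ly] by auto
  then show "(x, y) \<in> T" using ab(1) x y by (simp add: T_def)
qed

lemma T_single_valued: "single_valued T"
proof (rule single_valuedI)
  fix x y z assume xy: "(x, y) \<in> T" and xz: "(x, z) \<in> T"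
  have c: "y \<in> Hf" "z \<in> Hf" using xy xz by (auto simp: T_def)
  have eq: "Mr (plateau n) y = Mr (plateau n) z" for n using xy xz unfolding T_iff by simp
  show "y = z"
    by (rule limit_unique[OF M_in[OF bdd_plateau(1) Hf_in[OF c(1)]] Hf_in[OF c(1)] Hf_in[OF c(2)]
        plateau_tendsto_id[OF c(1)] plateau_tendsto_id[OF c(2), folded eq]])
qed

text \<open>Here x is the resolvent at \<i> applied to y - \<i> x, and the range of a normal
  operator is orthogonal to its kernel. It yields membership in \<open>Hf\<close> for any vector
  that occurs as a first component of \<Gamma>, with no condition on the second.\<close>

lemma \<Gamma>_Domain_Hf: assumes "(x, y) \<in> \<Gamma>" shows "x \<in> Hf"
proof -
  have c: "x \<in> car H" "y \<in> car H" using assms \<Gamma>_sub by auto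
  have i: "\<bar>Im \<i>\<bar> = 1" by simp
  note r = bdd_resolvent[OF i]
  define w where "w = sub H y (scl H \<i> x)"
  have w: "w \<in> car H" using c by (simp add: w_def)
  have "M (resolvent \<i>) w = sub H (M (resolvent \<i>) y) (scl H \<i> (M (resolvent \<i>) x))"
    using c r by (simp add: w_def M_sub M_scl)
  also have "scl H \<i> (M (resolvent \<i>) x) = M (\<lambda>t. \<i> * resolvent \<i> t) x"
    using M_mult[of "\<lambda>_. \<i>" "resolvent \<i>" x] M_const[of "M (resolvent \<i>) x" \<i>] c r M_in by simp
  also have "M (resolvent \<i>) y = M (\<lambda>t. of_real t * resolvent \<i> t) x" by (rule \<Gamma>_M[OF assms r])
  also have "sub H (M (\<lambda>t. of_real t * resolvent \<i> t) x) (M (\<lambda>t. \<i> * resolvent \<i> t) x) =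
     M (\<lambda>t. of_real t * resolvent \<i> t - \<i> * resolvent \<i> t) x"
    using M_diff_fun[OF r(2) bounded_range_mult[OF bounded_range_const r(1)] c(1), symmetric] .
  also have "(\<lambda>t. of_real t * resolvent \<i> t - \<i> * resolvent \<i> t) = (\<lambda>_. 1)"
    using bounded_resolvent(3)[OF i] by (auto simp: algebra_simps)
  finally have xw: "x = M (resolvent \<i>) w" using M_one c by simp
  have "ip H k x = 0" if k: "k \<in> car H" "M (resolvent \<i>) k = zer H" for k
  proof -
    \<comment> \<open>With R the resolvent and R^* its adjoint, k' = R^* k satisfies R k' = R^* R k
      = 0, whence |k'|^2 = \<langle>k, R k'\<rangle> = 0: the kernel of R lies in that of
      R^*.\<close>
    define k' where "k' = M (\<lambda>t. cnj (resolvent \<i> t)) k"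
    note rc = bounded_range_cnj[OF r(1)]
    have k': "k' \<in> car H" using M_in[OF rc k(1)] by (simp add: k'_def)
    have "M (resolvent \<i>) k' = M (\<lambda>t. cnj (resolvent \<i> t)) (M (resolvent \<i>) k)"
      using M_mult[OF r(1) rc k(1)] M_mult[OF rc r(1) k(1)] by (simp add: k'_def mult.commute)
    also have "\<dots> = zer H"
      using M_sub[OF rc zer_in zer_in] M_in[OF rc zer_in] by (simp add: k)
    finally have "ip H k' k' = 0"
      using M_adj[OF r(1) k(1) k'] k(1) by (simp add: k'_def)
    then have "nrm H k' = 0" by (simp add: nrm_def)
    then have "k' = zer H" using nrm_eq_0_iff[OF k'] by simp
    then show ?thesis using M_adj[OF r(1) k(1) w] w by (simp add: xw[symmetric] k'_def)
  qed
  then show ?thesis using c by (simp add: Hf_def)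
qed

text \<open>At each truncation level, multiplication by t times the plateau is bounded and
  symmetric; the limits of both sides exist because b and y lie in \<open>Hf\<close>.\<close>

lemma T_symmetric:
  assumes xy: "(x, y) \<in> T" and ab: "(a, b) \<in> T" shows "ip H x b = ip H y a"
proof -
  have c: "x \<in> car H" "y \<in> car H" "a \<in> car H" "b \<in> car H" "b \<in> Hf" "y \<in> Hf"
    using assms by (auto simp: T_def Hf_in)
  have "ip H x (Mr (plateau n) b) = ip H (Mr (plateau n) y) a" for n
  proof -
    have "ip H x (Mr (plateau n) b) = ip H x (M (\<lambda>t. of_real t * of_real (plateau n t)) a)"
      using ab by (simp add: T_iff)
    also have "\<dots> = ip H (M (\<lambda>t. of_real t * of_real (plateau n t)) x) a"
      using M_adj[OF bdd_plateau(2) c(1,3)] by simp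
    also have "\<dots> = ip H (Mr (plateau n) y) a" using xy by (simp add: T_iff)
    finally show ?thesis .
  qed
  from tendsto_ip_right[OF plateau_tendsto_id[OF c(5)] M_in[OF bdd_plateau(1) c(4)] c(4) c(1), unfolded this]
  show ?thesis
    using tendsto_ip_left[OF plateau_tendsto_id[OF c(6)] M_in[OF bdd_plateau(1) c(2)] c(2) c(3)]
    by (rule LIMSEQ_unique)
qed

lemma T_M: "h \<in> Hf \<Longrightarrow> bounded (range \<phi>) \<Longrightarrow> bounded (range (\<lambda>t. of_real t * \<phi> t)) \<Longrightarrow>
   (M \<phi> h, M (\<lambda>t. of_real t * \<phi> t) h) \<in> T"
  by (simp add: T_def M_\<Gamma> Hf_in M_Hf)

text \<open>The domain contains all truncated vectors, hence is dense. The adjoint relation, tested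
  on truncated vectors, becomes the family of bounded equations of \<open>T_iff\<close>.\<close>

lemma T_selfadjoint: "selfadjoint (H\<lparr>car := Hf\<rparr>) T"
  unfolding selfadjoint_def
proof (intro conjI)
  have sub: "Hf \<subseteq> car H" "zer H \<in> Hf" "\<And>x y. x \<in> Hf \<Longrightarrow> y \<in> Hf \<Longrightarrow> add H x y \<in> Hf"
    "\<And>c x. x \<in> Hf \<Longrightarrow> scl H c x \<in> Hf" using Hf_subspace by (auto simp: subspace_of_def)
  have TH: "x \<in> Hf" "y \<in> Hf" "x \<in> car H" "y \<in> car H" if "(x, y) \<in> T" for x y
    using that by (auto simp: T_def Hf_in)
  show "linear_operator (H\<lparr>car := Hf\<rparr>) T"
    unfolding linear_operator_def
  proof (intro conjI allI ballI)
    show "T \<subseteq> car (H\<lparr>car := Hf\<rparr>) \<times> car (H\<lparr>car := Hf\<rparr>)" by (auto simp: T_def)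
    show "single_valued T" by (rule T_single_valued)
    have z: "M \<phi> (zer H) = zer H" if "bounded (range \<phi>)" for \<phi>
      using M_sub[OF that zer_in zer_in] M_in[OF that zer_in] by simp
    show "(zer (H\<lparr>car := Hf\<rparr>), zer (H\<lparr>car := Hf\<rparr>)) \<in> T"
      unfolding T_iff by (simp add: z[OF bdd_plateau(1)] z[OF bdd_plateau(2)] sub(2))
    show "case p of (x, y) \<Rightarrow> \<forall>(x', y')\<in>T. (add (H\<lparr>car := Hf\<rparr>) x x', add (H\<lparr>car := Hf\<rparr>) y y') \<in> T"
      if "p \<in> T" for p
    proof (clarify)
      fix x y x' y' assume "p = (x, y)" and x': "(x', y') \<in> T"
      then have x: "(x, y) \<in> T" using that by simp
      show "(add (H\<lparr>car := Hf\<rparr>) x x', add (H\<lparr>car := Hf\<rparr>) y y') \<in> T"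
        using x x' TH[OF x] TH[OF x'] unfolding T_iff
        by (simp add: M_add[OF bdd_plateau(1)] M_add[OF bdd_plateau(2)] sub(3))
    qed
    show "case p of (x, y) \<Rightarrow> (scl (H\<lparr>car := Hf\<rparr>) c x, scl (H\<lparr>car := Hf\<rparr>) c y) \<in> T"
      if "p \<in> T" for p c
    proof (clarify)
      fix x y assume "p = (x, y)"
      then have x: "(x, y) \<in> T" using that by simp
      show "(scl (H\<lparr>car := Hf\<rparr>) c x, scl (H\<lparr>car := Hf\<rparr>) c y) \<in> T"
        using x TH[OF x] unfolding T_iff
        by (simp add: M_scl[OF bdd_plateau(1)] M_scl[OF bdd_plateau(2)] sub(4))
    qed
  qed
  show "closure_in (H\<lparr>car := Hf\<rparr>) (Domain T) = car (H\<lparr>car := Hf\<rparr>)"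
  proof -
    have "\<exists>a\<in>Domain T. nrm H (sub H h a) < e" if h: "h \<in> Hf" and e: "e > 0" for h e
    proof -
      obtain n where n: "nrm H (sub H (Mr (plateau n) h) h) < e"
        using order_tendstoD(2)[OF plateau_tendsto_id[OF h] e] by (auto simp: eventually_sequentially)
      have "nrm H (sub H h (Mr (plateau n) h)) < e"
        using n nrm_sub_commute[OF Hf_in[OF h] M_in[OF bdd_plateau(1) Hf_in[OF h], of n]] by simp
      moreover have "Mr (plateau n) h \<in> Domain T" using T_M[OF h bdd_plateau] by blast
      ultimately show ?thesis by blast
    qed
    then show ?thesis by (auto simp: closure_in_def)
  qed
  show "adjoint_graph (H\<lparr>car := Hf\<rparr>) T = T"
  proof (intro equalityI subsetI; clarify)
    fix y z assume yz: "(y, z) \<in> adjoint_graph (H\<lparr>car := Hf\<rparr>) T"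
    then have c: "y \<in> Hf" "z \<in> Hf" and ad: "\<And>x x'. (x, x') \<in> T \<Longrightarrow> ip H y x' = ip H z x"
      by (auto simp: adjoint_graph_def)
    note cc = Hf_in[OF c(1)] Hf_in[OF c(2)]
    have "Mr (plateau n) z = M (\<lambda>t. of_real t * of_real (plateau n t)) y" for n
    proof -
      \<comment> \<open>The defect of the equation at level n is its own test vector: truncating d
        gives a pair in T, and the adjoint relation on that pair reads \<langle>d, d\<rangle> =
        0.\<close>
      define d where "d = sub H (Mr (plateau n) z) (M (\<lambda>t. of_real t * of_real (plateau n t)) y)"
      note m = M_in[OF bdd_plateau(1) cc(2), of n] M_in[OF bdd_plateau(2) cc(1), of n]
      have m': "Mr (plateau n) z \<in> Hf" "M (\<lambda>t. of_real t * of_real (plateau n t)) y \<in> Hf"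
        using M_Hf bdd_plateau c by auto
      have d: "d \<in> Hf" using m' sub unfolding d_def sub_def by simp
      have dc: "d \<in> car H" using d Hf_in by simp
      have "ip H y (M (\<lambda>t. of_real t * of_real (plateau n t)) d) = ip H z (Mr (plateau n) d)"
        by (rule ad[OF T_M[OF d bdd_plateau]])
      then have "ip H (M (\<lambda>t. of_real t * of_real (plateau n t)) y) d = ip H (Mr (plateau n) z) d"
        using M_adj[OF bdd_plateau(1) cc(2) dc] M_adj[OF bdd_plateau(2) cc(1) dc] by simp
      then have "ip H d d = 0" using ip_sub_left[OF dc m] by (simp add: d_def)
      then have "nrm H d = 0" by (simp add: nrm_def)
      then show ?thesis using nrm_sub_eq_0[OF m] by (simp add: d_def)
    qed
    then show "(y, z) \<in> T" using c by (simp add: T_iff)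
  next
    fix y z assume "(y, z) \<in> T"
    then show "(y, z) \<in> adjoint_graph (H\<lparr>car := Hf\<rparr>) T"
      using TH T_symmetric by (auto simp: adjoint_graph_def)
  qed
qed

text \<open>If (x, y) is in T, the integrals of (t \<open>plateau n t\<close>)^2 are the squared
  norms of the truncations of y, hence at most |y|^2, and monotone convergence applies. Conversely,
  integrability of t^2 makes the candidate images a Cauchy sequence, and
  \<open>\<Gamma>_complete\<close> provides the image of x.\<close>

lemma Domain_T: "Domain T = {x \<in> Hf. integrable (\<mu> x) (\<lambda>t. t\<^sup>2)}"
proof (intro equalityI subsetI CollectI conjI)
  fix x assume "x \<in> Domain T"
  then obtain y where xy: "(x, y) \<in> T" by blast
  then show x: "x \<in> Hf" by (simp add: T_def)
  have xc: "x \<in> car H" "y \<in> car H" using xy by (auto simp: T_def Hf_in)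
  have int: "integrable (\<mu> x) (\<lambda>t. (t * plateau n t)\<^sup>2)" for n
  proof -
    have "C0 (\<lambda>t. (t * plateau n t) * (t * plateau n t))"
      using C0_mult[OF C0_t_plateau _ C0_bounded[OF C0_t_plateau]] C0_t_plateau by (simp add: C0_def)
    from integrable_C0[OF this xc(1)] show ?thesis by (simp add: power2_eq_square)
  qed
  have le: "(\<integral>t. (t * plateau n t)\<^sup>2 \<partial>\<mu> x) \<le> (nrm H y)\<^sup>2" for n
  proof -
    have "(\<integral>t. (t * plateau n t)\<^sup>2 \<partial>\<mu> x) = (nrm H (Mr (\<lambda>t. t * plateau n t) x))\<^sup>2"
      by (rule Mr_self[OF C0_t_plateau xc(1), symmetric])
    also have "Mr (\<lambda>t. t * plateau n t) x = Mr (plateau n) y" using xy by (simp add: T_iff)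
    also have "(nrm H (Mr (plateau n) y))\<^sup>2 \<le> (nrm H y)\<^sup>2"
      using M_bound[of "\<lambda>t. of_real (plateau n t)" 1 y] M_in[OF bdd_plateau(1) xc(2)] xc
      by (intro power_mono) auto
    finally show ?thesis .
  qed
  have mono: "(t * plateau m t)\<^sup>2 \<le> (t * plateau n t)\<^sup>2" if "m \<le> n" for t m n
    unfolding power_mult_distrib using plateau_mono[OF that, of t] by (intro mult_left_mono power_mono) auto
  have "incseq (\<lambda>n. \<integral>t. (t * plateau n t)\<^sup>2 \<partial>\<mu> x)"
    unfolding incseq_def using int mono by (auto intro!: integral_mono)
  from incseq_convergent[OF this] le obtain L where L: "(\<lambda>n. \<integral>t. (t * plateau n t)\<^sup>2 \<partial>\<mu> x) \<longlonglongrightarrow> L" by metis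
  show "integrable (\<mu> x) (\<lambda>t. t\<^sup>2)"
  proof (rule integrable_monotone_convergence[OF int _ _ L])
    show "AE t in \<mu> x. mono (\<lambda>n. (t * plateau n t)\<^sup>2)" using mono by (auto simp: mono_def)
    show "AE t in \<mu> x. (\<lambda>n. (t * plateau n t)\<^sup>2) \<longlonglongrightarrow> t\<^sup>2"
    proof (rule AE_I2)
      fix t
      have "(\<lambda>n. (t * plateau n t)\<^sup>2) \<longlonglongrightarrow> (t * 1)\<^sup>2" by (intro tendsto_intros plateau_tendsto)
      then show "(\<lambda>n. (t * plateau n t)\<^sup>2) \<longlonglongrightarrow> t\<^sup>2" by simp
    qed
    show "(\<lambda>t. t\<^sup>2) \<in> borel_measurable (\<mu> x)"
      by (rule borel_measurable_\<mu>[OF xc(1)]) simp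
  qed
next
  fix x assume "x \<in> {x \<in> Hf. integrable (\<mu> x) (\<lambda>t. t\<^sup>2)}"
  then have x: "x \<in> Hf" and int: "integrable (\<mu> x) (\<lambda>t. t\<^sup>2)" by auto
  have xc: "x \<in> car H" using x by (rule Hf_in)
  define y where "y n = M (\<lambda>t. of_real t * of_real (plateau n t)) x" for n
  have yc: "y n \<in> car H" for n unfolding y_def by (rule M_in[OF bdd_plateau(2) xc])
  have dist: "(nrm H (sub H (y m) (y n)))\<^sup>2 = (\<integral>t. (t * plateau m t - t * plateau n t)\<^sup>2 \<partial>\<mu> x)" for m n
    using Mr_dist[OF C0_t_plateau C0_t_plateau xc] by (simp add: y_def)
  have tail: "(\<lambda>k. \<integral>t. (t * (1 - plateau k t))\<^sup>2 \<partial>\<mu> x) \<longlonglongrightarrow> (\<integral>t. 0 \<partial>\<mu> x)"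
  proof (rule dominated[OF xc int])
    show "(\<lambda>n. (t * (1 - plateau n t))\<^sup>2) \<longlonglongrightarrow> 0" for t
    proof -
      have "(\<lambda>n. (t * (1 - plateau n t))\<^sup>2) \<longlonglongrightarrow> (t * (1 - 1))\<^sup>2" by (intro tendsto_intros plateau_tendsto)
      then show ?thesis by simp
    qed
    show "\<bar>(t * (1 - plateau n t))\<^sup>2\<bar> \<le> t\<^sup>2" for n t
      using mult_left_mono[of "(1 - plateau n t)\<^sup>2" 1 "t\<^sup>2"] by (simp add: power_mult_distrib power_le_one)
  qed (auto intro!: continuous_intros)
  have cauchy: "cauchy_seq H y"
    unfolding cauchy_seq_def
  proof safe
    fix e :: real assume e: "e > 0"
    have "e\<^sup>2 > 0" using e by simp
    then obtain k where k: "(\<integral>t. (t * (1 - plateau k t))\<^sup>2 \<partial>\<mu> x) < e\<^sup>2"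
      using order_tendstoD(2)[OF tail, of "e\<^sup>2"] by (auto simp: eventually_sequentially)
    have "nrm H (sub H (y m) (y n)) < e" if mn: "m \<ge> k" "n \<ge> k" for m n
    proof -
      have "(nrm H (sub H (y m) (y n)))\<^sup>2 \<le> (\<integral>t. (t * (1 - plateau k t))\<^sup>2 \<partial>\<mu> x)"
        unfolding dist
      proof (rule integral_mono_AE')
        show "integrable (\<mu> x) (\<lambda>t. (t * (1 - plateau k t))\<^sup>2)"
        proof (rule Bochner_Integration.integrable_bound[OF int])
          have "(\<lambda>t. (t * (1 - plateau k t))\<^sup>2) \<in> borel_measurable borel"
            by (intro borel_measurable_continuous_onI continuous_intros)
          then show "(\<lambda>t. (t * (1 - plateau k t))\<^sup>2) \<in> borel_measurable (\<mu> x)"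
            by (rule borel_measurable_\<mu>[OF xc])
          show "AE t in \<mu> x. norm ((t * (1 - plateau k t))\<^sup>2) \<le> norm (t\<^sup>2)"
            by (intro AE_I2) (simp add: power_mult_distrib power_le_one mult_left_le)
        qed
        have "(t * plateau m t - t * plateau n t)\<^sup>2 \<le> (t * (1 - plateau k t))\<^sup>2" for t
        proof -
          \<comment> \<open>For m, n \<ge> k both values lie between \<open>plateau k t\<close> and
            1, so the difference is controlled by a single tail that depends on k only.\<close>
          have "\<bar>plateau m t - plateau n t\<bar> \<le> 1 - plateau k t"
            using plateau_mono[OF mn(1), of t] plateau_mono[OF mn(2), of t] plateau_bounds(2)[of m t]
              plateau_bounds(2)[of n t] by linarith
          then have "\<bar>t\<bar> * \<bar>plateau m t - plateau n t\<bar> \<le> \<bar>t\<bar> * \<bar>1 - plateau k t\<bar>"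
            by (intro mult_left_mono) auto
          then show ?thesis
            unfolding right_diff_distrib[symmetric] abs_le_square_iff[symmetric] abs_mult by simp
        qed
        then show "AE t in \<mu> x. (t * plateau m t - t * plateau n t)\<^sup>2 \<le> (t * (1 - plateau k t))\<^sup>2" by simp
      qed simp
      then have "(nrm H (sub H (y m) (y n)))\<^sup>2 < e\<^sup>2" using k by linarith
      then show ?thesis by (rule power_less_imp_less_base) (use e in simp)
    qed
    then show "\<exists>n0. \<forall>m\<ge>n0. \<forall>n\<ge>n0. nrm H (sub H (y m) (y n)) < e" by blast
  qed
  have ev: "(Mr (plateau n) x, y n) \<in> \<Gamma>" for n
    using M_\<Gamma>[OF xc bdd_plateau(1) bdd_plateau(2)] by (simp add: y_def)
  note cx = M_in[OF bdd_plateau(1) xc]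
  obtain a b where ab: "(a, b) \<in> \<Gamma>" "(\<lambda>n. nrm H (sub H (Mr (plateau n) x) a)) \<longlonglongrightarrow> 0"
    "(\<lambda>n. nrm H (sub H (y n) b)) \<longlonglongrightarrow> 0"
    using \<Gamma>_complete[OF ev tendsto_cauchy_seq[OF cx xc plateau_tendsto_id[OF x]] cauchy] by blast
  have abc: "a \<in> car H" "b \<in> car H" using ab(1) \<Gamma>_sub by auto
  have "a = x" using limit_unique[OF cx abc(1) xc ab(2) plateau_tendsto_id[OF x]] .
  moreover have "b \<in> Hf"
    using Hf_closed[OF _ abc(2) ab(3)] M_Hf[OF bdd_plateau(2) x] by (simp add: y_def)
  ultimately show "x \<in> Domain T" using ab(1) x by (auto simp: T_def)
qed

lemma T_value:
  assumes xy: "(x, y) \<in> T" shows "ip H x y = of_real (\<integral>t. t \<partial>\<mu> x)"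
proof -
  have c: "x \<in> car H" "y \<in> car H" "x \<in> Hf" "y \<in> Hf" using xy by (auto simp: T_def Hf_in)
  have int2: "integrable (\<mu> x) (\<lambda>t. t\<^sup>2)" using xy Domain_T by blast
  \<comment> \<open>1 + t^2 dominates |t| and is integrable because x is in the domain and \<mu> x
    is finite.\<close>
  have w: "integrable (\<mu> x) (\<lambda>t. 1 + t\<^sup>2)" using integrable_one[OF c(1), of 1] int2 by auto
  have "(\<lambda>n. \<integral>t. t * plateau n t \<partial>\<mu> x) \<longlonglongrightarrow> (\<integral>t. t \<partial>\<mu> x)"
  proof (rule dominated[OF c(1) w])
    show "(\<lambda>n. t * plateau n t) \<longlonglongrightarrow> t" for t
      using tendsto_mult_left[OF plateau_tendsto, of t t] by simp
    show "\<bar>t * plateau n t\<bar> \<le> 1 + t\<^sup>2" for n t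
    proof -
      have "\<bar>t * plateau n t\<bar> \<le> \<bar>t\<bar> * 1" unfolding abs_mult by (intro mult_left_mono) auto
      moreover have "0 \<le> (\<bar>t\<bar> - 1)\<^sup>2" "\<bar>t\<bar>\<^sup>2 = t\<^sup>2" by auto
      moreover have "(\<bar>t\<bar> - 1)\<^sup>2 = \<bar>t\<bar>\<^sup>2 - 2 * \<bar>t\<bar> + 1" by (simp add: power2_eq_square algebra_simps)
      ultimately show ?thesis using abs_ge_zero[of t] by linarith
    qed
  qed (auto intro!: continuous_intros)
  then have 1: "(\<lambda>n. complex_of_real (\<integral>t. t * plateau n t \<partial>\<mu> x)) \<longlonglongrightarrow> of_real (\<integral>t. t \<partial>\<mu> x)"
    by (rule tendsto_of_real)
  have "complex_of_real (\<integral>t. t * plateau n t \<partial>\<mu> x) = ip H x (Mr (plateau n) y)" for n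
    using M_int[OF C0_t_plateau c(1)] xy by (simp add: T_iff)
  then have 2: "(\<lambda>n. complex_of_real (\<integral>t. t * plateau n t \<partial>\<mu> x)) \<longlonglongrightarrow> ip H x y"
    using tendsto_ip_right[OF plateau_tendsto_id[OF c(4)] M_in[OF bdd_plateau(1) c(2)] c(2) c(1)] by simp
  show ?thesis using LIMSEQ_unique[OF 2 1] .
qed

lemma interval_measure_E:
  assumes "h \<in> car H" shows "interval_measure (\<lambda>t. Re (ip H h (E t h))) = \<mu> h"
  using interval_measure_cdf[OF \<mu>[OF assms]] E_int[OF assms] by (simp add: cdf_def)

text \<open>The quadratic forms of the projectors are the masses of half-lines, hence increase with
  the endpoint; for projectors this order is the order of ranges.\<close>

lemma E_le:
  assumes "s \<le> t" "h \<in> car H"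
  shows "E t (E s h) = E s h" "E s (E t h) = E s h"
proof -
  have "Re (ip H h (E s h)) \<le> Re (ip H h (E t h))" if h: "h \<in> car H" for h
  proof -
    interpret finite_borel_measure "\<mu> h" by (rule \<mu>[OF h])
    show ?thesis using E_int[OF h] cdf_nondecreasing[OF assms(1)] by (simp add: cdf_def)
  qed
  then show "E t (E s h) = E s h" "E s (E t h) = E s h"
    using orth_projector_mono[OF E E _ assms(2)] by auto
qed

lemma PE: assumes "h \<in> car H" shows "P (E t h) = E t h"
proof -
  have "Re (ip H h (E t h)) \<le> Re (ip H h (P h))" if h: "h \<in> car H" for h
  proof -
    interpret finite_borel_measure "\<mu> h" by (rule \<mu>[OF h])
    show ?thesis using E_int[OF h] P_int[OF h] cdf_bounded by (simp add: cdf_def borel_UNIV)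
  qed
  then show ?thesis using orth_projector_mono[OF E P _ assms] by auto
qed

lemma E_Hf: "h \<in> car H \<Longrightarrow> E t h \<in> Hf"
  using PE orth_projector_in[OF E] by (simp add: Hf_eq)

lemma E_dist:
  assumes "s \<le> t" "h \<in> car H"
  shows "(nrm H (sub H (E t h) (E s h)))\<^sup>2 = measure (\<mu> h) {..t} - measure (\<mu> h) {..s}"
proof -
  have c: "E t h \<in> car H" "E s h \<in> car H" using orth_projector_in[OF E assms(2)] by auto
  have "ip H (E t h) (E s h) = ip H h (E t (E s h))"
    using E[of t] assms c by (simp add: orth_projector_def)
  then have "ip H (E t h) (E s h) = of_real (measure (\<mu> h) {..s})" using E_le[OF assms] E_int[OF assms(2)] by simp
  then show ?thesis using nrm_sub_sq[OF c] E_nrm[OF assms(2)] by simp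
qed

text \<open>The squared distances are differences of the distribution function of \<mu> h, so its
  one-sided continuity and limits suffice. At the upper end the natural limit is P h; it equals h
  only on \<open>Hf\<close>, whence the extra condition.\<close>

lemma E_limits:
  assumes h: "h \<in> car H"
  shows "((\<lambda>s. nrm H (sub H (E s h) (E t h))) \<longlongrightarrow> 0) (at_right t)"
    "((\<lambda>t. nrm H (E t h)) \<longlongrightarrow> 0) at_bot"
    "h \<in> Hf \<Longrightarrow> ((\<lambda>t. nrm H (sub H (E t h) h)) \<longlongrightarrow> 0) at_top"
proof -
  interpret finite_borel_measure "\<mu> h" by (rule \<mu>[OF h])
  have c: "E t h \<in> car H" for t using orth_projector_in[OF E h] .
  have "((\<lambda>s. sqrt (cdf (\<mu> h) s - cdf (\<mu> h) t)) \<longlongrightarrow> sqrt (cdf (\<mu> h) t - cdf (\<mu> h) t)) (at_right t)"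
    using cdf_is_right_cont[of t] by (intro tendsto_intros) (simp add: continuous_within)
  moreover have "\<forall>\<^sub>F s in at_right t. nrm H (sub H (E s h) (E t h)) = sqrt (cdf (\<mu> h) s - cdf (\<mu> h) t)"
    unfolding eventually_at_right_field
  proof (intro exI[of _ "t + 1"] conjI allI impI)
    fix s assume "t < s"
    then show "nrm H (sub H (E s h) (E t h)) = sqrt (cdf (\<mu> h) s - cdf (\<mu> h) t)"
      using E_dist[of t s h] h c by (simp add: cdf_def real_sqrt_unique)
  qed simp
  ultimately show "((\<lambda>s. nrm H (sub H (E s h) (E t h))) \<longlongrightarrow> 0) (at_right t)"
    by (simp add: tendsto_cong)
  have "((\<lambda>t. sqrt (cdf (\<mu> h) t)) \<longlongrightarrow> sqrt 0) at_bot" by (intro tendsto_intros cdf_lim_at_bot)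
  moreover have "nrm H (E t h) = sqrt (cdf (\<mu> h) t)" for t
    using E_nrm[OF h, of t] c by (simp add: cdf_def real_sqrt_unique)
  ultimately show "((\<lambda>t. nrm H (E t h)) \<longlongrightarrow> 0) at_bot" by simp
  assume hf: "h \<in> Hf"
  have "((\<lambda>t. sqrt (measure (\<mu> h) (space (\<mu> h)) - cdf (\<mu> h) t)) \<longlongrightarrow>
     sqrt (measure (\<mu> h) (space (\<mu> h)) - measure (\<mu> h) (space (\<mu> h)))) at_top"
    by (intro tendsto_intros cdf_lim_at_top)
  moreover have "nrm H (sub H (E t h) h) = sqrt (measure (\<mu> h) (space (\<mu> h)) - cdf (\<mu> h) t)" for t
  proof -
    have "ip H (E t h) h = cnj (ip H h (E t h))" by (rule ip_cnj[OF h c])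
    then have "(nrm H (sub H (E t h) h))\<^sup>2 = measure (\<mu> h) (space (\<mu> h)) - cdf (\<mu> h) t"
      using nrm_sub_sq[OF c h] E_nrm[OF h] E_int[OF h] measure_Hf[OF hf] by (simp add: cdf_def borel_UNIV)
    then show ?thesis using c h by (metis real_sqrt_unique nrm_nonneg sub_in)
  qed
  ultimately show "((\<lambda>t. nrm H (sub H (E t h) h)) \<longlongrightarrow> 0) at_top" by simp
qed

text \<open>Stated for an invariant subspace because it serves twice: for T on \<open>Hf\<close>,
  and for the closure of u on the closure of G. The integrability condition at x depends on \<mu> x
  alone, so \<open>Domain S = Domain T \<inter> K\<close> is what makes it describe the domain of
  S.\<close>

lemma spectral_family_reduced:
  assumes K: "K \<subseteq> Hf" and EK: "\<And>t h. h \<in> K \<Longrightarrow> E t h \<in> K"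
    and S: "selfadjoint (H\<lparr>car := K\<rparr>) S" "S \<subseteq> T" "Domain S = Domain T \<inter> K"
  shows "spectral_family (H\<lparr>car := K\<rparr>) E S"
  unfolding spectral_family_def
proof (intro conjI allI impI ballI)
  have Kc: "h \<in> Hf" "h \<in> car H" if "h \<in> K" for h using K that Hf_in by auto
  show "selfadjoint (H\<lparr>car := K\<rparr>) S" by fact
  show "orth_projector (H\<lparr>car := K\<rparr>) (E t)" for t
    using E[of t] EK Kc by (auto simp: orth_projector_def linear_map_def)
  show "E s (E t x) = E s x" "E t (E s x) = E s x" if "s \<le> t" "x \<in> car (H\<lparr>car := K\<rparr>)" for s t x
    using E_le[OF that(1)] Kc that(2) by auto
  show "((\<lambda>s. nrm (H\<lparr>car := K\<rparr>) (sub (H\<lparr>car := K\<rparr>) (E s x) (E t x))) \<longlongrightarrow> 0) (at_right t)"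
    "((\<lambda>t. nrm (H\<lparr>car := K\<rparr>) (E t x)) \<longlongrightarrow> 0) at_bot"
    "((\<lambda>t. nrm (H\<lparr>car := K\<rparr>) (sub (H\<lparr>car := K\<rparr>) (E t x) x)) \<longlongrightarrow> 0) at_top"
    if "x \<in> car (H\<lparr>car := K\<rparr>)" for x t
    using E_limits[of x] Kc that by auto
  show "Domain S = {x \<in> car (H\<lparr>car := K\<rparr>).
      integrable (interval_measure (\<lambda>t. Re (ip (H\<lparr>car := K\<rparr>) x (E t x)))) (\<lambda>t. t\<^sup>2)}"
    unfolding S(3) Domain_T using Kc by (auto simp: interval_measure_E)
  show "case p of (x, y) \<Rightarrow> ip (H\<lparr>car := K\<rparr>) x y =
      of_real (\<integral>t. t \<partial>interval_measure (\<lambda>t. Re (ip (H\<lparr>car := K\<rparr>) x (E t x))))" if "p \<in> S" for p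
  proof (clarify)
    fix x y assume "p = (x, y)"
    then have xy: "(x, y) \<in> T" using that S by auto
    then have "x \<in> car H" by (auto simp: T_def Hf_in)
    then show "ip (H\<lparr>car := K\<rparr>) x y =
      of_real (\<integral>t. t \<partial>interval_measure (\<lambda>t. Re (ip (H\<lparr>car := K\<rparr>) x (E t x))))"
      using T_value[OF xy] by (simp add: interval_measure_E)
  qed
qed

lemma spectral_family_T: "spectral_family (H\<lparr>car := Hf\<rparr>) E T"
proof (rule spectral_family_reduced[OF subset_refl _ T_selfadjoint subset_refl])
  show "Domain T = Domain T \<inter> Hf" by (auto simp: T_def)
qed (use E_Hf Hf_in in auto)

end

text \<open>The inverse of \<open>resolvent \<i>\<close>, which maps the real line onto a circle without the point 0.\<close>

lemma resolvent_circle: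
  "resolvent \<i> t \<in> sphere (\<i> / 2) (1/2)" "resolvent \<i> t \<noteq> 0" "Re (1 / resolvent \<i> t) = t"
proof -
  have nz: "of_real t - \<i> \<noteq> 0" by (auto simp: complex_eq_iff)
  then show "resolvent \<i> t \<noteq> 0" "Re (1 / resolvent \<i> t) = t" by (auto simp: resolvent_def)
  have "\<i> / 2 - resolvent \<i> t = (\<i> / 2) * ((of_real t + \<i>) / (of_real t - \<i>))"
    using nz by (simp add: resolvent_def field_simps)
  then have "cmod (\<i> / 2 - resolvent \<i> t) = cmod (\<i> / 2) * (cmod (of_real t + \<i>) / cmod (of_real t - \<i>))"
    by (simp only: norm_mult norm_divide)
  moreover have "cmod (of_real t + \<i>) = cmod (of_real t - \<i>)" by (simp add: cmod_def)
  ultimately have "cmod (\<i> / 2 - resolvent \<i> t) = 1/2"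
    using nz by (simp add: norm_divide)
  then show "resolvent \<i> t \<in> sphere (\<i> / 2) (1/2)" by (simp add: dist_norm)
qed

text \<open>The equation of the circle reads |z|^2 = Im z, and Im (1 / z) = - Im z / |z|^2. Thus 1 /
  z lies on the line of the numbers t - \<i>.\<close>

lemma Im_inverse_circle:
  assumes "z \<in> sphere (\<i> / 2) (1/2)" "z \<noteq> 0" shows "Im (1 / z) = - 1"
proof -
  have "(cmod (\<i> / 2 - z))\<^sup>2 = (1/2)\<^sup>2" using assms(1) by (simp add: dist_norm)
  then have "(Re z)\<^sup>2 + (Im z)\<^sup>2 = Im z"
    by (simp add: cmod_power2 power2_diff power_divide)
  moreover have "(Re z)\<^sup>2 + (Im z)\<^sup>2 \<noteq> 0" using assms(2) by (simp add: complex_eq_iff sum_power2_eq_zero_iff)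
  ultimately show ?thesis by (simp add: Im_divide)
qed

text \<open>The circle is the one-point compactification of the line, with 0 in the place of
  infinity. Compact support makes the transported function vanish near 0, and elsewhere it is a
  composition of continuous maps.\<close>

lemma circle_compactification:
  fixes f :: "real \<Rightarrow> real"
  assumes f: "continuous_on UNIV f" and R: "\<And>t. R \<le> \<bar>t\<bar> \<Longrightarrow> f t = 0"
  defines "g \<equiv> \<lambda>z. if z = 0 then 0 else f (Re (1 / z))"
  shows "continuous_on (sphere (\<i> / 2) (1/2)) g" "\<And>t. g (resolvent \<i> t) = f t"
proof -
  show "g (resolvent \<i> t) = f t" for t
    using resolvent_circle[of t] by (simp add: g_def)
  show "continuous_on (sphere (\<i> / 2) (1/2)) g"
    unfolding continuous_on_eq_continuous_within
  proof
    fix z assume z: "z \<in> sphere (\<i> / 2) (1/2)"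
    show "continuous (at z within sphere (\<i> / 2) (1/2)) g"
    proof (cases "z = 0")
      case True
      \<comment> \<open>If |w| < d then |1 / w| > |R| + 1; the imaginary part of 1 / w has modulus
        1, so its real part exceeds |R| in modulus.\<close>
      define d where "d = 1 / (\<bar>R\<bar> + 1)"
      have d: "d > 0" by (simp add: d_def)
      have "g w = 0" if w: "w \<in> sphere (\<i> / 2) (1/2)" "cmod w < d" for w
      proof (cases "w = 0")
        case False
        have "cmod (1 / w) > \<bar>R\<bar> + 1"
          using w(2) False by (simp add: d_def norm_divide field_simps)
        moreover have "cmod (1 / w) \<le> \<bar>Re (1 / w)\<bar> + \<bar>Im (1 / w)\<bar>" by (rule cmod_le)
        ultimately have "R \<le> \<bar>Re (1 / w)\<bar>" using Im_inverse_circle[OF w(1) False] by linarith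
        then show ?thesis using R False by (simp add: g_def)
      qed (simp add: g_def)
      then have "\<forall>\<^sub>F w in at z within sphere (\<i> / 2) (1/2). g w = 0"
        unfolding eventually_at using d True by (intro exI[of _ d]) auto
      then have "(g \<longlongrightarrow> 0) (at z within sphere (\<i> / 2) (1/2))" by (rule tendsto_eventually)
      then show ?thesis using True by (simp add: continuous_within g_def)
    next
      case False
      have "isCont (\<lambda>w. f (Re (1 / w))) z"
      proof (rule isCont_o2[where f = "\<lambda>w. Re (1 / w)" and g = f])
        show "isCont (\<lambda>w. Re (1 / w)) z" by (intro continuous_Re isCont_divide continuous_const continuous_ident False)
        show "isCont f (Re (1 / z))" using f by (simp add: continuous_on_eq_continuous_at)
      qed
      then have "((\<lambda>w. f (Re (1 / w))) \<longlongrightarrow> f (Re (1 / z))) (at z)" by (simp add: isCont_def)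
      moreover have "\<forall>\<^sub>F w in at z. f (Re (1 / w)) = g w"
        unfolding eventually_at
        using False by (intro exI[of _ "cmod z"]) (auto simp: g_def)
      ultimately have "(g \<longlongrightarrow> f (Re (1 / z))) (at z)" by (rule Lim_transform_eventually)
      then have "isCont g z" using False by (simp add: isCont_def g_def)
      then show ?thesis by (rule continuous_at_imp_continuous_at_within)
    qed
  qed
qed

text \<open>Continuous functions with compact support decreasing to the indicator of \<open>{..s}\<close>.\<close>

definition cutoff :: "real \<Rightarrow> nat \<Rightarrow> real \<Rightarrow> real" where
  "cutoff s n t = plateau n t * max 0 (min 1 (1 + real n * (s - t)))"

lemma continuous_cutoff [continuous_intros]: "continuous_on S (cutoff s n)"
  unfolding cutoff_def by (intro continuous_intros)

lemma cutoff_eq_0: "real n + 1 \<le> \<bar>t\<bar> \<Longrightarrow> cutoff s n t = 0"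
  by (simp add: cutoff_def plateau_eq_0)

lemma C0_cutoff: "C0 (cutoff s n)"
  by (rule C0_compact_support[of _ "real n + 1"]) (auto intro: continuous_intros cutoff_eq_0)

lemma cutoff_bounds: "0 \<le> cutoff s n t" "cutoff s n t \<le> 1"
  by (auto simp: cutoff_def intro!: mult_le_one)

lemma cutoff_tendsto: "(\<lambda>n. cutoff s n t) \<longlonglongrightarrow> indicator {..s} t"
proof (cases "t \<le> s")
  case True
  then have "cutoff s n t = plateau n t" for n by (simp add: cutoff_def)
  then show ?thesis using plateau_tendsto[of t] True by simp
next
  case False
  obtain N :: nat where N: "1 / (t - s) \<le> N" using real_arch_simple by blast
  have "cutoff s n t = 0" if "n \<ge> N" for n
  proof -
    have "1 / (t - s) \<le> n" using N that by linarith
    then have "1 + real n * (s - t) \<le> 0" using False by (simp add: field_simps)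
    then show ?thesis by (simp add: cutoff_def)
  qed
  then show ?thesis using False by (intro tendsto_eventually) (auto simp: eventually_sequentially)
qed

section \<open>Restriction to the closure of \<open>G\<close>\<close>

text \<open>V with e is G inside the hull; Gh with j is an abstract completion, over another type,
  in which essential selfadjointness is given. The two embeddings are compared only through the
  scalar product of V.\<close>

locale spectral_reduction = spectral_calculus H M \<Gamma> \<mu> E P
  for H :: "'a ips" and M and \<Gamma> :: "('a \<times> 'a) set" and \<mu> E P +
  fixes V :: "'b ips" and e :: "'b \<Rightarrow> 'a" and u :: "'b \<Rightarrow> 'b" and Gh :: "'c ips" and j :: "'b \<Rightarrow> 'c"
  assumes V: "prehilbert V"
    and e_lin: "linear_map V H e"
    and e_ip: "\<And>x y. x \<in> car V \<Longrightarrow> y \<in> car V \<Longrightarrow> ip H (e x) (e y) = ip V x y"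
    and u_lin: "linear_map V V u"
    and e_\<Gamma>: "\<And>x. x \<in> car V \<Longrightarrow> (e x, e (u x)) \<in> \<Gamma>"
    and completion: "hilbert_completion V Gh j"
    and ess_selfadjoint: "selfadjoint Gh (closure_graph Gh {(j x, j (u x)) |x. x \<in> car V})"
begin

sublocale V: prehilb V by unfold_locales (rule V)

definition K where "K = closure_in H (e ` car V)"
definition S where "S = closure_graph (H\<lparr>car := K\<rparr>) {(e x, e (u x)) |x. x \<in> car V}"

lemma Gh: "hilbert Gh" using completion by (simp add: hilbert_completion_def)

sublocale Gh: prehilb Gh by unfold_locales (use Gh in \<open>simp add: hilbert_def\<close>)

lemma j_lin: "linear_map V Gh j"
  and j_ip: "x \<in> car V \<Longrightarrow> y \<in> car V \<Longrightarrow> ip Gh (j x) (j y) = ip V x y"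
  using completion by (auto simp: hilbert_completion_def)

lemma e_in: "x \<in> car V \<Longrightarrow> e x \<in> car H"
  and e_add: "x \<in> car V \<Longrightarrow> y \<in> car V \<Longrightarrow> e (add V x y) = add H (e x) (e y)"
  and e_scl: "x \<in> car V \<Longrightarrow> e (scl V c x) = scl H c (e x)"
  using e_lin by (auto simp: linear_map_def)

lemma j_in: "x \<in> car V \<Longrightarrow> j x \<in> car Gh"
  and j_add: "x \<in> car V \<Longrightarrow> y \<in> car V \<Longrightarrow> j (add V x y) = add Gh (j x) (j y)"
  and j_scl: "x \<in> car V \<Longrightarrow> j (scl V c x) = scl Gh c (j x)"
  using j_lin by (auto simp: linear_map_def)

lemma u_in: "x \<in> car V \<Longrightarrow> u x \<in> car V"
  and u_add: "x \<in> car V \<Longrightarrow> y \<in> car V \<Longrightarrow> u (add V x y) = add V (u x) (u y)"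
  and u_scl: "x \<in> car V \<Longrightarrow> u (scl V c x) = scl V c (u x)"
  using u_lin by (auto simp: linear_map_def)

lemma e_sub: "x \<in> car V \<Longrightarrow> y \<in> car V \<Longrightarrow> e (sub V x y) = sub H (e x) (e y)"
  by (simp add: sub_def e_add e_scl)

lemma j_sub: "x \<in> car V \<Longrightarrow> y \<in> car V \<Longrightarrow> j (sub V x y) = sub Gh (j x) (j y)"
  by (simp add: sub_def j_add j_scl)

lemma nrm_e: "x \<in> car V \<Longrightarrow> nrm H (e x) = nrm V x"
  and nrm_j: "x \<in> car V \<Longrightarrow> nrm Gh (j x) = nrm V x"
  by (simp_all add: nrm_def e_ip j_ip)

text \<open>Both coordinates occur as first components of \<Gamma>: the second one because u maps V
  into itself, so that \<open>e_\<Gamma>\<close> also applies to u x. Hence both lie in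
  \<open>Hf\<close>.\<close>

lemma e_T: "x \<in> car V \<Longrightarrow> (e x, e (u x)) \<in> T"
  using e_\<Gamma>[of x] e_\<Gamma>[of "u x"] u_in[of x] \<Gamma>_Domain_Hf by (auto simp: T_def)

lemma e_Hf: "x \<in> car V \<Longrightarrow> e x \<in> Hf"
  using e_T by (auto simp: T_def)

lemma range_e_subspace: "subspace_of H (e ` car V)"
  unfolding subspace_of_def
proof (intro conjI ballI allI)
  show "e ` car V \<subseteq> car H" using e_in by auto
  have "nrm H (e (zer V)) = 0" by (simp add: nrm_e)
  then have "e (zer V) = zer H" using nrm_eq_0_iff e_in by simp
  then show "zer H \<in> e ` car V" by (metis V.zer_in image_eqI)
qed (auto simp: e_add[symmetric] e_scl[symmetric] intro!: imageI)

lemma K_subspace: "subspace_of H K"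
  unfolding K_def by (rule subspace_closure_in[OF range_e_subspace])

lemma e_K: "x \<in> car V \<Longrightarrow> e x \<in> K"
  unfolding K_def using subset_closure_in[of "e ` car V"] e_in by blast

lemma K_in: "h \<in> K \<Longrightarrow> h \<in> car H" by (simp add: K_def closure_in_def)

lemma K_limit:
  assumes "\<And>n. x n \<in> K" "l \<in> car H" "(\<lambda>n. nrm H (sub H (x n) l)) \<longlonglongrightarrow> 0"
  shows "l \<in> K"
  unfolding K_def
  by (rule closure_in_limit[OF _ assms(1)[unfolded K_def] assms(2,3)]) (use e_in in auto)

lemma K_approx:
  assumes "h \<in> K"
  obtains g where "\<And>n. g n \<in> car V" "(\<lambda>n. nrm H (sub H (e (g n)) h)) \<longlonglongrightarrow> 0"
proof -
  have "e ` car V \<subseteq> car H" using e_in by auto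
  then obtain a where a: "\<forall>n. a n \<in> e ` car V" "(\<lambda>n. nrm H (sub H (a n) h)) \<longlonglongrightarrow> 0"
    using assms closure_in_iff[of "e ` car V" h] unfolding K_def by blast
  have "\<forall>n. \<exists>x. x \<in> car V \<and> a n = e x" using a(1) by blast
  then obtain g where g: "\<forall>n. g n \<in> car V \<and> a n = e (g n)" by (rule choice[THEN exE]) blast
  show thesis by (rule that[of g]) (use g a(2) in auto)
qed

lemma K_Hf: "h \<in> K \<Longrightarrow> h \<in> Hf"
proof -
  assume h: "h \<in> K"
  obtain g where g: "\<And>n. g n \<in> car V" "(\<lambda>n. nrm H (sub H (e (g n)) h)) \<longlonglongrightarrow> 0" using K_approx[OF h] by blast
  show "h \<in> Hf" using Hf_closed[OF e_Hf[OF g(1)] K_in[OF h] g(2)] .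
qed

text \<open>A vector w orthogonal to the range of u - s satisfies the adjoint relation with image
  conj(s) w. As the closure of u is its own adjoint, \<langle>w, conj(s) w\<rangle> =
  \<langle>conj(s) w, w\<rangle>, which forces w = 0 for nonreal s. The result is phrased in V so
  that it can be moved from Gh to H.\<close>

lemma range_dense:
  assumes s: "\<bar>Im s\<bar> = 1" and g: "g \<in> car V" and \<epsilon>: "\<epsilon> > 0"
  shows "\<exists>x\<in>car V. nrm V (sub V (sub V (u x) (scl V s x)) g) < \<epsilon>"
proof -
  define A where "A = {(j x, j (u x)) |x. x \<in> car V}"
  define d where "d x = sub V (u x) (scl V s x)" for x
  define L where "L = j ` d ` car V"
  have A: "A \<subseteq> car Gh \<times> car Gh" using j_in u_in by (auto simp: A_def)
  have d: "d x \<in> car V" if "x \<in> car V" for x using that u_in by (simp add: d_def)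
  have d_add: "d (add V x y) = add V (d x) (d y)" if "x \<in> car V" "y \<in> car V" for x y
    unfolding d_def u_add[OF that] by (rule V.ip_eqI) (use that u_in in \<open>auto simp: algebra_simps\<close>)
  have d_scl: "d (scl V c x) = scl V c (d x)" if "x \<in> car V" for x c
    unfolding d_def u_scl[OF that] by (rule V.ip_eqI) (use that u_in in \<open>auto simp: algebra_simps\<close>)
  have L: "subspace_of Gh L"
    unfolding subspace_of_def
  proof (intro conjI ballI allI)
    show "L \<subseteq> car Gh" using d j_in by (auto simp: L_def)
    have "nrm V (d (zer V)) = 0" using d_scl[of "zer V" 0] d[of "zer V"]
      by (metis V.zer_in V.nrm_scl mult_zero_left norm_zero V.nrm_zer V.scl_in V.nrm_eq_0_iff)
    then have "nrm Gh (j (d (zer V))) = 0" using nrm_j d by simp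
    then have "j (d (zer V)) = zer Gh" using Gh.nrm_eq_0_iff j_in d by simp
    then show "zer Gh \<in> L" unfolding L_def by (metis V.zer_in image_eqI)
    fix x y assume "x \<in> L" "y \<in> L"
    then obtain a b where ab: "a \<in> car V" "b \<in> car V" "x = j (d a)" "y = j (d b)" by (auto simp: L_def)
    have "add Gh x y = j (d (add V a b))" using ab d by (simp add: d_add j_add)
    then show "add Gh x y \<in> L" unfolding L_def using ab by blast
  next
    fix c x assume "x \<in> L"
    then obtain a where a: "a \<in> car V" "x = j (d a)" by (auto simp: L_def)
    have "scl Gh c x = j (d (scl V c a))" using a d by (simp add: d_scl j_scl)
    then show "scl Gh c x \<in> L" unfolding L_def using a by blast
  qed
  have "closure_in Gh L = car Gh"
  proof (rule hilbert_dense_subspace[OF Gh L])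
    fix w assume w: "w \<in> car Gh" and orth: "\<forall>l\<in>L. ip Gh l w = 0"
    define w' where "w' = scl Gh (cnj s) w"
    have w': "w' \<in> car Gh" using w by (simp add: w'_def)
    have "ip Gh w (j (u x)) = ip Gh w' (j x)" if x: "x \<in> car V" for x
    proof -
      have "ip Gh (j (d x)) w = 0" using orth x by (auto simp: L_def)
      then have "ip Gh w (j (d x)) = 0" using Gh.ip_cnj[OF j_in[OF d[OF x]] w] by simp
      then show ?thesis using x w u_in j_in by (simp add: d_def j_sub j_scl w'_def)
    qed
    then have "(w, w') \<in> adjoint_graph Gh A" using w w' by (auto simp: adjoint_graph_def A_def)
    then have ad: "(w, w') \<in> adjoint_graph Gh (closure_graph Gh A)"
      by (simp add: Gh.adjoint_closure_graph[OF A])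
    then have "(w, w') \<in> closure_graph Gh A"
      using ess_selfadjoint unfolding A_def selfadjoint_def by simp
    then have "ip Gh w w' = ip Gh w' w" using ad by (auto simp: adjoint_graph_def)
    then have "cnj s * ip Gh w w = s * ip Gh w w" using w by (simp add: w'_def)
    moreover have "cnj s \<noteq> s" using s by (auto simp: complex_eq_iff)
    ultimately have "ip Gh w w = 0" by simp
    then have "nrm Gh w = 0" by (simp add: nrm_def)
    then show "w = zer Gh" using Gh.nrm_eq_0_iff[OF w] by simp
  qed
  then have "j g \<in> closure_in Gh L" using j_in[OF g] by simp
  then obtain l where l: "l \<in> L" "nrm Gh (sub Gh (j g) l) < \<epsilon>" using \<epsilon> unfolding closure_in_def by blast
  then obtain x where x: "x \<in> car V" "l = j (d x)" by (auto simp: L_def)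
  have "nrm V (sub V g (d x)) < \<epsilon>" using l x g d by (simp add: j_sub[symmetric] nrm_j)
  then have "nrm V (sub V (d x) g) < \<epsilon>" using V.nrm_sub_commute[OF g d[OF x(1)]] by simp
  then show ?thesis using x by (auto simp: d_def)
qed

text \<open>The resolvent sends e (u x - s x) back to e x. Such vectors are dense in K by
  \<open>range_dense\<close>, and the resolvent is a contraction since |t - s| \<ge> 1, so it maps
  limits into the closed set K.\<close>

lemma resolvent_K:
  assumes s: "\<bar>Im s\<bar> = 1" and h: "h \<in> K" shows "M (resolvent s) h \<in> K"
proof -
  note r = bdd_resolvent[OF s]
  have eK: "M (resolvent s) (e g) \<in> K" if g: "g \<in> car V" for g
  proof -
    have "\<exists>a\<in>e ` car V. nrm H (sub H (M (resolvent s) (e g)) a) < \<epsilon>" if \<epsilon>: "\<epsilon> > 0" for \<epsilon>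
    proof -
      obtain x where x: "x \<in> car V" "nrm V (sub V (sub V (u x) (scl V s x)) g) < \<epsilon>"
        using range_dense[OF s g \<epsilon>] by blast
      define w where "w = sub V (u x) (scl V s x)"
      have w: "w \<in> car V" using x u_in by (simp add: w_def)
      have "M (resolvent s) (e w) = sub H (M (resolvent s) (e (u x))) (scl H s (M (resolvent s) (e x)))"
        using x u_in r by (simp add: w_def e_sub e_scl M_sub M_scl e_in)
      also have "scl H s (M (resolvent s) (e x)) = M (\<lambda>t. s * resolvent s t) (e x)"
        using M_mult[of "\<lambda>_. s" "resolvent s" "e x"] M_const[of "M (resolvent s) (e x)" s] r M_in e_in x by simp
      also have "M (resolvent s) (e (u x)) = M (\<lambda>t. of_real t * resolvent s t) (e x)"
        by (rule \<Gamma>_M[OF e_\<Gamma>[OF x(1)] r])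
      also have "sub H (M (\<lambda>t. of_real t * resolvent s t) (e x)) (M (\<lambda>t. s * resolvent s t) (e x)) =
         M (\<lambda>t. of_real t * resolvent s t - s * resolvent s t) (e x)"
        by (rule M_diff_fun[OF r(2) bounded_range_mult[OF bounded_range_const r(1)] e_in[OF x(1)], symmetric])
      also have "(\<lambda>t. of_real t * resolvent s t - s * resolvent s t) = (\<lambda>_. 1)"
        using bounded_resolvent(3)[OF s] by (auto simp: algebra_simps)
      finally have Mw: "M (resolvent s) (e w) = e x" using M_one[OF e_in[OF x(1)]] by simp
      have "nrm H (sub H (e x) (M (resolvent s) (e g))) = nrm H (M (resolvent s) (e (sub V w g)))"
        using w g r by (simp add: e_sub M_sub e_in Mw)
      also have "\<dots> \<le> 1 * nrm H (e (sub V w g))"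
        using bounded_resolvent(1)[OF s] w g by (intro M_bound e_in) auto
      also have "\<dots> < \<epsilon>" using x(2) w g by (simp add: nrm_e w_def)
      finally have "nrm H (sub H (M (resolvent s) (e g)) (e x)) < \<epsilon>"
        using nrm_sub_commute[OF e_in[OF x(1)] M_in[OF r(1) e_in[OF g]]] by simp
      then show ?thesis using x(1) by blast
    qed
    then show ?thesis unfolding K_def closure_in_def using M_in[OF r(1) e_in[OF g]] by simp
  qed
  obtain g where g: "\<And>n. g n \<in> car V" "(\<lambda>n. nrm H (sub H (e (g n)) h)) \<longlonglongrightarrow> 0" using K_approx[OF h] by blast
  have hc: "h \<in> car H" using h by (rule K_in)
  have "norm (nrm H (sub H (M (resolvent s) (e (g n))) (M (resolvent s) h))) \<le> nrm H (sub H (e (g n)) h)" for n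
  proof -
    have c: "sub H (e (g n)) h \<in> car H" using e_in[OF g(1)] hc by simp
    have "sub H (M (resolvent s) (e (g n))) (M (resolvent s) h) = M (resolvent s) (sub H (e (g n)) h)"
      by (rule M_sub[OF r(1) e_in[OF g(1)] hc, symmetric])
    then show ?thesis using M_bound[OF bounded_resolvent(1)[OF s] c] M_in[OF r(1) c] by simp
  qed
  then have "(\<lambda>n. nrm H (sub H (M (resolvent s) (e (g n))) (M (resolvent s) h))) \<longlonglongrightarrow> 0"
    by (intro Lim_null_comparison[OF always_eventually g(2)] allI)
  from K_limit[OF eK[OF g(1)] M_in[OF r(1) hc] this] show ?thesis .
qed

text \<open>The symbols whose operators preserve K. They form an algebra with constants; as it
  contains the resolvents at \<i> and -\<i>, which are conjugate, it contains the real and imaginary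
  parts of the resolvent.\<close>

definition Q :: "(real \<Rightarrow> complex) \<Rightarrow> bool" where
  "Q \<phi> \<longleftrightarrow> bounded (range \<phi>) \<and> (\<forall>h\<in>K. M \<phi> h \<in> K)"

lemma K_add: "x \<in> K \<Longrightarrow> y \<in> K \<Longrightarrow> add H x y \<in> K" and K_scl: "x \<in> K \<Longrightarrow> scl H c x \<in> K"
  using K_subspace by (auto simp: subspace_of_def)

lemma Q_mult: "Q \<phi> \<Longrightarrow> Q \<psi> \<Longrightarrow> Q (\<lambda>t. \<phi> t * \<psi> t)"
  unfolding Q_def using bounded_range_mult[of \<phi> \<psi>] M_mult[of \<phi> \<psi>] K_in by metis

lemma Q_add: assumes "Q \<phi>" "Q \<psi>" shows "Q (\<lambda>t. \<phi> t + \<psi> t)"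
proof -
  obtain B C where "\<And>x. cmod (\<phi> x) \<le> B" "\<And>x. cmod (\<psi> x) \<le> C" using assms by (auto simp: Q_def bounded_iff)
  then have "cmod (\<phi> x + \<psi> x) \<le> B + C" for x by (rule order_trans[OF norm_triangle_ineq add_mono])
  then have "bounded (range (\<lambda>t. \<phi> t + \<psi> t))" by (auto simp: bounded_iff)
  then show ?thesis using assms M_add_fun[of \<phi> \<psi>] K_in K_add by (simp add: Q_def)
qed

lemma Q_const: "Q (\<lambda>_. c)"
  by (simp add: Q_def M_const K_in K_scl)

lemma Q_resolvent: "\<bar>Im s\<bar> = 1 \<Longrightarrow> Q (resolvent s)"
  by (simp add: Q_def bdd_resolvent resolvent_K)

text \<open>Stone-Weierstrass asks for a compact space, whence the transport to the circle, where
  the coordinates Re and Im separate points. \<open>M_bound\<close> turns uniform approximation of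
  symbols into approximation of operators, and K is closed.\<close>

lemma Q_compact_support:
  assumes f: "continuous_on UNIV f" "\<And>t. R \<le> \<bar>t\<bar> \<Longrightarrow> f t = 0"
  shows "Q (\<lambda>t. complex_of_real (f t))"
proof -
  define C where "C = sphere (\<i> / 2) (1/2 :: real)"
  define g where "g = (\<lambda>z. if z = 0 then 0 else f (Re (1 / z)))"
  have g: "continuous_on C g" "\<And>t. g (resolvent \<i> t) = f t"
    using circle_compactification[of f R] f by (simp_all add: g_def C_def)
  define A where "A = (\<lambda>p::complex \<Rightarrow> real. continuous_on C p \<and> Q (\<lambda>t. of_real (p (resolvent \<i> t))))"
  have r: "Q (resolvent \<i>)" "Q (resolvent (-\<i>))" by (rule Q_resolvent, simp)+
  have cr: "resolvent (-\<i>) t = cnj (resolvent \<i> t)" for t by (simp add: resolvent_def)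
  have ARe: "A Re"
  proof -
    have "Q (\<lambda>t. (1/2) * (resolvent \<i> t + resolvent (-\<i>) t))"
      by (intro Q_mult Q_add Q_const r)
    also have "(\<lambda>t. (1/2) * (resolvent \<i> t + resolvent (-\<i>) t)) = (\<lambda>t. of_real (Re (resolvent \<i> t)))"
      by (auto simp: cr complex_add_cnj)
    finally show ?thesis by (auto simp: A_def intro: continuous_intros)
  qed
  have AIm: "A Im"
  proof -
    have "Q (\<lambda>t. (1/(2 * \<i>)) * (resolvent \<i> t + (-1) * resolvent (-\<i>) t))"
      by (intro Q_mult Q_add Q_const r)
    also have "(\<lambda>t. (1/(2 * \<i>)) * (resolvent \<i> t + (-1) * resolvent (-\<i>) t)) = (\<lambda>t. of_real (Im (resolvent \<i> t)))"
      by (auto simp: cr complex_eq_iff)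
    finally show ?thesis by (auto simp: A_def intro: continuous_intros)
  qed
  have bf: "bounded (range (\<lambda>t. complex_of_real (f t)))" using bdd_C0[OF C0_compact_support[of f R]] f by blast
  have approx: "\<exists>p. A p \<and> (\<forall>z\<in>C. \<bar>g z - p z\<bar> < \<epsilon>)" if "\<epsilon> > 0" for \<epsilon>
  proof (rule Stone_Weierstrass_HOL[where P = A])
    show "compact C" by (simp add: C_def)
    show "A (\<lambda>x. c)" for c using Q_const by (simp add: A_def)
    show "continuous_on C p" if "A p" for p using that by (simp add: A_def)
    show "A (\<lambda>x. p x + q x)" if "A p \<and> A q" for p q
      using that Q_add by (auto simp: A_def intro: continuous_intros)
    show "A (\<lambda>x. p x * q x)" if "A p \<and> A q" for p q
      using that Q_mult by (auto simp: A_def intro: continuous_intros)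
    show "\<exists>p. A p \<and> p x \<noteq> p y" if "x \<in> C \<and> y \<in> C \<and> x \<noteq> y" for x y
      using that ARe AIm by (metis complex_eqI)
  qed (use g that in auto)
  have "M (\<lambda>t. of_real (f t)) h \<in> K" if h: "h \<in> K" for h
  proof -
    have hc: "h \<in> car H" using h by (rule K_in)
    have "\<forall>n. \<exists>p. A p \<and> (\<forall>z\<in>C. \<bar>g z - p z\<bar> < inverse (real (Suc n)))"
    proof
      fix n
      have "inverse (real (Suc n)) > 0" by simp
      then show "\<exists>p. A p \<and> (\<forall>z\<in>C. \<bar>g z - p z\<bar> < inverse (real (Suc n)))" by (rule approx)
    qed
    then obtain p where p: "\<And>n. A (p n)" "\<And>n z. z \<in> C \<Longrightarrow> \<bar>g z - p n z\<bar> < inverse (real (Suc n))" by metis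
    define q where "q n t = complex_of_real (p n (resolvent \<i> t))" for n t
    have Qq: "Q (q n)" for n using p(1)[of n] by (simp add: A_def q_def[abs_def])
    have q: "cmod (q n t - of_real (f t)) \<le> inverse (real (Suc n))" for n t
    proof -
      have "q n t - of_real (f t) = of_real (p n (resolvent \<i> t) - g (resolvent \<i> t))" by (simp add: q_def g(2))
      then show ?thesis
        using p(2)[of "resolvent \<i> t" n] resolvent_circle(1)[of t] unfolding C_def
        by (simp only: norm_of_real) (simp add: abs_minus_commute)
    qed
    have le: "norm (nrm H (sub H (M (q n) h) (M (\<lambda>t. of_real (f t)) h))) \<le> inverse (real (Suc n)) * nrm H h" for n
    proof -
      have bq: "bounded (range (q n))" using Qq by (simp add: Q_def)
      have "sub H (M (q n) h) (M (\<lambda>t. of_real (f t)) h) = M (\<lambda>t. q n t - of_real (f t)) h"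
        by (rule M_diff_fun[OF bq bf hc, symmetric])
      then show ?thesis
        using M_bound[of "\<lambda>t. q n t - of_real (f t)", OF q hc]
          nrm_nonneg[OF sub_in[OF M_in[OF bq hc] M_in[OF bf hc]]] by simp
    qed
    have lim: "(\<lambda>n. inverse (real (Suc n)) * nrm H h) \<longlonglongrightarrow> 0"
      using tendsto_mult_left_zero[OF LIMSEQ_inverse_real_of_nat] .
    have "(\<lambda>n. nrm H (sub H (M (q n) h) (M (\<lambda>t. of_real (f t)) h))) \<longlonglongrightarrow> 0"
      by (rule Lim_null_comparison[OF always_eventually lim], rule allI, rule le)
    from K_limit[OF _ M_in[OF bf hc] this] show ?thesis using Qq h by (simp add: Q_def)
  qed
  then show ?thesis using bf by (simp add: Q_def)
qed

text \<open>Dominated convergence gives convergence of the quadratic forms of the cutoffs, and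
  polarization gives weak convergence to the projector. \<open>K_limit\<close> asks for norm
  convergence, so the squared distance is expanded and weak convergence is used for the mixed
  term.\<close>

lemma E_K:
  assumes h: "h \<in> K" shows "E t h \<in> K"
proof -
  have hc: "h \<in> car H" using h by (rule K_in)
  define A where "A n = M (\<lambda>s. complex_of_real (cutoff t n s))" for n
  have bA: "bounded (range (\<lambda>s. complex_of_real (cutoff t n s)))" for n by (rule bdd_C0[OF C0_cutoff])
  have A_in: "A n x \<in> car H" if "x \<in> car H" for n x unfolding A_def by (rule M_in[OF bA that])
  have E_in: "E t x \<in> car H" if "x \<in> car H" for x by (rule orth_projector_in[OF E that])
  have ind: "(\<integral>s. indicator {..t} s \<partial>\<mu> x) = measure (\<mu> x) {..t}" if "x \<in> car H" for x
    using \<mu>_props[OF that] by simp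
  have quad: "(\<lambda>n. ip H x (A n x)) \<longlonglongrightarrow> ip H x (E t x)" if x: "x \<in> car H" for x
  proof -
    have "(\<lambda>n. \<integral>s. cutoff t n s \<partial>\<mu> x) \<longlonglongrightarrow> (\<integral>s. indicator {..t} s \<partial>\<mu> x)"
      by (rule dominated[OF x integrable_one[OF x, of 1]])
         (auto intro!: continuous_intros cutoff_tendsto simp: cutoff_bounds abs_le_iff order_trans[OF _ cutoff_bounds(1)])
    from tendsto_of_real[OF this, where 'a = complex] show ?thesis
      using M_int[OF C0_cutoff x] E_int[OF x] ind[OF x] by (simp add: A_def)
  qed
  have weak: "(\<lambda>n. ip H k (A n h)) \<longlonglongrightarrow> ip H k (E t h)" if k: "k \<in> car H" for k
  proof -
    have pA: "4 * ip H k (A n h) = ip H (add H k h) (A n (add H k h))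
       - ip H (add H k (scl H (-1) h)) (A n (add H k (scl H (-1) h)))
       - \<i> * ip H (add H k (scl H \<i> h)) (A n (add H k (scl H \<i> h)))
       + \<i> * ip H (add H k (scl H (-\<i>) h)) (A n (add H k (scl H (-\<i>) h)))" for n
      by (rule Re_ip_polarization[OF k hc]) (auto simp: A_def M_in[OF bA] M_add[OF bA] M_scl[OF bA])
    have pE: "4 * ip H k (E t h) = ip H (add H k h) (E t (add H k h))
       - ip H (add H k (scl H (-1) h)) (E t (add H k (scl H (-1) h)))
       - \<i> * ip H (add H k (scl H \<i> h)) (E t (add H k (scl H \<i> h)))
       + \<i> * ip H (add H k (scl H (-\<i>) h)) (E t (add H k (scl H (-\<i>) h)))"
      by (rule Re_ip_polarization[OF k hc]) (use E[of t] in \<open>auto simp: orth_projector_def linear_map_def\<close>)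
    have "(\<lambda>n. 4 * ip H k (A n h)) \<longlonglongrightarrow> 4 * ip H k (E t h)"
      unfolding pA pE by (intro tendsto_intros quad) (use k hc in auto)
    from tendsto_mult_left[OF this, of "1/4"] show ?thesis by simp
  qed
  \<comment> \<open>All three terms tend to multiples of the mass of \<open>{..t}\<close> with
    coefficients 1, -2 and 1. The indicator equals its square, so the squares of the cutoffs have
    the same limit as the cutoffs.\<close>
  have eq: "(nrm H (sub H (A n h) (E t h)))\<^sup>2 =
     (\<integral>s. (cutoff t n s)\<^sup>2 \<partial>\<mu> h) - 2 * Re (ip H (E t h) (A n h)) + measure (\<mu> h) {..t}" for n
  proof -
    have "ip H (A n h) (E t h) = cnj (ip H (E t h) (A n h))" by (rule ip_cnj[OF E_in[OF hc] A_in[OF hc]])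
    then show ?thesis
      using nrm_sub_sq[OF A_in[OF hc] E_in[OF hc]] Mr_self[OF C0_cutoff hc] E_nrm[OF hc] by (simp add: A_def)
  qed
  have "(\<lambda>n. \<integral>s. (cutoff t n s)\<^sup>2 \<partial>\<mu> h) \<longlonglongrightarrow> (\<integral>s. indicator {..t} s \<partial>\<mu> h)"
  proof (rule dominated[OF hc integrable_one[OF hc, of 1]])
    show "(\<lambda>n. (cutoff t n s)\<^sup>2) \<longlonglongrightarrow> indicator {..t} s" for s
      using tendsto_power[OF cutoff_tendsto[of t s], of 2] by (cases "s \<le> t") auto
  qed (auto intro!: continuous_intros simp: cutoff_bounds power_le_one)
  then have 1: "(\<lambda>n. \<integral>s. (cutoff t n s)\<^sup>2 \<partial>\<mu> h) \<longlonglongrightarrow> measure (\<mu> h) {..t}" using ind[OF hc] by simp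
  have "ip H (E t h) (E t h) = of_real (measure (\<mu> h) {..t})" using orth_projector_ip[OF E hc] E_int[OF hc] by simp
  then have 2: "(\<lambda>n. Re (ip H (E t h) (A n h))) \<longlonglongrightarrow> measure (\<mu> h) {..t}"
    using tendsto_Re[OF weak[OF E_in[OF hc]]] by simp
  have "(\<lambda>n. (nrm H (sub H (A n h) (E t h)))\<^sup>2) \<longlonglongrightarrow>
     measure (\<mu> h) {..t} - 2 * measure (\<mu> h) {..t} + measure (\<mu> h) {..t}"
    unfolding eq by (intro tendsto_intros 1 2)
  then have "(\<lambda>n. (nrm H (sub H (A n h) (E t h)))\<^sup>2) \<longlonglongrightarrow> 0" by simp
  from tendsto_real_sqrt[OF this] have "(\<lambda>n. nrm H (sub H (A n h) (E t h))) \<longlonglongrightarrow> 0"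
    using A_in[OF hc] E_in[OF hc] by simp
  note lim = this
  have "A n h \<in> K" for n
    using Q_compact_support[of "cutoff t n" "real n + 1"] h
    by (auto simp: Q_def A_def intro: continuous_intros cutoff_eq_0)
  from K_limit[OF this E_in[OF hc] lim] show ?thesis .
qed

lemma A_sub_K: "{(e x, e (u x)) |x. x \<in> car V} \<subseteq> K \<times> K"
  using e_K u_in by auto

sublocale KH: prehilb "H\<lparr>car := K\<rparr>"
  by unfold_locales (rule prehilbert_subspace[OF K_subspace])

lemma S_iff: "(x, y) \<in> S \<longleftrightarrow> x \<in> K \<and> y \<in> K \<and> (\<exists>g. (\<forall>n. g n \<in> car V) \<and>
   (\<lambda>n. nrm H (sub H (e (g n)) x)) \<longlonglongrightarrow> 0 \<and> (\<lambda>n. nrm H (sub H (e (u (g n))) y)) \<longlonglongrightarrow> 0)" (is "_ \<longleftrightarrow> ?R")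
proof -
  have sub: "{(e x, e (u x)) |x. x \<in> car V} \<subseteq> car (H\<lparr>car := K\<rparr>) \<times> car (H\<lparr>car := K\<rparr>)"
    using A_sub_K by simp
  show ?thesis
  proof
    assume "(x, y) \<in> S"
    then obtain a b where xy: "x \<in> K" "y \<in> K" and ab: "\<forall>n. (a n, b n) \<in> {(e x, e (u x)) |x. x \<in> car V}"
      "(\<lambda>n. nrm H (sub H (a n) x)) \<longlonglongrightarrow> 0" "(\<lambda>n. nrm H (sub H (b n) y)) \<longlonglongrightarrow> 0"
      unfolding S_def KH.closure_graph_iff[OF sub] by auto
    have "\<forall>n. \<exists>x. x \<in> car V \<and> a n = e x \<and> b n = e (u x)" using ab(1) by blast
    then obtain g where "\<And>n. g n \<in> car V" "\<And>n. a n = e (g n)" "\<And>n. b n = e (u (g n))" by metis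
    then show ?R using xy ab(2,3) by auto
  next
    assume ?R
    then obtain g where xy: "x \<in> K" "y \<in> K" and g: "\<And>n. g n \<in> car V"
      "(\<lambda>n. nrm H (sub H (e (g n)) x)) \<longlonglongrightarrow> 0" "(\<lambda>n. nrm H (sub H (e (u (g n))) y)) \<longlonglongrightarrow> 0" by blast
    show "(x, y) \<in> S"
      unfolding S_def KH.closure_graph_iff[OF sub]
    proof (intro conjI)
      show "\<exists>a b. (\<forall>n. (a n, b n) \<in> {(e x, e (u x)) |x. x \<in> car V}) \<and>
        (\<lambda>n. nrm (H\<lparr>car := K\<rparr>) (sub (H\<lparr>car := K\<rparr>) (a n) x)) \<longlonglongrightarrow> 0 \<and>
        (\<lambda>n. nrm (H\<lparr>car := K\<rparr>) (sub (H\<lparr>car := K\<rparr>) (b n) y)) \<longlonglongrightarrow> 0"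
        by (rule exI[of _ "\<lambda>n. e (g n)"], rule exI[of _ "\<lambda>n. e (u (g n))"]) (use g in auto)
    qed (use xy in auto)
  qed
qed

text \<open>A limit of pairs (e g, e (u g)) still satisfies the symmetry relation with every pair of
  T, hence lies in the adjoint of T on \<open>Hf\<close>, which is T.\<close>

lemma S_T: "S \<subseteq> T"
proof (clarify)
  fix x y assume "(x, y) \<in> S"
  then obtain g where xy: "x \<in> K" "y \<in> K" and g: "\<And>n. g n \<in> car V"
      "(\<lambda>n. nrm H (sub H (e (g n)) x)) \<longlonglongrightarrow> 0" "(\<lambda>n. nrm H (sub H (e (u (g n))) y)) \<longlonglongrightarrow> 0"
    unfolding S_iff by blast
  have "ip H x b = ip H y a" if ab: "(a, b) \<in> T" for a b
  proof -
    have c: "a \<in> car H" "b \<in> car H" using ab by (auto simp: T_def Hf_in)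
    have eq: "ip H (e (g n)) b = ip H (e (u (g n))) a" for n by (rule T_symmetric[OF e_T[OF g(1)] ab])
    from tendsto_ip_left[OF g(2) e_in[OF g(1)] K_in[OF xy(1)] c(2), unfolded eq]
    show ?thesis using tendsto_ip_left[OF g(3) e_in[OF u_in[OF g(1)]] K_in[OF xy(2)] c(1)] by (rule LIMSEQ_unique)
  qed
  then have "(x, y) \<in> adjoint_graph (H\<lparr>car := Hf\<rparr>) T"
    using xy K_Hf by (auto simp: adjoint_graph_def)
  then show "(x, y) \<in> T" using T_selfadjoint by (simp add: selfadjoint_def)
qed

text \<open>\<open>K\<close> embeds isometrically into the completion \<open>Gh\<close>; only completeness of \<open>Gh\<close> is used.\<close>

lemma K_to_Gh:
  assumes g: "\<And>n. g n \<in> car V" "(\<lambda>n. nrm H (sub H (e (g n)) h)) \<longlonglongrightarrow> 0" and h: "h \<in> car H"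
  obtains h' where "h' \<in> car Gh" "(\<lambda>n. nrm Gh (sub Gh (j (g n)) h')) \<longlonglongrightarrow> 0"
    "\<And>x. x \<in> car V \<Longrightarrow> nrm Gh (sub Gh h' (j x)) = nrm H (sub H h (e x))"
    "\<And>x. x \<in> car V \<Longrightarrow> ip Gh h' (j x) = ip H h (e x)"
proof -
  have "cauchy_seq H (\<lambda>n. e (g n))" using tendsto_cauchy_seq[OF e_in[OF g(1)] h g(2)] .
  moreover have "nrm H (sub H (e (g m)) (e (g n))) = nrm Gh (sub Gh (j (g m)) (j (g n)))" for m n
    using g(1)[of m] g(1)[of n] nrm_e[of "sub V (g m) (g n)"] nrm_j[of "sub V (g m) (g n)"]
    by (simp add: e_sub j_sub)
  ultimately have "\<forall>e>0. \<exists>n0. \<forall>m\<ge>n0. \<forall>n\<ge>n0. nrm Gh (sub Gh (j (g m)) (j (g n))) < e"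
    by (simp add: cauchy_seq_def)
  moreover have "range (\<lambda>n. j (g n)) \<subseteq> car Gh" using j_in[OF g(1)] by auto
  ultimately obtain h' where h': "h' \<in> car Gh" "(\<lambda>n. nrm Gh (sub Gh (j (g n)) h')) \<longlonglongrightarrow> 0"
    using Gh unfolding hilbert_def by blast
  show thesis
  proof (rule that[OF h'])
    fix x assume x: "x \<in> car V"
    have "(\<lambda>n. nrm Gh (sub Gh (j (g n)) (j x)) - nrm Gh (sub Gh h' (j x))) \<longlonglongrightarrow> 0"
    proof (rule Lim_null_comparison[OF always_eventually h'(2)], rule allI)
      fix n
      have "sub Gh (sub Gh (j (g n)) (j x)) (sub Gh h' (j x)) = sub Gh (j (g n)) h'"
        by (rule Gh.ip_eqI) (use h' j_in[OF g(1)] j_in[OF x] in auto)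
      then show "norm (nrm Gh (sub Gh (j (g n)) (j x)) - nrm Gh (sub Gh h' (j x))) \<le> nrm Gh (sub Gh (j (g n)) h')"
        using Gh.nrm_diff_le[of "sub Gh (j (g n)) (j x)" "sub Gh h' (j x)"] h' j_in[OF g(1)] j_in[OF x] by simp
    qed
    then have 1: "(\<lambda>n. nrm Gh (sub Gh (j (g n)) (j x))) \<longlonglongrightarrow> nrm Gh (sub Gh h' (j x))" by (rule LIM_zero_cancel)
    have "(\<lambda>n. nrm H (sub H (e (g n)) (e x)) - nrm H (sub H h (e x))) \<longlonglongrightarrow> 0"
    proof (rule Lim_null_comparison[OF always_eventually g(2)], rule allI)
      fix n
      have "sub H (sub H (e (g n)) (e x)) (sub H h (e x)) = sub H (e (g n)) h"
        by (rule ip_eqI) (use h e_in[OF g(1)] e_in[OF x] in auto)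
      then show "norm (nrm H (sub H (e (g n)) (e x)) - nrm H (sub H h (e x))) \<le> nrm H (sub H (e (g n)) h)"
        using nrm_diff_le[of "sub H (e (g n)) (e x)" "sub H h (e x)"] h e_in[OF g(1)] e_in[OF x] by simp
    qed
    then have 2: "(\<lambda>n. nrm H (sub H (e (g n)) (e x))) \<longlonglongrightarrow> nrm H (sub H h (e x))" by (rule LIM_zero_cancel)
    have eq: "nrm H (sub H (e (g n)) (e x)) = nrm Gh (sub Gh (j (g n)) (j x))" for n
      using g(1)[of n] x nrm_e[of "sub V (g n) x"] nrm_j[of "sub V (g n) x"] by (simp add: e_sub j_sub)
    show "nrm Gh (sub Gh h' (j x)) = nrm H (sub H h (e x))" by (rule LIMSEQ_unique[OF 1 2[unfolded eq]])
    have eq': "ip Gh (j (g n)) (j x) = ip H (e (g n)) (e x)" for n using g(1) x by (simp add: j_ip e_ip)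
    from Gh.tendsto_ip_left[OF h'(2) j_in[OF g(1)] h'(1) j_in[OF x], unfolded eq']
    show "ip Gh h' (j x) = ip H h (e x)"
      using tendsto_ip_left[OF g(2) e_in[OF g(1)] h e_in[OF x]] by (rule LIMSEQ_unique)
  qed
qed

text \<open>S is symmetric because T is. For the other inclusion, y and z are replaced by elements
  of Gh with the same scalar products with, and the same distances from, the images of V. There the
  adjoint relation gives approximation by pairs (j x, j (u x)), and equality of distances carries
  the approximation back to H.\<close>

lemma S_selfadjoint: "selfadjoint (H\<lparr>car := K\<rparr>) S"
  unfolding selfadjoint_def
proof (intro conjI)
  have SK: "x \<in> K" "y \<in> K" "x \<in> car H" "y \<in> car H" if "(x, y) \<in> S" for x y
    using that unfolding S_iff by (auto simp: K_in)
  have e_S: "(e x, e (u x)) \<in> S" if "x \<in> car V" for x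
    unfolding S_iff using that e_K u_in e_in by (auto intro!: exI[of _ "\<lambda>_. x"])
  have Ssub: "S \<subseteq> car (H\<lparr>car := K\<rparr>) \<times> car (H\<lparr>car := K\<rparr>)" using SK by auto
  show "closure_in (H\<lparr>car := K\<rparr>) (Domain S) = car (H\<lparr>car := K\<rparr>)"
  proof -
    have "\<exists>a\<in>Domain S. nrm H (sub H h a) < \<epsilon>" if h: "h \<in> K" "\<epsilon> > 0" for h \<epsilon>
    proof -
      obtain a where "a \<in> e ` car V" "nrm H (sub H h a) < \<epsilon>"
        using h unfolding K_def closure_in_def by blast
      then show ?thesis using e_S by blast
    qed
    then show ?thesis by (auto simp: closure_in_def)
  qed
  show adj: "adjoint_graph (H\<lparr>car := K\<rparr>) S = S"
  proof (intro equalityI subsetI; clarify)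
    fix y z assume "(y, z) \<in> S"
    then show "(y, z) \<in> adjoint_graph (H\<lparr>car := K\<rparr>) S"
      using SK T_symmetric S_T by (auto simp: adjoint_graph_def subset_iff)
  next
    fix y z assume "(y, z) \<in> adjoint_graph (H\<lparr>car := K\<rparr>) S"
    then have c: "y \<in> K" "z \<in> K" and ad: "\<And>x x'. (x, x') \<in> S \<Longrightarrow> ip H y x' = ip H z x"
      by (auto simp: adjoint_graph_def)
    obtain g where g: "\<And>n. g n \<in> car V" "(\<lambda>n. nrm H (sub H (e (g n)) y)) \<longlonglongrightarrow> 0" using K_approx[OF c(1)] by blast
    obtain f where f: "\<And>n. f n \<in> car V" "(\<lambda>n. nrm H (sub H (e (f n)) z)) \<longlonglongrightarrow> 0" using K_approx[OF c(2)] by blast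
    obtain y' where y': "y' \<in> car Gh" "\<And>x. x \<in> car V \<Longrightarrow> nrm Gh (sub Gh y' (j x)) = nrm H (sub H y (e x))"
      "\<And>x. x \<in> car V \<Longrightarrow> ip Gh y' (j x) = ip H y (e x)" using K_to_Gh[OF g K_in[OF c(1)]] by metis
    obtain z' where z': "z' \<in> car Gh" "\<And>x. x \<in> car V \<Longrightarrow> nrm Gh (sub Gh z' (j x)) = nrm H (sub H z (e x))"
      "\<And>x. x \<in> car V \<Longrightarrow> ip Gh z' (j x) = ip H z (e x)" using K_to_Gh[OF f K_in[OF c(2)]] by metis
    define A where "A = {(j x, j (u x)) |x. x \<in> car V}"
    have A: "A \<subseteq> car Gh \<times> car Gh" using j_in u_in by (auto simp: A_def)
    have "ip Gh y' (j (u x)) = ip Gh z' (j x)" if "x \<in> car V" for x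
      using ad[OF e_S[OF that]] y'(3) z'(3) that u_in by simp
    then have "(y', z') \<in> adjoint_graph Gh A" using y'(1) z'(1) by (auto simp: adjoint_graph_def A_def)
    then have yz: "(y', z') \<in> closure_graph Gh A"
      using ess_selfadjoint unfolding selfadjoint_def A_def[symmetric] by (simp add: Gh.adjoint_closure_graph[OF A])
    have "\<exists>p\<in>{(e x, e (u x)) |x. x \<in> car V}. case p of (a, b) \<Rightarrow> nrm H (sub H y a) < \<epsilon> \<and> nrm H (sub H z b) < \<epsilon>"
      if \<epsilon>: "\<epsilon> > 0" for \<epsilon>
    proof -
      obtain a b where ab: "(a, b) \<in> A" "nrm Gh (sub Gh y' a) < \<epsilon>" "nrm Gh (sub Gh z' b) < \<epsilon>"
        using yz \<epsilon> unfolding closure_graph_def by blast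
      then obtain x where x: "x \<in> car V" "a = j x" "b = j (u x)" by (auto simp: A_def)
      then have "nrm H (sub H y (e x)) < \<epsilon>" "nrm H (sub H z (e (u x))) < \<epsilon>"
        using ab y'(2) z'(2) u_in by auto
      then show ?thesis using x(1) by blast
    qed
    then show "(y, z) \<in> S" using c unfolding S_def closure_graph_def by auto
  qed
  show "linear_operator (H\<lparr>car := K\<rparr>) S"
    unfolding linear_operator_def
  proof (intro conjI allI ballI Ssub)
    show "single_valued S" using T_single_valued S_T by (rule single_valued_subset[rotated])
    \<comment> \<open>As S is its own adjoint, membership amounts to equations linear in the pair,
      which yields closure under sums and multiples.\<close>
    have ad: "(y, z) \<in> S \<longleftrightarrow> y \<in> K \<and> z \<in> K \<and> (\<forall>(x, x')\<in>S. ip H y x' = ip H z x)" for y z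
      by (subst adj[symmetric]) (simp add: adjoint_graph_def)
    have z: "zer H \<in> K" using K_subspace by (simp add: subspace_of_def)
    show "(zer (H\<lparr>car := K\<rparr>), zer (H\<lparr>car := K\<rparr>)) \<in> S"
      using SK z by (subst ad) auto
    show "case p of (x, y) \<Rightarrow> \<forall>(x', y')\<in>S. (add (H\<lparr>car := K\<rparr>) x x', add (H\<lparr>car := K\<rparr>) y y') \<in> S"
      if "p \<in> S" for p
    proof (clarify)
      fix x y x' y' assume "p = (x, y)" and x': "(x', y') \<in> S"
      then have x: "(x, y) \<in> S" using that by simp
      have "ip H (add H x x') b = ip H (add H y y') a" if "(a, b) \<in> S" for a b
      proof -
        have "ip H x b = ip H y a" "ip H x' b = ip H y' a"
          using T_symmetric S_T x x' that by blast+
        then show ?thesis using SK[OF x] SK[OF x'] SK[OF that] by simp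
      qed
      then show "(add (H\<lparr>car := K\<rparr>) x x', add (H\<lparr>car := K\<rparr>) y y') \<in> S"
        using SK[OF x] SK[OF x'] K_add by (subst ad) auto
    qed
    show "case p of (x, y) \<Rightarrow> (scl (H\<lparr>car := K\<rparr>) c x, scl (H\<lparr>car := K\<rparr>) c y) \<in> S"
      if "p \<in> S" for p c
    proof (clarify)
      fix x y assume "p = (x, y)"
      then have x: "(x, y) \<in> S" using that by simp
      have "ip H (scl H c x) b = ip H (scl H c y) a" if "(a, b) \<in> S" for a b
      proof -
        have "ip H x b = ip H y a" using T_symmetric S_T x that by blast
        then show ?thesis using SK[OF x] SK[OF that] by simp
      qed
      then show "(scl (H\<lparr>car := K\<rparr>) c x, scl (H\<lparr>car := K\<rparr>) c y) \<in> S"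
        using SK[OF x] K_scl by (subst ad) auto
    qed
  qed
qed

text \<open>The truncations of y equal compactly supported functions applied to x, hence lie in K,
  and so does their limit y. By symmetry of T the pair then lies in the adjoint of S, which is
  S.\<close>

lemma Domain_S: "Domain S = Domain T \<inter> K"
proof (intro equalityI subsetI)
  fix x assume "x \<in> Domain S"
  then show "x \<in> Domain T \<inter> K" using S_T S_iff by blast
next
  fix x assume "x \<in> Domain T \<inter> K"
  then obtain y where xy: "(x, y) \<in> T" and x: "x \<in> K" by blast
  have y: "y \<in> Hf" using xy by (simp add: T_def)
  have "Mr (plateau n) y \<in> K" for n
  proof -
    have "Q (\<lambda>t. complex_of_real (t * plateau n t))"
      by (rule Q_compact_support[of _ "real n + 1"]) (auto intro!: continuous_intros plateau_eq_0)
    then have "Mr (\<lambda>t. t * plateau n t) x \<in> K" using x by (simp add: Q_def)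
    then show ?thesis using xy by (simp add: T_iff)
  qed
  from K_limit[OF this Hf_in[OF y] plateau_tendsto_id[OF y]] have yK: "y \<in> K" .
  have "(x, y) \<in> adjoint_graph (H\<lparr>car := K\<rparr>) S"
    using x yK T_symmetric[OF xy] S_T by (auto simp: adjoint_graph_def subset_iff)
  then show "x \<in> Domain S" using S_selfadjoint by (auto simp: selfadjoint_def)
qed

lemma spectral_family_S: "spectral_family (H\<lparr>car := K\<rparr>) E S"
  by (rule spectral_family_reduced[OF _ E_K S_selfadjoint S_T Domain_S]) (use K_Hf in auto)

end

section \<open>Nonstandard universes\<close>

locale nonstandard =
  fixes N :: "'w universe"
  assumes nonstandard_universe: "nonstandard_universe N"
begin

lemma superstructure: "superstructure N"
  and atoms_sub: "atoms N \<subseteq> new_atoms N"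
  and inj_cnum: "inj (cnum N)"
  and cnum_atom: "range (cnum N) \<subseteq> atoms N"
  and star_atom: "x \<in> atoms N \<Longrightarrow> star N x = x"
  and transfer: "transfer_principle N"
  and saturated: "aleph1_saturated N"
  using nonstandard_universe by (auto simp: nonstandard_universe_def)

lemma elts_atom: "a \<in> new_atoms N \<Longrightarrow> elts N a = {}"
  and set_ext: "x \<notin> new_atoms N \<Longrightarrow> y \<notin> new_atoms N \<Longrightarrow> elts N x = elts N y \<Longrightarrow> x = y"
  and level_all: "\<exists>n. x \<in> level N (new_atoms N) n"
  and set_exists: "S \<subseteq> level N (new_atoms N) n \<Longrightarrow> \<exists>x. x \<notin> new_atoms N \<and> elts N x = S"
  using superstructure unfolding superstructure_def by blast+

lemma level_Suc_mono: "level N A n \<subseteq> level N A (Suc n)"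
  by (induction n) auto

lemma level_mono: "m \<le> n \<Longrightarrow> level N A m \<subseteq> level N A n"
  using lift_Suc_mono_le[of "level N A"] level_Suc_mono by blast

lemma level_transitive:
  assumes "A \<subseteq> new_atoms N" "x \<in> level N A n" "y \<in> elts N x" shows "y \<in> level N A n"
proof (cases n)
  case 0
  then show ?thesis using assms elts_atom by auto
next
  case (Suc m)
  then show ?thesis using assms elts_atom level_Suc_mono[of A m] by auto
qed

lemma level_atoms_sub: "level N (atoms N) n \<subseteq> level N (new_atoms N) n"
  by (induction n) (use atoms_sub in auto)

text \<open>Bounded rank guarantees that \<open>the_set\<close> denotes a genuine element;
  \<open>std_small\<close> moreover places that element in the standard universe, where
  \<open>star\<close> obeys transfer.\<close>

definition small :: "'w set \<Rightarrow> bool" where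
  "small S \<longleftrightarrow> (\<exists>n. S \<subseteq> level N (new_atoms N) n)"

definition std_small :: "'w set \<Rightarrow> bool" where
  "std_small S \<longleftrightarrow> (\<exists>n. S \<subseteq> level N (atoms N) n)"

lemma std_small_small: "std_small S \<Longrightarrow> small S"
  using level_atoms_sub by (auto simp: std_small_def small_def)

lemma small_subset: "small S \<Longrightarrow> T \<subseteq> S \<Longrightarrow> small T"
  by (auto simp: small_def)

lemma std_small_subset: "std_small S \<Longrightarrow> T \<subseteq> S \<Longrightarrow> std_small T"
  by (auto simp: std_small_def)

lemma std_small_Un: assumes "std_small S" "std_small T" shows "std_small (S \<union> T)"
proof -
  obtain m n where "S \<subseteq> level N (atoms N) m" "T \<subseteq> level N (atoms N) n" using assms by (auto simp: std_small_def)
  then have "S \<union> T \<subseteq> level N (atoms N) (max m n)"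
    using level_mono[of m "max m n" "atoms N"] level_mono[of n "max m n" "atoms N"] by auto
  then show ?thesis by (auto simp: std_small_def)
qed

lemma small_insert: assumes "small S" shows "small (insert x S)"
proof -
  obtain m where m: "S \<subseteq> level N (new_atoms N) m" using assms by (auto simp: small_def)
  obtain n where n: "x \<in> level N (new_atoms N) n" using level_all by blast
  have "insert x S \<subseteq> level N (new_atoms N) (max m n)"
    using m n level_mono[of m "max m n" "new_atoms N"] level_mono[of n "max m n" "new_atoms N"] by auto
  then show ?thesis by (auto simp: small_def)
qed

lemma small_empty [simp]: "small {}" by (simp add: small_def)

lemma small_elts: "small (elts N x)"
  using level_all[of x] level_transitive[of "new_atoms N"] unfolding small_def by blast

lemma the_set_props: assumes "small S" shows "the_set N S \<notin> new_atoms N" "elts N (the_set N S) = S"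
proof -
  obtain x where x: "x \<notin> new_atoms N \<and> elts N x = S" using assms set_exists unfolding small_def by blast
  then have "\<exists>!x. x \<notin> new_atoms N \<and> elts N x = S" using x set_ext by metis
  from theI'[OF this] have "the_set N S \<notin> new_atoms N \<and> elts N (the_set N S) = S"
    unfolding the_set_def .
  then show "the_set N S \<notin> new_atoms N" "elts N (the_set N S) = S" by auto
qed

lemma the_set_eqI: "x \<notin> new_atoms N \<Longrightarrow> elts N x = S \<Longrightarrow> the_set N S = x"
  using the_set_props[of S] small_elts set_ext by blast

lemma mem_the_set: "small S \<Longrightarrow> mem N x (the_set N S) \<longleftrightarrow> x \<in> S"
  using the_set_props(2)[of S] by (auto simp: elts_def)

lemma mem_not_atom: "mem N y x \<Longrightarrow> x \<notin> new_atoms N"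
  using elts_atom by (auto simp: elts_def)

lemma the_set_inj: "small S \<Longrightarrow> small T \<Longrightarrow> the_set N S = the_set N T \<Longrightarrow> S = T"
  using the_set_props(2) by metis

lemma small_doubleton: "small {x, y}" by (intro small_insert small_empty)

lemma pr_inj [simp]: "pr N x y = pr N x' y' \<longleftrightarrow> x = x' \<and> y = y'"
proof
  assume "pr N x y = pr N x' y'"
  then have "{the_set N {x}, the_set N {x, y}} = {the_set N {x'}, the_set N {x', y'}}"
    unfolding pr_def by (rule the_set_inj[OF small_doubleton small_doubleton])
  then have "the_set N {x} = the_set N {x'} \<and> the_set N {x, y} = the_set N {x', y'} \<or>
      the_set N {x} = the_set N {x', y'} \<and> the_set N {x, y} = the_set N {x'}"
    by (simp add: doubleton_eq_iff)
  then have "{x} = {x'} \<and> {x, y} = {x', y'} \<or> {x} = {x', y'} \<and> {x, y} = {x'}"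
    using the_set_inj small_doubleton small_insert[OF small_empty] by metis
  then show "x = x' \<and> y = y'" by (auto simp: doubleton_eq_iff)
qed simp

lemma std_iff: "x \<in> standard_universe N \<longleftrightarrow> (\<exists>n. x \<in> level N (atoms N) n)"
  by (auto simp: standard_universe_def)

lemma std_the_set: "std_small S \<Longrightarrow> the_set N S \<in> standard_universe N"
proof -
  assume S: "std_small S"
  then obtain n where "S \<subseteq> level N (atoms N) n" by (auto simp: std_small_def)
  then have "the_set N S \<in> level N (atoms N) (Suc n)" using the_set_props[OF std_small_small[OF S]] by simp
  then show ?thesis by (auto simp: std_iff simp del: level.simps)
qed

lemma std_small_elts: "x \<in> standard_universe N \<Longrightarrow> std_small (elts N x)"
  using level_transitive[OF atoms_sub] unfolding std_small_def std_iff by blast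

lemma std_small_singleton: "x \<in> standard_universe N \<Longrightarrow> std_small {x}"
  by (auto simp: std_iff std_small_def)

lemma std_small_mem: "std_small S \<Longrightarrow> x \<in> S \<Longrightarrow> x \<in> standard_universe N"
  by (auto simp: std_iff std_small_def)

lemma level_the_set: "S \<subseteq> level N (atoms N) n \<Longrightarrow> the_set N S \<in> level N (atoms N) (Suc n)"
  using the_set_props[of S] level_atoms_sub[of n] by (auto simp: small_def)

lemma level_pr:
  assumes "x \<in> level N (atoms N) n" "y \<in> level N (atoms N) n"
  shows "pr N x y \<in> level N (atoms N) (Suc (Suc n))"
  unfolding pr_def by (intro level_the_set insert_subsetI empty_subsetI) (use assms in auto)

lemma std_small_sets:
  assumes "std_small A" shows "std_small (the_set N ` Pow A)"
proof -
  obtain n where n: "A \<subseteq> level N (atoms N) n" using assms by (auto simp: std_small_def)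
  have "the_set N ` Pow A \<subseteq> level N (atoms N) (Suc n)"
  proof (clarify)
    fix S assume "S \<subseteq> A"
    then show "the_set N S \<in> level N (atoms N) (Suc n)" using n by (intro level_the_set) auto
  qed
  then show ?thesis unfolding std_small_def by blast
qed

definition pairs :: "'w set \<Rightarrow> 'w set \<Rightarrow> 'w set" where
  "pairs A B = {pr N x y |x y. x \<in> A \<and> y \<in> B}"

lemma std_small_pairs:
  assumes "std_small A" "std_small B" shows "std_small (pairs A B)"
proof -
  obtain n where n: "A \<union> B \<subseteq> level N (atoms N) n" using std_small_Un[OF assms] by (auto simp: std_small_def)
  have "pairs A B \<subseteq> level N (atoms N) (Suc (Suc n))"
    using n level_pr unfolding pairs_def by blast
  then show ?thesis unfolding std_small_def by blast
qed

text \<open>The variables 90--93 are reserved for the unfolding of Kuratowski pairs.\<close>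

definition fOr where "fOr p q = Neg (Conj (Neg p) (Neg q))"
definition fImp where "fImp p q = Neg (Conj p (Neg q))"
definition fIff where "fIff p q = Conj (fImp p q) (fImp q p)"
definition fEx where "fEx i k p = Neg (BAll i k (Neg p))"
definition fPair where "fPair z x y = fEx 90 z (fEx 91 z (Conj
  (Conj (Conj (Mem x 90) (BAll 92 90 (Equal 92 x)))
    (Conj (Conj (Mem x 91) (Mem y 91)) (BAll 92 91 (fOr (Equal 92 x) (Equal 92 y)))))
  (BAll 92 z (fOr (Equal 92 90) (Equal 92 91)))))"
definition fApp where "fApp f x y = fEx 93 f (fPair 93 x y)"

lemma sat_connectives [simp]:
  "sat N (fOr p q) e \<longleftrightarrow> sat N p e \<or> sat N q e"
  "sat N (fImp p q) e \<longleftrightarrow> (sat N p e \<longrightarrow> sat N q e)"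
  "sat N (fIff p q) e \<longleftrightarrow> (sat N p e \<longleftrightarrow> sat N q e)"
  "sat N (fEx i k p) e \<longleftrightarrow> (\<exists>x. mem N x (e k) \<and> sat N p (e(i := x)))"
  by (auto simp: fOr_def fImp_def fIff_def fEx_def)

text \<open>The two members of a Kuratowski pair range over the pair itself, so the equation becomes
  a bounded formula; extensionality turns the description of the members back into equality.\<close>

lemma sat_fPair [simp]:
  assumes "z \<notin> {90, 91, 92}" "x \<notin> {90, 91, 92}" "y \<notin> {90, 91, 92}"
  shows "sat N (fPair z x y) e \<longleftrightarrow> e z = pr N (e x) (e y)"
proof -
  have ne: "z \<noteq> 90" "z \<noteq> 91" "z \<noteq> 92" "x \<noteq> 90" "x \<noteq> 91" "x \<noteq> 92" "y \<noteq> 90" "y \<noteq> 91" "y \<noteq> 92"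
    using assms by auto
  define X Y Z where "X = e x" and "Y = e y" and "Z = e z"
  have "sat N (fPair z x y) e \<longleftrightarrow> (\<exists>s. mem N s Z \<and> (\<exists>t. mem N t Z \<and>
     ((mem N X s \<and> (\<forall>w. mem N w s \<longrightarrow> w = X)) \<and>
      (mem N X t \<and> mem N Y t) \<and> (\<forall>w. mem N w t \<longrightarrow> w = X \<or> w = Y)) \<and>
      (\<forall>w. mem N w Z \<longrightarrow> w = s \<or> w = t)))"
    using ne unfolding fPair_def X_def Y_def Z_def by simp
  also have "\<dots> \<longleftrightarrow> Z = pr N X Y"
  proof (intro iffI; (elim exE conjE)?)
    fix s t assume Z: "mem N s Z" "mem N t Z" "\<forall>w. mem N w Z \<longrightarrow> w = s \<or> w = t"
      and s: "mem N X s" "\<forall>w. mem N w s \<longrightarrow> w = X"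
      and t: "mem N X t" "mem N Y t" "\<forall>w. mem N w t \<longrightarrow> w = X \<or> w = Y"
    have "elts N s = {X}" using s unfolding elts_def by blast
    then have "the_set N {X} = s" by (rule the_set_eqI[OF mem_not_atom[OF s(1)]])
    moreover have "elts N t = {X, Y}" using t unfolding elts_def by blast
    then have "the_set N {X, Y} = t" by (rule the_set_eqI[OF mem_not_atom[OF t(1)]])
    moreover have "elts N Z = {s, t}" using Z unfolding elts_def by blast
    then have "the_set N {s, t} = Z" by (rule the_set_eqI[OF mem_not_atom[OF Z(1)]])
    ultimately
    show "Z = pr N X Y" by (simp add: pr_def)
  next
    assume Z: "Z = pr N X Y"
    show "\<exists>s. mem N s Z \<and> (\<exists>t. mem N t Z \<and>
     ((mem N X s \<and> (\<forall>w. mem N w s \<longrightarrow> w = X)) \<and>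
      (mem N X t \<and> mem N Y t) \<and> (\<forall>w. mem N w t \<longrightarrow> w = X \<or> w = Y)) \<and>
      (\<forall>w. mem N w Z \<longrightarrow> w = s \<or> w = t))"
      unfolding Z pr_def
      by (rule exI[of _ "the_set N {X}"], rule conjI, simp add: mem_the_set small_doubleton,
          rule exI[of _ "the_set N {X, Y}"])
         (simp add: mem_the_set small_doubleton small_insert)
  qed
  finally show ?thesis by (simp add: X_def Y_def Z_def)
qed

lemma sat_fApp [simp]:
  assumes "f < 90" "x < 90" "y < 90"
  shows "sat N (fApp f x y) e \<longleftrightarrow> mem N (pr N (e x) (e y)) (e f)"
  using assms by (auto simp: fApp_def)

end

section \<open>Transfer with finitely many parameters, and enlargements of standard sets\<close>

context nonstandard begin

text \<open>The default \<open>hd xs\<close> keeps the values at all further variables inside the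
  standard universe, as the transfer principle demands of the whole environment, and it commutes
  with \<open>star\<close>.\<close>

definition env :: "'w list \<Rightarrow> nat \<Rightarrow> 'w" where
  "env xs i = (if i < length xs then xs ! i else hd xs)"

lemma transfer_env:
  assumes "set xs \<subseteq> standard_universe N" "xs \<noteq> []"
  shows "sat N p (env xs) \<longleftrightarrow> sat N p (env (map (star N) xs))"
proof -
  have "env xs i \<in> standard_universe N" for i
    using assms by (auto simp: env_def intro!: subsetD[OF assms(1)])
  then have "range (env xs) \<subseteq> standard_universe N" by auto
  moreover have "star N \<circ> env xs = env (map (star N) xs)"
    using assms(2) by (auto simp: env_def fun_eq_iff hd_map)
  ultimately show ?thesis using transfer unfolding transfer_principle_def by metis
qed

lemma mem_star_set: "mem N x (star N (the_set N A)) \<longleftrightarrow> x \<in> star_set N A"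
  by (simp add: star_set_def elts_def)

lemma mem_std_set: "std_small A \<Longrightarrow> mem N x (the_set N A) \<longleftrightarrow> x \<in> A"
  by (simp add: mem_the_set std_small_small)

lemma star_set_mono:
  assumes "std_small B" "A \<subseteq> B" shows "star_set N A \<subseteq> star_set N B"
proof -
  have A: "std_small A" using assms by (rule std_small_subset)
  have "sat N (BAll 2 0 (Mem 2 1)) (env [the_set N A, the_set N B])"
    using assms A by (auto simp: env_def mem_std_set)
  then have "sat N (BAll 2 0 (Mem 2 1)) (env (map (star N) [the_set N A, the_set N B]))"
    using assms A by (subst (asm) transfer_env) (auto simp: std_the_set)
  then show ?thesis by (auto simp: env_def mem_star_set)
qed

text \<open>Intersections make \<open>germ\<close> a filter, complements make it an
  ultrafilter.\<close>

lemma star_set_Int_Diff: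
  assumes "std_small A" "S \<subseteq> A" "T \<subseteq> A"
  shows "star_set N (S \<inter> T) = star_set N S \<inter> star_set N T"
    "star_set N (A - S) = star_set N A - star_set N S"
proof -
  have S: "std_small S" "std_small T" "std_small (S \<inter> T)" "std_small (A - S)"
    using assms by (auto intro: std_small_subset)
  define p where "p = BAll 5 0 (Conj (fIff (Mem 5 3) (Conj (Mem 5 1) (Mem 5 2))) (fIff (Mem 5 4) (Neg (Mem 5 1))))"
  define xs where "xs = [the_set N A, the_set N S, the_set N T, the_set N (S \<inter> T), the_set N (A - S)]"
  have "sat N p (env xs)" using assms S by (auto simp: env_def mem_std_set p_def xs_def)
  then have "sat N p (env (map (star N) xs))"
    using assms S by (subst (asm) transfer_env) (auto simp: std_the_set xs_def)
  then have *: "\<And>x. x \<in> star_set N A \<Longrightarrow> (x \<in> star_set N (S \<inter> T) \<longleftrightarrow> x \<in> star_set N S \<and> x \<in> star_set N T) \<and>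
     (x \<in> star_set N (A - S) \<longleftrightarrow> x \<notin> star_set N S)"
    by (auto simp: env_def mem_star_set p_def xs_def)
  have "star_set N S \<subseteq> star_set N A" "star_set N T \<subseteq> star_set N A" "star_set N (S \<inter> T) \<subseteq> star_set N A"
     "star_set N (A - S) \<subseteq> star_set N A"
    by (rule star_set_mono[OF assms(1)], use assms in blast)+
  then show "star_set N (S \<inter> T) = star_set N S \<inter> star_set N T"
    "star_set N (A - S) = star_set N A - star_set N S" using * by blast+
qed

section \<open>Germs along a nonstandard index\<close>

text \<open>The standard sets containing \<open>\<xi>\<close> after enlargement form an ultrafilter. An internal object
  \<open>star1 N A f \<xi>\<close> is thus the class of the function \<open>f\<close> modulo this ultrafilter.\<close>

definition germ :: "'w set \<Rightarrow> 'w \<Rightarrow> 'w filter" where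
  "germ A \<xi> = Abs_filter (\<lambda>P. \<xi> \<in> star_set N {a \<in> A. P a})"

definition generic :: "'w set \<Rightarrow> 'w \<Rightarrow> bool" where
  "generic A \<xi> \<longleftrightarrow> std_small A \<and> \<xi> \<in> star_set N A"

lemma eventually_germ:
  assumes "generic A \<xi>" shows "eventually P (germ A \<xi>) \<longleftrightarrow> \<xi> \<in> star_set N {a \<in> A. P a}"
  unfolding germ_def
proof (rule eventually_Abs_filter, rule is_filter.intro)
  have A: "std_small A" "\<xi> \<in> star_set N A" using assms by (auto simp: generic_def)
  show "\<xi> \<in> star_set N {a \<in> A. True}" using A by simp
  show "\<xi> \<in> star_set N {a \<in> A. P a \<and> Q a}"
    if "\<xi> \<in> star_set N {a \<in> A. P a}" "\<xi> \<in> star_set N {a \<in> A. Q a}" for P Q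
  proof -
    have "{a \<in> A. P a \<and> Q a} = {a \<in> A. P a} \<inter> {a \<in> A. Q a}" by auto
    then show ?thesis using star_set_Int_Diff(1)[OF A(1), of "{a \<in> A. P a}" "{a \<in> A. Q a}"] that by auto
  qed
  show "\<xi> \<in> star_set N {a \<in> A. Q a}" if "\<forall>a. P a \<longrightarrow> Q a" "\<xi> \<in> star_set N {a \<in> A. P a}" for P Q
    using star_set_mono[of "{a \<in> A. Q a}" "{a \<in> A. P a}"] that A
    by (auto intro: std_small_subset)
qed

lemma eventually_in: "generic A \<xi> \<Longrightarrow> eventually (\<lambda>a. a \<in> A) (germ A \<xi>)"
  by (simp add: eventually_germ) (simp add: generic_def)

text \<open>The ultrafilter property: \<xi> lies in the enlargement of a subset of A or in that of
  its complement, and not in both.\<close>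

lemma eventually_not:
  assumes "generic A \<xi>" shows "eventually (\<lambda>a. \<not> P a) (germ A \<xi>) \<longleftrightarrow> \<not> eventually P (germ A \<xi>)"
proof -
  have "{a \<in> A. \<not> P a} = A - {a \<in> A. P a}" by auto
  then show ?thesis
    using star_set_Int_Diff(2)[of A "{a \<in> A. P a}"] assms by (auto simp: eventually_germ generic_def)
qed

lemma germ_nonbot: "generic A \<xi> \<Longrightarrow> germ A \<xi> \<noteq> bot"
  using eventually_not[of A \<xi> "\<lambda>_. True"] by (auto simp: trivial_limit_def)

lemma mem_graph1:
  assumes "std_small A" "std_small (f ` A)"
  shows "std_small {pr N x (f x) |x. x \<in> A}" "mem N p (graph1 N A f) \<longleftrightarrow> (\<exists>x\<in>A. p = pr N x (f x))"
proof -
  show s: "std_small {pr N x (f x) |x. x \<in> A}"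
    using std_small_pairs[OF assms] by (rule std_small_subset) (auto simp: pairs_def)
  show "mem N p (graph1 N A f) \<longleftrightarrow> (\<exists>x\<in>A. p = pr N x (f x))"
    using mem_std_set[OF s] by (auto simp: graph1_def)
qed

lemma std_graph1: "std_small A \<Longrightarrow> std_small (f ` A) \<Longrightarrow> graph1 N A f \<in> standard_universe N"
  unfolding graph1_def by (intro std_the_set mem_graph1)

text \<open>Transfer of three facts about the graph: it is total on A, single-valued, and contains
  only pairs from A and the image. They make the description in \<open>app\<close> denote.\<close>

lemma star1_props:
  assumes "generic A \<xi>" "std_small (f ` A)"
  shows "mem N (pr N \<xi> y) (star N (graph1 N A f)) \<longleftrightarrow> y = star1 N A f \<xi>"
    "star1 N A f \<xi> \<in> star_set N (f ` A)"
proof -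
  have A: "std_small A" "\<xi> \<in> star_set N A" using assms by (auto simp: generic_def)
  define p where "p = Conj (BAll 3 0 (fEx 4 1 (fApp 2 3 4)))
    (Conj (BAll 3 0 (BAll 4 1 (BAll 5 1 (fImp (Conj (fApp 2 3 4) (fApp 2 3 5)) (Equal 4 5)))))
     (BAll 3 2 (fEx 4 0 (fEx 5 1 (fPair 3 4 5)))))"
  define xs where "xs = [the_set N A, the_set N (f ` A), graph1 N A f]"
  have "sat N p (env xs)"
    using A assms by (auto simp: env_def mem_std_set p_def xs_def mem_graph1)
  then have "sat N p (env (map (star N) xs))"
    using A assms by (subst (asm) transfer_env) (auto simp: std_the_set xs_def std_graph1)
  then have *: "\<forall>x\<in>star_set N A. \<exists>y\<in>star_set N (f ` A). mem N (pr N x y) (star N (graph1 N A f))"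
    "\<forall>x\<in>star_set N A. \<forall>y\<in>star_set N (f ` A). \<forall>z\<in>star_set N (f ` A).
      mem N (pr N x y) (star N (graph1 N A f)) \<and> mem N (pr N x z) (star N (graph1 N A f)) \<longrightarrow> y = z"
    "\<forall>w. mem N w (star N (graph1 N A f)) \<longrightarrow> (\<exists>x\<in>star_set N A. \<exists>y\<in>star_set N (f ` A). w = pr N x y)"
    by (auto simp: env_def mem_star_set p_def xs_def)
  obtain z where z: "z \<in> star_set N (f ` A)" "mem N (pr N \<xi> z) (star N (graph1 N A f))" using *(1) A(2) by blast
  have uniq: "y = z" if "mem N (pr N \<xi> y) (star N (graph1 N A f))" for y
  proof -
    have "y \<in> star_set N (f ` A)" using *(3) that by fastforce
    then show ?thesis using *(2) A(2) z that by blast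
  qed
  have "star1 N A f \<xi> = z" unfolding star1_def app_def by (rule the_equality) (fact z(2), fact uniq)
  then show "mem N (pr N \<xi> y) (star N (graph1 N A f)) \<longleftrightarrow> y = star1 N A f \<xi>"
    "star1 N A f \<xi> \<in> star_set N (f ` A)" using z uniq by metis+
qed

text \<open>The theorem of Los for three arguments. Transferred is the sentence that every index a
  whose values are x, y, z lies in S iff Q holds of x, y, z; it is then read at the index
  \<xi>.\<close>

lemma los:
  assumes \<xi>: "generic A \<xi>" and f: "std_small (f ` A)" and g: "std_small (g ` A)" and h: "std_small (h ` A)"
    and q: "\<And>e. sat N q e \<longleftrightarrow> Q (e 0) (e 1) (e 2)"
  shows "Q (star1 N A f \<xi>) (star1 N A g \<xi>) (star1 N A h \<xi>) \<longleftrightarrow>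
    eventually (\<lambda>a. Q (f a) (g a) (h a)) (germ A \<xi>)"
proof -
  have A: "std_small A" "\<xi> \<in> star_set N A" using \<xi> by (auto simp: generic_def)
  define S where "S = {a \<in> A. Q (f a) (g a) (h a)}"
  have S: "std_small S" using A(1) by (rule std_small_subset) (auto simp: S_def)
  \<comment> \<open>Variables 0, 1, 2 carry the arguments of q and are bound here; their places in
    the list hold dummies. The parameters stand at 3 to 10, and 11 is the index.\<close>
  define p where "p = BAll 11 3 (BAll 0 4 (BAll 1 5 (BAll 2 6
    (fImp (Conj (fApp 7 11 0) (Conj (fApp 8 11 1) (fApp 9 11 2))) (fIff (Mem 11 10) q)))))"
  define xs where "xs = [the_set N A, the_set N A, the_set N A, the_set N A,
    the_set N (f ` A), the_set N (g ` A), the_set N (h ` A),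
    graph1 N A f, graph1 N A g, graph1 N A h, the_set N S]"
  have "sat N p (env xs)"
    using A f g h S by (auto simp: env_def mem_std_set p_def xs_def mem_graph1 q S_def)
  then have "sat N p (env (map (star N) xs))"
    using A S f g h by (subst (asm) transfer_env) (auto simp: std_the_set xs_def std_graph1)
  then have "\<forall>a\<in>star_set N A. \<forall>x\<in>star_set N (f ` A). \<forall>y\<in>star_set N (g ` A). \<forall>z\<in>star_set N (h ` A).
     mem N (pr N a x) (star N (graph1 N A f)) \<and> mem N (pr N a y) (star N (graph1 N A g)) \<and>
     mem N (pr N a z) (star N (graph1 N A h)) \<longrightarrow> (a \<in> star_set N S \<longleftrightarrow> Q x y z)"
    by (auto simp: env_def mem_star_set p_def xs_def q)
  then have "\<xi> \<in> star_set N S \<longleftrightarrow> Q (star1 N A f \<xi>) (star1 N A g \<xi>) (star1 N A h \<xi>)"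
    using A(2) star1_props[OF \<xi> f] star1_props[OF \<xi> g] star1_props[OF \<xi> h] by blast
  then show ?thesis using eventually_germ[OF \<xi>] by (simp add: S_def)
qed

lemma los_mem:
  assumes "generic A \<xi>" "std_small (f ` A)" "std_small (g ` A)"
  shows "mem N (star1 N A f \<xi>) (star1 N A g \<xi>) \<longleftrightarrow> eventually (\<lambda>a. mem N (f a) (g a)) (germ A \<xi>)"
  using los[OF assms assms(3), of "Mem 0 1" "\<lambda>x y z. mem N x y"] by simp

lemma los_eq:
  assumes "generic A \<xi>" "std_small (f ` A)" "std_small (g ` A)"
  shows "star1 N A f \<xi> = star1 N A g \<xi> \<longleftrightarrow> eventually (\<lambda>a. f a = g a) (germ A \<xi>)"
  using los[OF assms assms(3), of "Equal 0 1" "\<lambda>x y z. x = y"] by simp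

lemma std_small_pr:
  assumes "std_small (f ` A)" "std_small (g ` A)" shows "std_small ((\<lambda>a. pr N (f a) (g a)) ` A)"
  using std_small_pairs[OF assms] by (rule std_small_subset) (auto simp: pairs_def)

lemma los_pr:
  assumes "generic A \<xi>" "std_small (f ` A)" "std_small (g ` A)"
  shows "star1 N A (\<lambda>a. pr N (f a) (g a)) \<xi> = pr N (star1 N A f \<xi>) (star1 N A g \<xi>)"
  using los[OF assms(1) std_small_pr[OF assms(2,3)] assms(2,3), of "fPair 0 1 2" "\<lambda>x y z. x = pr N y z"]
  by simp

lemma los_app:
  assumes "generic A \<xi>" "std_small (f ` A)" "std_small (g ` A)" "std_small (h ` A)"
  shows "mem N (pr N (star1 N A f \<xi>) (star1 N A g \<xi>)) (star1 N A h \<xi>) \<longleftrightarrow>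
    eventually (\<lambda>a. mem N (pr N (f a) (g a)) (h a)) (germ A \<xi>)"
  using los[OF assms, of "fApp 2 0 1" "\<lambda>x y z. mem N (pr N x y) z"] by simp

lemma std_small_const: "c \<in> standard_universe N \<Longrightarrow> std_small ((\<lambda>_. c) ` A)"
  by (rule std_small_subset[OF std_small_singleton]) auto

lemma star1_const:
  assumes "generic A \<xi>" "c \<in> standard_universe N" shows "star1 N A (\<lambda>_. c) \<xi> = star N c"
proof -
  have A: "std_small A" "\<xi> \<in> star_set N A" using assms by (auto simp: generic_def)
  have c: "std_small {c}" using std_small_singleton[OF assms(2)] .
  have ci: "(\<lambda>_. c) ` A \<subseteq> {c}" by auto
  have "sat N (BAll 2 0 (Equal 2 1)) (env [the_set N {c}, c])"
    using c by (auto simp: env_def mem_std_set)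
  then have "sat N (BAll 2 0 (Equal 2 1)) (env (map (star N) [the_set N {c}, c]))"
    using assms c by (subst (asm) transfer_env) (auto simp: std_the_set)
  then have "\<forall>x\<in>star_set N {c}. x = star N c" by (auto simp: env_def mem_star_set)
  then show ?thesis using star1_props(2)[OF assms(1) std_small_const[OF assms(2)]] star_set_mono[OF c ci] by blast
qed

lemma star1_id: assumes "generic A \<xi>" shows "star1 N A (\<lambda>a. a) \<xi> = \<xi>"
proof -
  have A: "std_small A" "\<xi> \<in> star_set N A" using assms by (auto simp: generic_def)
  define xs where "xs = [the_set N A, graph1 N A (\<lambda>a. a)]"
  have i: "std_small ((\<lambda>a. a) ` A)" using A by simp
  have "sat N (BAll 2 0 (fApp 1 2 2)) (env xs)"
    using A i by (auto simp: env_def mem_std_set xs_def mem_graph1)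
  then have "sat N (BAll 2 0 (fApp 1 2 2)) (env (map (star N) xs))"
    using A i by (subst (asm) transfer_env) (auto simp: std_the_set std_graph1 xs_def)
  then have "mem N (pr N \<xi> \<xi>) (star N (graph1 N A (\<lambda>a. a)))" using A(2) by (auto simp: env_def mem_star_set xs_def)
  then show ?thesis using star1_props(1)[OF assms i] by simp
qed

lemma los_in:
  assumes "generic A \<xi>" "std_small (f ` A)" "std_small C"
  shows "star1 N A f \<xi> \<in> star_set N C \<longleftrightarrow> eventually (\<lambda>a. f a \<in> C) (germ A \<xi>)"
proof -
  have C: "the_set N C \<in> standard_universe N" using assms(3) by (rule std_the_set)
  have "star1 N A f \<xi> \<in> star_set N C \<longleftrightarrow> mem N (star1 N A f \<xi>) (star1 N A (\<lambda>_. the_set N C) \<xi>)"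
    using star1_const[OF assms(1) C] by (simp add: star_set_def elts_def)
  also have "\<dots> \<longleftrightarrow> eventually (\<lambda>a. f a \<in> C) (germ A \<xi>)"
    using los_mem[OF assms(1,2) std_small_const[OF C]] assms(3) by (simp add: mem_std_set)
  finally show ?thesis .
qed

lemma generic_star1:
  "generic A \<xi> \<Longrightarrow> f ` A \<subseteq> C \<Longrightarrow> std_small C \<Longrightarrow> generic C (star1 N A f \<xi>)"
  unfolding generic_def using star1_props(2)[of A \<xi> f] star_set_mono[of C "f ` A"]
  by (auto simp: generic_def intro: std_small_subset)

text \<open>Enlarged functions act index by index. Together with its binary form it reduces
  computations with internal vectors and numbers to standard ones.\<close>

lemma los_star1:
  assumes \<xi>: "generic A \<xi>" and f: "f ` A \<subseteq> C" and C: "std_small C" and h: "std_small (h ` C)"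
  shows "star1 N C h (star1 N A f \<xi>) = star1 N A (\<lambda>a. h (f a)) \<xi>"
proof -
  have fs: "std_small (f ` A)" using C f by (rule std_small_subset)
  have hs: "std_small ((\<lambda>a. h (f a)) ` A)" using h by (rule std_small_subset) (use f in auto)
  have G: "graph1 N C h \<in> standard_universe N" using C h by (rule std_graph1)
  have "eventually (\<lambda>a. mem N (pr N (f a) (h (f a))) (graph1 N C h)) (germ A \<xi>)"
    using eventually_in[OF \<xi>] by (rule eventually_mono) (use f in \<open>auto simp: mem_graph1[OF C h]\<close>)
  then have "mem N (pr N (star1 N A f \<xi>) (star1 N A (\<lambda>a. h (f a)) \<xi>)) (star N (graph1 N C h))"
    using los_app[OF \<xi> fs hs std_small_const[OF G]] star1_const[OF \<xi> G] by simp
  then show ?thesis using star1_props(1)[OF generic_star1[OF \<xi> f C] h] by simp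
qed

definition pfst :: "'w \<Rightarrow> 'w" where "pfst p = (THE x. \<exists>y. p = pr N x y)"
definition psnd :: "'w \<Rightarrow> 'w" where "psnd p = (THE y. \<exists>x. p = pr N x y)"

lemma pfst_pr [simp]: "pfst (pr N x y) = x" and psnd_pr [simp]: "psnd (pr N x y) = y"
  by (auto simp: pfst_def psnd_def)

lemma pairs_iff: "p \<in> pairs A B \<longleftrightarrow> p = pr N (pfst p) (psnd p) \<and> pfst p \<in> A \<and> psnd p \<in> B"
proof
  assume "p \<in> pairs A B"
  then obtain x y where "p = pr N x y" "x \<in> A" "y \<in> B" by (auto simp: pairs_def)
  then show "p = pr N (pfst p) (psnd p) \<and> pfst p \<in> A \<and> psnd p \<in> B" by simp
next
  assume "p = pr N (pfst p) (psnd p) \<and> pfst p \<in> A \<and> psnd p \<in> B"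
  then show "p \<in> pairs A B" unfolding pairs_def by blast
qed

text \<open>Pairing merges two unrelated indices into one. It is the device for representing several
  internal objects simultaneously.\<close>

lemma generic_pr:
  assumes "generic A \<xi>" "generic C \<eta>" shows "generic (pairs A C) (pr N \<xi> \<eta>)"
proof -
  have A: "std_small A" "\<xi> \<in> star_set N A" "std_small C" "\<eta> \<in> star_set N C" using assms by (auto simp: generic_def)
  define xs where "xs = [the_set N A, the_set N C, the_set N (pairs A C)]"
  define p where "p = BAll 3 0 (BAll 4 1 (fApp 2 3 4))"
  note t = std_small_pairs[OF A(1,3)]
  have "sat N p (env xs)"
    using A t by (auto simp: env_def mem_std_set xs_def p_def pairs_def)
  then have "sat N p (env (map (star N) xs))"
    using A t by (subst (asm) transfer_env) (auto simp: std_the_set std_graph1 xs_def)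
  then have "pr N \<xi> \<eta> \<in> star_set N (pairs A C)"
    using A by (auto simp: env_def mem_star_set xs_def p_def)
  then show ?thesis using t by (simp add: generic_def)
qed

lemma star1_proj:
  assumes "generic A \<xi>" "generic C \<eta>"
  shows "star1 N (pairs A C) pfst (pr N \<xi> \<eta>) = \<xi>" "star1 N (pairs A C) psnd (pr N \<xi> \<eta>) = \<eta>"
proof -
  note g = generic_pr[OF assms]
  have "pfst ` pairs A C \<subseteq> A" "psnd ` pairs A C \<subseteq> C" by (auto simp: pairs_iff)
  then have f: "std_small (pfst ` pairs A C)" "std_small (psnd ` pairs A C)"
    using assms std_small_subset unfolding generic_def by blast+
  have "pr N (star1 N (pairs A C) pfst (pr N \<xi> \<eta>)) (star1 N (pairs A C) psnd (pr N \<xi> \<eta>)) =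
     star1 N (pairs A C) (\<lambda>a. pr N (pfst a) (psnd a)) (pr N \<xi> \<eta>)"
    by (rule los_pr[OF g f, symmetric])
  also have "\<dots> = star1 N (pairs A C) (\<lambda>a. a) (pr N \<xi> \<eta>)"
  proof (subst los_eq[OF g std_small_pr[OF f]])
    show "std_small ((\<lambda>a. a) ` pairs A C)" using g by (simp add: generic_def)
    show "\<forall>\<^sub>F a in germ (pairs A C) (pr N \<xi> \<eta>). pr N (pfst a) (psnd a) = a"
      using eventually_in[OF g] by (rule eventually_mono) (metis pairs_iff)
  qed
  also have "\<dots> = pr N \<xi> \<eta>" by (rule star1_id[OF g])
  finally show "star1 N (pairs A C) pfst (pr N \<xi> \<eta>) = \<xi>" "star1 N (pairs A C) psnd (pr N \<xi> \<eta>) = \<eta>" by auto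
qed

lemma star2_eq_star1: "star2 N A B h x y = star1 N (pairs A B) (\<lambda>p. h (pfst p) (psnd p)) (pr N x y)"
proof -
  have "{pr N (pr N x y) (h x y) |x y. x \<in> A \<and> y \<in> B} = {pr N p (h (pfst p) (psnd p)) |p. p \<in> pairs A B}"
    unfolding pairs_def by (auto; metis pfst_pr psnd_pr)
  then show ?thesis by (simp add: star2_def star1_def graph2_def graph1_def)
qed

lemma los_star2:
  assumes \<xi>: "generic A \<xi>" and f: "f ` A \<subseteq> C" and C: "std_small C" and g: "g ` A \<subseteq> D" and D: "std_small D"
    and h: "\<And>x y. x \<in> C \<Longrightarrow> y \<in> D \<Longrightarrow> h x y \<in> R" and R: "std_small R"
  shows "star2 N C D h (star1 N A f \<xi>) (star1 N A g \<xi>) = star1 N A (\<lambda>a. h (f a) (g a)) \<xi>"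
proof -
  have s: "std_small (f ` A)" "std_small (g ` A)" using f C g D by (auto intro: std_small_subset)
  have t: "(\<lambda>a. pr N (f a) (g a)) ` A \<subseteq> pairs C D" using f g unfolding pairs_def by blast
  have r: "std_small ((\<lambda>p. h (pfst p) (psnd p)) ` pairs C D)"
    using R by (rule std_small_subset) (use h in \<open>auto simp: pairs_iff\<close>)
  show ?thesis
    unfolding star2_eq_star1 los_pr[OF \<xi> s, symmetric]
    using los_star1[OF \<xi> t std_small_pairs[OF C D] r] by simp
qed

text \<open>An element x of \<open>star a\<close> is itself an index, for the set of elements of a.
  Only the case of an atom a has to be excluded: \<open>star\<close> fixes it, and atoms have no
  elements.\<close>

lemma internal_iff: "internal N x \<longleftrightarrow> (\<exists>A. generic A x)"
proof
  assume "internal N x"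
  then obtain a where a: "a \<in> standard_universe N" "mem N x (star N a)" by (auto simp: internal_def)
  have "a \<notin> atoms N"
  proof
    assume "a \<in> atoms N"
    then show False using a(2) star_atom atoms_sub mem_not_atom by force
  qed
  then have "a \<notin> new_atoms N"
  proof -
    obtain n where "a \<in> level N (atoms N) n" using a(1) std_iff by blast
    then show ?thesis using \<open>a \<notin> atoms N\<close> by (cases n) auto
  qed
  then have "the_set N (elts N a) = a" by (intro the_set_eqI) auto
  then have "generic (elts N a) x" using a std_small_elts by (simp add: generic_def star_set_def elts_def)
  then show "\<exists>A. generic A x" by blast
next
  assume "\<exists>A. generic A x"
  then show "internal N x" using std_the_set by (auto simp: generic_def internal_def star_set_def elts_def)
qed

lemma internal_star1: "generic A \<xi> \<Longrightarrow> std_small (f ` A) \<Longrightarrow> internal N (star1 N A f \<xi>)"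
  using generic_star1[of A \<xi> f "f ` A"] internal_iff by blast

text \<open>Compactness of the disc yields a cluster point, and a cluster point of an ultrafilter is
  a limit. This is the existence of standard parts of limited numbers.\<close>

lemma germ_limit:
  fixes f :: "'w \<Rightarrow> complex"
  assumes \<xi>: "generic A \<xi>" and b: "eventually (\<lambda>a. cmod (f a) \<le> C) (germ A \<xi>)"
  obtains l where "(f \<longlongrightarrow> l) (germ A \<xi>)"
proof -
  have "\<exists>l\<in>cball 0 C. inf (nhds l) (filtermap f (germ A \<xi>)) \<noteq> bot"
  proof (rule compact_cball[unfolded compact_filter, rule_format])
    show "filtermap f (germ A \<xi>) \<noteq> bot" using germ_nonbot[OF \<xi>] by (simp add: filtermap_bot_iff)
    show "eventually (\<lambda>x. x \<in> cball 0 C) (filtermap f (germ A \<xi>))" using b by (simp add: eventually_filtermap)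
  qed
  then obtain l where l: "inf (nhds l) (filtermap f (germ A \<xi>)) \<noteq> bot" by blast
  have "(f \<longlongrightarrow> l) (germ A \<xi>)"
  proof (rule topological_tendstoI, rule ccontr)
    fix S assume S: "open S" "l \<in> S" "\<not> (\<forall>\<^sub>F x in germ A \<xi>. f x \<in> S)"
    then have "eventually (\<lambda>x. x \<notin> S) (filtermap f (germ A \<xi>))"
      using eventually_not[OF \<xi>] by (simp add: eventually_filtermap)
    moreover have "eventually (\<lambda>x. x \<in> S) (nhds l)" using S by (simp add: eventually_nhds_in_open)
    ultimately have "eventually (\<lambda>x. False) (inf (nhds l) (filtermap f (germ A \<xi>)))"
      unfolding eventually_inf by blast
    then show False using l by (simp add: trivial_limit_def)
  qed
  then show thesis by (rule that)
qed

end

section \<open>Orthonormal systems and finite linear combinations\<close>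

context prehilb begin

definition orthonormal :: "'a set \<Rightarrow> bool" where
  "orthonormal C \<longleftrightarrow> C \<subseteq> car H \<and> (\<forall>b\<in>C. \<forall>c\<in>C. ip H b c = (if b = c then 1 else 0))"

definition lincomb :: "'a set \<Rightarrow> ('a \<Rightarrow> complex) \<Rightarrow> 'a" where
  "lincomb C c = (SOME y. y \<in> car H \<and> (\<forall>z\<in>car H. ip H z y = (\<Sum>b\<in>C. c b * ip H z b)))"

lemma lincomb_exists:
  assumes "finite C" "C \<subseteq> S" "subspace_of H S"
  shows "\<exists>y\<in>S. \<forall>z\<in>car H. ip H z y = (\<Sum>b\<in>C. c b * ip H z b)"
  using assms(1,2)
proof (induction C)
  case empty
  show ?case using assms(3) by (intro bexI[of _ "zer H"]) (auto simp: subspace_of_def)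
next
  case (insert b C)
  then obtain y where y: "y \<in> S" "\<forall>z\<in>car H. ip H z y = (\<Sum>b\<in>C. c b * ip H z b)" by auto
  have S: "S \<subseteq> car H" using assms(3) by (simp add: subspace_of_def)
  have "add H y (scl H (c b) b) \<in> S" using y(1) insert.prems assms(3) by (auto simp: subspace_of_def)
  moreover have "y \<in> car H" "b \<in> car H" using y(1) insert.prems S by auto
  ultimately show ?case using y(2) insert.hyps by (intro bexI[of _ "add H y (scl H (c b) b)"]) (auto simp: add.commute)
qed

lemma car_subspace: "subspace_of H (car H)" by (auto simp: subspace_of_def)

lemma lincomb:
  assumes "finite C" "C \<subseteq> car H"
  shows "lincomb C c \<in> car H" "z \<in> car H \<Longrightarrow> ip H z (lincomb C c) = (\<Sum>b\<in>C. c b * ip H z b)"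
proof -
  have "\<exists>y. y \<in> car H \<and> (\<forall>z\<in>car H. ip H z y = (\<Sum>b\<in>C. c b * ip H z b))"
    using lincomb_exists[OF assms car_subspace] by blast
  from someI_ex[OF this] show "lincomb C c \<in> car H"
    "z \<in> car H \<Longrightarrow> ip H z (lincomb C c) = (\<Sum>b\<in>C. c b * ip H z b)"
    unfolding lincomb_def[symmetric] by auto
qed

lemma lincomb_subspace:
  assumes "finite C" "C \<subseteq> S" "subspace_of H S" shows "lincomb C c \<in> S"
proof -
  have S: "S \<subseteq> car H" using assms(3) by (simp add: subspace_of_def)
  obtain y where y: "y \<in> S" "\<forall>z\<in>car H. ip H z y = (\<Sum>b\<in>C. c b * ip H z b)"
    using lincomb_exists[OF assms] by blast
  have "lincomb C c = y"
    by (rule ip_eqI) (use lincomb[OF assms(1) order_trans[OF assms(2) S]] y S in auto)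
  then show ?thesis using y by simp
qed

lemma ip_lincomb_basis:
  assumes "orthonormal C" "finite C" "b \<in> C" shows "ip H b (lincomb C c) = c b"
proof -
  have C: "C \<subseteq> car H" using assms by (simp add: orthonormal_def)
  have "ip H b (lincomb C c) = (\<Sum>b'\<in>C. c b' * ip H b b')" using lincomb[OF assms(2) C] C assms(3) by blast
  also have "\<dots> = (\<Sum>b'\<in>C. if b' = b then c b else 0)"
    using assms by (intro sum.cong) (auto simp: orthonormal_def)
  finally show ?thesis using assms by simp
qed

lemma bessel:
  assumes "orthonormal C" "finite C" "x \<in> car H"
  shows "(\<Sum>b\<in>C. (cmod (ip H b x))\<^sup>2) \<le> (nrm H x)\<^sup>2"
proof -
  have C: "C \<subseteq> car H" using assms by (simp add: orthonormal_def)
  define y where "y = lincomb C (\<lambda>b. ip H b x)"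
  have y: "y \<in> car H" using lincomb[OF assms(2) C] by (simp add: y_def)
  have xy: "ip H x y = (\<Sum>b\<in>C. of_real ((cmod (ip H b x))\<^sup>2))"
  proof -
    have "ip H x y = (\<Sum>b\<in>C. ip H b x * ip H x b)" using lincomb(2)[OF assms(2) C assms(3)] by (simp add: y_def)
    also have "\<dots> = (\<Sum>b\<in>C. of_real ((cmod (ip H b x))\<^sup>2))"
    proof (rule sum.cong)
      fix b assume "b \<in> C"
      then have "ip H x b = cnj (ip H b x)" using C assms(3) by (intro ip_cnj) auto
      then show "ip H b x * ip H x b = of_real ((cmod (ip H b x))\<^sup>2)" by (simp only: complex_norm_square)
    qed simp
    finally show ?thesis .
  qed
  have yy: "ip H y y = ip H x y"
  proof -
    have "ip H y y = (\<Sum>b\<in>C. ip H b x * ip H y b)"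
      using lincomb(2)[OF assms(2) C y, of "\<lambda>b. ip H b x"] unfolding y_def[symmetric] .
    also have "\<dots> = (\<Sum>b\<in>C. ip H b x * ip H x b)"
    proof (rule sum.cong)
      fix b assume b: "b \<in> C"
      then have bc: "b \<in> car H" using C by auto
      have "ip H b y = ip H b x" using ip_lincomb_basis[OF assms(1,2) b] by (simp add: y_def)
      then have "ip H y b = ip H x b" using ip_cnj[OF bc y] ip_cnj[OF bc assms(3)] by simp
      then show "ip H b x * ip H y b = ip H b x * ip H x b" by simp
    qed simp
    also have "\<dots> = ip H x y" using lincomb(2)[OF assms(2) C assms(3)] by (simp add: y_def)
    finally show ?thesis .
  qed
  have "0 \<le> (nrm H (sub H x y))\<^sup>2" by simp
  also have "\<dots> = (nrm H x)\<^sup>2 - Re (ip H x y)"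
    using nrm_sub_sq[OF assms(3) y] nrm_sq[OF y] yy by simp
  finally show ?thesis using xy by simp
qed

text \<open>That C spans X is expressed by orthogonality: whatever is orthogonal to C within S is
  orthogonal to X. This avoids linear spans and is the form in which maximality is used
  later.\<close>

lemma gram_schmidt:
  assumes S: "subspace_of H S" and "finite X" "X \<subseteq> S"
  shows "\<exists>C. finite C \<and> C \<subseteq> S \<and> orthonormal C \<and>
    (\<forall>x\<in>X. \<forall>y\<in>S. (\<forall>b\<in>C. ip H b y = 0) \<longrightarrow> ip H y x = 0)"
  using assms(2,3)
proof (induction X)
  case empty
  show ?case by (rule exI[of _ "{}"]) (simp add: orthonormal_def)
next
  case (insert x X)
  have Sc: "S \<subseteq> car H" using S by (simp add: subspace_of_def)
  obtain C where C: "finite C" "C \<subseteq> S" "orthonormal C"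
    "\<And>x y. x \<in> X \<Longrightarrow> y \<in> S \<Longrightarrow> \<forall>b\<in>C. ip H b y = 0 \<Longrightarrow> ip H y x = 0"
    using insert by auto
  have Cc: "C \<subseteq> car H" using C Sc by auto
  define p where "p = lincomb C (\<lambda>b. ip H b x)"
  have p: "p \<in> S" "p \<in> car H" using lincomb_subspace[OF C(1,2) S] Sc by (auto simp: p_def)
  have x: "x \<in> S" "x \<in> car H" using insert.prems Sc by auto
  define w where "w = sub H x p"
  have w: "w \<in> S" "w \<in> car H" using x p S by (auto simp: w_def sub_def subspace_of_def)
  have bw: "ip H b w = 0" if "b \<in> C" for b
  proof -
    have "ip H b p = ip H b x" unfolding p_def by (rule ip_lincomb_basis[OF C(3,1) that])
    then show ?thesis using that Cc x p by (auto simp: w_def)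
  qed
  have py: "ip H y p = 0" if "y \<in> S" "\<forall>b\<in>C. ip H b y = 0" for y
  proof -
    have "ip H y p = (\<Sum>b\<in>C. ip H b x * ip H y b)" using lincomb(2)[OF C(1) Cc] that Sc by (auto simp: p_def)
    also have "\<dots> = 0"
    proof (rule sum.neutral, rule ballI)
      fix b assume "b \<in> C"
      then have "ip H y b = cnj (ip H b y)" using Cc that(1) Sc by (intro ip_cnj) auto
      then show "ip H b x * ip H y b = 0" using that(2) \<open>b \<in> C\<close> by simp
    qed
    finally show ?thesis .
  qed
  show ?case
  proof (cases "w = zer H")
    case True
    then have "x = p" using sub_eq_zer x p by (simp add: w_def)
    then show ?thesis using C py by (intro exI[of _ C]) auto
  next
    case False
    define n where "n = nrm H w"
    have n: "n > 0" using False w nrm_eq_0_iff[of w] nrm_nonneg[of w] by (simp add: n_def less_le)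
    define e where "e = scl H (1 / of_real n) w"
    have e: "e \<in> S" "e \<in> car H" using w S by (auto simp: e_def subspace_of_def)
    have be: "ip H b e = 0" if "b \<in> C" for b using bw[OF that] that Cc w by (auto simp: e_def)
    have eb: "ip H e b = 0" if "b \<in> C" for b
      using be[OF that] ip_cnj[of b e] that Cc e by auto
    have ee: "ip H e e = 1"
      using n w ip_self[OF w(2)] by (simp add: e_def n_def[symmetric] power2_eq_square)
    have "orthonormal (insert e C)" using C(3) be eb ee e unfolding orthonormal_def by auto
    moreover have "ip H y z = 0" if z: "z \<in> insert x X" and y: "y \<in> S" and o: "\<forall>b\<in>insert e C. ip H b y = 0" for z y
    proof (cases "z = x")
      case True
      have yc: "y \<in> car H" using y Sc by auto
      have "ip H y e = 0" using o ip_cnj[OF e(2) yc] by simp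
      then have "ip H y w = 0" using n w yc by (simp add: e_def)
      then have "ip H y x - ip H y p = 0" using x p yc by (simp add: w_def)
      then show ?thesis using py[OF y] o True by simp
    qed (use C(4) z y o in auto)
    ultimately show ?thesis using C(1,2) e(1) by (intro exI[of _ "insert e C"]) auto
  qed
qed

lemma orthonormal_expansion:
  assumes S: "subspace_of H S" and C: "finite C" "C \<subseteq> S" "orthonormal C"
    and max: "\<And>y. y \<in> S \<Longrightarrow> \<forall>b\<in>C. ip H b y = 0 \<Longrightarrow> y = zer H" and x: "x \<in> S"
  shows "lincomb C (\<lambda>b. ip H b x) = x"
proof -
  have Sc: "S \<subseteq> car H" using S by (simp add: subspace_of_def)
  define p where "p = lincomb C (\<lambda>b. ip H b x)"
  have p: "p \<in> S" "p \<in> car H" using lincomb_subspace[OF C(1,2) S] Sc by (auto simp: p_def)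
  have xc: "x \<in> car H" using x Sc by auto
  have "sub H p x = zer H"
  proof (rule max)
    show "sub H p x \<in> S" using x p S by (auto simp: sub_def subspace_of_def)
    show "\<forall>b\<in>C. ip H b (sub H p x) = 0"
    proof
      fix b assume b: "b \<in> C"
      then have "b \<in> car H" using C Sc by auto
      then show "ip H b (sub H p x) = 0" using ip_lincomb_basis[OF C(3,1) b, of "\<lambda>b. ip H b x"] xc p
        by (simp add: p_def[symmetric])
    qed
  qed
  then show ?thesis using sub_eq_zer p xc by (simp add: p_def)
qed

text \<open>Double counting of the sum of |\<langle>c, b\<rangle>|^2: by expansion each b
  contributes 1, by Bessel each c contributes at most 1. So card C + 1 vectors of B are
  impossible.\<close>

lemma orthonormal_finite:
  assumes S: "subspace_of H S" and C: "finite C" "C \<subseteq> S" "orthonormal C"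
    and max: "\<And>y. y \<in> S \<Longrightarrow> \<forall>b\<in>C. ip H b y = 0 \<Longrightarrow> y = zer H"
    and B: "orthonormal B" "B \<subseteq> S"
  shows "finite B"
proof (rule ccontr)
  assume "infinite B"
  then obtain B' where B': "finite B'" "card B' = Suc (card C)" "B' \<subseteq> B"
    using infinite_arbitrarily_large by blast
  have Sc: "S \<subseteq> car H" using S by (simp add: subspace_of_def)
  have o: "orthonormal B'" using B(1) B'(3) unfolding orthonormal_def by (meson subset_iff)
  have one: "(\<Sum>c\<in>C. (cmod (ip H c b))\<^sup>2) = 1" if b: "b \<in> B'" for b
  proof -
    have bc: "b \<in> S" "b \<in> car H" "ip H b b = 1" using b B B' Sc by (auto simp: orthonormal_def)
    have "ip H b (lincomb C (\<lambda>c. ip H c b)) = (\<Sum>c\<in>C. ip H c b * ip H b c)"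
      using lincomb(2)[OF C(1) order_trans[OF C(2) Sc] bc(2)] .
    also have "\<dots> = (\<Sum>c\<in>C. of_real ((cmod (ip H c b))\<^sup>2))"
    proof (rule sum.cong)
      fix c assume "c \<in> C"
      then have "ip H b c = cnj (ip H c b)" using C Sc bc by (intro ip_cnj) auto
      then show "ip H c b * ip H b c = of_real ((cmod (ip H c b))\<^sup>2)" by (simp only: complex_norm_square)
    qed simp
    finally have "complex_of_real (\<Sum>c\<in>C. (cmod (ip H c b))\<^sup>2) = 1"
      using orthonormal_expansion[OF S C max bc(1)] bc(3) by simp
    then show ?thesis by (metis of_real_eq_1_iff)
  qed
  have "real (card B') = (\<Sum>b\<in>B'. \<Sum>c\<in>C. (cmod (ip H c b))\<^sup>2)" by (simp add: one)
  also have "\<dots> = (\<Sum>c\<in>C. \<Sum>b\<in>B'. (cmod (ip H c b))\<^sup>2)" by (rule sum.swap)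
  also have "\<dots> \<le> (\<Sum>c\<in>C. 1)"
  proof (rule sum_mono)
    fix c assume c: "c \<in> C"
    then have cc: "c \<in> car H" "ip H c c = 1" using C Sc by (auto simp: orthonormal_def)
    have "(\<Sum>b\<in>B'. (cmod (ip H c b))\<^sup>2) = (\<Sum>b\<in>B'. (cmod (ip H b c))\<^sup>2)"
    proof (rule sum.cong)
      fix b assume "b \<in> B'"
      then have "ip H b c = cnj (ip H c b)" using B B' Sc cc by (intro ip_cnj) auto
      then show "(cmod (ip H c b))\<^sup>2 = (cmod (ip H b c))\<^sup>2" by simp
    qed simp
    also have "\<dots> \<le> (nrm H c)\<^sup>2" by (rule bessel[OF o B'(1) cc(1)])
    also have "\<dots> = 1" using nrm_sq[OF cc(1)] cc(2) by simp
    finally show "(\<Sum>b\<in>B'. (cmod (ip H c b))\<^sup>2) \<le> 1" .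
  qed
  finally show False using B'(2) by simp
qed

end

context nonstandard begin

lemma std_small_cset: "std_small (cset N)"
  unfolding std_small_def cset_def by (rule exI[of _ 0]) (use cnum_atom in auto)

lemma std_small_cnum: "std_small ((\<lambda>a. cnum N (f a)) ` A)"
  using std_small_cset by (rule std_small_subset) (auto simp: cset_def)

lemma cnum_eq [simp]: "cnum N z = cnum N w \<longleftrightarrow> z = w"
  using inj_cnum by (auto dest: injD)

lemma cval_cnum [simp]: "cval N (cnum N z) = z"
  using inj_cnum by (simp add: cval_def)

lemma std_cnum: "cnum N z \<in> standard_universe N"
  using std_small_mem[OF std_small_cset] by (auto simp: cset_def)

section \<open>Hypercomplex numbers\<close>

definition hc :: "'w set \<Rightarrow> 'w \<Rightarrow> ('w \<Rightarrow> complex) \<Rightarrow> 'w" where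
  "hc A \<xi> f = star1 N A (\<lambda>a. cnum N (f a)) \<xi>"

lemma hc_eq: "generic A \<xi> \<Longrightarrow> hc A \<xi> f = hc A \<xi> g \<longleftrightarrow> eventually (\<lambda>a. f a = g a) (germ A \<xi>)"
  unfolding hc_def by (subst los_eq) (auto intro: std_small_cnum)

lemma hc_const: "generic A \<xi> \<Longrightarrow> hc A \<xi> (\<lambda>_. c) = cnum N c"
  unfolding hc_def using star1_const[OF _ std_cnum] star_atom[of "cnum N c"] cnum_atom by (simp add: image_subset_iff)

lemma hc_in: "generic A \<xi> \<Longrightarrow> hc A \<xi> f \<in> hcomplex N"
  unfolding hc_def hcomplex_def by (subst los_in) (auto intro: std_small_cnum std_small_cset simp: cset_def)

lemma hc1_hc:
  assumes "generic A \<xi>" shows "hc1 N \<phi> (hc A \<xi> f) = hc A \<xi> (\<lambda>a. \<phi> (f a))"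
proof -
  have "(\<lambda>a. cnum N (f a)) ` A \<subseteq> cset N" by (auto simp: cset_def)
  from los_star1[where h = "\<lambda>z. cnum N (\<phi> (cval N z))", OF assms this std_small_cset std_small_cnum] show ?thesis
    unfolding hc_def hc1_def by simp
qed

lemma hc2_hc:
  assumes "generic A \<xi>" shows "hc2 N \<phi> (hc A \<xi> f) (hc A \<xi> g) = hc A \<xi> (\<lambda>a. \<phi> (f a) (g a))"
proof -
  have s: "(\<lambda>a. cnum N (f a)) ` A \<subseteq> cset N" "(\<lambda>a. cnum N (g a)) ` A \<subseteq> cset N"
    "\<And>x y. cnum N (\<phi> (cval N x) (cval N y)) \<in> cset N" by (auto simp: cset_def)
  from los_star2[where h = "\<lambda>z w. cnum N (\<phi> (cval N z) (cval N w))",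
      OF assms s(1) std_small_cset s(2) std_small_cset s(3) std_small_cset] show ?thesis
    unfolding hc_def hc2_def by simp
qed

lemma hless_hc:
  assumes \<xi>: "generic A \<xi>"
  shows "hless N (hc A \<xi> (\<lambda>a. of_real (r a))) (hc A \<xi> (\<lambda>a. of_real (s a))) \<longleftrightarrow>
    eventually (\<lambda>a. r a < s a) (germ A \<xi>)"
proof -
  have s: "std_small {pr N (cnum N (of_real r)) (cnum N (of_real s)) |r s::real. r < s}"
    using std_small_pairs[OF std_small_cset std_small_cset]
    by (rule std_small_subset) (auto simp: pairs_def cset_def)
  have eq: "pr N (hc A \<xi> (\<lambda>a. of_real (r a))) (hc A \<xi> (\<lambda>a. of_real (s a))) =
     star1 N A (\<lambda>a. pr N (cnum N (of_real (r a))) (cnum N (of_real (s a)))) \<xi>"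
    unfolding hc_def by (rule los_pr[OF \<xi> std_small_cnum std_small_cnum, symmetric])
  show ?thesis
    unfolding hless_def eq
    by (subst los_in[OF \<xi> std_small_pr[OF std_small_cnum std_small_cnum] s]) auto
qed

lemma limited_hc:
  assumes \<xi>: "generic A \<xi>"
  shows "limited N (hc A \<xi> f) \<longleftrightarrow> (\<exists>C. eventually (\<lambda>a. cmod (f a) \<le> C) (germ A \<xi>))"
proof -
  have "limited N (hc A \<xi> f) \<longleftrightarrow> (\<exists>n::nat. eventually (\<lambda>a. cmod (f a) < n) (germ A \<xi>))"
    using hless_hc[OF \<xi>, of "\<lambda>a. cmod (f a)" "\<lambda>_. real n" for n] hc_const[OF \<xi>, of "of_nat n" for n]
    by (simp add: limited_def hc_in[OF \<xi>] habs_def hc1_hc[OF \<xi>])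
  also have "\<dots> \<longleftrightarrow> (\<exists>C. eventually (\<lambda>a. cmod (f a) \<le> C) (germ A \<xi>))"
  proof
    assume "\<exists>n::nat. eventually (\<lambda>a. cmod (f a) < n) (germ A \<xi>)"
    then show "\<exists>C. eventually (\<lambda>a. cmod (f a) \<le> C) (germ A \<xi>)"
      by (meson eventually_mono less_imp_le)
  next
    assume "\<exists>C. eventually (\<lambda>a. cmod (f a) \<le> C) (germ A \<xi>)"
    then obtain C where C: "eventually (\<lambda>a. cmod (f a) \<le> C) (germ A \<xi>)" by blast
    obtain n :: nat where "C < n" using reals_Archimedean2 by blast
    then have "eventually (\<lambda>a. cmod (f a) < n) (germ A \<xi>)" using C by (auto elim: eventually_mono)
    then show "\<exists>n::nat. eventually (\<lambda>a. cmod (f a) < n) (germ A \<xi>)" by blast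
  qed
  finally show ?thesis .
qed

lemma infinitesimal_hc:
  assumes \<xi>: "generic A \<xi>"
  shows "infinitesimal N (hc A \<xi> f) \<longleftrightarrow> (f \<longlongrightarrow> 0) (germ A \<xi>)"
proof -
  have "infinitesimal N (hc A \<xi> f) \<longleftrightarrow> (\<forall>e>0. eventually (\<lambda>a. cmod (f a) < e) (germ A \<xi>))"
    using hless_hc[OF \<xi>, of "\<lambda>a. cmod (f a)" "\<lambda>_. e" for e] hc_const[OF \<xi>, of "of_real e" for e]
    by (simp add: infinitesimal_def hc_in[OF \<xi>] habs_def hc1_hc[OF \<xi>])
  then show ?thesis by (simp add: tendsto_iff dist_norm)
qed

text \<open>An infinitesimal difference from a constant means convergence to that constant along the
  ultrafilter, and such limits are unique.\<close>

lemma std_part_hc: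
  assumes \<xi>: "generic A \<xi>" and l: "(f \<longlongrightarrow> l) (germ A \<xi>)"
  shows "std_part N (hc A \<xi> f) = l"
  unfolding std_part_def
proof (rule the_equality)
  have eq: "hc2 N (-) (hc A \<xi> f) (cnum N c) = hc A \<xi> (\<lambda>a. f a - c)" for c
    using hc2_hc[OF \<xi>, of "(-)" f "\<lambda>_. c"] by (simp add: hc_const[OF \<xi>])
  have iff: "infinitesimal N (hc2 N (-) (hc A \<xi> f) (cnum N c)) \<longleftrightarrow> (f \<longlongrightarrow> c) (germ A \<xi>)" for c
    unfolding eq infinitesimal_hc[OF \<xi>] by (rule LIM_zero_iff)
  show "infinitesimal N (hc2 N (-) (hc A \<xi> f) (cnum N l))" using iff l by simp
  show "c = l" if "infinitesimal N (hc2 N (-) (hc A \<xi> f) (cnum N c))" for c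
    using that iff tendsto_unique[OF germ_nonbot[OF \<xi>] _ l] by blast
qed

text \<open>Passing to a pair index does not alter what holds eventually of the first coordinate, so
  a representation survives when a new object is adjoined.\<close>

lemma germ_extend:
  assumes \<xi>: "generic A \<xi>" and \<eta>: "generic C \<eta>"
  shows "eventually P (germ A \<xi>) \<longleftrightarrow> eventually (\<lambda>p. P (pfst p)) (germ (pairs A C) (pr N \<xi> \<eta>))"
proof -
  note g = generic_pr[OF \<xi> \<eta>]
  have A: "std_small A" using \<xi> by (simp add: generic_def)
  have s: "std_small (pfst ` pairs A C)" using A by (rule std_small_subset) (auto simp: pairs_iff)
  have "eventually P (germ A \<xi>) \<longleftrightarrow> star1 N (pairs A C) pfst (pr N \<xi> \<eta>) \<in> star_set N {a \<in> A. P a}"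
    using star1_proj(1)[OF \<xi> \<eta>] eventually_germ[OF \<xi>] by simp
  also have "\<dots> \<longleftrightarrow> eventually (\<lambda>p. pfst p \<in> {a \<in> A. P a}) (germ (pairs A C) (pr N \<xi> \<eta>))"
    by (rule los_in[OF g s]) (use A in \<open>auto elim: std_small_subset\<close>)
  also have "\<dots> \<longleftrightarrow> eventually (\<lambda>p. P (pfst p)) (germ (pairs A C) (pr N \<xi> \<eta>))"
    by (rule eventually_cong[OF eventually_in[OF g]]) (auto simp: pairs_iff)
  finally show ?thesis .
qed

lemma star1_extend:
  assumes \<xi>: "generic A \<xi>" and \<eta>: "generic C \<eta>" and f: "std_small (f ` A)"
  shows "star1 N A f \<xi> = star1 N (pairs A C) (\<lambda>p. f (pfst p)) (pr N \<xi> \<eta>)"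
proof -
  have "pfst ` pairs A C \<subseteq> A" by (auto simp: pairs_iff)
  from los_star1[OF generic_pr[OF \<xi> \<eta>] this _ f] show ?thesis
    using \<xi> star1_proj(1)[OF \<xi> \<eta>] by (simp add: generic_def)
qed

text \<open>Moves a universal quantifier over the sections inside the germ. If the claim failed,
  counterexamples would exist eventually by the ultrafilter property, and a choice of them would be
  a family g that contradicts P.\<close>

lemma eventually_ball:
  assumes \<xi>: "generic A \<xi>" and C: "std_small C" and S: "\<And>a. a \<in> A \<Longrightarrow> S a \<subseteq> C"
    and P: "\<And>g. g ` A \<subseteq> C \<Longrightarrow> eventually (\<lambda>a. g a \<in> S a) (germ A \<xi>) \<Longrightarrow>
      eventually (\<lambda>a. P a (g a)) (germ A \<xi>)"
  shows "eventually (\<lambda>a. \<forall>x\<in>S a. P a x) (germ A \<xi>)"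
proof (rule ccontr)
  assume "\<not> ?thesis"
  then have "eventually (\<lambda>a. \<exists>x\<in>S a. \<not> P a x) (germ A \<xi>)"
    by (simp add: eventually_not[OF \<xi>, symmetric])
  then have ev: "eventually (\<lambda>a. a \<in> A \<and> (\<exists>x\<in>S a. \<not> P a x)) (germ A \<xi>)"
    using eventually_in[OF \<xi>] by (simp add: eventually_conj_iff)
  then obtain c where c: "c \<in> C" using S eventually_happens'[OF germ_nonbot[OF \<xi>] ev] by blast
  \<comment> \<open>c is a default in C for the indices without a counterexample; it keeps g inside
    C on all of A.\<close>
  define g where "g a = (if \<exists>x\<in>S a. \<not> P a x then SOME x. x \<in> S a \<and> \<not> P a x else c)" for a
  have g: "g a \<in> S a \<and> \<not> P a (g a)" if "\<exists>x\<in>S a. \<not> P a x" for a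
  proof -
    have "\<exists>x. x \<in> S a \<and> \<not> P a x" using that by blast
    from someI_ex[OF this] show ?thesis using that by (simp add: g_def)
  qed
  have "g a \<in> C" if "a \<in> A" for a
  proof (cases "\<exists>x\<in>S a. \<not> P a x")
    case True
    then show ?thesis using g S[OF that] by blast
  qed (use c in \<open>simp add: g_def\<close>)
  then have gC: "g ` A \<subseteq> C" by auto
  have gS: "eventually (\<lambda>a. g a \<in> S a) (germ A \<xi>)"
    and gP: "eventually (\<lambda>a. \<not> P a (g a)) (germ A \<xi>)"
    using eventually_mono[OF ev] g by simp_all
  note gP
  moreover have "eventually (\<lambda>a. P a (g a)) (germ A \<xi>)" by (rule P[OF gC gS])
  ultimately show False using eventually_not[OF \<xi>] by blast
qed

lemma eventually_imp:
  assumes "generic A \<xi>"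
  shows "eventually (\<lambda>a. P a \<longrightarrow> Q a) (germ A \<xi>) \<longleftrightarrow> (eventually P (germ A \<xi>) \<longrightarrow> eventually Q (germ A \<xi>))"
proof (cases "eventually P (germ A \<xi>)")
  case True
  then show ?thesis using eventually_mp[of P Q] by (auto elim: eventually_mono)
next
  case False
  then have "eventually (\<lambda>a. \<not> P a) (germ A \<xi>)" using eventually_not[OF assms] by blast
  then have "eventually (\<lambda>a. P a \<longrightarrow> Q a) (germ A \<xi>)" by (rule eventually_mono) simp
  then show ?thesis using False by simp
qed

text \<open>What holds eventually may be assumed at every index: the index set is cut down, and the
  represented objects stay the same.\<close>

lemma generic_shrink:
  assumes \<xi>: "generic A \<xi>" and P: "eventually P (germ A \<xi>)"
  shows "generic {a \<in> A. P a} \<xi>" "std_small (f ` A) \<Longrightarrow> star1 N {a \<in> A. P a} f \<xi> = star1 N A f \<xi>"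
proof -
  show g: "generic {a \<in> A. P a} \<xi>"
    using assms eventually_germ[OF \<xi>] unfolding generic_def by (auto elim: std_small_subset)
  assume f: "std_small (f ` A)"
  have A: "std_small A" using \<xi> by (simp add: generic_def)
  have "star1 N A f (star1 N {a \<in> A. P a} (\<lambda>a. a) \<xi>) = star1 N {a \<in> A. P a} f \<xi>"
    by (rule los_star1[OF g _ A f]) auto
  then show "star1 N {a \<in> A. P a} f \<xi> = star1 N A f \<xi>" using star1_id[OF g] by simp
qed

text \<open>By induction, the index of the new object is paired with the common index of the earlier
  ones.\<close>

lemma internal_represent:
  assumes "\<And>i. i < n \<Longrightarrow> internal N (x i)"
  shows "\<exists>A \<xi> f. generic A \<xi> \<and> (\<forall>i<(n::nat). std_small (f i ` A) \<and> star1 N A (f i) \<xi> = x i)"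
  using assms
proof (induction n)
  case 0
  \<comment> \<open>With no objects to represent, any index will do; a singleton provides
    one.\<close>
  have c: "std_small {cnum N 0}" by (rule std_small_singleton[OF std_cnum])
  have "sat N (Mem 0 1) (env [cnum N 0, the_set N {cnum N 0}])"
    using c by (simp add: env_def mem_std_set)
  then have "sat N (Mem 0 1) (env (map (star N) [cnum N 0, the_set N {cnum N 0}]))"
    using c by (subst (asm) transfer_env) (auto simp: std_the_set std_cnum)
  then have "generic {cnum N 0} (star N (cnum N 0))"
    using c by (simp add: env_def mem_star_set generic_def)
  then show ?case by blast
next
  case (Suc n)
  then obtain A \<xi> f where A: "generic A \<xi>" "\<And>i. i < n \<Longrightarrow> std_small (f i ` A)"
    "\<And>i. i < n \<Longrightarrow> star1 N A (f i) \<xi> = x i" by (metis less_Suc_eq)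
  obtain C where C: "generic C (x n)" using Suc.prems internal_iff by blast
  define f' where "f' i = (if i < n then (\<lambda>p. f i (pfst p)) else psnd)" for i
  have "std_small (f' i ` pairs A C) \<and> star1 N (pairs A C) (f' i) (pr N \<xi> (x n)) = x i" if "i < Suc n" for i
  proof (cases "i < n")
    case True
    have "(\<lambda>p. f i (pfst p)) ` pairs A C \<subseteq> f i ` A" by (auto simp: pairs_iff)
    then show ?thesis using True A(2,3)[OF True] star1_extend[OF A(1) C A(2)[OF True]] std_small_subset
      by (auto simp: f'_def)
  next
    case False
    then have i: "i = n" using that by simp
    have "psnd ` pairs A C \<subseteq> C" by (auto simp: pairs_iff)
    then show ?thesis using i star1_proj(2)[OF A(1) C] C std_small_subset
      by (auto simp: f'_def generic_def)
  qed
  then show ?case using generic_pr[OF A(1) C] by blast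
qed

definition iset :: "'w set \<Rightarrow> 'w \<Rightarrow> ('w \<Rightarrow> 'w set) \<Rightarrow> 'w set" where
  "iset A \<xi> S = elts N (star1 N A (\<lambda>a. the_set N (S a)) \<xi>)"

lemma std_small_family:
  assumes "std_small C" "\<And>a. a \<in> A \<Longrightarrow> S a \<subseteq> C" shows "std_small ((\<lambda>a. the_set N (S a)) ` A)"
  using std_small_sets[OF assms(1)] by (rule std_small_subset) (use assms(2) in auto)

lemma in_iset:
  assumes "generic A \<xi>" "std_small C" "\<And>a. a \<in> A \<Longrightarrow> S a \<subseteq> C" "std_small (g ` A)"
  shows "star1 N A g \<xi> \<in> iset A \<xi> S \<longleftrightarrow> eventually (\<lambda>a. g a \<in> S a) (germ A \<xi>)"
proof -
  have "star1 N A g \<xi> \<in> iset A \<xi> S \<longleftrightarrow> eventually (\<lambda>a. mem N (g a) (the_set N (S a))) (germ A \<xi>)"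
    using los_mem[OF assms(1,4) std_small_family[OF assms(2,3)]] by (simp add: iset_def elts_def)
  also have "\<dots> \<longleftrightarrow> eventually (\<lambda>a. g a \<in> S a) (germ A \<xi>)"
    by (rule eventually_cong[OF eventually_in[OF assms(1)]])
       (use assms(2,3) std_small_subset in \<open>simp add: mem_std_set\<close>)
  finally show ?thesis .
qed

lemma internal_iset:
  assumes "generic A \<xi>" "std_small C" "\<And>a. a \<in> A \<Longrightarrow> S a \<subseteq> C"
  shows "internal N (star1 N A (\<lambda>a. the_set N (S a)) \<xi>)"
  by (rule internal_star1[OF assms(1) std_small_family[OF assms(2,3)]])

lemma iset_sub:
  assumes "generic A \<xi>" "std_small C" "\<And>a. a \<in> A \<Longrightarrow> S a \<subseteq> C"
  shows "iset A \<xi> S \<subseteq> star_set N C"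
proof -
  note s = std_small_family[OF assms(2,3)]
  have C: "the_set N C \<in> standard_universe N" using assms(2) by (rule std_the_set)
  define P where "P = (\<lambda>x y z::'w. \<forall>w. mem N w x \<longrightarrow> mem N w y)"
  have "P (star1 N A (\<lambda>a. the_set N (S a)) \<xi>) (star1 N A (\<lambda>_. the_set N C) \<xi>) (star1 N A (\<lambda>_. the_set N C) \<xi>)
    \<longleftrightarrow> eventually (\<lambda>a. P (the_set N (S a)) (the_set N C) (the_set N C)) (germ A \<xi>)"
    by (rule los[where q = "BAll 80 0 (Mem 80 1)" and Q = P, OF assms(1) s std_small_const[OF C] std_small_const[OF C]])
       (simp_all add: P_def)
  moreover have "eventually (\<lambda>a. P (the_set N (S a)) (the_set N C) (the_set N C)) (germ A \<xi>)"
    using eventually_in[OF assms(1)]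
    by (rule eventually_mono) (use assms(2,3) std_small_subset in \<open>auto simp: P_def mem_std_set\<close>)
  ultimately show ?thesis
    by (auto simp: P_def iset_def elts_def star1_const[OF assms(1) C] mem_star_set)
qed

text \<open>The standard values f a may have elements outside C. Cutting them down to C makes them a
  family of subsets of C, and does not change the internal set, all of whose elements lie in the
  enlargement of C.\<close>

lemma iset_represent:
  assumes \<xi>: "generic A \<xi>" and f: "std_small (f ` A)" and C: "std_small C"
    and sub: "elts N (star1 N A f \<xi>) \<subseteq> star_set N C"
  shows "elts N (star1 N A f \<xi>) = iset A \<xi> (\<lambda>a. elts N (f a) \<inter> C)"
proof -
  have Cs: "the_set N C \<in> standard_universe N" using C by (rule std_the_set)
  have s: "std_small ((\<lambda>a. the_set N (elts N (f a) \<inter> C)) ` A)" by (rule std_small_family[OF C]) auto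
  define P where "P = (\<lambda>x y z. (\<forall>w. mem N w x \<longrightarrow> (mem N w z \<longrightarrow> mem N w y)) \<and> (\<forall>w. mem N w y \<longrightarrow> mem N w x))"
  have "P (star1 N A f \<xi>) (star1 N A (\<lambda>a. the_set N (elts N (f a) \<inter> C)) \<xi>) (star1 N A (\<lambda>_. the_set N C) \<xi>)
    \<longleftrightarrow> eventually (\<lambda>a. P (f a) (the_set N (elts N (f a) \<inter> C)) (the_set N C)) (germ A \<xi>)"
    by (rule los[where Q = P and q = "Conj (BAll 80 0 (fImp (Mem 80 2) (Mem 80 1))) (BAll 80 1 (Mem 80 0))",
          OF \<xi> f s std_small_const[OF Cs]])
       (simp_all add: P_def)
  moreover have "P (f a) (the_set N (elts N (f a) \<inter> C)) (the_set N C)" for a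
  proof -
    have "std_small (elts N (f a) \<inter> C)" using C by (rule std_small_subset) auto
    then show ?thesis using C by (auto simp: P_def mem_std_set elts_def)
  qed
  ultimately have "P (star1 N A f \<xi>) (star1 N A (\<lambda>a. the_set N (elts N (f a) \<inter> C)) \<xi>) (star1 N A (\<lambda>_. the_set N C) \<xi>)"
    by simp
  then show ?thesis
    using sub by (auto simp: P_def iset_def elts_def star1_const[OF \<xi> Cs] mem_star_set)
qed

end

text \<open>The comparison space E carries no scalar product, so this is cancellation from the
  vector space axioms.\<close>

lemma scl_zero:
  assumes V: "complex_vector_space V" and x: "x \<in> car V" shows "scl V 0 x = zer V"
proof -
  have s: "scl V 0 x \<in> car V" using V x unfolding complex_vector_space_def by blast
  then obtain y where y: "y \<in> car V" "add V (scl V 0 x) y = zer V"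
    using V unfolding complex_vector_space_def by blast
  have assoc: "\<And>a b c. a \<in> car V \<Longrightarrow> b \<in> car V \<Longrightarrow> c \<in> car V \<Longrightarrow> add V (add V a b) c = add V a (add V b c)"
    and zl: "\<And>a. a \<in> car V \<Longrightarrow> add V (zer V) a = a" and z: "zer V \<in> car V"
    and comm: "\<And>a b. a \<in> car V \<Longrightarrow> b \<in> car V \<Longrightarrow> add V a b = add V b a"
    using V unfolding complex_vector_space_def by blast+
  have "scl V (0 + 0) x = add V (scl V 0 x) (scl V 0 x)" using V x unfolding complex_vector_space_def by blast
  then have "add V (scl V 0 x) y = add V (scl V 0 x) (add V (scl V 0 x) y)" using assoc[OF s s y(1)] by simp
  then show ?thesis using y(2) comm[OF s z] zl[OF s] by simp
qed

section \<open>Hyperfinite-dimensional subspaces\<close>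

text \<open>Finite dimension is used only through the existence of a maximal orthonormal system.\<close>

lemma (in prehilb) findim_maximal_orthonormal:
  assumes S: "subspace_of H S" and E: "complex_vector_space E" and D: "findim_subspace_of E D"
    and tot: "\<And>x. x \<in> S \<Longrightarrow> \<exists>y\<in>D. R x y" and surj: "\<And>y. y \<in> D \<Longrightarrow> \<exists>x\<in>S. R x y"
    and inj: "\<And>x x' y. x \<in> S \<Longrightarrow> x' \<in> S \<Longrightarrow> R x y \<Longrightarrow> R x' y \<Longrightarrow> x = x'"
    and add: "\<And>x x' y y'. R x y \<Longrightarrow> R x' y' \<Longrightarrow> R (add H x x') (add E y y')"
    and scl: "\<And>c x y. R x y \<Longrightarrow> R (scl H c x) (scl E c y)"
  shows "\<exists>C. finite C \<and> C \<subseteq> S \<and> orthonormal C \<and> (\<forall>y\<in>S. (\<forall>b\<in>C. ip H b y = 0) \<longrightarrow> y = zer H)"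
proof -
  have Dsub: "subspace_of E D" using D by (simp add: findim_subspace_of_def)
  have Sc: "S \<subseteq> car H" using S by (simp add: subspace_of_def)
  obtain T where T: "finite T" "T \<subseteq> D" "\<And>D'. subspace_of E D' \<Longrightarrow> T \<subseteq> D' \<Longrightarrow> D \<subseteq> D'"
    using D by (auto simp: findim_subspace_of_def)
  obtain p where p: "\<And>y. y \<in> D \<Longrightarrow> p y \<in> S \<and> R (p y) y" using surj by metis
  have "p ` T \<subseteq> S" using p T(2) by auto
  from gram_schmidt[OF S finite_imageI[OF T(1)] this] obtain C where C: "finite C" "C \<subseteq> S" "orthonormal C"
    "\<forall>x\<in>p ` T. \<forall>y\<in>S. (\<forall>b\<in>C. ip H b y = 0) \<longrightarrow> ip H y x = 0" by blast
  \<comment> \<open>L is the biorthogonal of C within S. Its image under R is a subspace containing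
    the generators T, hence all of D; injectivity of R carries this back to L = S, which is
    maximality of C.\<close>
  define L where "L = {x \<in> S. \<forall>y\<in>S. (\<forall>b\<in>C. ip H b y = 0) \<longrightarrow> ip H y x = 0}"
  have L: "subspace_of H L"
    using S Sc unfolding L_def subspace_of_def by (auto simp: subset_iff)
  define D' where "D' = {d \<in> D. \<exists>x\<in>L. R x d}"
  have LS: "L \<subseteq> S" by (auto simp: L_def)
  have "subspace_of E D'"
    unfolding subspace_of_def
  proof (intro conjI ballI allI)
    show "D' \<subseteq> car E" using Dsub by (auto simp: D'_def subspace_of_def)
    have zD: "zer E \<in> D" using Dsub by (simp add: subspace_of_def)
    have "zer H \<in> S" using S by (simp add: subspace_of_def)
    then obtain z where z: "z \<in> D" "R (zer H) z" using tot by blast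
    have "scl E 0 z = zer E" using Dsub z E by (intro scl_zero) (auto simp: subspace_of_def)
    moreover have "scl H 0 (zer H) = zer H" by (rule ip_eqI) auto
    ultimately have "R (zer H) (zer E)" using scl[OF z(2), of 0] by simp
    then show "zer E \<in> D'" using zD L by (auto simp: D'_def subspace_of_def)
    show "add E d d' \<in> D'" if dd: "d \<in> D'" "d' \<in> D'" for d d'
    proof -
      obtain x x' where "x \<in> L" "R x d" "x' \<in> L" "R x' d'" using dd by (auto simp: D'_def)
      then have "add H x x' \<in> L" "R (add H x x') (add E d d')" using L add by (auto simp: subspace_of_def)
      then show ?thesis using dd Dsub by (auto simp: D'_def subspace_of_def)
    qed
    show "scl E c d \<in> D'" if dd: "d \<in> D'" for c d
    proof -
      obtain x where "x \<in> L" "R x d" using dd by (auto simp: D'_def)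
      then have "scl H c x \<in> L" "R (scl H c x) (scl E c d)" using L scl by (auto simp: subspace_of_def)
      then show ?thesis using dd Dsub by (auto simp: D'_def subspace_of_def)
    qed
  qed
  moreover have "T \<subseteq> D'"
  proof
    fix t assume t: "t \<in> T"
    then have "t \<in> D" using T(2) by auto
    moreover have "p t \<in> L" using p[OF \<open>t \<in> D\<close>] C(4) t by (auto simp: L_def)
    ultimately show "t \<in> D'" using p by (auto simp: D'_def)
  qed
  ultimately have DD': "D \<subseteq> D'" by (rule T(3))
  have "y = zer H" if y: "y \<in> S" "\<forall>b\<in>C. ip H b y = 0" for y
  proof -
    obtain d where d: "d \<in> D" "R y d" using tot[OF y(1)] by blast
    then obtain x where x: "x \<in> L" "R x d" using DD' by (auto simp: D'_def)
    then have "x = y" using inj d y(1) LS by blast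
    then have "ip H y y = 0" using x(1) y by (auto simp: L_def)
    then show ?thesis using nrm_eq_0_iff[of y] y(1) Sc by (auto simp: nrm_def)
  qed
  then show ?thesis using C by blast
qed

section \<open>Internal vector operations, and standard families that represent \<open>F\<close> and
  \<open>B\<close>\<close>

context nonstandard begin

lemma small_pairs: assumes "small A" "small B" shows "small (pairs A B)"
proof -
  obtain m n where "A \<subseteq> level N (new_atoms N) m" "B \<subseteq> level N (new_atoms N) n" using assms by (auto simp: small_def)
  then have AB: "A \<union> B \<subseteq> level N (new_atoms N) (max m n)"
    using level_mono[of m "max m n" "new_atoms N"] level_mono[of n "max m n" "new_atoms N"] by auto
  have the_set: "the_set N S \<in> level N (new_atoms N) (Suc k)" if "S \<subseteq> level N (new_atoms N) k" for S k
    using the_set_props[of S] that by (auto simp: small_def)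
  have "pr N x y \<in> level N (new_atoms N) (Suc (Suc (max m n)))" if "x \<in> A" "y \<in> B" for x y
    unfolding pr_def by (intro the_set insert_subsetI empty_subsetI) (use AB that in auto)
  then have "pairs A B \<subseteq> level N (new_atoms N) (Suc (Suc (max m n)))" unfolding pairs_def by blast
  then show ?thesis unfolding small_def by blast
qed

lemma elts_graph1:
  assumes "small X" "small (f ` X)" shows "elts N (graph1 N X f) = {pr N x (f x) |x. x \<in> X}"
proof -
  have "small {pr N x (f x) |x. x \<in> X}"
    using small_pairs[OF assms] by (rule small_subset) (auto simp: pairs_def)
  then show ?thesis unfolding graph1_def by (rule the_set_props(2))
qed

lemma elts_star1_subset:
  assumes \<xi>: "generic A \<xi>" and f: "std_small (f ` A)" and C: "std_small C"
  shows "elts N (star1 N A f \<xi>) \<subseteq> star_set N C \<longleftrightarrow> eventually (\<lambda>a. elts N (f a) \<subseteq> C) (germ A \<xi>)"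
proof -
  have Cs: "the_set N C \<in> standard_universe N" using C by (rule std_the_set)
  define P where "P = (\<lambda>x y z::'w. \<forall>w. mem N w x \<longrightarrow> mem N w y)"
  have "P (star1 N A f \<xi>) (star1 N A (\<lambda>_. the_set N C) \<xi>) (star1 N A (\<lambda>_. the_set N C) \<xi>)
    \<longleftrightarrow> eventually (\<lambda>a. P (f a) (the_set N C) (the_set N C)) (germ A \<xi>)"
    by (rule los[where q = "BAll 80 0 (Mem 80 1)" and Q = P, OF \<xi> f std_small_const[OF Cs] std_small_const[OF Cs]])
       (simp_all add: P_def)
  moreover have "P (f a) (the_set N C) (the_set N C) \<longleftrightarrow> elts N (f a) \<subseteq> C" for a
    using C by (auto simp: P_def mem_std_set elts_def)
  moreover have "P (star1 N A f \<xi>) (star1 N A (\<lambda>_. the_set N C) \<xi>) (star1 N A (\<lambda>_. the_set N C) \<xi>) \<longleftrightarrow>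
      elts N (star1 N A f \<xi>) \<subseteq> star_set N C"
    by (auto simp: P_def elts_def star1_const[OF \<xi> Cs] mem_star_set)
  ultimately show ?thesis by simp
qed

lemma iset_shrink:
  assumes "generic A \<xi>" "eventually P (germ A \<xi>)" "std_small C" "\<And>a. a \<in> A \<Longrightarrow> S a \<subseteq> C"
  shows "iset {a \<in> A. P a} \<xi> S = iset A \<xi> S"
  using generic_shrink(2)[OF assms(1,2), of "\<lambda>a. the_set N (S a)"] std_small_family[of C A S, OF assms(3,4)]
  by (simp add: iset_def)

lemma space_small: "space_in_universe N V \<Longrightarrow> std_small (car V)"
  using std_small_elts unfolding space_in_universe_def by metis

lemma vadd_star1:
  assumes V: "space_in_universe N V" and \<xi>: "generic A \<xi>" and fg: "f ` A \<subseteq> car V" "g ` A \<subseteq> car V"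
  shows "vadd N V (star1 N A f \<xi>) (star1 N A g \<xi>) = star1 N A (\<lambda>a. add V (f a) (g a)) \<xi>"
  unfolding vadd_def
  by (rule los_star2[OF \<xi> fg(1) space_small[OF V] fg(2) space_small[OF V] _ space_small[OF V]])
     (use V in \<open>auto simp: space_in_universe_def complex_vector_space_def\<close>)

lemma vscl_star1:
  assumes V: "space_in_universe N V" and \<xi>: "generic A \<xi>" and f: "f ` A \<subseteq> car V"
  shows "vscl N V (hc A \<xi> c) (star1 N A f \<xi>) = star1 N A (\<lambda>a. scl V (c a) (f a)) \<xi>"
proof -
  have c: "(\<lambda>a. cnum N (c a)) ` A \<subseteq> cset N" by (auto simp: cset_def)
  have "star2 N (cset N) (car V) (\<lambda>z x. scl V (cval N z) x) (star1 N A (\<lambda>a. cnum N (c a)) \<xi>) (star1 N A f \<xi>)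
     = star1 N A (\<lambda>a. scl V (cval N (cnum N (c a))) (f a)) \<xi>"
    by (rule los_star2[OF \<xi> c std_small_cset f space_small[OF V] _ space_small[OF V]])
       (use V in \<open>auto simp: space_in_universe_def complex_vector_space_def\<close>)
  then show ?thesis by (simp add: vscl_def hc_def)
qed

end

locale nonstandard_space = nonstandard N for N :: "'w universe" +
  fixes G :: "'w ips"
  assumes space: "space_in_universe N G" and hermitian: "hermitian_product G (ip G)"
begin

sublocale G: prehilb G
  by unfold_locales (use space hermitian in \<open>simp add: prehilbert_def space_in_universe_def\<close>)

lemmas G_small = space_small[OF space]

lemma std_small_vec: "f ` A \<subseteq> car G \<Longrightarrow> std_small (f ` A)"
  using G_small by (rule std_small_subset)

lemma vip_star1:
  assumes \<xi>: "generic A \<xi>" and fg: "f ` A \<subseteq> car G" "g ` A \<subseteq> car G"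
  shows "vip N G (star1 N A f \<xi>) (star1 N A g \<xi>) = hc A \<xi> (\<lambda>a. ip G (f a) (g a))"
  unfolding vip_def hc_def
  by (rule los_star2[OF \<xi> fg(1) G_small fg(2) G_small _ std_small_cset]) (simp add: cset_def)

lemma vsub_star1:
  assumes \<xi>: "generic A \<xi>" and fg: "f ` A \<subseteq> car G" "g ` A \<subseteq> car G"
  shows "vsub N G (star1 N A f \<xi>) (star1 N A g \<xi>) = star1 N A (\<lambda>a. sub G (f a) (g a)) \<xi>"
proof -
  have "vscl N G (cnum N (-1)) (star1 N A g \<xi>) = star1 N A (\<lambda>a. scl G (-1) (g a)) \<xi>"
    using vscl_star1[OF space \<xi> fg(2), of "\<lambda>_. -1"] hc_const[OF \<xi>] by simp
  then show ?thesis
    unfolding vsub_def sub_def using vadd_star1[OF space \<xi> fg(1), of "\<lambda>a. scl G (-1) (g a)"] fg(2)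
    by (simp add: image_subset_iff)
qed

lemma vnorm_star1:
  assumes \<xi>: "generic A \<xi>" and f: "f ` A \<subseteq> car G"
  shows "vnorm N G (star1 N A f \<xi>) = hc A \<xi> (\<lambda>a. of_real (nrm G (f a)))"
  unfolding vnorm_def vip_star1[OF \<xi> f f] hc1_hc[OF \<xi>] nrm_def by simp

text \<open>F, B, the finite-dimensional model D of F and the isomorphism are represented on one
  index. Each clause of the hypotheses becomes a property of almost all sections, and at an index
  where all hold, the section of the isomorphism carries finite dimension from the section of D to
  that of F. Counting then makes the orthonormal section of B finite.\<close>

lemma findim_base:
  assumes F: "internal_subspace N G F" "hyperfinite_dim N G F" and B: "orthonormal_hyperbasis N G F B"
  shows "\<exists>A \<xi> SF SB. generic A \<xi> \<and> elts N F = iset A \<xi> SF \<and> elts N B = iset A \<xi> SB \<and>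
    (\<forall>a\<in>A. subspace_of G (SF a) \<and> finite (SB a) \<and> SB a \<subseteq> SF a \<and> G.orthonormal (SB a) \<and>
      (\<forall>x\<in>SF a. (\<forall>b\<in>SB a. ip G b x = 0) \<longrightarrow> x = zer G))"
proof -
  have Fi: "internal N F" "elts N F \<subseteq> star_set N (car G)" "star N (zer G) \<in> elts N F"
    "\<And>x y. x \<in> elts N F \<Longrightarrow> y \<in> elts N F \<Longrightarrow> vadd N G x y \<in> elts N F"
    "\<And>z x. z \<in> hcomplex N \<Longrightarrow> x \<in> elts N F \<Longrightarrow> vscl N G z x \<in> elts N F"
    using F(1) by (auto simp: internal_subspace_def)
  have Bi: "internal N B" "elts N B \<subseteq> elts N F"
    "\<And>b c. b \<in> elts N B \<Longrightarrow> c \<in> elts N B \<Longrightarrow> vip N G b c = cnum N (if b = c then 1 else 0)"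
    "\<And>x. x \<in> elts N F \<Longrightarrow> (\<forall>b\<in>elts N B. vip N G b x = cnum N 0) \<Longrightarrow> x = star N (zer G)"
    using B by (auto simp: orthonormal_hyperbasis_def)
  obtain E :: "'w cvs" and D \<phi> where E: "space_in_universe N E" and D: "mem N D (star N (vss_f N E))"
    and \<phi>i: "internal N (graph1 N (elts N F) \<phi>)" and bij: "bij_betw \<phi> (elts N F) (elts N D)"
    and \<phi>add: "\<And>x y. x \<in> elts N F \<Longrightarrow> y \<in> elts N F \<Longrightarrow> \<phi> (vadd N G x y) = vadd N E (\<phi> x) (\<phi> y)"
    and \<phi>scl: "\<And>z x. z \<in> hcomplex N \<Longrightarrow> x \<in> elts N F \<Longrightarrow> \<phi> (vscl N G z x) = vscl N E z (\<phi> x)"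
    using F(2) unfolding hyperfinite_dim_def by blast
  note E_small = space_small[OF E]
  define VE where "VE = {the_set N S |S. findim_subspace_of E S}"
  have VEs: "std_small VE"
    using std_small_sets[OF E_small]
    by (rule std_small_subset) (auto simp: VE_def findim_subspace_of_def subspace_of_def)
  have DV: "D \<in> star_set N VE" using D by (simp add: vss_f_def VE_def star_set_def elts_def)
  define \<Gamma> where "\<Gamma> = graph1 N (elts N F) \<phi>"
  have Di: "internal N D" using DV VEs internal_iff by (auto simp: generic_def)
  define x where "x i = (if i = 0 then F else if i = 1 then B else if i = 2 then D else \<Gamma>)" for i :: nat
  have "internal N (x i)" for i using Fi(1) Bi(1) Di \<phi>i by (simp add: x_def \<Gamma>_def)
  from internal_represent[of 4 x, OF this] obtain A \<xi> f where \<xi>: "generic A \<xi>"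
    and f: "\<And>i. i < (4::nat) \<Longrightarrow> std_small (f i ` A)" "\<And>i. i < (4::nat) \<Longrightarrow> star1 N A (f i) \<xi> = x i" by metis
  have ff: "std_small (f 0 ` A)" "std_small (f 1 ` A)" "std_small (f 2 ` A)" "std_small (f 3 ` A)"
    "star1 N A (f 0) \<xi> = F" "star1 N A (f 1) \<xi> = B" "star1 N A (f 2) \<xi> = D" "star1 N A (f 3) \<xi> = \<Gamma>"
    using f(1)[of 0] f(1)[of 1] f(1)[of 2] f(1)[of 3] f(2)[of 0] f(2)[of 1] f(2)[of 2] f(2)[of 3]
    by (simp_all add: x_def)
  define SF where "SF = (\<lambda>a. elts N (f 0 a) \<inter> car G)"
  define SB where "SB = (\<lambda>a. elts N (f 1 a) \<inter> car G)"
  define SD where "SD = (\<lambda>a. elts N (f 2 a) \<inter> car E)"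
  define S\<Gamma> where "S\<Gamma> = (\<lambda>a. elts N (f 3 a) \<inter> pairs (car G) (car E))"
  have sub: "SF a \<subseteq> car G" "SB a \<subseteq> car G" "SD a \<subseteq> car E" "S\<Gamma> a \<subseteq> pairs (car G) (car E)" for a
    by (auto simp: SF_def SB_def SD_def S\<Gamma>_def)
  have F_eq: "elts N F = iset A \<xi> SF"
    using iset_represent[OF \<xi> ff(1) G_small] Fi(2) unfolding ff SF_def by blast
  have B_eq: "elts N B = iset A \<xi> SB"
    using iset_represent[OF \<xi> ff(2) G_small] Fi(2) Bi(2) unfolding ff SB_def by blast
  have evD: "eventually (\<lambda>a. f 2 a \<in> VE) (germ A \<xi>)" using DV los_in[OF \<xi> ff(3) VEs] by (simp add: ff)
  have VE_elts: "findim_subspace_of E (elts N d)" if dV: "d \<in> VE" for d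
  proof -
    obtain S where S: "d = the_set N S" "findim_subspace_of E S" using dV by (auto simp: VE_def)
    have "std_small S" using E_small by (rule std_small_subset) (use S in \<open>auto simp: findim_subspace_of_def subspace_of_def\<close>)
    then show ?thesis using S the_set_props(2)[OF std_small_small] by simp
  qed
  have Dsub: "elts N D \<subseteq> star_set N (car E)"
  proof -
    have "eventually (\<lambda>a. elts N (f 2 a) \<subseteq> car E) (germ A \<xi>)"
      using evD by (rule eventually_mono) (use VE_elts in \<open>auto simp: findim_subspace_of_def subspace_of_def\<close>)
    then show ?thesis using elts_star1_subset[OF \<xi> ff(3) E_small] by (simp add: ff)
  qed
  have D_eq: "elts N D = iset A \<xi> SD"
    using iset_represent[OF \<xi> ff(3) E_small] Dsub unfolding ff SD_def by blast
  have \<phi>D: "\<phi> x \<in> elts N D" if "x \<in> elts N F" for x using bij that by (auto simp: bij_betw_def)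
  have "\<phi> ` elts N F = elts N D" using bij by (simp add: bij_betw_def)
  then have \<Gamma>_elts: "elts N \<Gamma> = {pr N x (\<phi> x) |x. x \<in> elts N F}"
    unfolding \<Gamma>_def by (intro elts_graph1) (simp_all add: small_elts)
  have \<Gamma>_mem: "pr N x y \<in> elts N \<Gamma> \<longleftrightarrow> x \<in> elts N F \<and> y = \<phi> x" for x y by (auto simp: \<Gamma>_elts)
  have times_small: "std_small (pairs (car G) (car E))" by (rule std_small_pairs[OF G_small E_small])
  have \<Gamma>_eq: "elts N \<Gamma> = iset A \<xi> S\<Gamma>"
  proof -
    have "elts N \<Gamma> \<subseteq> star_set N (pairs (car G) (car E))"
    proof
      fix p assume "p \<in> elts N \<Gamma>"
      then obtain x where x: "p = pr N x (\<phi> x)" "x \<in> elts N F" by (auto simp: \<Gamma>_elts)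
      have "generic (car G) x" "generic (car E) (\<phi> x)"
        using x Fi(2) \<phi>D[OF x(2)] Dsub G_small E_small by (auto simp: generic_def)
      from generic_pr[OF this] show "p \<in> star_set N (pairs (car G) (car E))" by (simp add: generic_def x)
    qed
    then show ?thesis using iset_represent[OF \<xi> ff(4) times_small] unfolding ff S\<Gamma>_def by blast
  qed
  have inF: "star1 N A g \<xi> \<in> elts N F \<longleftrightarrow> eventually (\<lambda>a. g a \<in> SF a) (germ A \<xi>)" if "std_small (g ` A)" for g
    unfolding F_eq by (rule in_iset[OF \<xi> G_small sub(1) that])
  have inB: "star1 N A g \<xi> \<in> elts N B \<longleftrightarrow> eventually (\<lambda>a. g a \<in> SB a) (germ A \<xi>)" if "std_small (g ` A)" for g
    unfolding B_eq by (rule in_iset[OF \<xi> G_small sub(2) that])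
  have inD: "star1 N A g \<xi> \<in> elts N D \<longleftrightarrow> eventually (\<lambda>a. g a \<in> SD a) (germ A \<xi>)" if "std_small (g ` A)" for g
    unfolding D_eq by (rule in_iset[OF \<xi> E_small sub(3) that])
  have in\<Gamma>: "star1 N A g \<xi> \<in> elts N \<Gamma> \<longleftrightarrow> eventually (\<lambda>a. g a \<in> S\<Gamma> a) (germ A \<xi>)" if "std_small (g ` A)" for g
    unfolding \<Gamma>_eq by (rule in_iset[OF \<xi> times_small sub(4) that])
  have vec_add: "(\<lambda>a. add G (g a) (h a)) ` A \<subseteq> car G" if "g ` A \<subseteq> car G" "h ` A \<subseteq> car G" for g h
    using that by (auto simp: image_subset_iff)
  have vec_scl: "(\<lambda>a. scl G (c a) (g a)) ` A \<subseteq> car G" if "g ` A \<subseteq> car G" for g c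
    using that by (auto simp: image_subset_iff)

  have ev_zer: "eventually (\<lambda>a. zer G \<in> SF a) (germ A \<xi>)"
  proof -
    have z: "zer G \<in> standard_universe N" by (rule std_small_mem[OF G_small]) simp
    show ?thesis using inF[OF std_small_const[OF z]] Fi(3) star1_const[OF \<xi> z] by simp
  qed
  have ev_add: "eventually (\<lambda>a. \<forall>x\<in>SF a. \<forall>y\<in>SF a. add G x y \<in> SF a) (germ A \<xi>)"
  proof (rule eventually_ball[OF \<xi> G_small sub(1)], rule eventually_ball[OF \<xi> G_small sub(1)])
    fix g h assume g: "g ` A \<subseteq> car G" "eventually (\<lambda>a. g a \<in> SF a) (germ A \<xi>)"
      and h: "h ` A \<subseteq> car G" "eventually (\<lambda>a. h a \<in> SF a) (germ A \<xi>)"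
    have "star1 N A g \<xi> \<in> elts N F" "star1 N A h \<xi> \<in> elts N F" using inF std_small_vec g h by auto
    from Fi(4)[OF this] show "eventually (\<lambda>a. add G (g a) (h a) \<in> SF a) (germ A \<xi>)"
      using inF[OF std_small_vec[OF vec_add[OF g(1) h(1)]]] vadd_star1[OF space \<xi> g(1) h(1)] by simp
  qed
  \<comment> \<open>Scalars range over the codes in \<open>cset N\<close>, because
    \<open>eventually_ball\<close> quantifies over elements of the universe.\<close>
  have ev_scl: "eventually (\<lambda>a. \<forall>z\<in>cset N. \<forall>x\<in>SF a. scl G (cval N z) x \<in> SF a) (germ A \<xi>)"
  proof (rule eventually_ball[OF \<xi> std_small_cset order_refl], rule eventually_ball[OF \<xi> G_small sub(1)])
    fix c h assume h: "h ` A \<subseteq> car G" "eventually (\<lambda>a. h a \<in> SF a) (germ A \<xi>)"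
    have "star1 N A h \<xi> \<in> elts N F" using inF std_small_vec h by auto
    from Fi(5)[OF hc_in[OF \<xi>] this, of "\<lambda>a. cval N (c a)"]
    show "eventually (\<lambda>a. scl G (cval N (c a)) (h a) \<in> SF a) (germ A \<xi>)"
      using inF[OF std_small_vec[OF vec_scl[OF h(1)]]] vscl_star1[OF space \<xi> h(1)] by simp
  qed
  have ev_D: "eventually (\<lambda>a. findim_subspace_of E (SD a)) (germ A \<xi>)"
    using evD
  proof (rule eventually_mono)
    fix a assume "f 2 a \<in> VE"
    then have fs: "findim_subspace_of E (elts N (f 2 a))" by (rule VE_elts)
    then have "SD a = elts N (f 2 a)" by (auto simp: SD_def findim_subspace_of_def subspace_of_def)
    then show "findim_subspace_of E (SD a)" using fs by simp
  qed
  have s\<Gamma>: "std_small ((\<lambda>a. the_set N (S\<Gamma> a)) ` A)" by (rule std_small_family[OF times_small sub(4)])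
  have sD: "std_small ((\<lambda>a. the_set N (SD a)) ` A)" by (rule std_small_family[OF E_small sub(3)])
  have sF: "std_small ((\<lambda>a. the_set N (SF a)) ` A)" by (rule std_small_family[OF G_small sub(1)])
  have mem_sets: "mem N z (the_set N (S\<Gamma> a)) \<longleftrightarrow> z \<in> S\<Gamma> a" "mem N z (the_set N (SD a)) \<longleftrightarrow> z \<in> SD a"
     "mem N z (the_set N (SF a)) \<longleftrightarrow> z \<in> SF a" for z a
    by (rule mem_std_set, rule std_small_subset[OF times_small sub(4)])
       (rule mem_std_set, rule std_small_subset[OF E_small sub(3)],
        rule mem_std_set, rule std_small_subset[OF G_small sub(1)])
  have mem_star: "mem N z (star1 N A (\<lambda>a. the_set N (S\<Gamma> a)) \<xi>) \<longleftrightarrow> z \<in> elts N \<Gamma>"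
     "mem N z (star1 N A (\<lambda>a. the_set N (SD a)) \<xi>) \<longleftrightarrow> z \<in> elts N D"
     "mem N z (star1 N A (\<lambda>a. the_set N (SF a)) \<xi>) \<longleftrightarrow> z \<in> elts N F" for z
    unfolding \<Gamma>_eq D_eq F_eq by (simp_all add: iset_def elts_def)
  have ev_tot: "eventually (\<lambda>a. \<forall>x\<in>SF a. \<exists>y\<in>SD a. pr N x y \<in> S\<Gamma> a) (germ A \<xi>)"
  proof (rule eventually_ball[OF \<xi> G_small sub(1)])
    fix g assume g: "g ` A \<subseteq> car G" "eventually (\<lambda>a. g a \<in> SF a) (germ A \<xi>)"
    define P where "P = (\<lambda>x d \<gamma>. \<exists>y. mem N y d \<and> mem N (pr N x y) \<gamma>)"
    have "P (star1 N A g \<xi>) (star1 N A (\<lambda>a. the_set N (SD a)) \<xi>) (star1 N A (\<lambda>a. the_set N (S\<Gamma> a)) \<xi>)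
      \<longleftrightarrow> eventually (\<lambda>a. P (g a) (the_set N (SD a)) (the_set N (S\<Gamma> a))) (germ A \<xi>)"
      by (rule los[where q = "fEx 80 1 (fApp 2 0 80)" and Q = P, OF \<xi> std_small_vec[OF g(1)] sD s\<Gamma>])
         (simp_all add: P_def)
    moreover have "star1 N A g \<xi> \<in> elts N F" using inF std_small_vec g by auto
    then have "P (star1 N A g \<xi>) (star1 N A (\<lambda>a. the_set N (SD a)) \<xi>) (star1 N A (\<lambda>a. the_set N (S\<Gamma> a)) \<xi>)"
      using \<phi>D \<Gamma>_mem by (auto simp: P_def mem_star)
    ultimately show "eventually (\<lambda>a. \<exists>y\<in>SD a. pr N (g a) y \<in> S\<Gamma> a) (germ A \<xi>)"
      by (simp add: P_def mem_sets Bex_def)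
  qed
  have ev_surj: "eventually (\<lambda>a. \<forall>y\<in>SD a. \<exists>x\<in>SF a. pr N x y \<in> S\<Gamma> a) (germ A \<xi>)"
  proof (rule eventually_ball[OF \<xi> E_small sub(3)])
    fix g assume g: "g ` A \<subseteq> car E" "eventually (\<lambda>a. g a \<in> SD a) (germ A \<xi>)"
    have gs: "std_small (g ` A)" using E_small g(1) by (rule std_small_subset)
    define P where "P = (\<lambda>x d \<gamma>. \<exists>y. mem N y d \<and> mem N (pr N y x) \<gamma>)"
    have "P (star1 N A g \<xi>) (star1 N A (\<lambda>a. the_set N (SF a)) \<xi>) (star1 N A (\<lambda>a. the_set N (S\<Gamma> a)) \<xi>)
      \<longleftrightarrow> eventually (\<lambda>a. P (g a) (the_set N (SF a)) (the_set N (S\<Gamma> a))) (germ A \<xi>)"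
      by (rule los[where q = "fEx 80 1 (fApp 2 80 0)" and Q = P, OF \<xi> gs sF s\<Gamma>])
         (simp_all add: P_def)
    moreover have "star1 N A g \<xi> \<in> elts N D" using inD gs g by auto
    then have "P (star1 N A g \<xi>) (star1 N A (\<lambda>a. the_set N (SF a)) \<xi>) (star1 N A (\<lambda>a. the_set N (S\<Gamma> a)) \<xi>)"
      using bij \<Gamma>_mem by (auto simp: P_def mem_star bij_betw_def)
    ultimately show "eventually (\<lambda>a. \<exists>x\<in>SF a. pr N x (g a) \<in> S\<Gamma> a) (germ A \<xi>)"
      by (simp add: P_def mem_sets Bex_def)
  qed
  \<comment> \<open>A family of pairs from the sections of the graph represents a single point of
    the graph of \<phi>; its coordinate families then represent an element of F and its
    image.\<close>
  have split: "std_small (pfst ` g ` A) \<and> std_small (psnd ` g ` A) \<and> (pfst \<circ> g) ` A \<subseteq> car G \<and> (psnd \<circ> g) ` A \<subseteq> car E \<and>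
      star1 N A (psnd \<circ> g) \<xi> = \<phi> (star1 N A (pfst \<circ> g) \<xi>) \<and> star1 N A (pfst \<circ> g) \<xi> \<in> elts N F"
    if g: "g ` A \<subseteq> pairs (car G) (car E)" "eventually (\<lambda>a. g a \<in> S\<Gamma> a) (germ A \<xi>)" for g
  proof -
    have gs: "std_small (g ` A)" using times_small g(1) by (rule std_small_subset)
    have 1: "(pfst \<circ> g) ` A \<subseteq> car G" "(psnd \<circ> g) ` A \<subseteq> car E" using g(1) by (auto simp: pairs_iff)
    have 2: "std_small ((pfst \<circ> g) ` A)" "std_small ((psnd \<circ> g) ` A)"
      using std_small_subset[OF G_small 1(1)] std_small_subset[OF E_small 1(2)] by auto
    have ga: "g a = pr N ((pfst \<circ> g) a) ((psnd \<circ> g) a)" if "a \<in> A" for a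
    proof -
      have "g a \<in> pairs (car G) (car E)" using g(1) that by blast
      then show ?thesis unfolding pairs_iff[of "g a"] by simp
    qed
    have "star1 N A g \<xi> = star1 N A (\<lambda>a. pr N ((pfst \<circ> g) a) ((psnd \<circ> g) a)) \<xi>"
      by (subst los_eq[OF \<xi> gs std_small_pr[OF 2]]) (rule eventually_mono[OF eventually_in[OF \<xi>]], rule ga)
    also have "\<dots> = pr N (star1 N A (pfst \<circ> g) \<xi>) (star1 N A (psnd \<circ> g) \<xi>)" by (rule los_pr[OF \<xi> 2])
    finally have "pr N (star1 N A (pfst \<circ> g) \<xi>) (star1 N A (psnd \<circ> g) \<xi>) \<in> elts N \<Gamma>" using in\<Gamma>[OF gs] g(2) by simp
    then show ?thesis using 1 2 \<Gamma>_mem by (simp add: image_comp)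
  qed
  have ev_inj: "eventually (\<lambda>a. \<forall>p\<in>S\<Gamma> a. \<forall>q\<in>S\<Gamma> a. psnd p = psnd q \<longrightarrow> pfst p = pfst q) (germ A \<xi>)"
  proof (rule eventually_ball[OF \<xi> times_small sub(4)], rule eventually_ball[OF \<xi> times_small sub(4)])
    fix g h assume g: "g ` A \<subseteq> pairs (car G) (car E)" "eventually (\<lambda>a. g a \<in> S\<Gamma> a) (germ A \<xi>)"
      and h: "h ` A \<subseteq> pairs (car G) (car E)" "eventually (\<lambda>a. h a \<in> S\<Gamma> a) (germ A \<xi>)"
    note sg = split[OF g] and sh = split[OF h]
    have "star1 N A (pfst \<circ> g) \<xi> = star1 N A (pfst \<circ> h) \<xi>" if "star1 N A (psnd \<circ> g) \<xi> = star1 N A (psnd \<circ> h) \<xi>"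
      using that sg sh bij by (auto simp: bij_betw_def dest: inj_onD)
    then show "eventually (\<lambda>a. psnd (g a) = psnd (h a) \<longrightarrow> pfst (g a) = pfst (h a)) (germ A \<xi>)"
      unfolding eventually_imp[OF \<xi>] using los_eq[OF \<xi>, of "psnd \<circ> g" "psnd \<circ> h"] los_eq[OF \<xi>, of "pfst \<circ> g" "pfst \<circ> h"] sg sh
      by (simp add: image_comp)
  qed
  have ev_gadd: "eventually (\<lambda>a. \<forall>p\<in>S\<Gamma> a. \<forall>q\<in>S\<Gamma> a. pr N (add G (pfst p) (pfst q)) (add E (psnd p) (psnd q)) \<in> S\<Gamma> a) (germ A \<xi>)"
  proof (rule eventually_ball[OF \<xi> times_small sub(4)], rule eventually_ball[OF \<xi> times_small sub(4)])
    fix g h assume g: "g ` A \<subseteq> pairs (car G) (car E)" "eventually (\<lambda>a. g a \<in> S\<Gamma> a) (germ A \<xi>)"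
      and h: "h ` A \<subseteq> pairs (car G) (car E)" "eventually (\<lambda>a. h a \<in> S\<Gamma> a) (germ A \<xi>)"
    note sg = split[OF g] and sh = split[OF h]
    have 1: "(\<lambda>a. add G ((pfst \<circ> g) a) ((pfst \<circ> h) a)) ` A \<subseteq> car G" using sg sh by (intro vec_add) auto
    have 2: "(\<lambda>a. add E ((psnd \<circ> g) a) ((psnd \<circ> h) a)) ` A \<subseteq> car E"
      using sg sh E by (auto simp: image_subset_iff space_in_universe_def complex_vector_space_def)
    note s = std_small_subset[OF G_small 1] std_small_subset[OF E_small 2]
    have "pr N (star1 N A (\<lambda>a. add G ((pfst \<circ> g) a) ((pfst \<circ> h) a)) \<xi>) (star1 N A (\<lambda>a. add E ((psnd \<circ> g) a) ((psnd \<circ> h) a)) \<xi>) \<in> elts N \<Gamma>"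
    proof -
      have e1: "star1 N A (\<lambda>a. add G ((pfst \<circ> g) a) ((pfst \<circ> h) a)) \<xi> = vadd N G (star1 N A (pfst \<circ> g) \<xi>) (star1 N A (pfst \<circ> h) \<xi>)"
        using sg sh by (intro vadd_star1[OF space \<xi>, symmetric]) auto
      have e2: "star1 N A (\<lambda>a. add E ((psnd \<circ> g) a) ((psnd \<circ> h) a)) \<xi> = vadd N E (star1 N A (psnd \<circ> g) \<xi>) (star1 N A (psnd \<circ> h) \<xi>)"
        using sg sh by (intro vadd_star1[OF E \<xi>, symmetric]) auto
      show ?thesis unfolding e1 e2 \<Gamma>_mem using sg sh \<phi>add Fi(4) by simp
    qed
    then show "eventually (\<lambda>a. pr N (add G (pfst (g a)) (pfst (h a))) (add E (psnd (g a)) (psnd (h a))) \<in> S\<Gamma> a) (germ A \<xi>)"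
      using in\<Gamma>[OF std_small_pr[OF s]] unfolding los_pr[OF \<xi> s] by simp
  qed
  have ev_gscl: "eventually (\<lambda>a. \<forall>z\<in>cset N. \<forall>p\<in>S\<Gamma> a. pr N (scl G (cval N z) (pfst p)) (scl E (cval N z) (psnd p)) \<in> S\<Gamma> a) (germ A \<xi>)"
  proof (rule eventually_ball[OF \<xi> std_small_cset order_refl], rule eventually_ball[OF \<xi> times_small sub(4)])
    fix c g assume g: "g ` A \<subseteq> pairs (car G) (car E)" "eventually (\<lambda>a. g a \<in> S\<Gamma> a) (germ A \<xi>)"
    note sg = split[OF g]
    have 1: "(\<lambda>a. scl G (cval N (c a)) ((pfst \<circ> g) a)) ` A \<subseteq> car G" using sg by (intro vec_scl) auto
    have 2: "(\<lambda>a. scl E (cval N (c a)) ((psnd \<circ> g) a)) ` A \<subseteq> car E"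
      using sg E by (auto simp: image_subset_iff space_in_universe_def complex_vector_space_def)
    note s = std_small_subset[OF G_small 1] std_small_subset[OF E_small 2]
    have "pr N (star1 N A (\<lambda>a. scl G (cval N (c a)) ((pfst \<circ> g) a)) \<xi>) (star1 N A (\<lambda>a. scl E (cval N (c a)) ((psnd \<circ> g) a)) \<xi>) \<in> elts N \<Gamma>"
    proof -
      have e1: "star1 N A (\<lambda>a. scl G (cval N (c a)) ((pfst \<circ> g) a)) \<xi> = vscl N G (hc A \<xi> (\<lambda>a. cval N (c a))) (star1 N A (pfst \<circ> g) \<xi>)"
        using sg by (intro vscl_star1[OF space \<xi>, symmetric]) auto
      have e2: "star1 N A (\<lambda>a. scl E (cval N (c a)) ((psnd \<circ> g) a)) \<xi> = vscl N E (hc A \<xi> (\<lambda>a. cval N (c a))) (star1 N A (psnd \<circ> g) \<xi>)"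
        using sg by (intro vscl_star1[OF E \<xi>, symmetric]) auto
      show ?thesis unfolding e1 e2 \<Gamma>_mem using sg \<phi>scl Fi(5) hc_in[OF \<xi>] by simp
    qed
    then show "eventually (\<lambda>a. pr N (scl G (cval N (c a)) (pfst (g a))) (scl E (cval N (c a)) (psnd (g a))) \<in> S\<Gamma> a) (germ A \<xi>)"
      using in\<Gamma>[OF std_small_pr[OF s]] unfolding los_pr[OF \<xi> s] by simp
  qed
  have ev_BF: "eventually (\<lambda>a. \<forall>b\<in>SB a. b \<in> SF a) (germ A \<xi>)"
  proof (rule eventually_ball[OF \<xi> G_small sub(2)])
    fix g assume g: "g ` A \<subseteq> car G" "eventually (\<lambda>a. g a \<in> SB a) (germ A \<xi>)"
    then show "eventually (\<lambda>a. g a \<in> SF a) (germ A \<xi>)"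
      using inB inF std_small_vec[OF g(1)] Bi(2) by blast
  qed
  have ev_ON: "eventually (\<lambda>a. \<forall>b\<in>SB a. \<forall>c\<in>SB a. ip G b c = (if b = c then 1 else 0)) (germ A \<xi>)"
  proof (rule eventually_ball[OF \<xi> G_small sub(2)], rule eventually_ball[OF \<xi> G_small sub(2)])
    fix g h assume g: "g ` A \<subseteq> car G" "eventually (\<lambda>a. g a \<in> SB a) (germ A \<xi>)"
      and h: "h ` A \<subseteq> car G" "eventually (\<lambda>a. h a \<in> SB a) (germ A \<xi>)"
    have gh: "star1 N A g \<xi> \<in> elts N B" "star1 N A h \<xi> \<in> elts N B" using inB std_small_vec g h by auto
    have e: "hc A \<xi> (\<lambda>a. ip G (g a) (h a)) = cnum N (if star1 N A g \<xi> = star1 N A h \<xi> then 1 else 0)"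
      using Bi(3)[OF gh] vip_star1[OF \<xi> g(1) h(1)] by simp
    show "eventually (\<lambda>a. ip G (g a) (h a) = (if g a = h a then 1 else 0)) (germ A \<xi>)"
    proof (cases "star1 N A g \<xi> = star1 N A h \<xi>")
      case True
      then have "eventually (\<lambda>a. g a = h a) (germ A \<xi>)" using los_eq[OF \<xi> std_small_vec[OF g(1)] std_small_vec[OF h(1)]] by simp
      moreover have "hc A \<xi> (\<lambda>a. ip G (g a) (h a)) = hc A \<xi> (\<lambda>_. 1)" using e True hc_const[OF \<xi>] by simp
      then have "eventually (\<lambda>a. ip G (g a) (h a) = 1) (germ A \<xi>)" using hc_eq[OF \<xi>] by simp
      ultimately show ?thesis by eventually_elim simp
    next
      case False
      then have "eventually (\<lambda>a. \<not> g a = h a) (germ A \<xi>)" using los_eq[OF \<xi> std_small_vec[OF g(1)] std_small_vec[OF h(1)]] by (simp add: eventually_not[OF \<xi>])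
      moreover have "hc A \<xi> (\<lambda>a. ip G (g a) (h a)) = hc A \<xi> (\<lambda>_. 0)" using e False hc_const[OF \<xi>] by simp
      then have "eventually (\<lambda>a. ip G (g a) (h a) = 0) (germ A \<xi>)" using hc_eq[OF \<xi>] by simp
      ultimately show ?thesis by eventually_elim simp
    qed
  qed
  have ev_max: "eventually (\<lambda>a. \<forall>x\<in>SF a. (\<forall>b\<in>SB a. ip G b x = 0) \<longrightarrow> x = zer G) (germ A \<xi>)"
  proof (rule eventually_ball[OF \<xi> G_small sub(1)])
    fix g assume g: "g ` A \<subseteq> car G" "eventually (\<lambda>a. g a \<in> SF a) (germ A \<xi>)"
    have gF: "star1 N A g \<xi> \<in> elts N F" using inF std_small_vec g by auto
    have z: "zer G \<in> standard_universe N" by (rule std_small_mem[OF G_small]) simp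
    show "eventually (\<lambda>a. (\<forall>b\<in>SB a. ip G b (g a) = 0) \<longrightarrow> g a = zer G) (germ A \<xi>)"
      unfolding eventually_imp[OF \<xi>]
    proof
      assume ev: "eventually (\<lambda>a. \<forall>b\<in>SB a. ip G b (g a) = 0) (germ A \<xi>)"
      \<comment> \<open>An arbitrary b in B comes without a family on A. It serves as a second index
        of its own, and on the pair index it is represented by the second projection.\<close>
      have "vip N G b (star1 N A g \<xi>) = cnum N 0" if b: "b \<in> elts N B" for b
      proof -
        have bg: "generic (car G) b" using b Bi(2) Fi(2) G_small by (auto simp: generic_def)
        note \<xi>' = generic_pr[OF \<xi> bg]
        have p2: "psnd ` pairs A (car G) \<subseteq> car G" by (auto simp: pairs_iff)
        have p1: "(\<lambda>p. g (pfst p)) ` pairs A (car G) \<subseteq> car G" using g(1) by (auto simp: pairs_iff)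
        have bs: "b = star1 N (pairs A (car G)) psnd (pr N \<xi> b)" using star1_proj(2)[OF \<xi> bg] by simp
        have B': "elts N B = iset (pairs A (car G)) (pr N \<xi> b) (\<lambda>p. SB (pfst p))"
          unfolding B_eq iset_def using star1_extend[OF \<xi> bg std_small_family[OF G_small sub(2)]] by simp
        have "eventually (\<lambda>p. psnd p \<in> SB (pfst p)) (germ (pairs A (car G)) (pr N \<xi> b))"
          using b unfolding B' using bs in_iset[OF \<xi>' G_small sub(2) std_small_vec[OF p2]] by simp
        moreover have "eventually (\<lambda>p. \<forall>b\<in>SB (pfst p). ip G b (g (pfst p)) = 0) (germ (pairs A (car G)) (pr N \<xi> b))"
          by (rule ev[unfolded germ_extend[OF \<xi> bg]])
        ultimately have "eventually (\<lambda>p. ip G (psnd p) (g (pfst p)) = 0) (germ (pairs A (car G)) (pr N \<xi> b))"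
          by eventually_elim blast
        then have "hc (pairs A (car G)) (pr N \<xi> b) (\<lambda>p. ip G (psnd p) (g (pfst p))) = hc (pairs A (car G)) (pr N \<xi> b) (\<lambda>_. 0)"
          using hc_eq[OF \<xi>'] by blast
        then show ?thesis
          using vip_star1[OF \<xi>' p2 p1] bs star1_extend[OF \<xi> bg std_small_vec[OF g(1)]] hc_const[OF \<xi>'] by simp
      qed
      then have "star1 N A g \<xi> = star1 N A (\<lambda>_. zer G) \<xi>" using Bi(4)[OF gF] star1_const[OF \<xi> z] by simp
      then show "eventually (\<lambda>a. g a = zer G) (germ A \<xi>)"
        using los_eq[OF \<xi> std_small_vec[OF g(1)] std_small_const[OF z]] by simp
    qed
  qed
  \<comment> \<open>The property holds only eventually; restricting the index set to the indices
    that satisfy it makes it hold at each one.\<close>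
  define good where "good a \<longleftrightarrow> subspace_of G (SF a) \<and> finite (SB a) \<and> SB a \<subseteq> SF a \<and> G.orthonormal (SB a) \<and>
      (\<forall>x\<in>SF a. (\<forall>b\<in>SB a. ip G b x = 0) \<longrightarrow> x = zer G)" for a
  have "eventually good (germ A \<xi>)"
    using ev_zer ev_add ev_scl ev_D ev_tot ev_surj ev_inj ev_gadd ev_gscl ev_BF ev_ON ev_max
  proof eventually_elim
    case (elim a)
    have S: "subspace_of G (SF a)"
      unfolding subspace_of_def
    proof (intro conjI ballI allI)
      show "scl G c x \<in> SF a" if "x \<in> SF a" for c x
        using bspec[OF bspec[OF elim(3), of "cnum N c"] that] by (simp add: cset_def)
      show "SF a \<subseteq> car G" by (rule sub(1))
      show "zer G \<in> SF a" by (rule elim(1))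
      show "add G x y \<in> SF a" if "x \<in> SF a" "y \<in> SF a" for x y using elim(2) that by blast
    qed
    have "\<exists>C. finite C \<and> C \<subseteq> SF a \<and> G.orthonormal C \<and> (\<forall>y\<in>SF a. (\<forall>b\<in>C. ip G b y = 0) \<longrightarrow> y = zer G)"
    proof (rule G.findim_maximal_orthonormal[OF S _ elim(4), where R = "\<lambda>x y. pr N x y \<in> S\<Gamma> a"])
      show "complex_vector_space E" using E by (simp add: space_in_universe_def)
      show "\<exists>y\<in>SD a. pr N x y \<in> S\<Gamma> a" if "x \<in> SF a" for x using elim(5) that by blast
      show "\<exists>x\<in>SF a. pr N x y \<in> S\<Gamma> a" if "y \<in> SD a" for y using elim(6) that by blast
      show "x = x'" if "pr N x y \<in> S\<Gamma> a" "pr N x' y \<in> S\<Gamma> a" for x x' y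
        using elim(7) that by fastforce
      show "pr N (add G x x') (add E y y') \<in> S\<Gamma> a" if "pr N x y \<in> S\<Gamma> a" "pr N x' y' \<in> S\<Gamma> a" for x x' y y'
        using elim(8) that by fastforce
      show "pr N (scl G c x) (scl E c y) \<in> S\<Gamma> a" if "pr N x y \<in> S\<Gamma> a" for c x y
        using bspec[OF bspec[OF elim(9), of "cnum N c"] that] by (simp add: cset_def)
    qed
    then obtain C where C: "finite C" "C \<subseteq> SF a" "G.orthonormal C" "\<And>y. y \<in> SF a \<Longrightarrow> \<forall>b\<in>C. ip G b y = 0 \<Longrightarrow> y = zer G"
      by blast
    have on: "G.orthonormal (SB a)" using elim(11) sub(2) by (simp add: G.orthonormal_def)
    have BF: "SB a \<subseteq> SF a" using elim(10) by blast
    show "good a"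
      using G.orthonormal_finite[OF S C on BF] S on BF elim(12) by (simp add: good_def)
  qed
  note ev = this
  have "generic {a \<in> A. good a} \<xi>" by (rule generic_shrink(1)[OF \<xi> ev])
  moreover have "iset {a \<in> A. good a} \<xi> SF = elts N F" "iset {a \<in> A. good a} \<xi> SB = elts N B"
    unfolding F_eq B_eq by (rule iset_shrink[OF \<xi> ev G_small sub(1)], rule iset_shrink[OF \<xi> ev G_small sub(2)])
  ultimately
  show ?thesis
    by (intro exI[of _ "{a \<in> A. good a}"] exI[of _ \<xi>] exI[of _ SF] exI[of _ SB]) (simp add: good_def)
qed

end

section \<open>The compression and its eigenvalues\<close>

text \<open>The sections \<open>SF a\<close> and \<open>SB a\<close> satisfy everything at every
  index except that \<open>SB a\<close> consists of eigenvectors. That statement involves the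
  compression itself, is proved here eventually, and becomes an assumption of the next locale after
  a further restriction of the index set.\<close>

locale compression_base = nonstandard_space N G for N :: "'w universe" and G :: "'w ips" +
  fixes u :: "'w \<Rightarrow> 'w" and F B :: 'w and v \<Lambda> :: "'w \<Rightarrow> 'w"
    and A0 :: "'w set" and \<xi>0 :: 'w and SF SB :: "'w \<Rightarrow> 'w set"
  assumes u_lin: "linear_map G G u"
    and u_sym: "\<And>x y. x \<in> car G \<Longrightarrow> y \<in> car G \<Longrightarrow> ip G (u x) y = ip G x (u y)"
    and star_F: "\<And>g. g \<in> car G \<Longrightarrow> star N g \<in> elts N F"
    and v_def: "v = compression N G F u"
    and eigen: "\<And>b. b \<in> elts N B \<Longrightarrow> \<Lambda> b \<in> hreal N \<and> v b = vscl N G (\<Lambda> b) b"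
    and \<xi>0: "generic A0 \<xi>0"
    and F_eq: "elts N F = iset A0 \<xi>0 SF" and B_eq: "elts N B = iset A0 \<xi>0 SB"
    and SF: "\<And>a. a \<in> A0 \<Longrightarrow> subspace_of G (SF a)"
    and SB: "\<And>a. a \<in> A0 \<Longrightarrow> finite (SB a)" "\<And>a. a \<in> A0 \<Longrightarrow> SB a \<subseteq> SF a" "\<And>a. a \<in> A0 \<Longrightarrow> G.orthonormal (SB a)"
    and SB_max: "\<And>a x. a \<in> A0 \<Longrightarrow> x \<in> SF a \<Longrightarrow> \<forall>b\<in>SB a. ip G b x = 0 \<Longrightarrow> x = zer G"
begin

lemma u_in: "x \<in> car G \<Longrightarrow> u x \<in> car G"
  using u_lin by (auto simp: linear_map_def)

lemma SF_car: "a \<in> A0 \<Longrightarrow> SF a \<subseteq> car G"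
  using SF by (simp add: subspace_of_def)

lemma SB_car: "a \<in> A0 \<Longrightarrow> SB a \<subseteq> car G"
  using SF_car SB by blast

text \<open>New objects require richer indices, but all must refer to the same sections of F and B.
  The projection \<pi> names the base index above which a given index lies.\<close>

definition over :: "'w set \<Rightarrow> 'w \<Rightarrow> ('w \<Rightarrow> 'w) \<Rightarrow> bool" where
  "over A \<xi> \<pi> \<longleftrightarrow> generic A \<xi> \<and> \<pi> ` A \<subseteq> A0 \<and> star1 N A \<pi> \<xi> = \<xi>0"

lemma over_generic: "over A \<xi> \<pi> \<Longrightarrow> generic A \<xi>"
  and over_base: "over A \<xi> \<pi> \<Longrightarrow> a \<in> A \<Longrightarrow> \<pi> a \<in> A0"
  by (auto simp: over_def)

lemma A0_small: "std_small A0" using \<xi>0 by (simp add: generic_def)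

lemma over_id: "over A0 \<xi>0 (\<lambda>a. a)"
  using \<xi>0 star1_id by (simp add: over_def)

lemma over_iset:
  assumes o: "over A \<xi> \<pi>" and C: "std_small C" "\<And>a. a \<in> A0 \<Longrightarrow> S a \<subseteq> C"
  shows "iset A0 \<xi>0 S = iset A \<xi> (\<lambda>a. S (\<pi> a))"
proof -
  have "star1 N A0 (\<lambda>a. the_set N (S a)) (star1 N A \<pi> \<xi>) = star1 N A (\<lambda>a. the_set N (S (\<pi> a))) \<xi>"
    by (rule los_star1[OF over_generic[OF o] _ A0_small std_small_family[OF C]]) (use o in \<open>auto simp: over_def\<close>)
  then show ?thesis using o by (simp add: iset_def over_def)
qed

lemma in_base_iset:
  assumes o: "over A \<xi> \<pi>" and C: "std_small C" "\<And>a. a \<in> A0 \<Longrightarrow> S a \<subseteq> C" and g: "std_small (g ` A)"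
  shows "star1 N A g \<xi> \<in> iset A0 \<xi>0 S \<longleftrightarrow> eventually (\<lambda>a. g a \<in> S (\<pi> a)) (germ A \<xi>)"
proof -
  have e: "iset A0 \<xi>0 S = iset A \<xi> (\<lambda>a. S (\<pi> a))" by (rule over_iset[OF o C])
  show ?thesis
    unfolding e by (rule in_iset[OF over_generic[OF o] C(1) _ g]) (rule C(2), rule over_base[OF o])
qed

lemma in_F:
  "over A \<xi> \<pi> \<Longrightarrow> std_small (g ` A) \<Longrightarrow> star1 N A g \<xi> \<in> elts N F \<longleftrightarrow> eventually (\<lambda>a. g a \<in> SF (\<pi> a)) (germ A \<xi>)"
  unfolding F_eq by (rule in_base_iset[OF _ G_small SF_car])

lemma in_B:
  "over A \<xi> \<pi> \<Longrightarrow> std_small (g ` A) \<Longrightarrow> star1 N A g \<xi> \<in> elts N B \<longleftrightarrow> eventually (\<lambda>a. g a \<in> SB (\<pi> a)) (germ A \<xi>)"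
  unfolding B_eq by (rule in_base_iset[OF _ G_small SB_car])

lemma F_sub: "elts N F \<subseteq> star_set N (car G)"
  unfolding F_eq by (rule iset_sub[OF \<xi>0 G_small SF_car])

lemma internal_F: "x \<in> elts N F \<Longrightarrow> internal N x"
  using F_sub G_small internal_iff by (auto simp: generic_def)

lemma over_shrink:
  assumes "over A \<xi> \<pi>" "eventually P (germ A \<xi>)" shows "over {a \<in> A. P a} \<xi> \<pi>"
proof -
  have "std_small (\<pi> ` A)" using A0_small by (rule std_small_subset) (use assms in \<open>auto simp: over_def\<close>)
  then show ?thesis
    using assms generic_shrink[OF over_generic[OF assms(1)] assms(2)] by (auto simp: over_def)
qed

text \<open>\<xi>0 is represented as one more object; the function that represents it is the
  projection, corrected by discarding the indices at which it leaves \<open>A0\<close>.\<close>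

lemma represent_over:
  assumes "\<And>i. i < n \<Longrightarrow> internal N (x i)"
  shows "\<exists>A \<xi> \<pi> f. over A \<xi> \<pi> \<and> (\<forall>i<(n::nat). std_small (f i ` A) \<and> star1 N A (f i) \<xi> = x i)"
proof -
  define y where "y i = (if i < n then x i else \<xi>0)" for i
  have "internal N (y i)" for i using assms \<xi>0 internal_iff by (auto simp: y_def)
  from internal_represent[of "Suc n" y, OF this] obtain A \<xi> f where g: "generic A \<xi>"
    and f: "\<And>i. i < Suc n \<Longrightarrow> std_small (f i ` A)" "\<And>i. i < Suc n \<Longrightarrow> star1 N A (f i) \<xi> = y i" by metis
  have n: "std_small (f n ` A)" "star1 N A (f n) \<xi> = \<xi>0" using f[of n] by (auto simp: y_def)
  have ev: "eventually (\<lambda>a. f n a \<in> A0) (germ A \<xi>)"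
    using los_in[OF g n(1) A0_small] n(2) \<xi>0 by (simp add: generic_def)
  define A' where "A' = {a \<in> A. f n a \<in> A0}"
  have s: "star1 N A' (f i) \<xi> = y i" if "i < Suc n" for i
    unfolding A'_def using generic_shrink(2)[OF g ev f(1)[OF that]] f(2)[OF that] by simp
  have "over A' \<xi> (f n)"
    using generic_shrink(1)[OF g ev] s[of n] by (auto simp: over_def A'_def y_def)
  moreover have "std_small (f i ` A') \<and> star1 N A' (f i) \<xi> = x i" if "i < n" for i
    using s[of i] std_small_subset[OF f(1)[of i], of "f i ` A'"] that by (auto simp: y_def A'_def)
  ultimately show ?thesis by blast
qed

lemma represent_vectors:
  assumes "\<And>i. i < n \<Longrightarrow> x i \<in> elts N F"
  shows "\<exists>A \<xi> \<pi> X. over A \<xi> \<pi> \<and> (\<forall>i<(n::nat). (\<forall>a\<in>A. X i a \<in> SF (\<pi> a)) \<and> star1 N A (X i) \<xi> = x i)"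
proof -
  obtain A \<xi> \<pi> f where o: "over A \<xi> \<pi>"
    and f: "\<And>i. i < n \<Longrightarrow> std_small (f i ` A)" "\<And>i. i < n \<Longrightarrow> star1 N A (f i) \<xi> = x i"
    using represent_over[of n x] internal_F assms by metis
  have "eventually (\<lambda>a. f i a \<in> SF (\<pi> a)) (germ A \<xi>)" if "i < n" for i
    using in_F[OF o f(1)[OF that]] f(2)[OF that] assms[OF that] by simp
  then have ev: "eventually (\<lambda>a. \<forall>i\<in>{..<n}. f i a \<in> SF (\<pi> a)) (germ A \<xi>)"
    by (intro eventually_ball_finite) auto
  have "star1 N {a \<in> A. \<forall>i\<in>{..<n}. f i a \<in> SF (\<pi> a)} (f i) \<xi> = x i" if "i < n" for i
    using generic_shrink(2)[OF over_generic[OF o] ev f(1)[OF that]] f(2)[OF that] by simp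
  then show ?thesis using over_shrink[OF o ev]
    by (intro exI[of _ "{a \<in> A. \<forall>i\<in>{..<n}. f i a \<in> SF (\<pi> a)}"] exI[of _ \<xi>] exI[of _ \<pi>] exI[of _ f]) auto
qed

lemma represent3:
  assumes "x \<in> elts N F" "y \<in> elts N F" "z \<in> elts N F"
  obtains A \<xi> \<pi> X Y Z where "over A \<xi> \<pi>" "\<forall>a\<in>A. X a \<in> SF (\<pi> a)" "\<forall>a\<in>A. Y a \<in> SF (\<pi> a)"
    "\<forall>a\<in>A. Z a \<in> SF (\<pi> a)" "star1 N A X \<xi> = x" "star1 N A Y \<xi> = y" "star1 N A Z \<xi> = z"
proof -
  have "[x, y, z] ! i \<in> elts N F" if "i < 3" for i
    using that assms by (auto simp: numeral_3_eq_3 less_Suc_eq)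
  from represent_vectors[of 3 "(!) [x, y, z]", OF this] obtain A \<xi> \<pi> f where o: "over A \<xi> \<pi>"
    and f: "\<forall>i<3. (\<forall>a\<in>A. f i a \<in> SF (\<pi> a)) \<and> star1 N A (f i) \<xi> = [x, y, z] ! i" by blast
  show thesis
    by (rule that[OF o, of "f 0" "f 1" "f 2"]) (use f in \<open>auto simp: numeral_3_eq_3 numeral_2_eq_2\<close>)
qed

lemma family_car: "over A \<xi> \<pi> \<Longrightarrow> \<forall>a\<in>A. X a \<in> SF (\<pi> a) \<Longrightarrow> X ` A \<subseteq> car G"
  using over_base SF_car by blast

lemma family_F:
  assumes "over A \<xi> \<pi>" "\<forall>a\<in>A. X a \<in> SF (\<pi> a)" shows "star1 N A X \<xi> \<in> elts N F"
  using in_F[OF assms(1) std_small_vec[OF family_car[OF assms]]] eventually_in[OF over_generic[OF assms(1)]] assms(2)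
  by (auto elim: eventually_mono)

text \<open>The internal map with sections \<open>h a\<close>: the enlargement of h with its first
  argument frozen at \<xi>0. Its value does not depend on the index chosen to represent x.\<close>

definition lift :: "('w \<Rightarrow> 'w \<Rightarrow> 'w) \<Rightarrow> 'w \<Rightarrow> 'w" where
  "lift h x = star2 N A0 (car G) h \<xi>0 x"

lemma lift_star1:
  assumes o: "over A \<xi> \<pi>" and X: "X ` A \<subseteq> car G" and R: "std_small R"
    and h: "\<And>a x. a \<in> A0 \<Longrightarrow> x \<in> car G \<Longrightarrow> h a x \<in> R"
  shows "lift h (star1 N A X \<xi>) = star1 N A (\<lambda>a. h (\<pi> a) (X a)) \<xi>"
proof -
  have "\<pi> ` A \<subseteq> A0" using o by (simp add: over_def)
  from los_star2[OF over_generic[OF o] this A0_small X G_small, of h, OF h R]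
  show ?thesis using o by (simp add: lift_def over_def)
qed

lemma SB_lincomb: "a \<in> A0 \<Longrightarrow> G.lincomb (SB a) c \<in> car G" "a \<in> A0 \<Longrightarrow> G.lincomb (SB a) c \<in> SF a"
  using G.lincomb(1)[OF SB(1) SB_car] G.lincomb_subspace[OF SB(1,2) SF] by auto

lemma SB_coeff: "a \<in> A0 \<Longrightarrow> b \<in> SB a \<Longrightarrow> ip G b (G.lincomb (SB a) c) = c b"
  by (rule G.ip_lincomb_basis[OF SB(3,1)])

lemma SF_expansion:
  assumes "a \<in> A0" "x \<in> SF a" shows "G.lincomb (SB a) (\<lambda>b. ip G b x) = x"
  by (rule G.orthonormal_expansion[OF SF SB SB_max]) (use assms in auto)

lemma SF_eqI:
  assumes "a \<in> A0" "x \<in> SF a" "y \<in> SF a" "\<And>b. b \<in> SB a \<Longrightarrow> ip G b x = ip G b y" shows "x = y"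
proof -
  have c: "x \<in> car G" "y \<in> car G" using SF_car assms by auto
  have "sub G x y \<in> SF a" using SF[OF assms(1)] assms by (simp add: sub_def subspace_of_def)
  moreover have "\<forall>b\<in>SB a. ip G b (sub G x y) = 0"
  proof
    fix b assume b: "b \<in> SB a"
    then have "b \<in> car G" using SB_car assms(1) by auto
    then show "ip G b (sub G x y) = 0" using assms(4)[OF b] c by simp
  qed
  ultimately have "sub G x y = zer G" by (rule SB_max[OF assms(1)])
  then show ?thesis using G.sub_eq_zer c by blast
qed

lemma parseval:
  assumes "a \<in> A0" "x \<in> car G" "y \<in> SF a"
  shows "ip G x y = (\<Sum>b\<in>SB a. ip G b y * cnj (ip G b x))"
proof -
  have "ip G x y = (\<Sum>b\<in>SB a. ip G b y * ip G x b)"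
    using G.lincomb(2)[OF SB(1) SB_car, OF assms(1) assms(1,2), of "\<lambda>b. ip G b y"] SF_expansion[OF assms(1,3)] by simp
  also have "\<dots> = (\<Sum>b\<in>SB a. ip G b y * cnj (ip G b x))"
  proof (rule sum.cong)
    fix b assume "b \<in> SB a"
    then have "b \<in> car G" using SB_car assms(1) by auto
    then show "ip G b y * ip G x b = ip G b y * cnj (ip G b x)" using G.ip_cnj[OF _ assms(2)] by simp
  qed simp
  finally show ?thesis .
qed

definition compr :: "'w \<Rightarrow> 'w \<Rightarrow> 'w" where
  "compr a x = G.lincomb (SB a) (\<lambda>b. ip G b (u x))"

lemma compr_in: "a \<in> A0 \<Longrightarrow> compr a x \<in> car G" "a \<in> A0 \<Longrightarrow> compr a x \<in> SF a"
  using SB_lincomb by (auto simp: compr_def)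

lemma ip_compr:
  assumes a: "a \<in> A0" and z: "z \<in> SF a" and x: "x \<in> car G"
  shows "ip G z (compr a x) = ip G z (u x)"
proof -
  have zc: "z \<in> car G" using z SF_car a by auto
  have "ip G z (compr a x) = (\<Sum>b\<in>SB a. ip G b (u x) * cnj (ip G b z))"
    using parseval[OF a zc compr_in(2)[OF a, of x]] SB_coeff[OF a] by (simp add: compr_def)
  also have "\<dots> = cnj (\<Sum>b\<in>SB a. ip G b z * cnj (ip G b (u x)))" by (simp add: mult.commute)
  also have "\<dots> = cnj (ip G (u x) z)" using parseval[OF a u_in[OF x] z] by simp
  also have "\<dots> = ip G z (u x)" using G.ip_cnj[OF u_in[OF x] zc] by simp
  finally show ?thesis .
qed

lemma u_star1:
  assumes "generic A \<xi>" "X ` A \<subseteq> car G" shows "star1 N (car G) u (star1 N A X \<xi>) = star1 N A (\<lambda>a. u (X a)) \<xi>"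
  by (rule los_star1[OF assms G_small]) (rule std_small_vec, use u_in in auto)

text \<open>v is defined by a description, so the lift of the sectional compressions has to satisfy
  the orthogonality condition and be the only such vector. Both are checked on families of the
  finite-dimensional sections.\<close>

lemma v_eq:
  assumes x: "x \<in> elts N F" shows "v x = lift compr x"
  unfolding v_def compression_def
proof (rule the_equality)
  have lc: "lift compr (star1 N A X \<xi>) = star1 N A (\<lambda>a. compr (\<pi> a) (X a)) \<xi>"
    if "over A \<xi> \<pi>" "\<forall>a\<in>A. X a \<in> SF (\<pi> a)" for A \<xi> \<pi> X
    by (rule lift_star1[OF that(1) family_car[OF that] G_small compr_in(1)])
  have fc: "\<forall>a\<in>A. compr (\<pi> a) (X a) \<in> SF (\<pi> a)" if "over A \<xi> \<pi>" for A \<xi> \<pi> X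
    using compr_in(2) over_base[OF that] by blast
  have zip: "vip N G (star1 N A Z \<xi>) (vsub N G (star1 N (car G) u (star1 N A X \<xi>)) (star1 N A Y \<xi>)) = cnum N 0 \<longleftrightarrow>
     eventually (\<lambda>a. ip G (Z a) (sub G (u (X a)) (Y a)) = 0) (germ A \<xi>)"
    if "generic A \<xi>" "X ` A \<subseteq> car G" "Y ` A \<subseteq> car G" "Z ` A \<subseteq> car G" for A \<xi> X Y Z
  proof -
    have uX: "(\<lambda>a. u (X a)) ` A \<subseteq> car G" using that(2) u_in by auto
    have s: "(\<lambda>a. sub G (u (X a)) (Y a)) ` A \<subseteq> car G" using uX that(3) by (auto simp: image_subset_iff)
    have "vip N G (star1 N A Z \<xi>) (vsub N G (star1 N (car G) u (star1 N A X \<xi>)) (star1 N A Y \<xi>)) =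
      hc A \<xi> (\<lambda>a. ip G (Z a) (sub G (u (X a)) (Y a)))"
      unfolding u_star1[OF that(1,2)] vsub_star1[OF that(1) uX that(3)] vip_star1[OF that(1,4) s] ..
    moreover have "hc A \<xi> (\<lambda>_. 0) = cnum N 0" by (rule hc_const[OF that(1)])
    ultimately show ?thesis using hc_eq[OF that(1), of _ "\<lambda>_. 0"] by simp
  qed
  show "lift compr x \<in> elts N F \<and> (\<forall>z\<in>elts N F. vip N G z (vsub N G (star1 N (car G) u x) (lift compr x)) = cnum N 0)"
  proof (intro conjI ballI)
    fix z assume z: "z \<in> elts N F"
    obtain A \<xi> \<pi> X Z Z' where o: "over A \<xi> \<pi>" and X: "\<forall>a\<in>A. X a \<in> SF (\<pi> a)" "\<forall>a\<in>A. Z a \<in> SF (\<pi> a)"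
      "star1 N A X \<xi> = x" "star1 N A Z \<xi> = z" using represent3[OF x z z] by metis
    have w: "lift compr x = star1 N A (\<lambda>a. compr (\<pi> a) (X a)) \<xi>" using lc[OF o X(1)] X(3) by simp
    have "eventually (\<lambda>a. ip G (Z a) (sub G (u (X a)) (compr (\<pi> a) (X a))) = 0) (germ A \<xi>)"
      using eventually_in[OF over_generic[OF o]]
    proof (rule eventually_mono)
      fix a assume a: "a \<in> A"
      note p = over_base[OF o a]
      have c: "X a \<in> car G" "Z a \<in> car G" using X(1,2) a SF_car[OF p] by auto
      show "ip G (Z a) (sub G (u (X a)) (compr (\<pi> a) (X a))) = 0"
        using ip_compr[OF p bspec[OF X(2) a] c(1)] c u_in compr_in(1)[OF p] by simp
    qed
    then show "vip N G z (vsub N G (star1 N (car G) u x) (lift compr x)) = cnum N 0"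
      using zip[OF over_generic[OF o] family_car[OF o X(1)] family_car[OF o fc[OF o]] family_car[OF o X(2)]]
      by (simp add: X(3,4) w)
  next
    obtain A \<xi> \<pi> X Z Z' where o: "over A \<xi> \<pi>" and X: "\<forall>a\<in>A. X a \<in> SF (\<pi> a)" "star1 N A X \<xi> = x"
      using represent3[OF x x x] by metis
    have "lift compr x = star1 N A (\<lambda>a. compr (\<pi> a) (X a)) \<xi>" using lc[OF o X(1)] X(2) by simp
    then show "lift compr x \<in> elts N F" using family_F[OF o fc[OF o]] by simp
  qed
  fix y assume y: "y \<in> elts N F \<and> (\<forall>z\<in>elts N F. vip N G z (vsub N G (star1 N (car G) u x) y) = cnum N 0)"
  obtain A \<xi> \<pi> X Y Z' where o: "over A \<xi> \<pi>" and X: "\<forall>a\<in>A. X a \<in> SF (\<pi> a)" "\<forall>a\<in>A. Y a \<in> SF (\<pi> a)"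
      "star1 N A X \<xi> = x" "star1 N A Y \<xi> = y" using represent3[OF x conjunct1[OF y] x] by metis
  have w: "lift compr x = star1 N A (\<lambda>a. compr (\<pi> a) (X a)) \<xi>" using lc[OF o X(1)] X(3) by simp
  \<comment> \<open>The difference of the two candidates lies in F and is used as test vector
    against itself, so its norm is 0 at almost all indices.\<close>
  define Z where "Z a = sub G (compr (\<pi> a) (X a)) (Y a)" for a
  have Z: "\<forall>a\<in>A. Z a \<in> SF (\<pi> a)"
    using fc[OF o] X(2) SF[OF over_base[OF o]] by (auto simp: Z_def sub_def subspace_of_def)
  have "eventually (\<lambda>a. ip G (Z a) (sub G (u (X a)) (Y a)) = 0) (germ A \<xi>)"
    using zip[OF over_generic[OF o] family_car[OF o X(1)] family_car[OF o X(2)] family_car[OF o Z]]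
      y family_F[OF o Z] by (simp add: X(3,4))
  then have "eventually (\<lambda>a. Y a = compr (\<pi> a) (X a)) (germ A \<xi>)"
    using eventually_in[OF over_generic[OF o]]
  proof eventually_elim
    case (elim a)
    note p = over_base[OF o elim(2)]
    have c: "X a \<in> car G" "Y a \<in> car G" "Z a \<in> car G" using X(1,2) Z elim(2) SF_car[OF p] by auto
    have "ip G (Z a) (u (X a)) = ip G (Z a) (compr (\<pi> a) (X a))"
      using ip_compr[OF p bspec[OF Z elim(2)] c(1)] by simp
    then have "ip G (Z a) (sub G (compr (\<pi> a) (X a)) (Y a)) = 0" using elim(1) c u_in compr_in(1)[OF p] by simp
    then have "ip G (Z a) (Z a) = 0" by (simp add: Z_def)
    then have "nrm G (Z a) = 0" by (simp add: nrm_def)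
    then show "Y a = compr (\<pi> a) (X a)" using G.nrm_sub_eq_0[OF compr_in(1)[OF p] c(2), of "X a"] unfolding Z_def by simp
  qed
  then show "y = lift compr x"
    unfolding w X(4)[symmetric]
    by (subst los_eq[OF over_generic[OF o] std_small_vec[OF family_car[OF o X(2)]] std_small_vec[OF family_car[OF o fc[OF o]]]])
qed

text \<open>For a family g of basis vectors with class b, the number \<open>\<Lambda> b\<close> is
  internal and real but has no family on \<open>A0\<close>; it is adjoined as a second index. Only
  the existence of a real eigenvalue is kept, a statement on \<open>A0\<close> alone, and
  \<open>germ_extend\<close> brings it back there.\<close>

lemma eventually_eigen:
  "eventually (\<lambda>a. \<forall>b\<in>SB a. \<exists>r. compr a b = scl G (complex_of_real r) b) (germ A0 \<xi>0)"
proof (rule eventually_ball[OF \<xi>0 G_small SB_car])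
  fix g assume g: "g ` A0 \<subseteq> car G" "eventually (\<lambda>a. g a \<in> SB a) (germ A0 \<xi>0)"
  define b where "b = star1 N A0 g \<xi>0"
  have bB: "b \<in> elts N B" using in_B[OF over_id std_small_vec[OF g(1)]] g(2) by (simp add: b_def)
  have "eventually (\<lambda>a. g a \<in> SF a) (germ A0 \<xi>0)"
    using g(2) eventually_in[OF \<xi>0] by eventually_elim (use SB(2) in blast)
  then have bF: "b \<in> elts N F" using in_F[OF over_id std_small_vec[OF g(1)]] by (simp add: b_def)
  have R: "std_small (cnum N ` \<real>)" by (rule std_small_cnum)
  have L: "\<Lambda> b \<in> star_set N (cnum N ` \<real>)" "v b = vscl N G (\<Lambda> b) b" using eigen[OF bB] by (auto simp: hreal_def)
  have gL: "generic (cnum N ` \<real>) (\<Lambda> b)" using L(1) R by (simp add: generic_def)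
  define A where "A = pairs A0 (cnum N ` \<real>)"
  define \<xi> where "\<xi> = pr N \<xi>0 (\<Lambda> b)"
  have \<xi>: "generic A \<xi>" unfolding A_def \<xi>_def by (rule generic_pr[OF \<xi>0 gL])
  have gp: "(\<lambda>p. g (pfst p)) ` A \<subseteq> car G" using g(1) by (auto simp: A_def pairs_iff)
  have cp: "(\<lambda>p. compr (pfst p) (g (pfst p))) ` A \<subseteq> car G" using compr_in(1) by (auto simp: A_def pairs_iff)
  have b': "b = star1 N A (\<lambda>p. g (pfst p)) \<xi>"
    using star1_extend[OF \<xi>0 gL std_small_vec[OF g(1)]] by (simp only: b_def[symmetric] A_def \<xi>_def)
  have ps: "std_small (psnd ` A)" using R by (rule std_small_subset) (auto simp: A_def pairs_iff)
  have L': "\<Lambda> b = hc A \<xi> (\<lambda>p. cval N (psnd p))"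
  proof -
    have "\<Lambda> b = star1 N A psnd \<xi>" using star1_proj(2)[OF \<xi>0 gL] by (simp add: A_def \<xi>_def)
    also have "\<dots> = hc A \<xi> (\<lambda>p. cval N (psnd p))"
      unfolding hc_def
      by (subst los_eq[OF \<xi> ps std_small_cnum], rule eventually_mono[OF eventually_in[OF \<xi>]])
         (auto simp: A_def pairs_iff)
    finally show ?thesis .
  qed
  have "v b = star1 N A0 (\<lambda>a. compr a (g a)) \<xi>0"
    unfolding v_eq[OF bF] unfolding b_def by (rule lift_star1[OF over_id g(1) G_small compr_in(1)])
  also have "\<dots> = star1 N A (\<lambda>p. compr (pfst p) (g (pfst p))) \<xi>"
    unfolding A_def \<xi>_def by (rule star1_extend[OF \<xi>0 gL]) (rule std_small_vec, use compr_in(1) in auto)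
  finally have "star1 N A (\<lambda>p. compr (pfst p) (g (pfst p))) \<xi> = star1 N A (\<lambda>p. scl G (cval N (psnd p)) (g (pfst p))) \<xi>"
    using vscl_star1[OF space \<xi> gp] L(2) L' b' by simp
  moreover have "(\<lambda>p. scl G (cval N (psnd p)) (g (pfst p))) ` A \<subseteq> car G" using gp by (auto simp: image_subset_iff)
  ultimately have "eventually (\<lambda>p. compr (pfst p) (g (pfst p)) = scl G (cval N (psnd p)) (g (pfst p))) (germ A \<xi>)"
    using los_eq[OF \<xi> std_small_vec[OF cp] std_small_vec] by blast
  then have "eventually (\<lambda>p. \<exists>r. compr (pfst p) (g (pfst p)) = scl G (complex_of_real r) (g (pfst p))) (germ A \<xi>)"
    using eventually_in[OF \<xi>]
  proof eventually_elim
    case (elim p)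
    then have "psnd p \<in> cnum N ` \<real>" by (auto simp: A_def pairs_iff)
    then obtain r where "cval N (psnd p) = complex_of_real r" by (auto elim: Reals_cases)
    then show ?case using elim(1) by auto
  qed
  then show "eventually (\<lambda>a. \<exists>r. compr a (g a) = scl G (complex_of_real r) (g a)) (germ A0 \<xi>0)"
    unfolding germ_extend[OF \<xi>0 gL] A_def \<xi>_def .
qed

end

locale compression_eigen = compression_base +
  assumes compr_eigen: "\<And>a b. a \<in> A0 \<Longrightarrow> b \<in> SB a \<Longrightarrow> \<exists>r. compr a b = scl G (complex_of_real r) b"
begin

text \<open>The Rayleigh quotient. It depends on b alone, and yet is the eigenvalue of the
  compression at every index whose basis contains b.\<close>

definition lam :: "'a \<Rightarrow> real" where "lam b = Re (ip G b (u b))"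

lemma compr_lam:
  assumes a: "a \<in> A0" and b: "b \<in> SB a" shows "compr a b = scl G (complex_of_real (lam b)) b"
proof -
  obtain r where r: "compr a b = scl G (complex_of_real r) b" using compr_eigen[OF a b] by blast
  have bc: "b \<in> car G" "b \<in> SF a" "ip G b b = 1" using SB_car[OF a] SB(2,3)[OF a] b by (auto simp: G.orthonormal_def)
  have "ip G b (u b) = of_real r" using ip_compr[OF a bc(2,1)] r bc by simp
  then show ?thesis using r by (simp add: lam_def)
qed

text \<open>The function \<phi> of the compression at the index a, by diagonalization. \<phi> may be
  unbounded: \<open>of_real\<close> gives the compression itself.\<close>

definition mu :: "(real \<Rightarrow> complex) \<Rightarrow> 'a \<Rightarrow> 'a \<Rightarrow> 'a" where
  "mu \<phi> a x = G.lincomb (SB a) (\<lambda>b. \<phi> (lam b) * ip G b x)"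

lemma mu_in: "a \<in> A0 \<Longrightarrow> mu \<phi> a x \<in> car G" "a \<in> A0 \<Longrightarrow> mu \<phi> a x \<in> SF a"
  using SB_lincomb by (auto simp: mu_def)

lemma ip_mu: "a \<in> A0 \<Longrightarrow> b \<in> SB a \<Longrightarrow> ip G b (mu \<phi> a x) = \<phi> (lam b) * ip G b x"
  unfolding mu_def by (rule SB_coeff)

lemma compr_eq_mu:
  assumes a: "a \<in> A0" and x: "x \<in> SF a" shows "compr a x = mu of_real a x"
proof (rule SF_eqI[OF a compr_in(2)[OF a] mu_in(2)[OF a]])
  fix b assume b: "b \<in> SB a"
  have c: "b \<in> car G" "b \<in> SF a" "x \<in> car G" using SB_car[OF a] SB(2)[OF a] SF_car[OF a] b x by auto
  have "ip G b (compr a x) = ip G b (u x)" by (rule ip_compr[OF a c(2,3)])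
  also have "\<dots> = ip G (u b) x" using u_sym[OF c(1,3)] by simp
  also have "\<dots> = cnj (ip G x (u b))" by (rule G.ip_cnj[OF c(3) u_in[OF c(1)]])
  also have "ip G x (u b) = ip G x (compr a b)" by (rule ip_compr[OF a x c(1), symmetric])
  also have "\<dots> = of_real (lam b) * ip G x b" using compr_lam[OF a b] c by simp
  also have "cnj (of_real (lam b) * ip G x b) = of_real (lam b) * ip G b x" using G.ip_cnj[OF c(3,1)] by simp
  finally show "ip G b (compr a x) = ip G b (mu of_real a x)" using ip_mu[OF a b] by simp
qed

lemma mu_mult:
  assumes a: "a \<in> A0" shows "mu \<phi> a (mu \<psi> a x) = mu (\<lambda>t. \<phi> t * \<psi> t) a x"
  by (rule SF_eqI[OF a mu_in(2)[OF a] mu_in(2)[OF a]]) (simp add: ip_mu[OF a])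

lemma mu_add_fun:
  assumes a: "a \<in> A0" shows "mu (\<lambda>t. \<phi> t + \<psi> t) a x = add G (mu \<phi> a x) (mu \<psi> a x)"
proof (rule SF_eqI[OF a mu_in(2)[OF a]])
  show "add G (mu \<phi> a x) (mu \<psi> a x) \<in> SF a" using SF[OF a] mu_in(2)[OF a] by (simp add: subspace_of_def)
  fix b assume b: "b \<in> SB a"
  then have "b \<in> car G" using SB_car[OF a] by auto
  then show "ip G b (mu (\<lambda>t. \<phi> t + \<psi> t) a x) = ip G b (add G (mu \<phi> a x) (mu \<psi> a x))"
    using mu_in(1)[OF a] by (simp add: ip_mu[OF a b] algebra_simps)
qed

lemma mu_const:
  assumes a: "a \<in> A0" and x: "x \<in> SF a" shows "mu (\<lambda>_. c) a x = scl G c x"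
proof (rule SF_eqI[OF a mu_in(2)[OF a]])
  show "scl G c x \<in> SF a" using SF[OF a] x by (simp add: subspace_of_def)
  fix b assume b: "b \<in> SB a"
  then have "b \<in> car G" "x \<in> car G" using SB_car[OF a] SF_car[OF a] x by auto
  then show "ip G b (mu (\<lambda>_. c) a x) = ip G b (scl G c x)" by (simp add: ip_mu[OF a b])
qed

lemma mu_sub:
  assumes a: "a \<in> A0" and x: "x \<in> SF a" "y \<in> SF a" shows "mu \<phi> a (sub G x y) = sub G (mu \<phi> a x) (mu \<phi> a y)"
proof (rule SF_eqI[OF a mu_in(2)[OF a]])
  show "sub G (mu \<phi> a x) (mu \<phi> a y) \<in> SF a" using SF[OF a] mu_in(2)[OF a] by (simp add: sub_def subspace_of_def)
  fix b assume b: "b \<in> SB a"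
  then have "b \<in> car G" "x \<in> car G" "y \<in> car G" using SB_car[OF a] SF_car[OF a] x by auto
  then show "ip G b (mu \<phi> a (sub G x y)) = ip G b (sub G (mu \<phi> a x) (mu \<phi> a y))"
    using mu_in(1)[OF a] by (simp add: ip_mu[OF a b] algebra_simps)
qed

lemma mu_adj:
  assumes a: "a \<in> A0" and x: "x \<in> SF a" "y \<in> SF a"
  shows "ip G x (mu \<phi> a y) = ip G (mu (\<lambda>t. cnj (\<phi> t)) a x) y"
proof -
  have xc: "x \<in> car G" using SF_car[OF a] x by auto
  show ?thesis
    unfolding parseval[OF a xc mu_in(2)[OF a]] parseval[OF a mu_in(1)[OF a] x(2)]
    by (rule sum.cong) (simp_all add: ip_mu[OF a])
qed

lemma mu_bound:
  assumes a: "a \<in> A0" and x: "x \<in> SF a" and C: "\<And>t. cmod (\<phi> t) \<le> C"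
  shows "nrm G (mu \<phi> a x) \<le> C * nrm G x"
proof -
  have xc: "x \<in> car G" using SF_car[OF a] x by auto
  have C0: "0 \<le> C" using C[of 0] norm_ge_zero order_trans by blast
  have sq: "(nrm G y)\<^sup>2 = (\<Sum>b\<in>SB a. (cmod (ip G b y))\<^sup>2)" if y: "y \<in> SF a" for y
  proof -
    have yc: "y \<in> car G" using SF_car[OF a] y by auto
    have "complex_of_real ((nrm G y)\<^sup>2) = of_real (\<Sum>b\<in>SB a. (cmod (ip G b y))\<^sup>2)"
      using parseval[OF a yc y] G.ip_self[OF yc] by (simp only: complex_norm_square of_real_sum)
    then show ?thesis by (simp only: of_real_eq_iff)
  qed
  have "(nrm G (mu \<phi> a x))\<^sup>2 \<le> (C * nrm G x)\<^sup>2"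
    unfolding power_mult_distrib sq[OF mu_in(2)[OF a]] sq[OF x] sum_distrib_left
    by (rule sum_mono) (auto simp: ip_mu[OF a] norm_mult power_mult_distrib intro!: mult_right_mono power_mono C)
  then show ?thesis by (rule power2_le_imp_le) (use C0 xc in simp)
qed

lemma ip_mu_indicator:
  assumes a: "a \<in> A0" and x: "x \<in> SF a"
  shows "ip G x (mu (\<lambda>t. of_bool (t \<in> S)) a x) = of_real (\<Sum>b\<in>{b \<in> SB a. lam b \<in> S}. (cmod (ip G b x))\<^sup>2)"
proof -
  have xc: "x \<in> car G" using SF_car[OF a] x by auto
  have "ip G x (mu (\<lambda>t. of_bool (t \<in> S)) a x) = (\<Sum>b\<in>SB a. of_bool (lam b \<in> S) * (ip G b x * cnj (ip G b x)))"
    unfolding parseval[OF a xc mu_in(2)[OF a]] by (rule sum.cong) (simp_all add: ip_mu[OF a])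
  also have "\<dots> = (\<Sum>b\<in>SB a. if lam b \<in> S then of_real ((cmod (ip G b x))\<^sup>2) else 0)"
    by (rule sum.cong) (simp_all only: complex_norm_square, auto)
  also have "\<dots> = of_real (\<Sum>b\<in>{b \<in> SB a. lam b \<in> S}. (cmod (ip G b x))\<^sup>2)"
    by (simp only: of_real_sum sum.inter_filter[OF SB(1)[OF a]]) (rule sum.cong, auto)
  finally show ?thesis .
qed

definition mult :: "(real \<Rightarrow> complex) \<Rightarrow> 'a \<Rightarrow> 'a" where
  "mult \<phi> x = lift (mu \<phi>) x"

lemma mult_star1:
  assumes "over A \<xi> \<pi>" "\<forall>a\<in>A. X a \<in> SF (\<pi> a)"
  shows "mult \<phi> (star1 N A X \<xi>) = star1 N A (\<lambda>a. mu \<phi> (\<pi> a) (X a)) \<xi>"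
  unfolding mult_def by (rule lift_star1[OF assms(1) family_car[OF assms] G_small mu_in(1)])

lemma family_mu: "over A \<xi> \<pi> \<Longrightarrow> \<forall>a\<in>A. mu \<phi> (\<pi> a) (X a) \<in> SF (\<pi> a)"
  using mu_in(2) over_base by blast

lemma v_star1:
  assumes o: "over A \<xi> \<pi>" and X: "\<forall>a\<in>A. X a \<in> SF (\<pi> a)"
  shows "v (star1 N A X \<xi>) = star1 N A (\<lambda>a. mu of_real (\<pi> a) (X a)) \<xi>"
proof -
  have c: "(\<lambda>a. compr (\<pi> a) (X a)) ` A \<subseteq> car G" using compr_in(1) over_base[OF o] by blast
  have "v (star1 N A X \<xi>) = star1 N A (\<lambda>a. compr (\<pi> a) (X a)) \<xi>"
    unfolding v_eq[OF family_F[OF o X]] by (rule lift_star1[OF o family_car[OF o X] G_small compr_in(1)])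
  also have "\<dots> = star1 N A (\<lambda>a. mu of_real (\<pi> a) (X a)) \<xi>"
    by (subst los_eq[OF over_generic[OF o] std_small_vec[OF c] std_small_vec[OF family_car[OF o family_mu[OF o]]]],
        rule eventually_mono[OF eventually_in[OF over_generic[OF o]]])
       (use compr_eq_mu over_base[OF o] X in blast)
  finally show ?thesis .
qed

end

section \<open>The hull\<close>

context compression_eigen begin

abbreviation eF :: "'a set ips" where "eF \<equiv> hilbert_hull N G F"

abbreviation Bd :: "'a set" where "Bd \<equiv> bounded_elts N G F"

definition near :: "'a \<Rightarrow> 'a \<Rightarrow> bool" where
  "near x y \<longleftrightarrow> infinitesimal N (vnorm N G (vsub N G x y))"

text \<open>A bounded element of F is represented by a family with a bound at every index, not just
  eventually; shrinking the index set achieves this. Such families are closed under the vector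
  operations and under bounded functions of the compression.\<close>

definition bfam :: "'a set \<Rightarrow> 'a \<Rightarrow> ('a \<Rightarrow> 'a) \<Rightarrow> ('a \<Rightarrow> 'a) \<Rightarrow> bool" where
  "bfam A \<xi> \<pi> X \<longleftrightarrow> over A \<xi> \<pi> \<and> (\<forall>a\<in>A. X a \<in> SF (\<pi> a)) \<and> (\<exists>C. \<forall>a\<in>A. nrm G (X a) \<le> C)"

definition Sh :: "'a set \<Rightarrow> 'a \<Rightarrow> ('a \<Rightarrow> 'a) \<Rightarrow> 'a set" where
  "Sh A \<xi> X = shadow N G F (star1 N A X \<xi>)"

lemma bfam_over: "bfam A \<xi> \<pi> X \<Longrightarrow> over A \<xi> \<pi>"
  and bfam_SF: "bfam A \<xi> \<pi> X \<Longrightarrow> \<forall>a\<in>A. X a \<in> SF (\<pi> a)"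
  by (auto simp: bfam_def)

lemma bfam_generic: "bfam A \<xi> \<pi> X \<Longrightarrow> generic A \<xi>"
  using bfam_over over_generic by blast

lemma bfam_car: "bfam A \<xi> \<pi> X \<Longrightarrow> a \<in> A \<Longrightarrow> X a \<in> car G"
  using family_car[OF bfam_over bfam_SF] by blast

lemma bfam_img: "bfam A \<xi> \<pi> X \<Longrightarrow> X ` A \<subseteq> car G"
  using bfam_car by blast

lemma star1_cong:
  assumes "generic A \<xi>" "X ` A \<subseteq> car G" "Y ` A \<subseteq> car G" "\<And>a. a \<in> A \<Longrightarrow> X a = Y a"
  shows "star1 N A X \<xi> = star1 N A Y \<xi>"
  by (subst los_eq[OF assms(1) std_small_vec[OF assms(2)] std_small_vec[OF assms(3)]])
     (rule eventually_mono[OF eventually_in[OF assms(1)] assms(4)])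

lemma Bd_star1:
  assumes o: "over A \<xi> \<pi>" and X: "\<forall>a\<in>A. X a \<in> SF (\<pi> a)"
  shows "star1 N A X \<xi> \<in> Bd \<longleftrightarrow> (\<exists>C. eventually (\<lambda>a. nrm G (X a) \<le> C) (germ A \<xi>))"
proof -
  have nn: "cmod (of_real (nrm G (X a))) = nrm G (X a)" if "a \<in> A" for a
    using family_car[OF o X] that by (auto simp: image_subset_iff)
  have "eventually (\<lambda>a. cmod (of_real (nrm G (X a))) \<le> C \<longleftrightarrow> nrm G (X a) \<le> C) (germ A \<xi>)" for C
    by (rule eventually_mono[OF eventually_in[OF over_generic[OF o]]]) (simp only: nn)
  then have "eventually (\<lambda>a. cmod (of_real (nrm G (X a))) \<le> C) (germ A \<xi>) \<longleftrightarrow> eventually (\<lambda>a. nrm G (X a) \<le> C) (germ A \<xi>)" for C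
    by (rule eventually_subst)
  then show ?thesis
    using family_F[OF o X]
    by (simp add: bounded_elts_def vnorm_star1[OF over_generic[OF o] family_car[OF o X]] limited_hc[OF over_generic[OF o]])
qed

lemma bfam_Bd: assumes "bfam A \<xi> \<pi> X" shows "star1 N A X \<xi> \<in> Bd"
proof -
  obtain C where C: "\<forall>a\<in>A. nrm G (X a) \<le> C" using assms by (auto simp: bfam_def)
  have "eventually (\<lambda>a. nrm G (X a) \<le> C) (germ A \<xi>)"
    by (rule eventually_mono[OF eventually_in[OF bfam_generic[OF assms]]]) (use C in blast)
  then show ?thesis using Bd_star1[OF bfam_over[OF assms] bfam_SF[OF assms]] by blast
qed

lemma Bd_F: "x \<in> Bd \<Longrightarrow> x \<in> elts N F"
  by (simp add: bounded_elts_def)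

lemma near_star1:
  assumes g: "generic A \<xi>" and X: "X ` A \<subseteq> car G" "Y ` A \<subseteq> car G"
  shows "near (star1 N A X \<xi>) (star1 N A Y \<xi>) \<longleftrightarrow> ((\<lambda>a. nrm G (sub G (X a) (Y a))) \<longlongrightarrow> 0) (germ A \<xi>)"
proof -
  have s: "(\<lambda>a. sub G (X a) (Y a)) ` A \<subseteq> car G" using X by (auto simp: image_subset_iff)
  show ?thesis
    unfolding near_def vsub_star1[OF g X] vnorm_star1[OF g s] infinitesimal_hc[OF g]
    using tendsto_of_real_iff[of "\<lambda>a. nrm G (sub G (X a) (Y a))" 0 "germ A \<xi>", where 'a = complex] by simp
qed

lemma tendsto_null_le:
  assumes g: "generic A \<xi>" and f: "(f \<longlongrightarrow> (0::real)) (germ A \<xi>)" and le: "\<And>a. a \<in> A \<Longrightarrow> norm (h a) \<le> f a"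
  shows "(h \<longlongrightarrow> (0::'c::real_normed_vector)) (germ A \<xi>)"
  by (rule Lim_null_comparison[OF eventually_mono[OF eventually_in[OF g] le] f])

lemma near_refl: assumes "x \<in> elts N F" shows "near x x"
proof -
  obtain A \<xi> \<pi> X where o: "over A \<xi> \<pi>" and X: "\<forall>a\<in>A. X a \<in> SF (\<pi> a)" "star1 N A X \<xi> = x"
    using represent3[OF assms assms assms] by metis
  note c = family_car[OF o X(1)]
  have "((\<lambda>a. nrm G (sub G (X a) (X a))) \<longlongrightarrow> 0) (germ A \<xi>)"
    by (rule tendsto_null_le[OF over_generic[OF o] tendsto_const]) (use c in \<open>auto simp: image_subset_iff\<close>)
  then show ?thesis using near_star1[OF over_generic[OF o] c c] X(2) by simp
qed

text \<open>The Euclidean form of transitivity: together with reflexivity it also yields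
  symmetry.\<close>

lemma near_trans:
  assumes F: "x \<in> elts N F" "y \<in> elts N F" "z \<in> elts N F" and n: "near y x" "near y z"
  shows "near x z"
proof -
  obtain A \<xi> \<pi> X Y Z where o: "over A \<xi> \<pi>" and X: "\<forall>a\<in>A. X a \<in> SF (\<pi> a)" "\<forall>a\<in>A. Y a \<in> SF (\<pi> a)" "\<forall>a\<in>A. Z a \<in> SF (\<pi> a)"
    "star1 N A X \<xi> = x" "star1 N A Y \<xi> = y" "star1 N A Z \<xi> = z" using represent3[OF F] by metis
  note c = family_car[OF o X(1)] family_car[OF o X(2)] family_car[OF o X(3)] and g = over_generic[OF o]
  have l: "((\<lambda>a. nrm G (sub G (Y a) (X a)) + nrm G (sub G (Y a) (Z a))) \<longlongrightarrow> 0) (germ A \<xi>)"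
    using n near_star1[OF g c(2,1)] near_star1[OF g c(2,3)] X(4-6) tendsto_add[of _ 0 _ _ 0] by fastforce
  have "((\<lambda>a. nrm G (sub G (X a) (Z a))) \<longlongrightarrow> 0) (germ A \<xi>)"
  proof (rule tendsto_null_le[OF g l])
    fix a assume "a \<in> A"
    then have m: "X a \<in> car G" "Y a \<in> car G" "Z a \<in> car G" using c by auto
    show "norm (nrm G (sub G (X a) (Z a))) \<le> nrm G (sub G (Y a) (X a)) + nrm G (sub G (Y a) (Z a))"
      using G.nrm_triangle[OF m] G.nrm_sub_commute[OF m(1,2)] G.nrm_nonneg[OF G.sub_in[OF m(1,3)]] by simp
  qed
  then show ?thesis using near_star1[OF g c(1,3)] X by simp
qed

lemma near_sym: "x \<in> elts N F \<Longrightarrow> y \<in> elts N F \<Longrightarrow> near x y \<Longrightarrow> near y x"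
  using near_trans[of y x x] near_refl by blast

lemma shadow_eq:
  assumes "x \<in> Bd" "y \<in> Bd" shows "shadow N G F x = shadow N G F y \<longleftrightarrow> near x y"
proof
  have s: "shadow N G F z = {w \<in> Bd. near z w}" for z by (simp add: shadow_def near_def)
  note F = Bd_F[OF assms(1)] Bd_F[OF assms(2)]
  show "near x y" if "shadow N G F x = shadow N G F y"
    using that near_refl[OF F(2)] assms(2) unfolding s by blast
  assume n: "near x y"
  have "near x w \<longleftrightarrow> near y w" if "w \<in> Bd" for w
    using near_trans[OF F(2,1) Bd_F[OF that] n] near_trans[OF F Bd_F[OF that] near_sym[OF F n]] by blast
  then show "shadow N G F x = shadow N G F y" unfolding s by blast
qed

lemma rep_shadow:
  assumes "x \<in> Bd"
  shows "rep (shadow N G F x) \<in> Bd" "near x (rep (shadow N G F x))" "near (rep (shadow N G F x)) x"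
proof -
  have "x \<in> shadow N G F x" using assms near_refl[OF Bd_F[OF assms]] by (simp add: shadow_def near_def)
  then have "rep (shadow N G F x) \<in> shadow N G F x" unfolding rep_def by (rule someI)
  then show r: "rep (shadow N G F x) \<in> Bd" "near x (rep (shadow N G F x))" by (simp_all add: shadow_def near_def)
  then show "near (rep (shadow N G F x)) x" using near_sym Bd_F assms by blast
qed

lemma bfam_shrink:
  assumes "over A \<xi> \<pi>" "\<forall>a\<in>A. X a \<in> SF (\<pi> a)" "A' \<subseteq> A" "over A' \<xi> \<pi>" "\<forall>a\<in>A'. nrm G (X a) \<le> C"
  shows "bfam A' \<xi> \<pi> X"
  using assms unfolding bfam_def by blast

lemma represent_Bd3:
  assumes "x \<in> Bd" "y \<in> Bd" "z \<in> Bd"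
  obtains A \<xi> \<pi> X Y Z where "bfam A \<xi> \<pi> X" "bfam A \<xi> \<pi> Y" "bfam A \<xi> \<pi> Z"
    "star1 N A X \<xi> = x" "star1 N A Y \<xi> = y" "star1 N A Z \<xi> = z"
proof -
  obtain A \<xi> \<pi> X Y Z where o: "over A \<xi> \<pi>" and X: "\<forall>a\<in>A. X a \<in> SF (\<pi> a)" "\<forall>a\<in>A. Y a \<in> SF (\<pi> a)" "\<forall>a\<in>A. Z a \<in> SF (\<pi> a)"
    "star1 N A X \<xi> = x" "star1 N A Y \<xi> = y" "star1 N A Z \<xi> = z" using represent3[OF assms[THEN Bd_F]] by metis
  obtain C1 C2 C3 where C: "eventually (\<lambda>a. nrm G (X a) \<le> C1) (germ A \<xi>)" "eventually (\<lambda>a. nrm G (Y a) \<le> C2) (germ A \<xi>)"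
     "eventually (\<lambda>a. nrm G (Z a) \<le> C3) (germ A \<xi>)"
    using assms Bd_star1[OF o X(1)] Bd_star1[OF o X(2)] Bd_star1[OF o X(3)] X(4-6) by auto
  define Q where "Q a \<longleftrightarrow> nrm G (X a) \<le> C1 \<and> nrm G (Y a) \<le> C2 \<and> nrm G (Z a) \<le> C3" for a
  have ev: "eventually Q (germ A \<xi>)" unfolding Q_def using C by (intro eventually_conj)
  note sh = generic_shrink(2)[OF over_generic[OF o] ev std_small_vec[OF family_car[OF o]]]
  have o': "over {a \<in> A. Q a} \<xi> \<pi>" by (rule over_shrink[OF o ev])
  show thesis
  proof (rule that[of "{a \<in> A. Q a}" \<xi> \<pi> X Y Z])
    show "bfam {a \<in> A. Q a} \<xi> \<pi> X" by (rule bfam_shrink[OF o X(1) _ o', of C1]) (auto simp: Q_def)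
    show "bfam {a \<in> A. Q a} \<xi> \<pi> Y" by (rule bfam_shrink[OF o X(2) _ o', of C2]) (auto simp: Q_def)
    show "bfam {a \<in> A. Q a} \<xi> \<pi> Z" by (rule bfam_shrink[OF o X(3) _ o', of C3]) (auto simp: Q_def)
  qed (use sh[OF X(1)] sh[OF X(2)] sh[OF X(3)] X(4-6) in simp_all)
qed

lemma bfam_add: assumes "bfam A \<xi> \<pi> X" "bfam A \<xi> \<pi> Y" shows "bfam A \<xi> \<pi> (\<lambda>a. add G (X a) (Y a))"
proof -
  obtain C D where C: "\<forall>a\<in>A. nrm G (X a) \<le> C" "\<forall>a\<in>A. nrm G (Y a) \<le> D" using assms by (auto simp: bfam_def)
  have "nrm G (add G (X a) (Y a)) \<le> C + D" if "a \<in> A" for a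
    using G.nrm_add_le[OF bfam_car[OF assms(1) that] bfam_car[OF assms(2) that]] C that by force
  moreover have "add G (X a) (Y a) \<in> SF (\<pi> a)" if "a \<in> A" for a
    using assms that SF[OF over_base[OF bfam_over[OF assms(1)] that]] by (simp add: bfam_def subspace_of_def)
  ultimately show ?thesis using assms by (auto simp: bfam_def)
qed

lemma bfam_scl: assumes "bfam A \<xi> \<pi> X" shows "bfam A \<xi> \<pi> (\<lambda>a. scl G c (X a))"
proof -
  obtain C where C: "\<forall>a\<in>A. nrm G (X a) \<le> C" using assms by (auto simp: bfam_def)
  have "nrm G (scl G c (X a)) \<le> cmod c * C" if "a \<in> A" for a
    using bfam_car[OF assms that] C that by (simp add: mult_left_mono)
  moreover have "scl G c (X a) \<in> SF (\<pi> a)" if "a \<in> A" for a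
    using assms that SF[OF over_base[OF bfam_over[OF assms(1)] that]] by (simp add: bfam_def subspace_of_def)
  ultimately show ?thesis using assms by (auto simp: bfam_def)
qed

lemma bfam_sub: "bfam A \<xi> \<pi> X \<Longrightarrow> bfam A \<xi> \<pi> Y \<Longrightarrow> bfam A \<xi> \<pi> (\<lambda>a. sub G (X a) (Y a))"
  unfolding sub_def by (intro bfam_add bfam_scl)

lemma bfam_zer: "over A \<xi> \<pi> \<Longrightarrow> bfam A \<xi> \<pi> (\<lambda>_. zer G)"
  using SF over_base by (auto simp: bfam_def subspace_of_def)

lemma bfam_mu:
  assumes X: "bfam A \<xi> \<pi> X" and \<phi>: "bounded (range \<phi>)" shows "bfam A \<xi> \<pi> (\<lambda>a. mu \<phi> (\<pi> a) (X a))"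
proof -
  obtain C where C: "\<forall>a\<in>A. nrm G (X a) \<le> C" using X by (auto simp: bfam_def)
  obtain D where D: "\<And>t. cmod (\<phi> t) \<le> D" using \<phi> by (auto simp: bounded_iff)
  have D0: "0 \<le> D" using D[of 0] norm_ge_zero order_trans by blast
  have "nrm G (mu \<phi> (\<pi> a) (X a)) \<le> D * C" if a: "a \<in> A" for a
  proof -
    have "nrm G (mu \<phi> (\<pi> a) (X a)) \<le> D * nrm G (X a)"
      using mu_bound[OF over_base[OF bfam_over[OF X] a] bspec[OF bfam_SF[OF X] a] D] .
    also have "\<dots> \<le> D * C" using C a D0 by (intro mult_left_mono) auto
    finally show ?thesis .
  qed
  then show ?thesis using X family_mu[OF bfam_over[OF X]] by (auto simp: bfam_def)
qed

text \<open>Cauchy-Schwarz bounds the scalar products along the family, so their limit exists and is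
  the standard part. From here on the hull is computed by limits along the ultrafilter.\<close>

lemma tendsto_vip:
  assumes X: "bfam A \<xi> \<pi> X" and Y: "bfam A \<xi> \<pi> Y"
  shows "((\<lambda>a. ip G (X a) (Y a)) \<longlongrightarrow> std_part N (vip N G (star1 N A X \<xi>) (star1 N A Y \<xi>))) (germ A \<xi>)"
proof -
  obtain C D where C: "\<forall>a\<in>A. nrm G (X a) \<le> C" "\<forall>a\<in>A. nrm G (Y a) \<le> D" using X Y by (auto simp: bfam_def)
  note g = bfam_generic[OF X]
  have "eventually (\<lambda>a. cmod (ip G (X a) (Y a)) \<le> C * D) (germ A \<xi>)"
    using eventually_in[OF g]
  proof (rule eventually_mono)
    fix a assume a: "a \<in> A"
    note c = bfam_car[OF X a] bfam_car[OF Y a]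
    have "cmod (ip G (X a) (Y a)) \<le> nrm G (X a) * nrm G (Y a)" by (rule G.cauchy_schwarz[OF c])
    also have "\<dots> \<le> C * D" using C a c by (intro mult_mono) (auto intro: order_trans[OF G.nrm_nonneg])
    finally show "cmod (ip G (X a) (Y a)) \<le> C * D" .
  qed
  then obtain l where l: "((\<lambda>a. ip G (X a) (Y a)) \<longlongrightarrow> l) (germ A \<xi>)" by (rule germ_limit[OF g])
  then show ?thesis using std_part_hc[OF g l] vip_star1[OF g bfam_img[OF X] bfam_img[OF Y]] by simp
qed

lemma std_part_vip_near:
  assumes b: "x \<in> Bd" "x' \<in> Bd" "y \<in> Bd" and n: "near x x'"
  shows "std_part N (vip N G x y) = std_part N (vip N G x' y)" "std_part N (vip N G y x) = std_part N (vip N G y x')"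
proof -
  obtain A \<xi> \<pi> X X' Y where X: "bfam A \<xi> \<pi> X" "bfam A \<xi> \<pi> X'" "bfam A \<xi> \<pi> Y"
    "star1 N A X \<xi> = x" "star1 N A X' \<xi> = x'" "star1 N A Y \<xi> = y" using represent_Bd3[OF b] by metis
  note g = bfam_generic[OF X(1)]
  obtain C where C: "\<forall>a\<in>A. nrm G (Y a) \<le> C" using X(3) by (auto simp: bfam_def)
  have l: "((\<lambda>a. nrm G (sub G (X a) (X' a))) \<longlongrightarrow> 0) (germ A \<xi>)"
    using n near_star1[OF g bfam_img[OF X(1)] bfam_img[OF X(2)]] X by simp
  have l2: "((\<lambda>a. nrm G (sub G (X a) (X' a)) * C) \<longlongrightarrow> 0) (germ A \<xi>)" using tendsto_mult_left_zero[OF l] .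
  have le: "cmod (ip G (sub G (X a) (X' a)) (Y a)) \<le> nrm G (sub G (X a) (X' a)) * C"
    "cmod (ip G (Y a) (sub G (X a) (X' a))) \<le> nrm G (sub G (X a) (X' a)) * C" if a: "a \<in> A" for a
  proof -
    have c: "sub G (X a) (X' a) \<in> car G" "Y a \<in> car G" using bfam_car[OF X(1) a] bfam_car[OF X(2) a] bfam_car[OF X(3) a] by auto
    have m: "nrm G (sub G (X a) (X' a)) * nrm G (Y a) \<le> nrm G (sub G (X a) (X' a)) * C"
      using C a c by (intro mult_left_mono) auto
    show "cmod (ip G (sub G (X a) (X' a)) (Y a)) \<le> nrm G (sub G (X a) (X' a)) * C"
      using G.cauchy_schwarz[OF c] m by linarith
    show "cmod (ip G (Y a) (sub G (X a) (X' a))) \<le> nrm G (sub G (X a) (X' a)) * C"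
      using G.cauchy_schwarz[OF c(2,1)] m by (simp add: mult.commute)
  qed
  have "((\<lambda>a. ip G (X a) (Y a) - ip G (X' a) (Y a)) \<longlongrightarrow> 0) (germ A \<xi>)"
  proof (rule tendsto_null_le[OF g l2])
    fix a assume a: "a \<in> A"
    show "norm (ip G (X a) (Y a) - ip G (X' a) (Y a)) \<le> nrm G (sub G (X a) (X' a)) * C"
      using le(1)[OF a] G.ip_sub_left[OF bfam_car[OF X(3) a] bfam_car[OF X(1) a] bfam_car[OF X(2) a]] by simp
  qed
  moreover have "((\<lambda>a. ip G (X a) (Y a) - ip G (X' a) (Y a)) \<longlongrightarrow>
     std_part N (vip N G x y) - std_part N (vip N G x' y)) (germ A \<xi>)"
    using tendsto_diff[OF tendsto_vip[OF X(1,3)] tendsto_vip[OF X(2,3)]] X by simp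
  ultimately show "std_part N (vip N G x y) = std_part N (vip N G x' y)"
    using tendsto_unique[OF germ_nonbot[OF g]] by fastforce
  have "((\<lambda>a. ip G (Y a) (X a) - ip G (Y a) (X' a)) \<longlongrightarrow> 0) (germ A \<xi>)"
  proof (rule tendsto_null_le[OF g l2])
    fix a assume a: "a \<in> A"
    show "norm (ip G (Y a) (X a) - ip G (Y a) (X' a)) \<le> nrm G (sub G (X a) (X' a)) * C"
      using le(2)[OF a] G.ip_sub_right[OF bfam_car[OF X(3) a] bfam_car[OF X(1) a] bfam_car[OF X(2) a]] by simp
  qed
  moreover have "((\<lambda>a. ip G (Y a) (X a) - ip G (Y a) (X' a)) \<longlongrightarrow>
     std_part N (vip N G y x) - std_part N (vip N G y x')) (germ A \<xi>)"
    using tendsto_diff[OF tendsto_vip[OF X(3,1)] tendsto_vip[OF X(3,2)]] X by simp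
  ultimately show "std_part N (vip N G y x) = std_part N (vip N G y x')"
    using tendsto_unique[OF germ_nonbot[OF g]] by fastforce
qed

lemma ip_hull:
  assumes "x \<in> Bd" "y \<in> Bd" shows "ip eF (shadow N G F x) (shadow N G F y) = std_part N (vip N G x y)"
proof -
  note rx = rep_shadow[OF assms(1)] and ry = rep_shadow[OF assms(2)]
  have "ip eF (shadow N G F x) (shadow N G F y) = std_part N (vip N G (rep (shadow N G F x)) (rep (shadow N G F y)))"
    by (simp add: hilbert_hull_def)
  also have "\<dots> = std_part N (vip N G x (rep (shadow N G F y)))" by (rule std_part_vip_near(1)[OF rx(1) assms(1) ry(1) rx(3)])
  also have "\<dots> = std_part N (vip N G x y)" by (rule std_part_vip_near(2)[OF ry(1) assms(2) assms(1) ry(3)])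
  finally show ?thesis .
qed

lemma Sh_ip: "bfam A \<xi> \<pi> X \<Longrightarrow> bfam A \<xi> \<pi> Y \<Longrightarrow> ((\<lambda>a. ip G (X a) (Y a)) \<longlongrightarrow> ip eF (Sh A \<xi> X) (Sh A \<xi> Y)) (germ A \<xi>)"
  unfolding Sh_def by (subst ip_hull) (auto intro: bfam_Bd tendsto_vip)

lemma Sh_nrm: "bfam A \<xi> \<pi> X \<Longrightarrow> ((\<lambda>a. nrm G (X a)) \<longlongrightarrow> nrm eF (Sh A \<xi> X)) (germ A \<xi>)"
  unfolding nrm_def by (intro tendsto_real_sqrt tendsto_Re Sh_ip)

lemma Sh_in: "bfam A \<xi> \<pi> X \<Longrightarrow> Sh A \<xi> X \<in> car eF"
  using bfam_Bd by (simp add: hilbert_hull_def Sh_def)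

lemma Sh_eq:
  assumes "bfam A \<xi> \<pi> X" "bfam A \<xi> \<pi> Y"
  shows "Sh A \<xi> X = Sh A \<xi> Y \<longleftrightarrow> ((\<lambda>a. nrm G (sub G (X a) (Y a))) \<longlongrightarrow> 0) (germ A \<xi>)"
  unfolding Sh_def shadow_eq[OF bfam_Bd[OF assms(1)] bfam_Bd[OF assms(2)]]
  by (rule near_star1[OF bfam_generic[OF assms(1)] bfam_img[OF assms(1)] bfam_img[OF assms(2)]])

lemma Sh_cong:
  assumes "bfam A \<xi> \<pi> X" "bfam A \<xi> \<pi> Y" "\<And>a. a \<in> A \<Longrightarrow> X a = Y a" shows "Sh A \<xi> X = Sh A \<xi> Y"
  unfolding Sh_def using star1_cong[OF bfam_generic[OF assms(1)] bfam_img[OF assms(1)] bfam_img[OF assms(2)] assms(3)] by simp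

text \<open>An operation that acts boundedly on families induces an operation on shadows.\<close>

lemma shadow_lipschitz:
  assumes b: "x \<in> Bd" "x' \<in> Bd" "y \<in> Bd" and n: "near x x'"
    and op: "\<And>A \<xi> \<pi> X Y. bfam A \<xi> \<pi> X \<Longrightarrow> bfam A \<xi> \<pi> Y \<Longrightarrow>
       p (star1 N A X \<xi>) (star1 N A Y \<xi>) = star1 N A (\<lambda>a. h (\<pi> a) (X a) (Y a)) \<xi> \<and>
       bfam A \<xi> \<pi> (\<lambda>a. h (\<pi> a) (X a) (Y a))"
    and lip: "\<And>a x x' y. a \<in> A0 \<Longrightarrow> x \<in> SF a \<Longrightarrow> x' \<in> SF a \<Longrightarrow> y \<in> SF a \<Longrightarrow>
       nrm G (sub G (h a x y) (h a x' y)) \<le> L * nrm G (sub G x x')"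
  shows "shadow N G F (p x y) = shadow N G F (p x' y)"
proof -
  obtain A \<xi> \<pi> X X' Y where X: "bfam A \<xi> \<pi> X" "bfam A \<xi> \<pi> X'" "bfam A \<xi> \<pi> Y"
    "star1 N A X \<xi> = x" "star1 N A X' \<xi> = x'" "star1 N A Y \<xi> = y" using represent_Bd3[OF b] by metis
  note g = bfam_generic[OF X(1)] and p = op[OF X(1,3)] op[OF X(2,3)]
  have l: "((\<lambda>a. nrm G (sub G (X a) (X' a))) \<longlongrightarrow> 0) (germ A \<xi>)"
    using n near_star1[OF g bfam_img[OF X(1)] bfam_img[OF X(2)]] X by simp
  have l2: "((\<lambda>a. L * nrm G (sub G (X a) (X' a))) \<longlongrightarrow> 0) (germ A \<xi>)" using tendsto_mult_right_zero[OF l] .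
  have "((\<lambda>a. nrm G (sub G (h (\<pi> a) (X a) (Y a)) (h (\<pi> a) (X' a) (Y a)))) \<longlongrightarrow> 0) (germ A \<xi>)"
  proof (rule tendsto_null_le[OF g l2])
    fix a assume a: "a \<in> A"
    have "sub G (h (\<pi> a) (X a) (Y a)) (h (\<pi> a) (X' a) (Y a)) \<in> car G"
      using bfam_car[OF conjunct2[OF p(1)] a] bfam_car[OF conjunct2[OF p(2)] a] by simp
    then show "norm (nrm G (sub G (h (\<pi> a) (X a) (Y a)) (h (\<pi> a) (X' a) (Y a)))) \<le> L * nrm G (sub G (X a) (X' a))"
      using lip[OF over_base[OF bfam_over[OF X(1)] a] bspec[OF bfam_SF[OF X(1)] a] bspec[OF bfam_SF[OF X(2)] a] bspec[OF bfam_SF[OF X(3)] a]]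
      by simp
  qed
  then have "Sh A \<xi> (\<lambda>a. h (\<pi> a) (X a) (Y a)) = Sh A \<xi> (\<lambda>a. h (\<pi> a) (X' a) (Y a))" using Sh_eq p by blast
  then show ?thesis using p X by (simp add: Sh_def)
qed

lemma vadd_bfam:
  "bfam A \<xi> \<pi> X \<Longrightarrow> bfam A \<xi> \<pi> Y \<Longrightarrow> vadd N G (star1 N A X \<xi>) (star1 N A Y \<xi>) = star1 N A (\<lambda>a. add G (X a) (Y a)) \<xi>"
  by (rule vadd_star1[OF space bfam_generic bfam_img bfam_img])

lemma vscl_bfam:
  assumes "bfam A \<xi> \<pi> X" shows "vscl N G (cnum N c) (star1 N A X \<xi>) = star1 N A (\<lambda>a. scl G c (X a)) \<xi>"
  using vscl_star1[OF space bfam_generic[OF assms] bfam_img[OF assms], of "\<lambda>_. c"] hc_const[OF bfam_generic[OF assms]] by simp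

lemma Sh_add:
  assumes X: "bfam A \<xi> \<pi> X" "bfam A \<xi> \<pi> Y" shows "add eF (Sh A \<xi> X) (Sh A \<xi> Y) = Sh A \<xi> (\<lambda>a. add G (X a) (Y a))"
proof -
  define x y where "x = star1 N A X \<xi>" and "y = star1 N A Y \<xi>"
  have b: "x \<in> Bd" "y \<in> Bd" using X bfam_Bd by (auto simp: x_def y_def)
  note rx = rep_shadow[OF b(1)] and ry = rep_shadow[OF b(2)]
  have lip: "nrm G (sub G (add G x y) (add G x' y)) \<le> 1 * nrm G (sub G x x')"
    "nrm G (sub G (add G y x) (add G y x')) \<le> 1 * nrm G (sub G x x')"
    if "a \<in> A0" "x \<in> SF a" "x' \<in> SF a" "y \<in> SF a" for a x x' y
  proof -
    have c: "x \<in> car G" "x' \<in> car G" "y \<in> car G" using that SF_car by auto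
    show "nrm G (sub G (add G x y) (add G x' y)) \<le> 1 * nrm G (sub G x x')"
      "nrm G (sub G (add G y x) (add G y x')) \<le> 1 * nrm G (sub G x x')"
      using G.nrm_sub_add_le[OF c(1,3,2,3)] G.nrm_sub_add_le[OF c(3,1,3,2)] c by auto
  qed
  have "add eF (Sh A \<xi> X) (Sh A \<xi> Y) = shadow N G F (vadd N G (rep (shadow N G F x)) (rep (shadow N G F y)))"
    by (simp add: hilbert_hull_def Sh_def x_def y_def)
  \<comment> \<open>The arbitrary representatives in the definition of addition are exchanged one
    argument at a time, as addition is 1-Lipschitz in each.\<close>
  also have "\<dots> = shadow N G F (vadd N G x (rep (shadow N G F y)))"
    by (rule shadow_lipschitz[OF rx(1) b(1) ry(1) rx(3), where h = "\<lambda>_ x y. add G x y" and p = "vadd N G"])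
       (auto intro: vadd_bfam bfam_add lip)
  also have "\<dots> = shadow N G F (vadd N G x y)"
    by (rule shadow_lipschitz[OF ry(1) b(2) b(1) ry(3), where h = "\<lambda>_ x y. add G y x" and p = "\<lambda>x y. vadd N G y x"])
       (auto intro: vadd_bfam bfam_add lip)
  finally show ?thesis using vadd_bfam[OF X] by (simp add: Sh_def x_def y_def)
qed

lemma Sh_scl:
  assumes X: "bfam A \<xi> \<pi> X" shows "scl eF c (Sh A \<xi> X) = Sh A \<xi> (\<lambda>a. scl G c (X a))"
proof -
  define x where "x = star1 N A X \<xi>"
  have b: "x \<in> Bd" using X bfam_Bd by (auto simp: x_def)
  note rx = rep_shadow[OF b]
  have "scl eF c (Sh A \<xi> X) = shadow N G F (vscl N G (cnum N c) (rep (shadow N G F x)))"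
    by (simp add: hilbert_hull_def Sh_def x_def)
  also have "\<dots> = shadow N G F (vscl N G (cnum N c) x)"
  proof (rule shadow_lipschitz[OF rx(1) b b rx(3), where h = "\<lambda>_ x y. scl G c x" and p = "\<lambda>x y. vscl N G (cnum N c) x"])
    fix a x x' y assume "a \<in> A0" "x \<in> SF a" "x' \<in> SF a"
    then have "x \<in> car G" "x' \<in> car G" using SF_car by auto
    then show "nrm G (sub G (scl G c x) (scl G c x')) \<le> cmod c * nrm G (sub G x x')" by (simp add: G.nrm_sub_scl)
  qed (auto intro: vscl_bfam bfam_scl)
  finally show ?thesis using vscl_bfam[OF X] by (simp add: Sh_def x_def)
qed

definition M :: "(real \<Rightarrow> complex) \<Rightarrow> 'a set \<Rightarrow> 'a set" where
  "M \<phi> h = shadow N G F (mult \<phi> (rep h))"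

lemma Sh_M:
  assumes X: "bfam A \<xi> \<pi> X" and \<phi>: "bounded (range \<phi>)" shows "M \<phi> (Sh A \<xi> X) = Sh A \<xi> (\<lambda>a. mu \<phi> (\<pi> a) (X a))"
proof -
  define x where "x = star1 N A X \<xi>"
  have b: "x \<in> Bd" using X bfam_Bd by (auto simp: x_def)
  note rx = rep_shadow[OF b]
  obtain C where C: "\<And>t. cmod (\<phi> t) \<le> C" using \<phi> by (auto simp: bounded_iff)
  have "M \<phi> (Sh A \<xi> X) = shadow N G F (mult \<phi> (rep (shadow N G F x)))"
    by (simp add: M_def Sh_def x_def)
  also have "\<dots> = shadow N G F (mult \<phi> x)"
  proof (rule shadow_lipschitz[OF rx(1) b b rx(3), where h = "\<lambda>a x y. mu \<phi> a x" and p = "\<lambda>x y. mult \<phi> x"])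
    fix a x x' y assume a: "a \<in> A0" "x \<in> SF a" "x' \<in> SF a"
    have "sub G x x' \<in> SF a" using a SF[OF a(1)] by (simp add: sub_def subspace_of_def)
    from mu_bound[OF a(1) this C] show "nrm G (sub G (mu \<phi> a x) (mu \<phi> a x')) \<le> C * nrm G (sub G x x')"
      using mu_sub[OF a] by simp
  qed (auto intro: mult_star1[OF bfam_over bfam_SF] bfam_mu \<phi>)
  finally show ?thesis using mult_star1[OF bfam_over[OF X] bfam_SF[OF X]] by (simp add: Sh_def x_def)
qed

lemma represent_hull3:
  assumes "h \<in> car eF" "k \<in> car eF" "l \<in> car eF"
  obtains A \<xi> \<pi> X Y Z where "bfam A \<xi> \<pi> X" "bfam A \<xi> \<pi> Y" "bfam A \<xi> \<pi> Z"
    "h = Sh A \<xi> X" "k = Sh A \<xi> Y" "l = Sh A \<xi> Z"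
proof -
  obtain x y z where b: "x \<in> Bd" "y \<in> Bd" "z \<in> Bd" "h = shadow N G F x" "k = shadow N G F y" "l = shadow N G F z"
    using assms by (auto simp: hilbert_hull_def)
  obtain A \<xi> \<pi> X Y Z where "bfam A \<xi> \<pi> X" "bfam A \<xi> \<pi> Y" "bfam A \<xi> \<pi> Z"
    "star1 N A X \<xi> = x" "star1 N A Y \<xi> = y" "star1 N A Z \<xi> = z" using represent_Bd3[OF b(1-3)] by metis
  then show thesis using b that by (simp add: Sh_def)
qed

lemma zer_standard: "zer G \<in> standard_universe N"
  by (rule std_small_mem[OF G_small]) simp

lemma Sh_zer: "over A \<xi> \<pi> \<Longrightarrow> zer eF = Sh A \<xi> (\<lambda>_. zer G)"
  using star1_const[OF over_generic zer_standard] by (simp add: hilbert_hull_def Sh_def)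

lemma hull_vector_space: "complex_vector_space eF"
  unfolding complex_vector_space_def
proof (intro conjI ballI allI)
  show "zer eF \<in> car eF" using Sh_zer[OF over_id] Sh_in[OF bfam_zer[OF over_id]] by simp
  fix h k l c d assume h: "h \<in> car eF"
  obtain A \<xi> \<pi> X where X: "bfam A \<xi> \<pi> X" "h = Sh A \<xi> X" using represent_hull3[OF h h h] by metis
  note c = bfam_car[OF X(1)] and o = bfam_over[OF X(1)]
  have 1: "add G (zer G) x = x" "scl G 1 x = x" "add G x (scl G (-1) x) = zer G" "scl G (c + d) x = add G (scl G c x) (scl G d x)"
    "scl G (c * d) x = scl G c (scl G d x)" if "x \<in> car G" for x
    by (rule G.ip_eqI; use that in \<open>simp add: algebra_simps\<close>)+
  show "add eF (zer eF) h = h"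
    unfolding Sh_zer[OF o] X(2) Sh_add[OF bfam_zer[OF o] X(1)]
    by (rule Sh_cong[OF bfam_add[OF bfam_zer[OF o] X(1)] X(1)]) (simp add: 1 c)
  show "\<exists>y\<in>car eF. add eF h y = zer eF"
  proof (rule bexI[of _ "scl eF (-1) h"])
    show "add eF h (scl eF (-1) h) = zer eF"
      unfolding Sh_zer[OF o] X(2) Sh_scl[OF X(1)] Sh_add[OF X(1) bfam_scl[OF X(1)]]
      by (rule Sh_cong[OF bfam_add[OF X(1) bfam_scl[OF X(1)]] bfam_zer[OF o]]) (simp add: 1 c)
    show "scl eF (-1) h \<in> car eF" unfolding X(2) Sh_scl[OF X(1)] by (rule Sh_in[OF bfam_scl[OF X(1)]])
  qed
  show "scl eF c h \<in> car eF" unfolding X(2) Sh_scl[OF X(1)] by (rule Sh_in[OF bfam_scl[OF X(1)]])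
  show "scl eF 1 h = h"
    unfolding X(2) Sh_scl[OF X(1)] by (rule Sh_cong[OF bfam_scl[OF X(1)] X(1)]) (simp add: 1 c)
  show "scl eF (c + d) h = add eF (scl eF c h) (scl eF d h)"
    unfolding X(2) Sh_scl[OF X(1)] Sh_add[OF bfam_scl[OF X(1)] bfam_scl[OF X(1)]]
    by (rule Sh_cong[OF bfam_scl[OF X(1)] bfam_add[OF bfam_scl[OF X(1)] bfam_scl[OF X(1)]]]) (simp add: 1 c)
  show "scl eF (c * d) h = scl eF c (scl eF d h)"
    unfolding X(2) Sh_scl[OF X(1)] Sh_scl[OF bfam_scl[OF X(1)]]
    by (rule Sh_cong[OF bfam_scl[OF X(1)] bfam_scl[OF bfam_scl[OF X(1)]]]) (simp add: 1 c)
next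
  fix h k c assume h: "h \<in> car eF" and k: "k \<in> car eF"
  obtain A \<xi> \<pi> X Y where X: "bfam A \<xi> \<pi> X" "bfam A \<xi> \<pi> Y" "h = Sh A \<xi> X" "k = Sh A \<xi> Y"
    using represent_hull3[OF h k k] by metis
  note c = bfam_car[OF X(1)] bfam_car[OF X(2)]
  have 1: "add G x y = add G y x" "scl G c (add G x y) = add G (scl G c x) (scl G c y)" if "x \<in> car G" "y \<in> car G" for x y
    by (rule G.ip_eqI; use that in \<open>simp add: algebra_simps\<close>)+
  show "add eF h k \<in> car eF" unfolding X(3,4) Sh_add[OF X(1,2)] by (rule Sh_in[OF bfam_add[OF X(1,2)]])
  show "add eF h k = add eF k h"
    unfolding X(3,4) Sh_add[OF X(1,2)] Sh_add[OF X(2,1)]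
    by (rule Sh_cong[OF bfam_add[OF X(1,2)] bfam_add[OF X(2,1)]]) (rule 1(1)[OF c])
  show "scl eF c (add eF h k) = add eF (scl eF c h) (scl eF c k)"
    unfolding X(3,4) Sh_add[OF X(1,2)] Sh_scl[OF bfam_add[OF X(1,2)]] Sh_scl[OF X(1)] Sh_scl[OF X(2)]
      Sh_add[OF bfam_scl[OF X(1)] bfam_scl[OF X(2)]]
    by (rule Sh_cong[OF bfam_scl[OF bfam_add[OF X(1,2)]] bfam_add[OF bfam_scl[OF X(1)] bfam_scl[OF X(2)]]]) (rule 1(2)[OF c])
next
  fix h k l assume h: "h \<in> car eF" and k: "k \<in> car eF" and l: "l \<in> car eF"
  obtain A \<xi> \<pi> X Y Z where X: "bfam A \<xi> \<pi> X" "bfam A \<xi> \<pi> Y" "bfam A \<xi> \<pi> Z" "h = Sh A \<xi> X" "k = Sh A \<xi> Y" "l = Sh A \<xi> Z"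
    using represent_hull3[OF h k l] by metis
  have 1: "add G (add G x y) z = add G x (add G y z)" if "x \<in> car G" "y \<in> car G" "z \<in> car G" for x y z
    by (rule G.ip_eqI; use that in \<open>simp add: algebra_simps\<close>)+
  show "add eF (add eF h k) l = add eF h (add eF k l)"
    unfolding X(4-6) Sh_add[OF X(1,2)] Sh_add[OF X(2,3)] Sh_add[OF bfam_add[OF X(1,2)] X(3)] Sh_add[OF X(1) bfam_add[OF X(2,3)]]
    by (rule Sh_cong[OF bfam_add[OF bfam_add[OF X(1,2)] X(3)] bfam_add[OF X(1) bfam_add[OF X(2,3)]]])
       (rule 1[OF bfam_car[OF X(1)] bfam_car[OF X(2)] bfam_car[OF X(3)]])
qed

lemma tendsto_eqI:
  fixes f g :: "'a \<Rightarrow> complex"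
  assumes "generic A \<xi>" "(f \<longlongrightarrow> l) (germ A \<xi>)" "(g \<longlongrightarrow> m) (germ A \<xi>)" "\<And>a. a \<in> A \<Longrightarrow> f a = g a"
  shows "l = m"
proof -
  have "(f \<longlongrightarrow> m) (germ A \<xi>)"
    by (rule Lim_transform_eventually[OF assms(3)]) (rule eventually_mono[OF eventually_in[OF assms(1)]], simp add: assms(4))
  then show ?thesis using tendsto_unique[OF germ_nonbot[OF assms(1)] assms(2)] by simp
qed

lemma hull_prehilbert: "prehilbert eF"
  unfolding prehilbert_def hermitian_product_def
proof (intro conjI ballI allI impI hull_vector_space)
  fix h k c assume h: "h \<in> car eF" and k: "k \<in> car eF"
  obtain A \<xi> \<pi> X Y where X: "bfam A \<xi> \<pi> X" "bfam A \<xi> \<pi> Y" "h = Sh A \<xi> X" "k = Sh A \<xi> Y"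
    using represent_hull3[OF h k k] by metis
  note g = bfam_generic[OF X(1)]
  show "ip eF h (scl eF c k) = c * ip eF h k"
    unfolding X(3,4) Sh_scl[OF X(2)]
    by (rule tendsto_eqI[OF g Sh_ip[OF X(1) bfam_scl[OF X(2)]] tendsto_mult_left[OF Sh_ip[OF X(1,2)]]])
       (use bfam_car[OF X(1)] bfam_car[OF X(2)] in simp)
  show "ip eF k h = cnj (ip eF h k)"
    unfolding X(3,4)
    by (rule tendsto_eqI[OF g Sh_ip[OF X(2,1)] tendsto_cnj[OF Sh_ip[OF X(1,2)]]])
       (rule G.ip_cnj[OF bfam_car[OF X(1)] bfam_car[OF X(2)]])
next
  fix h k l assume h: "h \<in> car eF" and k: "k \<in> car eF" and l: "l \<in> car eF"
  obtain A \<xi> \<pi> X Y Z where X: "bfam A \<xi> \<pi> X" "bfam A \<xi> \<pi> Y" "bfam A \<xi> \<pi> Z" "h = Sh A \<xi> X" "k = Sh A \<xi> Y" "l = Sh A \<xi> Z"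
    using represent_hull3[OF h k l] by metis
  show "ip eF h (add eF k l) = ip eF h k + ip eF h l"
    unfolding X(4-6) Sh_add[OF X(2,3)]
    by (rule tendsto_eqI[OF bfam_generic[OF X(1)] Sh_ip[OF X(1) bfam_add[OF X(2,3)]] tendsto_add[OF Sh_ip[OF X(1,2)] Sh_ip[OF X(1,3)]]])
       (use bfam_car[OF X(1)] bfam_car[OF X(2)] bfam_car[OF X(3)] in simp)
next
  fix h assume h: "h \<in> car eF" and nz: "h \<noteq> zer eF"
  obtain A \<xi> \<pi> X where X: "bfam A \<xi> \<pi> X" "h = Sh A \<xi> X" using represent_hull3[OF h h h] by metis
  note g = bfam_generic[OF X(1)]
  have l: "((\<lambda>a. Re (ip G (X a) (X a))) \<longlongrightarrow> Re (ip eF h h)) (germ A \<xi>)"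
    unfolding X(2) by (rule tendsto_Re[OF Sh_ip[OF X(1,1)]])
  have ge: "0 \<le> Re (ip eF h h)"
    by (rule tendsto_lowerbound[OF l _ germ_nonbot[OF g]])
       (rule eventually_mono[OF eventually_in[OF g]], rule G.Re_ip_nonneg[OF bfam_car[OF X(1)]])
  show "0 < Re (ip eF h h)"
  proof (rule ccontr)
    assume "\<not> 0 < Re (ip eF h h)"
    then have "nrm eF h = 0" using ge by (simp add: nrm_def)
    then have "((\<lambda>a. nrm G (X a)) \<longlongrightarrow> 0) (germ A \<xi>)" using Sh_nrm[OF X(1)] X(2) by simp
    then have "((\<lambda>a. nrm G (sub G (X a) (zer G))) \<longlongrightarrow> 0) (germ A \<xi>)"
      by (rule tendsto_null_le[OF g]) (use bfam_car[OF X(1)] in simp)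
    then have "h = zer eF" unfolding X(2) Sh_zer[OF bfam_over[OF X(1)]] Sh_eq[OF X(1) bfam_zer[OF bfam_over[OF X(1)]]] .
    then show False using nz by simp
  qed
qed

sublocale eF: prehilb eF by unfold_locales (rule hull_prehilbert)

lemma Sh_sub:
  "bfam A \<xi> \<pi> X \<Longrightarrow> bfam A \<xi> \<pi> Y \<Longrightarrow> sub eF (Sh A \<xi> X) (Sh A \<xi> Y) = Sh A \<xi> (\<lambda>a. sub G (X a) (Y a))"
  unfolding sub_def by (simp add: Sh_scl Sh_add bfam_scl)

end

context nonstandard begin

lemma iset_mono:
  assumes \<xi>: "generic A \<xi>" and C: "std_small C" and T: "\<And>a. a \<in> A \<Longrightarrow> T a \<subseteq> C" and S: "\<And>a. a \<in> A \<Longrightarrow> S a \<subseteq> T a"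
  shows "iset A \<xi> S \<subseteq> iset A \<xi> T"
proof -
  have SC: "S a \<subseteq> C" if "a \<in> A" for a using S[OF that] T[OF that] by blast
  have s: "std_small ((\<lambda>a. the_set N (S a)) ` A)" "std_small ((\<lambda>a. the_set N (T a)) ` A)"
    by (rule std_small_family[OF C SC], simp, rule std_small_family[OF C T], simp)
  define P where "P = (\<lambda>x y z::'w. \<forall>w. mem N w x \<longrightarrow> mem N w y)"
  have "P (star1 N A (\<lambda>a. the_set N (S a)) \<xi>) (star1 N A (\<lambda>a. the_set N (T a)) \<xi>) (star1 N A (\<lambda>a. the_set N (T a)) \<xi>)
    \<longleftrightarrow> eventually (\<lambda>a. P (the_set N (S a)) (the_set N (T a)) (the_set N (T a))) (germ A \<xi>)"
    by (rule los[where q = "BAll 80 0 (Mem 80 1)" and Q = P, OF \<xi> s s(2)]) (simp_all add: P_def)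
  moreover have "eventually (\<lambda>a. P (the_set N (S a)) (the_set N (T a)) (the_set N (T a))) (germ A \<xi>)"
    using eventually_in[OF \<xi>]
  proof (rule eventually_mono)
    fix a assume a: "a \<in> A"
    show "P (the_set N (S a)) (the_set N (T a)) (the_set N (T a))"
      using S[OF a] mem_std_set[OF std_small_subset[OF C SC[OF a]]] mem_std_set[OF std_small_subset[OF C T[OF a]]]
      by (auto simp: P_def)
  qed
  ultimately show ?thesis by (auto simp: P_def iset_def elts_def)
qed

end

section \<open>The functional calculus on the hull\<close>

context compression_eigen begin

lemma represent_hull1:
  assumes "h \<in> car eF"
  obtains A \<xi> \<pi> X where "bfam A \<xi> \<pi> X" "h = Sh A \<xi> X"
  by (rule represent_hull3[OF assms assms assms], rule that)

lemma represent_hull2: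
  assumes "h \<in> car eF" "k \<in> car eF"
  obtains A \<xi> \<pi> X Y where "bfam A \<xi> \<pi> X" "bfam A \<xi> \<pi> Y" "h = Sh A \<xi> X" "k = Sh A \<xi> Y"
  by (rule represent_hull3[OF assms(1,2,2)], rule that)

lemma M_in:
  assumes \<phi>: "bounded (range \<phi>)" and h: "h \<in> car eF" shows "M \<phi> h \<in> car eF"
proof -
  obtain A \<xi> \<pi> X where X: "bfam A \<xi> \<pi> X" "h = Sh A \<xi> X" by (rule represent_hull1[OF h])
  show ?thesis unfolding X(2) Sh_M[OF X(1) \<phi>] by (rule Sh_in[OF bfam_mu[OF X(1) \<phi>]])
qed

text \<open>The identity for \<open>mu\<close> holds at each index, and scalar products of shadows
  are limits along the ultrafilter, so it passes to the hull.\<close>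

lemma M_adj:
  assumes \<phi>: "bounded (range \<phi>)" and h: "h \<in> car eF" "k \<in> car eF"
  shows "ip eF h (M \<phi> k) = ip eF (M (\<lambda>t. cnj (\<phi> t)) h) k"
proof -
  have \<phi>': "bounded (range (\<lambda>t. cnj (\<phi> t)))" using \<phi> by (auto simp: bounded_iff)
  obtain A \<xi> \<pi> X Y where X: "bfam A \<xi> \<pi> X" "bfam A \<xi> \<pi> Y" "h = Sh A \<xi> X" "k = Sh A \<xi> Y"
    by (rule represent_hull2[OF h])
  show ?thesis
    unfolding X(3,4) Sh_M[OF X(1) \<phi>'] Sh_M[OF X(2) \<phi>]
    by (rule tendsto_eqI[OF bfam_generic[OF X(1)] Sh_ip[OF X(1) bfam_mu[OF X(2) \<phi>]] Sh_ip[OF bfam_mu[OF X(1) \<phi>'] X(2)]])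
       (rule mu_adj[OF over_base[OF bfam_over[OF X(1)]] bspec[OF bfam_SF[OF X(1)]] bspec[OF bfam_SF[OF X(2)]]])
qed

lemma M_mult:
  assumes \<phi>: "bounded (range \<phi>)" "bounded (range \<psi>)" and h: "h \<in> car eF"
  shows "M \<phi> (M \<psi> h) = M (\<lambda>t. \<phi> t * \<psi> t) h"
proof -
  have b: "bounded (range (\<lambda>t. \<phi> t * \<psi> t))" using \<phi> by (rule bounded_range_mult)
  obtain A \<xi> \<pi> X where X: "bfam A \<xi> \<pi> X" "h = Sh A \<xi> X" by (rule represent_hull1[OF h])
  note m = bfam_mu[OF X(1) \<phi>(2)]
  show ?thesis
    unfolding X(2) Sh_M[OF X(1) \<phi>(2)] Sh_M[OF m \<phi>(1)] Sh_M[OF X(1) b]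
    by (rule Sh_cong[OF bfam_mu[OF m \<phi>(1)] bfam_mu[OF X(1) b]]) (rule mu_mult[OF over_base[OF bfam_over[OF X(1)]]])
qed

lemma M_add_fun:
  assumes \<phi>: "bounded (range \<phi>)" "bounded (range \<psi>)" and h: "h \<in> car eF"
  shows "M (\<lambda>t. \<phi> t + \<psi> t) h = add eF (M \<phi> h) (M \<psi> h)"
proof -
  obtain B C where "\<And>x. cmod (\<phi> x) \<le> B" "\<And>x. cmod (\<psi> x) \<le> C" using \<phi> by (auto simp: bounded_iff)
  then have "cmod (\<phi> x + \<psi> x) \<le> B + C" for x by (rule order_trans[OF norm_triangle_ineq add_mono])
  then have b: "bounded (range (\<lambda>t. \<phi> t + \<psi> t))" by (auto simp: bounded_iff)
  obtain A \<xi> \<pi> X where X: "bfam A \<xi> \<pi> X" "h = Sh A \<xi> X" by (rule represent_hull1[OF h])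
  note m = bfam_mu[OF X(1) \<phi>(1)] bfam_mu[OF X(1) \<phi>(2)]
  show ?thesis
    unfolding X(2) Sh_M[OF X(1) \<phi>(2)] Sh_M[OF X(1) \<phi>(1)] Sh_M[OF X(1) b] Sh_add[OF m]
    by (rule Sh_cong[OF bfam_mu[OF X(1) b] bfam_add[OF m]]) (rule mu_add_fun[OF over_base[OF bfam_over[OF X(1)]]])
qed

lemma M_const:
  assumes h: "h \<in> car eF" shows "M (\<lambda>_. c) h = scl eF c h"
proof -
  obtain A \<xi> \<pi> X where X: "bfam A \<xi> \<pi> X" "h = Sh A \<xi> X" by (rule represent_hull1[OF h])
  show ?thesis
    unfolding X(2) Sh_M[OF X(1) bounded_range_const] Sh_scl[OF X(1)]
    by (rule Sh_cong[OF bfam_mu[OF X(1) bounded_range_const] bfam_scl[OF X(1)]])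
       (rule mu_const[OF over_base[OF bfam_over[OF X(1)]] bspec[OF bfam_SF[OF X(1)]]])
qed

lemma M_bound:
  assumes C: "\<And>t. cmod (\<phi> t) \<le> C" and h: "h \<in> car eF" shows "nrm eF (M \<phi> h) \<le> C * nrm eF h"
proof -
  have \<phi>: "bounded (range \<phi>)" using C by (auto simp: bounded_iff)
  obtain A \<xi> \<pi> X where X: "bfam A \<xi> \<pi> X" "h = Sh A \<xi> X" by (rule represent_hull1[OF h])
  note g = bfam_generic[OF X(1)]
  show ?thesis
    unfolding X(2) Sh_M[OF X(1) \<phi>]
    by (rule tendsto_le[OF germ_nonbot[OF g] tendsto_mult_left[OF Sh_nrm[OF X(1)]] Sh_nrm[OF bfam_mu[OF X(1) \<phi>]]],
        rule eventually_mono[OF eventually_in[OF g]], rule mu_bound[OF over_base[OF bfam_over[OF X(1)]] bspec[OF bfam_SF[OF X(1)]] C])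
qed

section \<open>The shadow graph and the Cayley transform\<close>

abbreviation \<Gamma> where "\<Gamma> \<equiv> shadow_graph N G F v"

lemma bfam_subset: "bfam A \<xi> \<pi> X \<Longrightarrow> A' \<subseteq> A \<Longrightarrow> over A' \<xi> \<pi> \<Longrightarrow> bfam A' \<xi> \<pi> X"
  unfolding bfam_def by blast

lemma v_bfam: "bfam A \<xi> \<pi> X \<Longrightarrow> v (star1 N A X \<xi>) = star1 N A (\<lambda>a. mu of_real (\<pi> a) (X a)) \<xi>"
  using v_star1[OF bfam_over bfam_SF] .

lemma \<Gamma>_intro:
  assumes "bfam A \<xi> \<pi> X" "bfam A \<xi> \<pi> (\<lambda>a. mu of_real (\<pi> a) (X a))"
  shows "(Sh A \<xi> X, Sh A \<xi> (\<lambda>a. mu of_real (\<pi> a) (X a))) \<in> \<Gamma>"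
  unfolding shadow_graph_def Sh_def using bfam_Bd[OF assms(1)] bfam_Bd[OF assms(2)] v_bfam[OF assms(1)] by force

text \<open>\<open>v\<close> is not bounded, so bounded families for x and w need not have bounded
  images; a second shrinking makes the images bounded as well.\<close>

lemma represent_graph2:
  assumes b: "x \<in> Bd" "v x \<in> Bd" "w \<in> Bd" "v w \<in> Bd"
  obtains A \<xi> \<pi> X W where "bfam A \<xi> \<pi> X" "bfam A \<xi> \<pi> W" "bfam A \<xi> \<pi> (\<lambda>a. mu of_real (\<pi> a) (X a))"
    "bfam A \<xi> \<pi> (\<lambda>a. mu of_real (\<pi> a) (W a))" "star1 N A X \<xi> = x" "star1 N A W \<xi> = w"
    "star1 N A (\<lambda>a. mu of_real (\<pi> a) (X a)) \<xi> = v x" "star1 N A (\<lambda>a. mu of_real (\<pi> a) (W a)) \<xi> = v w"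
proof -
  obtain A \<xi> \<pi> X W where X: "bfam A \<xi> \<pi> X" "bfam A \<xi> \<pi> W" "star1 N A X \<xi> = x" "star1 N A W \<xi> = w"
    using represent_Bd3[OF b(1,3,3)] by metis
  note o = bfam_over[OF X(1)]
  obtain C D where C: "eventually (\<lambda>a. nrm G (mu of_real (\<pi> a) (X a)) \<le> C) (germ A \<xi>)"
    "eventually (\<lambda>a. nrm G (mu of_real (\<pi> a) (W a)) \<le> D) (germ A \<xi>)"
    using b(2,4) v_bfam[OF X(1)] v_bfam[OF X(2)] X(3,4) Bd_star1[OF o family_mu[OF o]] by auto
  define Q where "Q a \<longleftrightarrow> nrm G (mu of_real (\<pi> a) (X a)) \<le> C \<and> nrm G (mu of_real (\<pi> a) (W a)) \<le> D" for a
  have ev: "eventually Q (germ A \<xi>)" unfolding Q_def using C by (rule eventually_conj)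
  have o': "over {a \<in> A. Q a} \<xi> \<pi>" by (rule over_shrink[OF o ev])
  note sh = generic_shrink(2)[OF over_generic[OF o] ev std_small_vec]
  have b': "bfam {a \<in> A. Q a} \<xi> \<pi> X" "bfam {a \<in> A. Q a} \<xi> \<pi> W"
    by (rule bfam_subset[OF X(1) _ o'], simp, rule bfam_subset[OF X(2) _ o'], simp)
  show thesis
  proof (rule that[OF b'])
    show "bfam {a \<in> A. Q a} \<xi> \<pi> (\<lambda>a. mu of_real (\<pi> a) (X a))"
      by (rule bfam_shrink[OF o family_mu[OF o] _ o', of _ _ C]) (auto simp: Q_def)
    show "bfam {a \<in> A. Q a} \<xi> \<pi> (\<lambda>a. mu of_real (\<pi> a) (W a))"
      by (rule bfam_shrink[OF o family_mu[OF o] _ o', of _ _ D]) (auto simp: Q_def)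
    show s: "star1 N {a \<in> A. Q a} X \<xi> = x" "star1 N {a \<in> A. Q a} W \<xi> = w"
      using sh[OF bfam_img[OF X(1)]] sh[OF bfam_img[OF X(2)]] X(3,4) by auto
    show "star1 N {a \<in> A. Q a} (\<lambda>a. mu of_real (\<pi> a) (X a)) \<xi> = v x"
      "star1 N {a \<in> A. Q a} (\<lambda>a. mu of_real (\<pi> a) (W a)) \<xi> = v w"
      using v_bfam[OF b'(1)] v_bfam[OF b'(2)] s by simp_all
  qed
qed

lemma \<Gamma>_cases:
  assumes "(h, k) \<in> \<Gamma>"
  obtains A \<xi> \<pi> X where "bfam A \<xi> \<pi> X" "bfam A \<xi> \<pi> (\<lambda>a. mu of_real (\<pi> a) (X a))"
    "h = Sh A \<xi> X" "k = Sh A \<xi> (\<lambda>a. mu of_real (\<pi> a) (X a))"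
proof -
  obtain x where x: "x \<in> Bd" "v x \<in> Bd" "h = shadow N G F x" "k = shadow N G F (v x)"
    using assms by (auto simp: shadow_graph_def)
  from represent_graph2[OF x(1,2,1,2)] obtain A \<xi> \<pi> X W where
    "bfam A \<xi> \<pi> X" "bfam A \<xi> \<pi> (\<lambda>a. mu of_real (\<pi> a) (X a))" "star1 N A X \<xi> = x"
    "star1 N A (\<lambda>a. mu of_real (\<pi> a) (X a)) \<xi> = v x" by metis
  then show thesis using x that by (simp add: Sh_def)
qed

lemma \<Gamma>_sub: "\<Gamma> \<subseteq> car eF \<times> car eF"
  by (auto simp: shadow_graph_def hilbert_hull_def)

lemma \<Gamma>_M:
  assumes hk: "(h, k) \<in> \<Gamma>" and \<phi>: "bounded (range \<phi>)" "bounded (range (\<lambda>t. of_real t * \<phi> t))"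
  shows "M \<phi> k = M (\<lambda>t. of_real t * \<phi> t) h"
proof -
  obtain A \<xi> \<pi> X where X: "bfam A \<xi> \<pi> X" "bfam A \<xi> \<pi> (\<lambda>a. mu of_real (\<pi> a) (X a))"
    "h = Sh A \<xi> X" "k = Sh A \<xi> (\<lambda>a. mu of_real (\<pi> a) (X a))" by (rule \<Gamma>_cases[OF hk])
  show ?thesis
    unfolding X(3,4) Sh_M[OF X(2) \<phi>(1)] Sh_M[OF X(1) \<phi>(2)]
    by (rule Sh_cong[OF bfam_mu[OF X(2) \<phi>(1)] bfam_mu[OF X(1) \<phi>(2)]])
       (simp add: mu_mult[OF over_base[OF bfam_over[OF X(1)]]] mult.commute)
qed

lemma M_\<Gamma>:
  assumes h: "h \<in> car eF" and \<phi>: "bounded (range \<phi>)" "bounded (range (\<lambda>t. of_real t * \<phi> t))"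
  shows "(M \<phi> h, M (\<lambda>t. of_real t * \<phi> t) h) \<in> \<Gamma>"
proof -
  obtain A \<xi> \<pi> X where X: "bfam A \<xi> \<pi> X" "h = Sh A \<xi> X" by (rule represent_hull1[OF h])
  note m = bfam_mu[OF X(1) \<phi>(1)] bfam_mu[OF X(1) \<phi>(2)]
  have eq: "mu of_real (\<pi> a) (mu \<phi> (\<pi> a) (X a)) = mu (\<lambda>t. of_real t * \<phi> t) (\<pi> a) (X a)" if "a \<in> A" for a
    by (rule mu_mult[OF over_base[OF bfam_over[OF X(1)] that]])
  have m': "bfam A \<xi> \<pi> (\<lambda>a. mu of_real (\<pi> a) (mu \<phi> (\<pi> a) (X a)))"
    using m(2) eq by (simp add: bfam_def)
  show ?thesis
    using \<Gamma>_intro[OF m(1) m'] Sh_cong[OF m' m(2) eq] by (simp add: X(2) Sh_M[OF X(1) \<phi>(1)] Sh_M[OF X(1) \<phi>(2)])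
qed

text \<open>Completeness of the graph is saturation applied to graph-norm balls.\<close>

definition graph_ball :: "real \<Rightarrow> 'a \<Rightarrow> 'a \<Rightarrow> 'a set" where
  "graph_ball e a x = {w \<in> SF a. nrm G (sub G w x) < e \<and> nrm G (sub G (mu of_real a w) (mu of_real a x)) < e}"

text \<open>A lift, so the centre may be any element of F, while the ball is an internal set, as
  saturation requires.\<close>

definition star_ball :: "real \<Rightarrow> 'a \<Rightarrow> 'a" where
  "star_ball e x = lift (\<lambda>a x. the_set N (graph_ball e a x)) x"

lemma graph_ball_car: "a \<in> A0 \<Longrightarrow> graph_ball e a x \<subseteq> car G"
  using SF_car by (auto simp: graph_ball_def)

lemma star_ball_star1:
  assumes o: "over A \<xi> \<pi>" and X: "\<forall>a\<in>A. X a \<in> SF (\<pi> a)"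
  shows "star_ball e (star1 N A X \<xi>) = star1 N A (\<lambda>a. the_set N (graph_ball e (\<pi> a) (X a))) \<xi>"
  unfolding star_ball_def
  by (rule lift_star1[OF o family_car[OF o X] std_small_sets[OF G_small]]) (rule imageI, rule PowI, rule graph_ball_car)

lemma mem_star_ball:
  assumes o: "over A \<xi> \<pi>" and X: "\<forall>a\<in>A. X a \<in> SF (\<pi> a)" and W: "std_small (W ` A)"
  shows "star1 N A W \<xi> \<in> elts N (star_ball e (star1 N A X \<xi>)) \<longleftrightarrow> eventually (\<lambda>a. W a \<in> graph_ball e (\<pi> a) (X a)) (germ A \<xi>)"
  using in_iset[OF over_generic[OF o] G_small _ W, of "\<lambda>a. graph_ball e (\<pi> a) (X a)"] graph_ball_car over_base[OF o]
  unfolding star_ball_star1[OF o X] iset_def by blast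

lemma star_ball_F:
  assumes "x \<in> elts N F" shows "elts N (star_ball e x) \<subseteq> elts N F" "internal N (star_ball e x)"
proof -
  obtain A \<xi> \<pi> X where o: "over A \<xi> \<pi>" and X: "\<forall>a\<in>A. X a \<in> SF (\<pi> a)" "star1 N A X \<xi> = x"
    using represent3[OF assms assms assms] by metis
  have gb: "graph_ball e (\<pi> a) (X a) \<subseteq> car G" if "a \<in> A" for a by (rule graph_ball_car[OF over_base[OF o that]])
  have "iset A \<xi> (\<lambda>a. graph_ball e (\<pi> a) (X a)) \<subseteq> iset A \<xi> (\<lambda>a. SF (\<pi> a))"
    by (rule iset_mono[OF over_generic[OF o] G_small]) (use SF_car over_base[OF o] in \<open>auto simp: graph_ball_def\<close>)
  then show "elts N (star_ball e x) \<subseteq> elts N F"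
    using star_ball_star1[OF o X(1)] over_iset[OF o G_small SF_car] F_eq by (simp add: iset_def X(2))
  show "internal N (star_ball e x)"
    unfolding X(2)[symmetric] star_ball_star1[OF o X(1)] by (rule internal_iset[OF over_generic[OF o] G_small gb])
qed

lemma near_imp_star_ball:
  assumes b: "x \<in> Bd" "v x \<in> Bd" "w \<in> Bd" "v w \<in> Bd"
    and n: "nrm eF (sub eF (shadow N G F w) (shadow N G F x)) < e" "nrm eF (sub eF (shadow N G F (v w)) (shadow N G F (v x))) < e"
  shows "w \<in> elts N (star_ball e x)"
proof -
  obtain A \<xi> \<pi> X W where X: "bfam A \<xi> \<pi> X" "bfam A \<xi> \<pi> W" "bfam A \<xi> \<pi> (\<lambda>a. mu of_real (\<pi> a) (X a))"
    "bfam A \<xi> \<pi> (\<lambda>a. mu of_real (\<pi> a) (W a))" "star1 N A X \<xi> = x" "star1 N A W \<xi> = w"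
    "star1 N A (\<lambda>a. mu of_real (\<pi> a) (X a)) \<xi> = v x" "star1 N A (\<lambda>a. mu of_real (\<pi> a) (W a)) \<xi> = v w"
    by (rule represent_graph2[OF b])
  have "eventually (\<lambda>a. nrm G (sub G (W a) (X a)) < e) (germ A \<xi>)"
    by (rule order_tendstoD(2)[OF Sh_nrm[OF bfam_sub[OF X(2,1)]]]) (use n(1) Sh_sub[OF X(2,1)] X(5,6) in \<open>simp add: Sh_def\<close>)
  moreover have "eventually (\<lambda>a. nrm G (sub G (mu of_real (\<pi> a) (W a)) (mu of_real (\<pi> a) (X a))) < e) (germ A \<xi>)"
    by (rule order_tendstoD(2)[OF Sh_nrm[OF bfam_sub[OF X(4,3)]]]) (use n(2) Sh_sub[OF X(4,3)] X(7,8) in \<open>simp add: Sh_def\<close>)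
  ultimately have "eventually (\<lambda>a. W a \<in> graph_ball e (\<pi> a) (X a)) (germ A \<xi>)"
    using eventually_in[OF bfam_generic[OF X(1)]]
    by eventually_elim (use bfam_SF[OF X(2)] in \<open>simp add: graph_ball_def\<close>)
  then show ?thesis
    using mem_star_ball[OF bfam_over[OF X(1)] bfam_SF[OF X(1)] std_small_vec[OF bfam_img[OF X(2)]]] X(5,6) by simp
qed

text \<open>Strict inequalities at the indices become weak ones in the limit. A point of the ball
  has norm at most e plus that of the centre, and likewise for the images, so it has a shadow on the
  graph.\<close>

lemma star_ball_imp_near:
  assumes b: "x \<in> Bd" "v x \<in> Bd" and w: "w \<in> elts N (star_ball e x)"
  shows "w \<in> Bd" "v w \<in> Bd" "nrm eF (sub eF (shadow N G F w) (shadow N G F x)) \<le> e"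
    "nrm eF (sub eF (shadow N G F (v w)) (shadow N G F (v x))) \<le> e"
proof -
  note xF = Bd_F[OF b(1)]
  have wF: "w \<in> elts N F" using w star_ball_F[OF xF] by blast
  obtain A \<xi> \<pi> X W where o: "over A \<xi> \<pi>" and X: "\<forall>a\<in>A. X a \<in> SF (\<pi> a)" "\<forall>a\<in>A. W a \<in> SF (\<pi> a)"
    "star1 N A X \<xi> = x" "star1 N A W \<xi> = w" using represent3[OF xF wF wF] by metis
  have ev: "eventually (\<lambda>a. W a \<in> graph_ball e (\<pi> a) (X a)) (germ A \<xi>)"
    using mem_star_ball[OF o X(1) std_small_vec[OF family_car[OF o X(2)]]] w X(3,4) by simp
  have bd: "y \<le> e + C" if "nrm G (sub G p q) < e" "nrm G q \<le> C" "p \<in> car G" "q \<in> car G" "y = nrm G p" for p q y C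
    using that G.nrm_diff_le[of p q] by linarith
  obtain C D where C: "eventually (\<lambda>a. nrm G (X a) \<le> C) (germ A \<xi>)" "eventually (\<lambda>a. nrm G (mu of_real (\<pi> a) (X a)) \<le> D) (germ A \<xi>)"
    using b Bd_star1[OF o X(1)] Bd_star1[OF o family_mu[OF o]] v_star1[OF o X(1)] X(3) by auto
  have "eventually (\<lambda>a. nrm G (W a) \<le> e + C) (germ A \<xi>)"
    using ev C(1) eventually_in[OF over_generic[OF o]]
    by eventually_elim (rule bd, auto simp: graph_ball_def intro: subsetD[OF family_car[OF o X(1)]] subsetD[OF family_car[OF o X(2)]])
  then show wB: "w \<in> Bd" using Bd_star1[OF o X(2)] X(4) by blast
  have "eventually (\<lambda>a. nrm G (mu of_real (\<pi> a) (W a)) \<le> e + D) (germ A \<xi>)"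
    using ev C(2) eventually_in[OF over_generic[OF o]]
    by eventually_elim (rule bd, auto simp: graph_ball_def intro: mu_in(1)[OF over_base[OF o]])
  then show vwB: "v w \<in> Bd" using Bd_star1[OF o family_mu[OF o]] v_star1[OF o X(2)] X(4) by metis
  obtain A \<xi> \<pi> X W where X: "bfam A \<xi> \<pi> X" "bfam A \<xi> \<pi> W" "bfam A \<xi> \<pi> (\<lambda>a. mu of_real (\<pi> a) (X a))"
    "bfam A \<xi> \<pi> (\<lambda>a. mu of_real (\<pi> a) (W a))" "star1 N A X \<xi> = x" "star1 N A W \<xi> = w"
    "star1 N A (\<lambda>a. mu of_real (\<pi> a) (X a)) \<xi> = v x" "star1 N A (\<lambda>a. mu of_real (\<pi> a) (W a)) \<xi> = v w"
    by (rule represent_graph2[OF b wB vwB])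
  have ev: "eventually (\<lambda>a. W a \<in> graph_ball e (\<pi> a) (X a)) (germ A \<xi>)"
    using mem_star_ball[OF bfam_over[OF X(1)] bfam_SF[OF X(1)] std_small_vec[OF bfam_img[OF X(2)]]] w X(5,6) by simp
  note nb = germ_nonbot[OF bfam_generic[OF X(1)]]
  have "nrm eF (Sh A \<xi> (\<lambda>a. sub G (W a) (X a))) \<le> e"
    by (rule tendsto_upperbound[OF Sh_nrm[OF bfam_sub[OF X(2,1)]] _ nb], rule eventually_mono[OF ev])
       (simp add: graph_ball_def)
  then show "nrm eF (sub eF (shadow N G F w) (shadow N G F x)) \<le> e"
    using Sh_sub[OF X(2,1)] X(5,6) by (simp add: Sh_def)
  have "nrm eF (Sh A \<xi> (\<lambda>a. sub G (mu of_real (\<pi> a) (W a)) (mu of_real (\<pi> a) (X a)))) \<le> e"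
    by (rule tendsto_upperbound[OF Sh_nrm[OF bfam_sub[OF X(4,3)]] _ nb], rule eventually_mono[OF ev])
       (simp add: graph_ball_def)
  then show "nrm eF (sub eF (shadow N G F (v w)) (shadow N G F (v x))) \<le> e"
    using Sh_sub[OF X(4,3)] X(7,8) by (simp add: Sh_def)
qed

text \<open>Balls of radius 1/(k+1) are put around graph points from which both sequences vary by
  less than this radius. They have the finite intersection property, and the shadow of a point
  common to all of them is the limit.\<close>

lemma \<Gamma>_complete:
  assumes \<Gamma>: "\<And>n. (x n, y n) \<in> \<Gamma>" and cx: "cauchy_seq eF x" and cy: "cauchy_seq eF y"
  shows "\<exists>a b. (a, b) \<in> \<Gamma> \<and> (\<lambda>n. nrm eF (sub eF (x n) a)) \<longlonglongrightarrow> 0 \<and> (\<lambda>n. nrm eF (sub eF (y n) b)) \<longlonglongrightarrow> 0"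
proof -
  have "\<forall>n. \<exists>z. z \<in> Bd \<and> v z \<in> Bd \<and> x n = shadow N G F z \<and> y n = shadow N G F (v z)"
    using \<Gamma> unfolding shadow_graph_def by blast
  then obtain z where z: "\<And>n. z n \<in> Bd" "\<And>n. v (z n) \<in> Bd" "\<And>n. x n = shadow N G F (z n)" "\<And>n. y n = shadow N G F (v (z n))"
    by metis
  define e where "e k = inverse (real (Suc k))" for k
  have e: "e k > 0" for k by (simp add: e_def)
  have "\<forall>k. \<exists>r. \<forall>m\<ge>r. \<forall>n\<ge>r. nrm eF (sub eF (x m) (x n)) < e k \<and> nrm eF (sub eF (y m) (y n)) < e k"
  proof
    fix k
    obtain r s where "\<forall>m\<ge>r. \<forall>n\<ge>r. nrm eF (sub eF (x m) (x n)) < e k" "\<forall>m\<ge>s. \<forall>n\<ge>s. nrm eF (sub eF (y m) (y n)) < e k"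
      using cx cy e unfolding cauchy_seq_def by blast
    then show "\<exists>r. \<forall>m\<ge>r. \<forall>n\<ge>r. nrm eF (sub eF (x m) (x n)) < e k \<and> nrm eF (sub eF (y m) (y n)) < e k"
      by (intro exI[of _ "max r s"]) simp
  qed
  then obtain r where r: "\<And>k m n. m \<ge> r k \<Longrightarrow> n \<ge> r k \<Longrightarrow> nrm eF (sub eF (x m) (x n)) < e k \<and> nrm eF (sub eF (y m) (y n)) < e k"
    by metis
  define S where "S k = star_ball (e k) (z (r k))" for k
  have "internal N (S k)" for k unfolding S_def by (rule star_ball_F(2)[OF Bd_F[OF z(1)]])
  moreover have "(\<Inter>i\<le>K. elts N (S i)) \<noteq> {}" for K
  proof -
    \<comment> \<open>Beyond the largest of the finitely many thresholds, every term lies in all of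
      the first K + 1 balls.\<close>
    define m where "m = Max (r ` {..K})"
    have "z m \<in> elts N (S i)" if "i \<le> K" for i
    proof -
      have "m \<ge> r i" using that by (simp add: m_def)
      from r[OF this order_refl] show ?thesis
        unfolding S_def by (intro near_imp_star_ball z) (simp_all add: z(3,4)[symmetric])
    qed
    then show ?thesis by blast
  qed
  ultimately have "(\<Inter>i. elts N (S i)) \<noteq> {}" using saturated unfolding aleph1_saturated_def by blast
  then obtain w where w: "\<And>k. w \<in> elts N (star_ball (e k) (z (r k)))" by (auto simp: S_def)
  note wn = star_ball_imp_near[OF z(1,2) w]
  define a b where "a = shadow N G F w" and "b = shadow N G F (v w)"
  have ab: "(a, b) \<in> \<Gamma>" using wn(1,2) by (auto simp: shadow_graph_def a_def b_def)
  have c: "x n \<in> car eF" "y n \<in> car eF" "a \<in> car eF" "b \<in> car eF" for n using \<Gamma>_sub \<Gamma> ab by blast+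
  have d: "nrm eF (sub eF (x n) a) \<le> 2 * e k" "nrm eF (sub eF (y n) b) \<le> 2 * e k" if "n \<ge> r k" for n k
  proof -
    have "nrm eF (sub eF (x (r k)) a) \<le> e k" "nrm eF (sub eF (y (r k)) b) \<le> e k"
      using wn(3,4)[of k] eF.nrm_sub_commute[OF c(1,3)] eF.nrm_sub_commute[OF c(2,4)] by (simp_all add: z(3,4) a_def b_def)
    then show "nrm eF (sub eF (x n) a) \<le> 2 * e k" "nrm eF (sub eF (y n) b) \<le> 2 * e k"
      using r[OF that order_refl] eF.nrm_triangle[OF c(1) c(1) c(3), of n "r k"] eF.nrm_triangle[OF c(2) c(2) c(4), of n "r k"]
      by linarith+
  qed
  have lim: "f \<longlonglongrightarrow> 0" if f: "\<And>n k. n \<ge> r k \<Longrightarrow> f n \<le> 2 * e k" "\<And>n. 0 \<le> f n" for f :: "nat \<Rightarrow> real"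
  proof (rule LIMSEQ_I)
    fix \<epsilon> :: real assume "\<epsilon> > 0"
    then obtain k where k: "e k < \<epsilon> / 2" using reals_Archimedean[of "\<epsilon>/2"] by (auto simp: e_def)
    show "\<exists>no. \<forall>n\<ge>no. norm (f n - 0) < \<epsilon>"
    proof (intro exI[of _ "r k"] allI impI)
      fix n assume "n \<ge> r k"
      then show "norm (f n - 0) < \<epsilon>" using f(1)[of k n] f(2)[of n] k by simp
    qed
  qed
  have "(\<lambda>n. nrm eF (sub eF (x n) a)) \<longlonglongrightarrow> 0" by (rule lim[OF d(1)]) (use c in simp_all)
  moreover have "(\<lambda>n. nrm eF (sub eF (y n) b)) \<longlonglongrightarrow> 0" by (rule lim[OF d(2)]) (use c in simp_all)
  ultimately show ?thesis using ab by blast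
qed

text \<open>This is (t + \<i>) / (t - \<i>), written so that the fixed vectors of the Cayley
  transform are visibly the kernel of the resolvent.\<close>

definition cay :: "real \<Rightarrow> complex" where "cay t = 1 + 2 * \<i> * resolvent \<i> t"

lemma sub_scl_star1:
  assumes o: "over A \<xi> \<pi>" and X: "\<forall>a\<in>A. X a \<in> SF (\<pi> a)"
  shows "vsub N G (v (star1 N A X \<xi>)) (vscl N G (cnum N c) (star1 N A X \<xi>)) =
      star1 N A (\<lambda>a. sub G (mu of_real (\<pi> a) (X a)) (scl G c (X a))) \<xi>"
    "vadd N G (v (star1 N A X \<xi>)) (vscl N G (cnum N c) (star1 N A X \<xi>)) =
      star1 N A (\<lambda>a. add G (mu of_real (\<pi> a) (X a)) (scl G c (X a))) \<xi>"
proof -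
  note g = over_generic[OF o]
  have s: "vscl N G (cnum N c) (star1 N A X \<xi>) = star1 N A (\<lambda>a. scl G c (X a)) \<xi>"
    using vscl_star1[OF space g family_car[OF o X], of "\<lambda>_. c"] hc_const[OF g] by simp
  have c: "(\<lambda>a. scl G c (X a)) ` A \<subseteq> car G" using family_car[OF o X] by (auto simp: image_subset_iff)
  show "vsub N G (v (star1 N A X \<xi>)) (vscl N G (cnum N c) (star1 N A X \<xi>)) =
      star1 N A (\<lambda>a. sub G (mu of_real (\<pi> a) (X a)) (scl G c (X a))) \<xi>"
    unfolding s v_star1[OF o X] by (rule vsub_star1[OF g family_car[OF o family_mu[OF o]] c])
  show "vadd N G (v (star1 N A X \<xi>)) (vscl N G (cnum N c) (star1 N A X \<xi>)) =
      star1 N A (\<lambda>a. add G (mu of_real (\<pi> a) (X a)) (scl G c (X a))) \<xi>"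
    unfolding s v_star1[OF o X] by (rule vadd_star1[OF space g family_car[OF o family_mu[OF o]] c])
qed

lemma resolvent_mu:
  assumes a: "a \<in> A0" and y: "y \<in> SF a"
  shows "sub G (mu of_real a (mu (resolvent \<i>) a y)) (scl G \<i> (mu (resolvent \<i>) a y)) = y"
    "mu (resolvent \<i>) a (sub G (mu of_real a y) (scl G \<i> y)) = y"
    "add G (mu of_real a (mu (resolvent \<i>) a y)) (scl G \<i> (mu (resolvent \<i>) a y)) = mu cay a y"
proof -
  have i: "(of_real t - \<i>) * resolvent \<i> t = 1" for t
    using bounded_resolvent(3)[of \<i> t] by simp
  have r: "of_real t * (resolvent \<i> t * p) - \<i> * (resolvent \<i> t * p) = p"
    "resolvent \<i> t * (of_real t * p - \<i> * p) = p"
    "of_real t * (resolvent \<i> t * p) + \<i> * (resolvent \<i> t * p) = cay t * p" for t p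
  proof -
    have "of_real t * (resolvent \<i> t * p) - \<i> * (resolvent \<i> t * p) = ((of_real t - \<i>) * resolvent \<i> t) * p"
      by (simp add: left_diff_distrib mult.assoc)
    then show 1: "of_real t * (resolvent \<i> t * p) - \<i> * (resolvent \<i> t * p) = p" unfolding i by simp
    have "resolvent \<i> t * (of_real t * p - \<i> * p) = of_real t * (resolvent \<i> t * p) - \<i> * (resolvent \<i> t * p)"
      by (simp add: right_diff_distrib mult.left_commute)
    then show "resolvent \<i> t * (of_real t * p - \<i> * p) = p" using 1 by simp
    have "of_real t * (resolvent \<i> t * p) = p + \<i> * (resolvent \<i> t * p)" using 1 by (simp add: diff_eq_eq)
    then show "of_real t * (resolvent \<i> t * p) + \<i> * (resolvent \<i> t * p) = cay t * p"
      by (simp add: cay_def distrib_right)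
  qed
  note S = SF[OF a, unfolded subspace_of_def]
  have SF_sub: "sub G p q \<in> SF a" if "p \<in> SF a" "q \<in> SF a" for p q using S that by (simp add: sub_def)
  have yc: "y \<in> car G" using SF_car[OF a] y by blast
  have b: "b \<in> car G" if "b \<in> SB a" for b using SB_car[OF a] that by blast
  note c = mu_in(1)[OF a] and m = mu_in(2)[OF a]
  show "sub G (mu of_real a (mu (resolvent \<i>) a y)) (scl G \<i> (mu (resolvent \<i>) a y)) = y"
  proof (rule SF_eqI[OF a _ y])
    show "sub G (mu of_real a (mu (resolvent \<i>) a y)) (scl G \<i> (mu (resolvent \<i>) a y)) \<in> SF a"
      using SF_sub m S by simp
    fix x assume x: "x \<in> SB a"
    show "ip G x (sub G (mu of_real a (mu (resolvent \<i>) a y)) (scl G \<i> (mu (resolvent \<i>) a y))) = ip G x y"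
      using b[OF x] c by (simp add: ip_mu[OF a x] r)
  qed
  show "mu (resolvent \<i>) a (sub G (mu of_real a y) (scl G \<i> y)) = y"
  proof (rule SF_eqI[OF a m y])
    fix x assume x: "x \<in> SB a"
    show "ip G x (mu (resolvent \<i>) a (sub G (mu of_real a y) (scl G \<i> y))) = ip G x y"
      using b[OF x] c yc by (simp add: ip_mu[OF a x] r)
  qed
  show "add G (mu of_real a (mu (resolvent \<i>) a y)) (scl G \<i> (mu (resolvent \<i>) a y)) = mu cay a y"
  proof (rule SF_eqI[OF a _ m])
    show "add G (mu of_real a (mu (resolvent \<i>) a y)) (scl G \<i> (mu (resolvent \<i>) a y)) \<in> SF a"
      using m S by simp
    fix x assume x: "x \<in> SB a"
    show "ip G x (add G (mu of_real a (mu (resolvent \<i>) a y)) (scl G \<i> (mu (resolvent \<i>) a y))) = ip G x (mu cay a y)"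
      using b[OF x] c by (simp add: ip_mu[OF a x] r)
  qed
qed

text \<open>\<open>cayley\<close> picks the solution x of (v - \<i>) x = y by a description. At each
  index the resolvent gives a solution and is also a left inverse, which yields existence and
  uniqueness.\<close>

lemma cayley_eq:
  assumes y: "y \<in> elts N F" shows "cayley N G F v y = mult cay y"
proof -
  obtain A \<xi> \<pi> Y where o: "over A \<xi> \<pi>" and Y: "\<forall>a\<in>A. Y a \<in> SF (\<pi> a)" "star1 N A Y \<xi> = y"
    using represent3[OF y y y] by metis
  note fY = family_car[OF o Y(1)] and m = family_mu[OF o] and g = over_generic[OF o]
  define R where "R = (\<lambda>a. mu (resolvent \<i>) (\<pi> a) (Y a))"
  have R: "\<forall>a\<in>A. R a \<in> SF (\<pi> a)" using m unfolding R_def by blast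
  have "(THE x. x \<in> elts N F \<and> vsub N G (v x) (vscl N G (cnum N \<i>) x) = y) = star1 N A R \<xi>"
  proof (rule the_equality)
    have c: "(\<lambda>a. sub G (mu of_real (\<pi> a) (R a)) (scl G \<i> (R a))) ` A \<subseteq> car G"
      using family_car[OF o R] family_car[OF o m] by (auto simp: image_subset_iff)
    have "star1 N A (\<lambda>a. sub G (mu of_real (\<pi> a) (R a)) (scl G \<i> (R a))) \<xi> = star1 N A Y \<xi>"
      by (rule star1_cong[OF g c fY]) (use resolvent_mu(1) over_base[OF o] Y(1) in \<open>simp add: R_def\<close>)
    then show "star1 N A R \<xi> \<in> elts N F \<and> vsub N G (v (star1 N A R \<xi>)) (vscl N G (cnum N \<i>) (star1 N A R \<xi>)) = y"
      using family_F[OF o R] sub_scl_star1(1)[OF o R] Y(2) by simp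
    fix x assume x: "x \<in> elts N F \<and> vsub N G (v x) (vscl N G (cnum N \<i>) x) = y"
    \<comment> \<open>A competing solution x has to be represented on another index. The two
      solutions are compared through \<open>mult (resolvent \<i>) y\<close>, which does not refer to
      an index.\<close>
    have Rm: "star1 N A R \<xi> = mult (resolvent \<i>) y" using mult_star1[OF o Y(1)] Y(2) by (simp add: R_def)
    obtain A' \<xi>' \<pi>' X Y' where o': "over A' \<xi>' \<pi>'" and X: "\<forall>a\<in>A'. X a \<in> SF (\<pi>' a)" "\<forall>a\<in>A'. Y' a \<in> SF (\<pi>' a)"
      "star1 N A' X \<xi>' = x" "star1 N A' Y' \<xi>' = y" using represent3[OF conjunct1[OF x] y y] by metis
    have c': "(\<lambda>a. sub G (mu of_real (\<pi>' a) (X a)) (scl G \<i> (X a))) ` A' \<subseteq> car G"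
      using family_car[OF o' X(1)] family_car[OF o' family_mu[OF o']] by (auto simp: image_subset_iff)
    have "star1 N A' (\<lambda>a. sub G (mu of_real (\<pi>' a) (X a)) (scl G \<i> (X a))) \<xi>' = star1 N A' Y' \<xi>'"
      using x sub_scl_star1(1)[OF o' X(1)] X by simp
    then have "eventually (\<lambda>a. sub G (mu of_real (\<pi>' a) (X a)) (scl G \<i> (X a)) = Y' a) (germ A' \<xi>')"
      using los_eq[OF over_generic[OF o'] std_small_vec[OF c'] std_small_vec[OF family_car[OF o' X(2)]]] by simp
    then have "eventually (\<lambda>a. X a = mu (resolvent \<i>) (\<pi>' a) (Y' a)) (germ A' \<xi>')"
      using eventually_in[OF over_generic[OF o']]
    proof eventually_elim
      case (elim a)
      then show ?case using resolvent_mu(2)[OF over_base[OF o' elim(2)] bspec[OF X(1) elim(2)]] by simp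
    qed
    then have "star1 N A' X \<xi>' = star1 N A' (\<lambda>a. mu (resolvent \<i>) (\<pi>' a) (Y' a)) \<xi>'"
      using los_eq[OF over_generic[OF o'] std_small_vec[OF family_car[OF o' X(1)]] std_small_vec[OF family_car[OF o' family_mu[OF o']]]] by simp
    then show "x = star1 N A R \<xi>" using mult_star1[OF o' X(2)] X(3,4) Rm by simp
  qed
  then have "cayley N G F v y = star1 N A (\<lambda>a. add G (mu of_real (\<pi> a) (R a)) (scl G \<i> (R a))) \<xi>"
    unfolding cayley_def Let_def using sub_scl_star1(2)[OF o R] by simp
  also have "\<dots> = star1 N A (\<lambda>a. mu cay (\<pi> a) (Y a)) \<xi>"
  proof (rule star1_cong[OF g _ family_car[OF o m]])
    show "(\<lambda>a. add G (mu of_real (\<pi> a) (R a)) (scl G \<i> (R a))) ` A \<subseteq> car G"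
      using family_car[OF o R] family_car[OF o m] by (auto simp: image_subset_iff)
  qed (use resolvent_mu(3) over_base[OF o] Y(1) in \<open>simp add: R_def\<close>)
  also have "\<dots> = mult cay y" using mult_star1[OF o Y(1)] Y(2) by simp
  finally show ?thesis .
qed

text \<open>The transform acts on the hull as k + 2\<i> R k, with R the operator of the resolvent.
  This identifies the carrier of \<open>hull_fin\<close> with \<open>Hf\<close>.\<close>

lemma cayley_fixed:
  assumes k: "k \<in> car eF" shows "hull_map N G F (cayley N G F v) k = k \<longleftrightarrow> M (resolvent \<i>) k = zer eF"
proof -
  obtain x where x: "x \<in> Bd" "k = shadow N G F x" using k by (auto simp: hilbert_hull_def)
  have "hull_map N G F (cayley N G F v) k = M cay k"
    using cayley_eq[OF Bd_F[OF rep_shadow(1)[OF x(1)]]] by (simp add: hull_map_def M_def x(2))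
  also have r: "bounded (range (resolvent \<i>))" using bounded_resolvent(1)[of \<i>] by (auto simp: bounded_iff)
  have "M cay k = add eF k (scl eF (2 * \<i>) (M (resolvent \<i>) k))"
  proof -
    have "M cay k = add eF (M (\<lambda>_. 1) k) (M (\<lambda>t. 2 * \<i> * resolvent \<i> t) k)"
      unfolding cay_def[abs_def] by (rule M_add_fun[OF bounded_range_const bounded_range_mult[OF bounded_range_const r] k])
    also have "M (\<lambda>_. 1) k = k" unfolding M_const[OF k] by (rule eF.ip_eqI) (use k in auto)
    also have "M (\<lambda>t. 2 * \<i> * resolvent \<i> t) k = scl eF (2 * \<i>) (M (resolvent \<i>) k)"
      using M_mult[OF bounded_range_const r k, of "2 * \<i>"] M_const[OF M_in[OF r k]] by simp
    finally show ?thesis .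
  qed
  finally have eq: "hull_map N G F (cayley N G F v) k = add eF k (scl eF (2 * \<i>) (M (resolvent \<i>) k))" .
  define z where "z = M (resolvent \<i>) k"
  have z: "z \<in> car eF" unfolding z_def by (rule M_in[OF r k])
  have "add eF k (scl eF (2 * \<i>) z) = k \<longleftrightarrow> z = zer eF"
  proof
    assume a: "add eF k (scl eF (2 * \<i>) z) = k"
    show "z = zer eF"
    proof (rule eF.ip_eqI[OF z eF.zer_in])
      fix y assume y: "y \<in> car eF"
      have "ip eF y (add eF k (scl eF (2 * \<i>) z)) = ip eF y k" using a by simp
      then show "ip eF y z = ip eF y (zer eF)" using y k z by simp
    qed
  next
    assume "z = zer eF"
    then show "add eF k (scl eF (2 * \<i>) z) = k" by (intro eF.ip_eqI) (use k z in auto)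
  qed
  then show ?thesis using eq by (simp add: z_def)
qed

abbreviation emb :: "'a \<Rightarrow> 'a set" where "emb \<equiv> hull_embed N G F"

text \<open>As \<open>star N g\<close> lies in F, the vector g lies in almost every section. For
  finitely many vectors this can be arranged at every index, and constant families then represent
  them.\<close>

lemma represent_standard:
  assumes "finite S" "S \<subseteq> car G"
  obtains A where "over A \<xi>0 (\<lambda>a. a)" "\<forall>a\<in>A. S \<subseteq> SF a"
    "\<forall>g\<in>S. bfam A \<xi>0 (\<lambda>a. a) (\<lambda>_. g) \<and> emb g = Sh A \<xi>0 (\<lambda>_. g)"
proof -
  have std: "g \<in> standard_universe N" if "g \<in> S" for g using std_small_mem[OF G_small] assms(2) that by blast
  have "eventually (\<lambda>a. g \<in> SF a) (germ A0 \<xi>0)" if "g \<in> S" for g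
    using in_F[OF over_id std_small_const[OF std[OF that]]] star1_const[OF \<xi>0 std[OF that]] star_F assms(2) that by auto
  then have ev: "eventually (\<lambda>a. \<forall>g\<in>S. g \<in> SF a) (germ A0 \<xi>0)" using assms(1) by (intro eventually_ball_finite) auto
  define A where "A = {a \<in> A0. \<forall>g\<in>S. g \<in> SF a}"
  have o: "over A \<xi>0 (\<lambda>a. a)" unfolding A_def by (rule over_shrink[OF over_id ev])
  have "bfam A \<xi>0 (\<lambda>a. a) (\<lambda>_. g)" if "g \<in> S" for g using o that by (auto simp: bfam_def A_def)
  moreover have "emb g = Sh A \<xi>0 (\<lambda>_. g)" if "g \<in> S" for g
    using star1_const[OF over_generic[OF o] std[OF that]] by (simp add: hull_embed_def Sh_def)
  ultimately show thesis by (intro that[OF o]) (auto simp: A_def)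
qed

lemma emb_linear: "linear_map G eF emb"
  unfolding linear_map_def
proof (intro conjI ballI allI)
  show "emb ` car G \<subseteq> car eF"
  proof clarify
    fix x assume "x \<in> car G"
    then show "emb x \<in> car eF" using represent_standard[of "{x}"] Sh_in by (metis empty_subsetI finite.emptyI finite.insertI insertI1 insert_subset)
  qed
  fix x assume x: "x \<in> car G"
  show "emb (add G x y) = add eF (emb x) (emb y)" if y: "y \<in> car G" for y
  proof -
    have "finite {x, y, add G x y}" "{x, y, add G x y} \<subseteq> car G" using x y by auto
    then obtain A where "\<forall>g\<in>{x, y, add G x y}. bfam A \<xi>0 (\<lambda>a. a) (\<lambda>_. g) \<and> emb g = Sh A \<xi>0 (\<lambda>_. g)"
      by (rule represent_standard)
    then have A: "g \<in> {x, y, add G x y} \<Longrightarrow> bfam A \<xi>0 (\<lambda>a. a) (\<lambda>_. g)" "g \<in> {x, y, add G x y} \<Longrightarrow> emb g = Sh A \<xi>0 (\<lambda>_. g)" for g by blast+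
    show ?thesis using Sh_add[OF A(1)[of x] A(1)[of y]] A(2) by simp
  qed
  show "emb (scl G c x) = scl eF c (emb x)" for c
  proof -
    have "finite {x, scl G c x}" "{x, scl G c x} \<subseteq> car G" using x by auto
    then obtain A where "\<forall>g\<in>{x, scl G c x}. bfam A \<xi>0 (\<lambda>a. a) (\<lambda>_. g) \<and> emb g = Sh A \<xi>0 (\<lambda>_. g)"
      by (rule represent_standard)
    then have A: "g \<in> {x, scl G c x} \<Longrightarrow> bfam A \<xi>0 (\<lambda>a. a) (\<lambda>_. g)" "g \<in> {x, scl G c x} \<Longrightarrow> emb g = Sh A \<xi>0 (\<lambda>_. g)" for g by blast+
    show ?thesis using Sh_scl[OF A(1)[of x]] A(2) by simp
  qed
qed

lemma emb_ip:
  assumes "x \<in> car G" "y \<in> car G" shows "ip eF (emb x) (emb y) = ip G x y"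
proof -
  have "finite {x, y}" "{x, y} \<subseteq> car G" using assms by auto
  then obtain A where "\<forall>g\<in>{x, y}. bfam A \<xi>0 (\<lambda>a. a) (\<lambda>_. g) \<and> emb g = Sh A \<xi>0 (\<lambda>_. g)"
      by (rule represent_standard)
    then have A: "g \<in> {x, y} \<Longrightarrow> bfam A \<xi>0 (\<lambda>a. a) (\<lambda>_. g)" "g \<in> {x, y} \<Longrightarrow> emb g = Sh A \<xi>0 (\<lambda>_. g)" for g by blast+
  have "((\<lambda>_. ip G x y) \<longlongrightarrow> ip eF (emb x) (emb y)) (germ A \<xi>0)" using Sh_ip[OF A(1)[of x] A(1)[of y]] A(2) by simp
  from tendsto_unique[OF germ_nonbot[OF bfam_generic[OF A(1)[of x]]] this tendsto_const] show ?thesis by simp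
qed

text \<open>At indices whose section contains both x and u x, the projection does not move u x: the
  compression sends x to u x exactly.\<close>

lemma emb_\<Gamma>:
  assumes x: "x \<in> car G" shows "(emb x, emb (u x)) \<in> \<Gamma>"
proof -
  have "finite {x, u x}" "{x, u x} \<subseteq> car G" using x u_in by auto
  then obtain A where A: "over A \<xi>0 (\<lambda>a. a)" "\<forall>a\<in>A. {x, u x} \<subseteq> SF a"
    "\<forall>g\<in>{x, u x}. bfam A \<xi>0 (\<lambda>a. a) (\<lambda>_. g) \<and> emb g = Sh A \<xi>0 (\<lambda>_. g)"
    by (rule represent_standard)
  have eq: "mu of_real a x = u x" if a: "a \<in> A" for a
  proof -
    have a0: "a \<in> A0" by (rule over_base[OF A(1) a])
    have m: "x \<in> SF a" "u x \<in> SF a" using A(2) a by auto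
    have "compr a x = u x"
    proof (rule SF_eqI[OF a0 compr_in(2)[OF a0] m(2)])
      fix b assume "b \<in> SB a"
      then have "b \<in> SF a" using SB(2)[OF a0] by blast
      then show "ip G b (compr a x) = ip G b (u x)" by (rule ip_compr[OF a0 _ x])
    qed
    then show ?thesis using compr_eq_mu[OF a0 m(1)] by simp
  qed
  have bx: "bfam A \<xi>0 (\<lambda>a. a) (\<lambda>_. x)" and bu: "bfam A \<xi>0 (\<lambda>a. a) (\<lambda>_. u x)" using A(3) by auto
  have bm: "bfam A \<xi>0 (\<lambda>a. a) (\<lambda>a. mu of_real a x)" using bu eq by (simp add: bfam_def)
  show ?thesis using \<Gamma>_intro[OF bx bm] Sh_cong[OF bm bu eq] A(3) by simp
qed

section \<open>The Loeb spectral measure\<close>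

text \<open>The basis vectors whose eigenvalue lies in the enlargement of S. It is internal for
  every set S of reals, Borel or not.\<close>

definition spec :: "real set \<Rightarrow> 'a set" where
  "spec S = iset A0 \<xi>0 (\<lambda>a. {b \<in> SB a. lam b \<in> S})"

lemma spec_star1:
  assumes o: "over A \<xi> \<pi>" and g: "std_small (g ` A)"
  shows "star1 N A g \<xi> \<in> spec S \<longleftrightarrow> eventually (\<lambda>a. g a \<in> SB (\<pi> a) \<and> lam (g a) \<in> S) (germ A \<xi>)"
proof -
  have "{b \<in> SB a. lam b \<in> S} \<subseteq> car G" if "a \<in> A0" for a using SB_car[OF that] by blast
  from in_base_iset[OF o G_small this g] show ?thesis by (simp add: spec_def)
qed

lemma spec_UNIV: "spec UNIV = elts N B"
  by (simp add: spec_def B_eq)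

lemma spec_subset: "spec S \<subseteq> elts N B"
  unfolding spec_def B_eq by (rule iset_mono[OF \<xi>0 G_small SB_car]) auto

lemma spec_internal: "spec S \<in> internal_subsets N B"
proof -
  have "{b \<in> SB a. lam b \<in> S} \<subseteq> car G" if "a \<in> A0" for a using SB_car[OF that] by blast
  note i = internal_iset[OF \<xi>0 G_small this]
  show ?thesis
    unfolding internal_subsets_def
    by (intro CollectI exI[of _ "star1 N A0 (\<lambda>a. the_set N {b \<in> SB a. lam b \<in> S}) \<xi>0"] conjI i)
       (use spec_subset[of S] in \<open>simp_all add: spec_def iset_def\<close>)
qed

lemma B_sub_F: "elts N B \<subseteq> elts N F"
  unfolding B_eq F_eq by (rule iset_mono[OF \<xi>0 G_small SF_car SB(2)])

text \<open>b and \<open>\<Lambda> b\<close> are represented on one index; the eigenvector equation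
  then holds for almost all sections and compares the given eigenvalue with
  \<open>lam\<close>.\<close>

lemma represent_eigenvector:
  assumes b: "b \<in> elts N B"
  obtains A \<xi> \<pi> g where "over A \<xi> \<pi>" "\<forall>a\<in>A. g a \<in> SB (\<pi> a)" "star1 N A g \<xi> = b"
    "\<Lambda> b = hc A \<xi> (\<lambda>a. of_real (lam (g a)))"
proof -
  have L: "\<Lambda> b \<in> star_set N (cnum N ` \<real>)" "v b = vscl N G (\<Lambda> b) b" using eigen[OF b] by (auto simp: hreal_def)
  have R: "std_small (cnum N ` \<real>)" by (rule std_small_cnum)
  have "internal N b" using internal_F B_sub_F b by blast
  moreover have "internal N (\<Lambda> b)" using L(1) R internal_iff by (auto simp: generic_def)
  ultimately have "internal N (if i = 0 then b else \<Lambda> b)" for i :: nat by simp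
  from represent_over[of 2 "\<lambda>i. if i = 0 then b else \<Lambda> b", OF this]
  obtain A \<xi> \<pi> f where o: "over A \<xi> \<pi>" and f: "\<forall>i<(2::nat). std_small (f i ` A) \<and> star1 N A (f i) \<xi> = (if i = 0 then b else \<Lambda> b)"
    by blast
  have f0: "std_small (f 0 ` A)" "star1 N A (f 0) \<xi> = b" and f1: "std_small (f 1 ` A)" "star1 N A (f 1) \<xi> = \<Lambda> b"
    using f[rule_format, of 0] f[rule_format, of 1] by simp_all
  define P where "P a \<longleftrightarrow> f 0 a \<in> SB (\<pi> a) \<and> f 1 a \<in> cnum N ` \<real>" for a
  have ev: "eventually P (germ A \<xi>)"
    unfolding P_def using in_B[OF o f0(1)] los_in[OF over_generic[OF o] f1(1) R] f0(2) f1(2) b L(1)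
    by (intro eventually_conj) simp_all
  define A' where "A' = {a \<in> A. P a}"
  have o': "over A' \<xi> \<pi>" unfolding A'_def by (rule over_shrink[OF o ev])
  note g = over_generic[OF o']
  have b': "star1 N A' (f 0) \<xi> = b" and L': "star1 N A' (f 1) \<xi> = \<Lambda> b"
    unfolding A'_def using generic_shrink(2)[OF over_generic[OF o] ev] f0 f1 by simp_all
  have SBg: "\<forall>a\<in>A'. f 0 a \<in> SB (\<pi> a)" by (simp add: A'_def P_def)
  have SFg: "\<forall>a\<in>A'. f 0 a \<in> SF (\<pi> a)" using SBg SB(2) over_base[OF o'] by blast
  have c: "f 0 ` A' \<subseteq> car G" by (rule family_car[OF o' SFg])
  have s1: "std_small (f 1 ` A')" by (rule std_small_subset[OF f1(1)]) (auto simp: A'_def)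
  have Lc: "\<Lambda> b = hc A' \<xi> (\<lambda>a. cval N (f 1 a))"
    unfolding L'[symmetric] hc_def
    by (subst los_eq[OF g s1 std_small_cnum], rule eventually_mono[OF eventually_in[OF g]]) (auto simp: A'_def P_def)
  have c2: "(\<lambda>a. scl G (cval N (f 1 a)) (f 0 a)) ` A' \<subseteq> car G" using c by (auto simp: image_subset_iff)
  have "star1 N A' (\<lambda>a. mu of_real (\<pi> a) (f 0 a)) \<xi> = star1 N A' (\<lambda>a. scl G (cval N (f 1 a)) (f 0 a)) \<xi>"
    using v_star1[OF o' SFg] L(2) Lc vscl_star1[OF space g c, of "\<lambda>a. cval N (f 1 a)"] b' by simp
  then have "eventually (\<lambda>a. mu of_real (\<pi> a) (f 0 a) = scl G (cval N (f 1 a)) (f 0 a)) (germ A' \<xi>)"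
    using los_eq[OF g std_small_vec[OF family_car[OF o' family_mu[OF o']]] std_small_vec[OF c2]] by simp
  then have "eventually (\<lambda>a. cval N (f 1 a) = of_real (lam (f 0 a))) (germ A' \<xi>)"
    using eventually_in[OF g]
  proof eventually_elim
    case (elim a)
    have a: "\<pi> a \<in> A0" and m: "f 0 a \<in> SB (\<pi> a)" "f 0 a \<in> car G"
      using over_base[OF o' elim(2)] SBg c elim(2) by auto
    \<comment> \<open>Taking the scalar product with the unit vector itself extracts the eigenvalue
      from the vector equation.\<close>
    have "ip G (f 0 a) (f 0 a) = 1" using SB(3)[OF a] m(1) by (auto simp: G.orthonormal_def)
    then show ?case using arg_cong[OF elim(1), of "ip G (f 0 a)"] ip_mu[OF a m(1)] m(2) by simp
  qed
  then have "\<Lambda> b = hc A' \<xi> (\<lambda>a. of_real (lam (f 0 a)))" unfolding Lc using hc_eq[OF g] by blast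
  with o' SBg b' show thesis by (rule that)
qed

definition val :: "'a \<Rightarrow> real" where "val b = Re (std_part N (\<Lambda> b))"
definition Bfin :: "'a set" where "Bfin = {b \<in> elts N B. limited N (\<Lambda> b)}"

lemma eigenvector_limit:
  assumes b: "b \<in> elts N B"
  obtains A \<xi> \<pi> g where "generic A \<xi>"
    "\<And>S. b \<in> spec S \<longleftrightarrow> eventually (\<lambda>a. lam (g a) \<in> S) (germ A \<xi>)"
    "b \<in> Bfin \<longleftrightarrow> (\<exists>C. eventually (\<lambda>a. \<bar>lam (g a)\<bar> \<le> C) (germ A \<xi>))"
    "b \<in> Bfin \<Longrightarrow> ((\<lambda>a. lam (g a)) \<longlongrightarrow> val b) (germ A \<xi>)"
proof -
  obtain A \<xi> \<pi> g where o: "over A \<xi> \<pi>" and g: "\<forall>a\<in>A. g a \<in> SB (\<pi> a)" "star1 N A g \<xi> = b"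
    and L: "\<Lambda> b = hc A \<xi> (\<lambda>a. of_real (lam (g a)))" by (rule represent_eigenvector[OF b])
  note ge = over_generic[OF o]
  have c: "g ` A \<subseteq> car G" using g(1) SB_car over_base[OF o] by blast
  have 1: "b \<in> spec S \<longleftrightarrow> eventually (\<lambda>a. lam (g a) \<in> S) (germ A \<xi>)" for S
  proof -
    have "eventually (\<lambda>a. g a \<in> SB (\<pi> a)) (germ A \<xi>)" using eventually_in[OF ge] by (rule eventually_mono) (use g(1) in simp)
    then show ?thesis using spec_star1[OF o std_small_vec[OF c], of S] by (simp add: g(2) eventually_conj_iff)
  qed
  have 2: "b \<in> Bfin \<longleftrightarrow> (\<exists>C. eventually (\<lambda>a. \<bar>lam (g a)\<bar> \<le> C) (germ A \<xi>))"
    using limited_hc[OF ge, of "\<lambda>a. of_real (lam (g a))"] b by (simp add: Bfin_def L)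
  have 3: "((\<lambda>a. lam (g a)) \<longlongrightarrow> val b) (germ A \<xi>)" if f: "b \<in> Bfin"
  proof -
    obtain C where "eventually (\<lambda>a. cmod (of_real (lam (g a))) \<le> C) (germ A \<xi>)" using 2 f by auto
    then obtain l where l: "((\<lambda>a. complex_of_real (lam (g a))) \<longlongrightarrow> l) (germ A \<xi>)" by (rule germ_limit[OF ge])
    have "val b = Re l" using std_part_hc[OF ge l] by (simp add: val_def L)
    then show ?thesis using tendsto_Re[OF l] by simp
  qed
  show thesis by (rule that[OF ge 1 2 3])
qed

text \<open>A limited eigenvalue is bounded by some standard n. As a countable union of internal
  sets, \<open>Bfin\<close> belongs to the Loeb \<sigma>-algebra.\<close>

lemma Bfin_eq: "Bfin = (\<Union>n. spec {- real n..real n})"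
proof (intro set_eqI iffI)
  fix b assume b: "b \<in> Bfin"
  then have bB: "b \<in> elts N B" by (simp add: Bfin_def)
  obtain A \<xi> \<pi> g where g: "generic A \<xi>" "\<And>S. b \<in> spec S \<longleftrightarrow> eventually (\<lambda>a. lam (g a) \<in> S) (germ A \<xi>)"
    "b \<in> Bfin \<longleftrightarrow> (\<exists>C. eventually (\<lambda>a. \<bar>lam (g a)\<bar> \<le> C) (germ A \<xi>))"
    using eigenvector_limit[OF bB] by metis
  obtain C where C: "eventually (\<lambda>a. \<bar>lam (g a)\<bar> \<le> C) (germ A \<xi>)" using b g(3) by blast
  obtain n where "C \<le> real n" using real_arch_simple by blast
  then have "eventually (\<lambda>a. lam (g a) \<in> {- real n..real n}) (germ A \<xi>)" by (intro eventually_mono[OF C]) auto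
  then show "b \<in> (\<Union>n. spec {- real n..real n})" using g(2) by blast
next
  fix b assume "b \<in> (\<Union>n. spec {- real n..real n})"
  then obtain n where n: "b \<in> spec {- real n..real n}" by blast
  have bB: "b \<in> elts N B" using n spec_subset by blast
  obtain A \<xi> \<pi> g where g: "\<And>S. b \<in> spec S \<longleftrightarrow> eventually (\<lambda>a. lam (g a) \<in> S) (germ A \<xi>)"
    "b \<in> Bfin \<longleftrightarrow> (\<exists>C. eventually (\<lambda>a. \<bar>lam (g a)\<bar> \<le> C) (germ A \<xi>))"
    using eigenvector_limit[OF bB] by metis
  have "eventually (\<lambda>a. lam (g a) \<in> {- real n..real n}) (germ A \<xi>)" using n g(1) by blast
  then have "eventually (\<lambda>a. \<bar>lam (g a)\<bar> \<le> real n) (germ A \<xi>)" by (rule eventually_mono) auto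
  then show "b \<in> Bfin" using g(2) by blast
qed

text \<open>A standard part at most r allows the eigenvalue to exceed r by an infinitesimal, so the
  internal conditions are strict bounds r + 1/(n+1) for all n. This shows membership in the Loeb
  \<sigma>-algebra.\<close>

lemma eigen_sublevel_eq: "eigen_sublevel N B \<Lambda> r = Bfin \<inter> (\<Inter>n. spec {..<r + inverse (real (Suc n))})"
proof -
  have "val b \<le> r \<longleftrightarrow> (\<forall>n. b \<in> spec {..<r + inverse (real (Suc n))})" if f: "b \<in> Bfin" for b
  proof -
    have bB: "b \<in> elts N B" using f by (simp add: Bfin_def)
    obtain A \<xi> \<pi> g where g: "generic A \<xi>" "\<And>S. b \<in> spec S \<longleftrightarrow> eventually (\<lambda>a. lam (g a) \<in> S) (germ A \<xi>)"
      "b \<in> Bfin \<Longrightarrow> ((\<lambda>a. lam (g a)) \<longlongrightarrow> val b) (germ A \<xi>)"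
      using eigenvector_limit[OF bB] by metis
    note lim = g(3)[OF f]
    show ?thesis
    proof
      assume le: "val b \<le> r"
      have "eventually (\<lambda>a. lam (g a) < r + inverse (real (Suc n))) (germ A \<xi>)" for n
        by (rule order_tendstoD(2)[OF lim]) (use le in \<open>simp add: add_pos_pos le_less_trans\<close>)
      then show "\<forall>n. b \<in> spec {..<r + inverse (real (Suc n))}" using g(2) by simp
    next
      assume "\<forall>n. b \<in> spec {..<r + inverse (real (Suc n))}"
      then have ev: "eventually (\<lambda>a. lam (g a) < r + inverse (real (Suc n))) (germ A \<xi>)" for n using g(2) by simp
      have le: "val b \<le> r + inverse (real (Suc n))" for n
        by (rule tendsto_upperbound[OF lim eventually_mono[OF ev less_imp_le] germ_nonbot[OF g(1)]])
      show "val b \<le> r"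
      proof (rule field_le_epsilon)
        fix e :: real assume "e > 0"
        then obtain n where "inverse (real (Suc n)) < e" using reals_Archimedean by blast
        then show "val b \<le> r + e" using le[of n] by linarith
      qed
    qed
  qed
  then show ?thesis unfolding eigen_sublevel_def val_def[symmetric] by (auto simp: Bfin_def)
qed

text \<open>Along a family representing b, f of the eigenvalue tends to f of the standard part if
  the eigenvalue is limited, and to 0 otherwise, since f vanishes at infinity. Membership in each
  \<open>S k\<close> is eventually constant, so the uniform bound passes to the limit.\<close>

lemma eigenvector_C0:
  assumes b: "b \<in> elts N B" and f: "C0 f"
    and s: "\<And>t. f' t = (\<Sum>k\<in>J. c k * of_bool (t \<in> S k))" "finite J" "\<And>t. \<bar>f t - f' t\<bar> \<le> e"
  shows "\<bar>indicator Bfin b * f (val b) - (\<Sum>k\<in>J. c k * indicator (spec (S k)) b)\<bar> \<le> e"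
proof -
  obtain A \<xi> \<pi> g where g: "generic A \<xi>" "\<And>S. b \<in> spec S \<longleftrightarrow> eventually (\<lambda>a. lam (g a) \<in> S) (germ A \<xi>)"
    "b \<in> Bfin \<longleftrightarrow> (\<exists>C. eventually (\<lambda>a. \<bar>lam (g a)\<bar> \<le> C) (germ A \<xi>))"
    "b \<in> Bfin \<Longrightarrow> ((\<lambda>a. lam (g a)) \<longlongrightarrow> val b) (germ A \<xi>)"
    using eigenvector_limit[OF b] by metis
  have lim: "((\<lambda>a. f (lam (g a))) \<longlongrightarrow> indicator Bfin b * f (val b)) (germ A \<xi>)"
  proof (cases "b \<in> Bfin")
    case True
    have "isCont f (val b)" using f by (simp add: C0_def continuous_on_eq_continuous_at)
    from isCont_tendsto_compose[OF this g(4)[OF True]] show ?thesis using True by simp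
  next
    case False
    have "filterlim (\<lambda>a. lam (g a)) at_infinity (germ A \<xi>)"
      unfolding filterlim_at_infinity[OF order_refl]
    proof (intro allI impI)
      fix r :: real
      have "\<not> eventually (\<lambda>a. \<bar>lam (g a)\<bar> \<le> r) (germ A \<xi>)" using False g(3) by blast
      then have "eventually (\<lambda>a. \<not> \<bar>lam (g a)\<bar> \<le> r) (germ A \<xi>)" using eventually_not[OF g(1)] by blast
      then show "eventually (\<lambda>a. r \<le> norm (lam (g a))) (germ A \<xi>)" by (rule eventually_mono) simp
    qed
    from filterlim_compose[OF _ this, of f "nhds 0"] f False show ?thesis by (simp add: C0_def)
  qed
  have "eventually (\<lambda>a. c k * of_bool (lam (g a) \<in> S k) = c k * indicator (spec (S k)) b) (germ A \<xi>)" for k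
  proof (cases "b \<in> spec (S k)")
    case True
    then have "eventually (\<lambda>a. lam (g a) \<in> S k) (germ A \<xi>)" using g(2) by blast
    then show ?thesis by (rule eventually_mono) (use True in simp)
  next
    case False
    then have "eventually (\<lambda>a. \<not> lam (g a) \<in> S k) (germ A \<xi>)" using g(2) eventually_not[OF g(1)] by blast
    then show ?thesis by (rule eventually_mono) (use False in simp)
  qed
  then have "eventually (\<lambda>a. \<forall>k\<in>J. c k * of_bool (lam (g a) \<in> S k) = c k * indicator (spec (S k)) b) (germ A \<xi>)"
    by (intro eventually_ball_finite s(2)) blast
  then have "eventually (\<lambda>a. \<bar>f (lam (g a)) - (\<Sum>k\<in>J. c k * indicator (spec (S k)) b)\<bar> \<le> e) (germ A \<xi>)"
  proof (rule eventually_mono)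
    fix a assume "\<forall>k\<in>J. c k * of_bool (lam (g a) \<in> S k) = c k * indicator (spec (S k)) b"
    then have "f' (lam (g a)) = (\<Sum>k\<in>J. c k * indicator (spec (S k)) b)" unfolding s(1) by (intro sum.cong) auto
    then show "\<bar>f (lam (g a)) - (\<Sum>k\<in>J. c k * indicator (spec (S k)) b)\<bar> \<le> e" using s(3)[of "lam (g a)"] by simp
  qed
  from tendsto_upperbound[OF tendsto_rabs[OF tendsto_diff[OF lim tendsto_const]] this germ_nonbot[OF g(1)]]
  show ?thesis .
qed

text \<open>The level sets of the integer part of f / e; boundedness leaves finitely many. They may
  be arbitrary sets of reals, as \<open>spec\<close> is internal for each.\<close>

lemma level_approximation:
  fixes f :: "real \<Rightarrow> real"
  assumes f: "bounded (range f)" and e: "e > 0"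
  obtains f' :: "real \<Rightarrow> real" and J :: "int set" and c S where "\<And>t. f' t = (\<Sum>k\<in>J. c k * of_bool (t \<in> S k))" "finite J" "\<And>t. \<bar>f t - f' t\<bar> \<le> e"
proof -
  obtain C where C: "\<And>t. \<bar>f t\<bar> \<le> C" using f by (auto simp: bounded_iff)
  define J where "J = {\<lfloor>- C / e\<rfloor>..\<lfloor>C / e\<rfloor>}"
  have k: "\<lfloor>f t / e\<rfloor> \<in> J" for t
  proof -
    have "- C \<le> f t" "f t \<le> C" using C[of t] by auto
    then have "- C / e \<le> f t / e" "f t / e \<le> C / e" using e by (intro divide_right_mono; simp)+
    then show ?thesis unfolding J_def by (auto intro: floor_mono)
  qed
  have "of_int \<lfloor>f t / e\<rfloor> * e = (\<Sum>k\<in>J. of_int k * e * of_bool (t \<in> {t. \<lfloor>f t / e\<rfloor> = k}))" for t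
    using k[of t] by (simp add: of_bool_def if_distrib sum.delta' J_def cong: if_cong)
  moreover have "finite J" by (simp add: J_def)
  moreover have "\<bar>f t - of_int \<lfloor>f t / e\<rfloor> * e\<bar> \<le> e" for t
  proof -
    have "of_int \<lfloor>f t / e\<rfloor> \<le> f t / e" "f t / e < of_int \<lfloor>f t / e\<rfloor> + 1" by linarith+
    from iffD1[OF pos_le_divide_eq[OF e] this(1)] iffD1[OF pos_divide_less_eq[OF e] this(2)]
    show ?thesis using e by (simp add: distrib_right abs_le_iff)
  qed
  ultimately show thesis
    by (rule that[of "\<lambda>t. of_int \<lfloor>f t / e\<rfloor> * e" "\<lambda>k. of_int k * e" "\<lambda>k. {t. \<lfloor>f t / e\<rfloor> = k}" J])
qed

lemma over_extend:
  assumes X: "bfam A \<xi> \<pi> X" and \<eta>: "generic C \<eta>"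
  shows "bfam (pairs A C) (pr N \<xi> \<eta>) (\<lambda>p. \<pi> (pfst p)) (\<lambda>p. X (pfst p))"
    "star1 N (pairs A C) (\<lambda>p. X (pfst p)) (pr N \<xi> \<eta>) = star1 N A X \<xi>"
    "star1 N (pairs A C) psnd (pr N \<xi> \<eta>) = \<eta>"
proof -
  note o = bfam_over[OF X] and g = bfam_generic[OF X]
  have s: "std_small (\<pi> ` A)" by (rule std_small_subset[OF A0_small]) (use o in \<open>auto simp: over_def\<close>)
  have "over (pairs A C) (pr N \<xi> \<eta>) (\<lambda>p. \<pi> (pfst p))"
    using generic_pr[OF g \<eta>] star1_extend[OF g \<eta> s] o by (auto simp: over_def pairs_iff)
  moreover obtain K where "\<forall>a\<in>A. nrm G (X a) \<le> K" using X by (auto simp: bfam_def)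
  then have "\<forall>p\<in>pairs A C. nrm G (X (pfst p)) \<le> K" by (simp add: pairs_iff)
  moreover have "\<forall>p\<in>pairs A C. X (pfst p) \<in> SF (\<pi> (pfst p))" using bfam_SF[OF X] by (simp add: pairs_iff)
  ultimately show "bfam (pairs A C) (pr N \<xi> \<eta>) (\<lambda>p. \<pi> (pfst p)) (\<lambda>p. X (pfst p))"
    unfolding bfam_def by blast
  show "star1 N (pairs A C) (\<lambda>p. X (pfst p)) (pr N \<xi> \<eta>) = star1 N A X \<xi>"
    using star1_extend[OF g \<eta> std_small_vec[OF bfam_img[OF X]]] by simp
  show "star1 N (pairs A C) psnd (pr N \<xi> \<eta>) = \<eta>" by (rule star1_proj(2)[OF g \<eta>])
qed

abbreviation coef :: "'a \<Rightarrow> 'a \<Rightarrow> complex" where "coef b x \<equiv> complex_of_real ((cmod (ip G b x))\<^sup>2)"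

text \<open>The section, at the index a, of the graph that \<open>hypersum\<close> sums: a function
  on a finite set of basis vectors.\<close>

definition coef_graph :: "real set \<Rightarrow> 'a \<Rightarrow> 'a \<Rightarrow> 'a" where
  "coef_graph S a x = graph1 N {b \<in> SB a. lam b \<in> S} (\<lambda>b. cnum N (coef b x))"

lemma elts_coef_graph:
  assumes a: "a \<in> A0"
  shows "mem N y (coef_graph S a x) \<longleftrightarrow> (\<exists>b\<in>SB a. lam b \<in> S \<and> y = pr N b (cnum N (coef b x)))"
    "coef_graph S a x \<in> finite_functions N G" "coef_graph S a x \<notin> new_atoms N"
    "finite_sum N (coef_graph S a x) = (\<Sum>b\<in>{b \<in> SB a. lam b \<in> S}. coef b x)"
proof -
  have T: "finite {b \<in> SB a. lam b \<in> S}" "{b \<in> SB a. lam b \<in> S} \<subseteq> car G" using SB(1)[OF a] SB_car[OF a] by auto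
  have s: "std_small {b \<in> SB a. lam b \<in> S}" by (rule std_small_subset[OF G_small T(2)])
  show m: "mem N y (coef_graph S a x) \<longleftrightarrow> (\<exists>b\<in>SB a. lam b \<in> S \<and> y = pr N b (cnum N (coef b x)))" for y
    unfolding coef_graph_def mem_graph1(2)[OF s std_small_cnum] by blast
  show "coef_graph S a x \<in> finite_functions N G"
    unfolding coef_graph_def finite_functions_def
    by (intro CollectI exI[of _ "{b \<in> SB a. lam b \<in> S}"] exI[of _ "\<lambda>b. coef b x"] conjI refl T)
  show "coef_graph S a x \<notin> new_atoms N"
    unfolding coef_graph_def graph1_def by (rule the_set_props(1)[OF std_small_small[OF mem_graph1(1)[OF s std_small_cnum]]])
  have d: "{b. \<exists>y. mem N (pr N b y) (coef_graph S a x)} = {b \<in> SB a. lam b \<in> S}" by (auto simp: m)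
  have "app N (coef_graph S a x) b = cnum N (coef b x)" if "b \<in> {b \<in> SB a. lam b \<in> S}" for b
    unfolding app_def m using that by (intro the_equality) auto
  then show "finite_sum N (coef_graph S a x) = (\<Sum>b\<in>{b \<in> SB a. lam b \<in> S}. coef b x)"
    unfolding finite_sum_def d by (intro sum.cong) simp_all
qed

lemma finite_functions_small: "std_small (finite_functions N G)"
proof (rule std_small_subset[OF std_small_sets[OF std_small_pairs[OF G_small std_small_cset]]])
  show "finite_functions N G \<subseteq> the_set N ` Pow (pairs (car G) (cset N))"
    unfolding finite_functions_def graph1_def pairs_def cset_def by blast
qed

lemma atoms_star: "star_set N (atoms N) = new_atoms N"
  using nonstandard_universe by (simp add: nonstandard_universe_def star_set_def)

text \<open>\<open>hypersum\<close> receives a graph formed by \<open>the_set\<close> from an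
  external description; to evaluate it, the graph has to be recognized as an internal object with
  known sections. The elements are compared in both directions, each on an index enlarged by the
  element in question, and extensionality concludes.\<close>

lemma graph_spec:
  assumes X: "bfam A \<xi> \<pi> X"
  defines "f \<equiv> \<lambda>b. hc1 N (\<lambda>z. of_real ((cmod z)\<^sup>2)) (vip N G b (star1 N A X \<xi>))"
  shows "graph1 N (spec S) f = star1 N A (\<lambda>a. coef_graph S (\<pi> a) (X a)) \<xi>"
proof -
  note o = bfam_over[OF X] and g = bfam_generic[OF X]
  define \<gamma> where "\<gamma> = (\<lambda>a. coef_graph S (\<pi> a) (X a))"
  have \<gamma>F: "\<gamma> ` A \<subseteq> finite_functions N G" unfolding \<gamma>_def using elts_coef_graph(2)[OF over_base[OF o]] by blast
  have \<gamma>s: "std_small (\<gamma> ` A)" by (rule std_small_subset[OF finite_functions_small \<gamma>F])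
  have fin: "f b \<in> hcomplex N" if "b \<in> spec S" for b
  proof -
    have gb: "generic (car G) b" using that spec_subset B_sub_F F_sub G_small by (auto simp: generic_def)
    note e = over_extend[OF X gb]
    have c: "psnd ` pairs A (car G) \<subseteq> car G" by (auto simp: pairs_iff)
    have "f b = hc (pairs A (car G)) (pr N \<xi> b) (\<lambda>p. coef (psnd p) (X (pfst p)))"
      unfolding f_def using vip_star1[OF bfam_generic[OF e(1)] c bfam_img[OF e(1)]] hc1_hc[OF bfam_generic[OF e(1)]] e(2,3) by simp
    then show ?thesis using hc_in[OF bfam_generic[OF e(1)]] by simp
  qed
  have sm: "small (spec S)" unfolding spec_def iset_def by (rule small_elts)
  have smf: "small (f ` spec S)"
    by (rule small_subset[of "hcomplex N"]) (use small_elts fin in \<open>auto simp: hcomplex_def star_set_def\<close>)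
  have el: "elts N (graph1 N (spec S) f) = {pr N b (f b) |b. b \<in> spec S}" by (rule elts_graph1[OF sm smf])
  have "{pr N b (f b) |b. b \<in> spec S} \<subseteq> pairs (spec S) (f ` spec S)" by (auto simp: pairs_def)
  then have na: "graph1 N (spec S) f \<notin> new_atoms N"
    unfolding graph1_def by (intro the_set_props(1) small_subset[OF small_pairs[OF sm smf]])
  \<comment> \<open>Extensionality fails for atoms, which have no elements either, so it must be
    excluded that the internal object is an atom of the enlargement. Its sections are not atoms, and
    the new atoms are the enlargement of the old ones.\<close>
  have "std_small (atoms N)" unfolding std_small_def by (rule exI[of _ 0]) simp
  from los_in[OF g \<gamma>s this] have nb: "star1 N A \<gamma> \<xi> \<notin> new_atoms N"
    unfolding atoms_star
  proof -
    assume *: "star1 N A \<gamma> \<xi> \<in> new_atoms N \<longleftrightarrow> eventually (\<lambda>a. \<gamma> a \<in> atoms N) (germ A \<xi>)"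
    have "eventually (\<lambda>a. \<not> \<gamma> a \<in> atoms N) (germ A \<xi>)"
      by (rule eventually_mono[OF eventually_in[OF g]])
         (use elts_coef_graph(3)[OF over_base[OF o]] atoms_sub in \<open>auto simp: \<gamma>_def\<close>)
    then show ?thesis using * eventually_not[OF g] by blast
  qed
  have "elts N (star1 N A \<gamma> \<xi>) = {pr N b (f b) |b. b \<in> spec S}"
  proof (intro set_eqI iffI)
    fix y assume "y \<in> {pr N b (f b) |b. b \<in> spec S}"
    then obtain b where b: "b \<in> spec S" "y = pr N b (f b)" by blast
    have gb: "generic (car G) b" using b(1) spec_subset B_sub_F F_sub G_small by (auto simp: generic_def)
    note e = over_extend[OF X gb]
    define A' \<xi>' where "A' = pairs A (car G)" and "\<xi>' = pr N \<xi> b"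
    note e' = e[folded A'_def \<xi>'_def]
    note g' = bfam_generic[OF e'(1)]
    have c: "psnd ` A' \<subseteq> car G" by (auto simp: A'_def pairs_iff)
    have fb: "f b = hc A' \<xi>' (\<lambda>p. coef (psnd p) (X (pfst p)))"
      unfolding f_def using vip_star1[OF g' c bfam_img[OF e'(1)]] hc1_hc[OF g'] e'(2,3) by simp
    have y: "y = star1 N A' (\<lambda>p. pr N (psnd p) (cnum N (coef (psnd p) (X (pfst p))))) \<xi>'"
      using los_pr[OF g' std_small_vec[OF c] std_small_cnum, of "\<lambda>p. coef (psnd p) (X (pfst p))"] e'(3)
      by (simp only: b(2) fb hc_def)
    have "eventually (\<lambda>p. psnd p \<in> SB (\<pi> (pfst p)) \<and> lam (psnd p) \<in> S) (germ A' \<xi>')"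
      using spec_star1[OF bfam_over[OF e'(1)] std_small_vec[OF c]] b(1) e'(3) by simp
    then have ev: "eventually (\<lambda>p. mem N (pr N (psnd p) (cnum N (coef (psnd p) (X (pfst p))))) (\<gamma> (pfst p))) (germ A' \<xi>')"
      using eventually_in[OF g']
    proof eventually_elim
      case (elim p)
      then show ?case unfolding \<gamma>_def elts_coef_graph(1)[OF over_base[OF bfam_over[OF e'(1)] elim(2)]] by blast
    qed
    have s: "std_small ((\<lambda>p. \<gamma> (pfst p)) ` A')" by (rule std_small_subset[OF \<gamma>s]) (auto simp: A'_def pairs_iff)
    have "star1 N A' (\<lambda>p. \<gamma> (pfst p)) \<xi>' = star1 N A \<gamma> \<xi>"
      using star1_extend[OF g gb \<gamma>s] by (simp add: A'_def \<xi>'_def)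
    then show "y \<in> elts N (star1 N A \<gamma> \<xi>)"
      using los_mem[OF g' std_small_pr[OF std_small_vec[OF c] std_small_cnum] s] ev y by (simp add: elts_def)
  next
    fix y assume y: "y \<in> elts N (star1 N A \<gamma> \<xi>)"
    define C where "C = pairs (car G) (cset N)"
    have Cs: "std_small C" unfolding C_def by (rule std_small_pairs[OF G_small std_small_cset])
    have "eventually (\<lambda>a. elts N (\<gamma> a) \<subseteq> C) (germ A \<xi>)"
    proof (rule eventually_mono[OF eventually_in[OF g]])
      fix a assume a: "a \<in> A"
      have "\<pi> a \<in> A0" by (rule over_base[OF o a])
      then show "elts N (\<gamma> a) \<subseteq> C"
        using SB_car[of "\<pi> a"] by (auto simp: \<gamma>_def elts_def elts_coef_graph(1) C_def pairs_iff cset_def)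
    qed
    then have gy: "generic C y" using elts_star1_subset[OF g \<gamma>s Cs] y Cs by (auto simp: generic_def)
    note e = over_extend[OF X gy]
    define A' \<xi>' where "A' = pairs A C" and "\<xi>' = pr N \<xi> y"
    note e' = e[folded A'_def \<xi>'_def]
    note g' = bfam_generic[OF e'(1)]
    have ps: "psnd ` A' \<subseteq> C" by (auto simp: A'_def pairs_iff)
    define \<beta> where "\<beta> p = pfst (psnd p)" for p
    have c: "\<beta> ` A' \<subseteq> car G" using ps by (auto simp: \<beta>_def C_def pairs_iff)
    define b where "b = star1 N A' \<beta> \<xi>'"
    have s: "std_small ((\<lambda>p. \<gamma> (pfst p)) ` A')" by (rule std_small_subset[OF \<gamma>s]) (auto simp: A'_def pairs_iff)
    have "star1 N A' (\<lambda>p. \<gamma> (pfst p)) \<xi>' = star1 N A \<gamma> \<xi>"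
      using star1_extend[OF g gy \<gamma>s] by (simp add: A'_def \<xi>'_def)
    then have "eventually (\<lambda>p. mem N (psnd p) (\<gamma> (pfst p))) (germ A' \<xi>')"
      using los_mem[OF g' std_small_subset[OF Cs ps] s] y e'(3) by (simp add: elts_def)
    then have ev: "eventually (\<lambda>p. (\<beta> p \<in> SB (\<pi> (pfst p)) \<and> lam (\<beta> p) \<in> S) \<and>
        psnd p = pr N (\<beta> p) (cnum N (coef (\<beta> p) (X (pfst p))))) (germ A' \<xi>')"
      using eventually_in[OF g']
    proof eventually_elim
      case (elim p)
      from elim(1) show ?case
        unfolding \<gamma>_def elts_coef_graph(1)[OF over_base[OF bfam_over[OF e'(1)] elim(2)]] by (auto simp: \<beta>_def)
    qed
    have "b \<in> spec S"
      unfolding b_def spec_star1[OF bfam_over[OF e'(1)] std_small_vec[OF c]] by (rule eventually_mono[OF ev]) blast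
    moreover have "y = pr N b (f b)"
    proof -
      have "y = star1 N A' psnd \<xi>'" using e'(3) by simp
      also have "\<dots> = star1 N A' (\<lambda>p. pr N (\<beta> p) (cnum N (coef (\<beta> p) (X (pfst p))))) \<xi>'"
        unfolding los_eq[OF g' std_small_subset[OF Cs ps] std_small_pr[OF std_small_vec[OF c] std_small_cnum]]
        by (rule eventually_mono[OF ev]) blast
      also have "\<dots> = pr N b (hc A' \<xi>' (\<lambda>p. coef (\<beta> p) (X (pfst p))))"
        unfolding b_def hc_def by (rule los_pr[OF g' std_small_vec[OF c] std_small_cnum])
      also have "hc A' \<xi>' (\<lambda>p. coef (\<beta> p) (X (pfst p))) = f b"
        unfolding f_def b_def using vip_star1[OF g' c bfam_img[OF e'(1)]] hc1_hc[OF g'] e'(2) by simp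
      finally show ?thesis .
    qed
    ultimately show "y \<in> {pr N b (f b) |b. b \<in> spec S}" by blast
  qed
  then have "elts N (graph1 N (spec S) f) = elts N (star1 N A \<gamma> \<xi>)" using el by simp
  from set_ext[OF na nb this] show ?thesis by (simp add: \<gamma>_def)
qed

lemma bounded_of_bool: "bounded (range (\<lambda>t. of_bool (t \<in> S) :: complex))"
  by (auto simp: bounded_iff intro!: exI[of _ 1])

text \<open>Index by index, the sum of the |\<langle>b, x\<rangle>|^2 over the eigenvalues in S is
  the quadratic form of the indicator of S applied to the compression. In the limit the hyperfinite
  sum becomes the quadratic form of \<open>M\<close> at that indicator.\<close>

lemma hypersum_spec:
  fixes S :: "real set"
  assumes X: "bfam A \<xi> \<pi> X"
  defines "m \<equiv> ip eF (Sh A \<xi> X) (M (\<lambda>t. of_bool (t \<in> S)) (Sh A \<xi> X))"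
  shows "std_part N (hypersum N G (spec S) (\<lambda>b. hc1 N (\<lambda>z. of_real ((cmod z)\<^sup>2)) (vip N G b (star1 N A X \<xi>)))) = m"
    "of_real (Re m) = m" "0 \<le> Re m"
proof -
  note o = bfam_over[OF X] and g = bfam_generic[OF X]
  note mb = bfam_mu[OF X bounded_of_bool, of S]
  define q where "q a = (\<Sum>b\<in>{b \<in> SB (\<pi> a). lam b \<in> S}. (cmod (ip G b (X a)))\<^sup>2)" for a
  have eq: "ip G (X a) (mu (\<lambda>t. of_bool (t \<in> S)) (\<pi> a) (X a)) = of_real (q a)" if "a \<in> A" for a
    unfolding q_def by (rule ip_mu_indicator[OF over_base[OF o that] bspec[OF bfam_SF[OF X] that]])
  have "((\<lambda>a. ip G (X a) (mu (\<lambda>t. of_bool (t \<in> S)) (\<pi> a) (X a))) \<longlongrightarrow> m) (germ A \<xi>)"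
    using Sh_ip[OF X mb] by (simp add: m_def Sh_M[OF X bounded_of_bool])
  then have lim: "((\<lambda>a. complex_of_real (q a)) \<longlongrightarrow> m) (germ A \<xi>)"
    by (rule Lim_transform_eventually) (rule eventually_mono[OF eventually_in[OF g] eq])
  have "((\<lambda>a. 0 :: real) \<longlongrightarrow> Im m) (germ A \<xi>)" using tendsto_Im[OF lim] by simp
  then have "Im m = 0" using tendsto_unique[OF germ_nonbot[OF g] _ tendsto_const] by blast
  then show "of_real (Re m) = m" by (simp add: complex_eq_iff)
  have "(q \<longlongrightarrow> Re m) (germ A \<xi>)" using tendsto_Re[OF lim] by simp
  then show "0 \<le> Re m" by (rule tendsto_lowerbound[OF _ always_eventually germ_nonbot[OF g]]) (simp add: q_def sum_nonneg)
  have c: "(\<lambda>a. coef_graph S (\<pi> a) (X a)) ` A \<subseteq> finite_functions N G" using elts_coef_graph(2)[OF over_base[OF o]] by blast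
  have "hypersum N G (spec S) (\<lambda>b. hc1 N (\<lambda>z. of_real ((cmod z)\<^sup>2)) (vip N G b (star1 N A X \<xi>)))
      = hc A \<xi> (\<lambda>a. finite_sum N (coef_graph S (\<pi> a) (X a)))"
    unfolding hypersum_def graph_spec[OF X] hc_def by (rule los_star1[OF g c finite_functions_small std_small_cnum])
  also have "\<dots> = hc A \<xi> (\<lambda>a. of_real (q a))"
    unfolding hc_eq[OF g] by (rule eventually_mono[OF eventually_in[OF g]])
      (simp add: elts_coef_graph(4)[OF over_base[OF o]] q_def)
  finally show "std_part N (hypersum N G (spec S) (\<lambda>b. hc1 N (\<lambda>z. of_real ((cmod z)\<^sup>2)) (vip N G b (star1 N A X \<xi>)))) = m"
    using std_part_hc[OF g lim] by simp
qed

end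

section \<open>The image of the Loeb measure on the real line, and the conclusion\<close>

locale loeb_spectral = compression_eigen N G u F B v \<Lambda> A0 \<xi>0 SF SB
  for N :: "'w universe" and G u F B v \<Lambda> A0 \<xi>0 SF SB +
  fixes \<nu> :: "'w set \<Rightarrow> 'w measure" and varpi :: "'w set \<Rightarrow> 'w set \<Rightarrow> 'w set"
  assumes loeb: "loeb_spectral_measure N G F B \<nu> varpi"
begin

lemma measure_spec:
  assumes h: "h \<in> car eF"
  shows "space (\<nu> h) = elts N B" "sets (\<nu> h) = loeb_sets N B"
    "of_real (measure (\<nu> h) (spec S)) = ip eF h (M (\<lambda>t. of_bool (t \<in> S)) h)" "finite_measure (\<nu> h)"
proof -
  obtain A \<xi> \<pi> X where X: "bfam A \<xi> \<pi> X" "h = Sh A \<xi> X" by (rule represent_hull1[OF h])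
  have "loeb_measure N G B (star1 N A X \<xi>) (\<nu> (shadow N G F (star1 N A X \<xi>)))"
    using loeb bfam_Bd[OF X(1)] unfolding loeb_spectral_measure_def by blast
  then have L: "loeb_measure N G B (star1 N A X \<xi>) (\<nu> h)" by (simp add: X(2) Sh_def)
  show sp: "space (\<nu> h) = elts N B" "sets (\<nu> h) = loeb_sets N B" using L by (simp_all add: loeb_measure_def)
  have e: "emeasure (\<nu> h) (spec S) = ennreal (Re (ip eF h (M (\<lambda>t. of_bool (t \<in> S)) h)))" for S
    using L spec_internal[of S] hypersum_spec(1)[OF X(1), of S] by (simp add: loeb_measure_def X(2))
  show "of_real (measure (\<nu> h) (spec S)) = ip eF h (M (\<lambda>t. of_bool (t \<in> S)) h)"
    using hypersum_spec(2,3)[OF X(1), of S] by (simp add: measure_def e X(2)[symmetric])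
  show "finite_measure (\<nu> h)" using e[of UNIV] by (intro finite_measureI) (simp add: sp spec_UNIV)
qed

lemma spec_loeb: "spec S \<in> loeb_sets N B"
  unfolding loeb_sets_def by (rule sigma_sets.Basic[OF spec_internal])

lemma Bfin_loeb: "Bfin \<in> loeb_sets N B"
  unfolding Bfin_eq loeb_sets_def by (rule sigma_sets.Union) (use spec_loeb in \<open>simp add: loeb_sets_def\<close>)

lemma zer_hull: "zer eF \<in> car eF" by simp

text \<open>The closure properties of the \<sigma>-algebra are borrowed from the measure space
  \<open>\<nu> (zer eF)\<close>, whose measurable sets are the Loeb sets.\<close>

lemma sublevel_loeb: "eigen_sublevel N B \<Lambda> r \<in> loeb_sets N B"
proof -
  note s = measure_spec(2)[OF zer_hull]
  have "spec S \<in> sets (\<nu> (zer eF))" "Bfin \<in> sets (\<nu> (zer eF))" for S using s spec_loeb Bfin_loeb by simp_all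
  then have "eigen_sublevel N B \<Lambda> r \<in> sets (\<nu> (zer eF))"
    unfolding eigen_sublevel_eq by (intro sets.Int sets.countable_INT) auto
  then show ?thesis using s by simp
qed

text \<open>Restriction to \<open>Bfin\<close> discards the mass at infinite eigenvalues, so the
  total mass is the quadratic form of \<open>varpi Bfin\<close>.\<close>

definition spectral_measure :: "'w set \<Rightarrow> real measure" where
  "spectral_measure h = distr (restrict_space (\<nu> h) Bfin) borel val"

lemma Bfin_sets:
  assumes h: "h \<in> car eF"
  shows "Bfin \<in> sets (\<nu> h)" "Bfin \<inter> space (\<nu> h) \<in> sets (\<nu> h)" "space (restrict_space (\<nu> h) Bfin) = Bfin"
  using measure_spec(1,2)[OF h] Bfin_loeb by (auto simp: Bfin_def space_restrict_space Int_absorb2)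

text \<open>Within \<open>Bfin\<close> the sublevel sets of \<open>val\<close> are the sets
  \<open>eigen_sublevel\<close>, already known to be Loeb sets.\<close>

lemma val_measurable:
  assumes h: "h \<in> car eF" shows "val \<in> borel_measurable (restrict_space (\<nu> h) Bfin)"
  unfolding borel_measurable_iff_le Bfin_sets(3)[OF h] sets_restrict_space_iff[OF Bfin_sets(2)[OF h]]
proof (intro allI conjI)
  fix a
  have "{w \<in> Bfin. val w \<le> a} = eigen_sublevel N B \<Lambda> a" by (auto simp: Bfin_def val_def eigen_sublevel_def)
  then show "{w \<in> Bfin. val w \<le> a} \<in> sets (\<nu> h)" using sublevel_loeb measure_spec(2)[OF h] by simp
qed blast

lemma spectral_measure_finite:
  assumes h: "h \<in> car eF" shows "finite_borel_measure (spectral_measure h)"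
proof -
  interpret finite_measure "\<nu> h" by (rule measure_spec(4)[OF h])
  interpret R: finite_measure "restrict_space (\<nu> h) Bfin"
    by (rule finite_measure_restrict_space[OF finite_measure_axioms Bfin_sets(1)[OF h]])
  interpret D: finite_measure "spectral_measure h"
    unfolding spectral_measure_def by (rule R.finite_measure_distr[OF val_measurable[OF h]])
  show ?thesis by unfold_locales (simp add: spectral_measure_def)
qed

lemma measure_spectral:
  assumes h: "h \<in> car eF" and S: "S \<in> sets borel"
  shows "measure (spectral_measure h) S = measure (\<nu> h) {b \<in> Bfin. val b \<in> S}"
proof -
  have "measure (spectral_measure h) S = measure (restrict_space (\<nu> h) Bfin) (val -` S \<inter> Bfin)"
    unfolding spectral_measure_def using measure_distr[OF val_measurable[OF h] S] Bfin_sets(3)[OF h] by simp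
  also have "\<dots> = measure (\<nu> h) (val -` S \<inter> Bfin)" by (rule measure_restrict_space[OF Bfin_sets(2)[OF h]]) blast
  finally show ?thesis by (simp add: vimage_def Int_def conj_commute)
qed

lemma M_sum:
  assumes h: "h \<in> car eF" and J: "finite J"
  shows "bounded (range (\<lambda>t. \<Sum>k\<in>J. of_real (c k) * of_bool (t \<in> S k) :: complex)) \<and>
    ip eF h (M (\<lambda>t. \<Sum>k\<in>J. of_real (c k) * of_bool (t \<in> S k)) h) = of_real (\<Sum>k\<in>J. c k * measure (\<nu> h) (spec (S k)))"
  using J
proof (induction J rule: finite_induct)
  case empty
  have "ip eF h (M (\<lambda>_. 0) h) = 0" using M_const[OF h, of 0] h by simp
  then show ?case by simp
next
  case (insert k J)
  define \<phi> where "\<phi> = (\<lambda>t. \<Sum>k\<in>J. of_real (c k) * of_bool (t \<in> S k) :: complex)"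
  have b: "bounded (range \<phi>)" and i: "ip eF h (M \<phi> h) = of_real (\<Sum>k\<in>J. c k * measure (\<nu> h) (spec (S k)))"
    using insert.IH by (simp_all add: \<phi>_def)
  have bk: "bounded (range (\<lambda>t. of_real (c k) * of_bool (t \<in> S k) :: complex))"
    by (rule bounded_range_mult[OF bounded_range_const bounded_of_bool])
  have Mk: "M (\<lambda>t. of_real (c k) * of_bool (t \<in> S k)) h = scl eF (of_real (c k)) (M (\<lambda>t. of_bool (t \<in> S k)) h)"
    using M_mult[OF bounded_range_const bounded_of_bool h, of "of_real (c k)" "S k"] M_const[OF M_in[OF bounded_of_bool h, of "S k"]]
    by simp
  have eq: "(\<lambda>t. \<Sum>k\<in>insert k J. of_real (c k) * of_bool (t \<in> S k)) = (\<lambda>t. of_real (c k) * of_bool (t \<in> S k) + \<phi> t)"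
    by (rule ext) (simp only: \<phi>_def sum.insert[OF insert.hyps])
  have "range (\<lambda>t. of_real (c k) * of_bool (t \<in> S k) + \<phi> t) \<subseteq> (\<lambda>(x, y). x + y) ` (range (\<lambda>t. of_real (c k) * of_bool (t \<in> S k)) \<times> range \<phi>)"
    by auto
  then have bs: "bounded (range (\<lambda>t. of_real (c k) * of_bool (t \<in> S k) + \<phi> t))"
    by (rule bounded_subset[OF bounded_plus[OF bk b]])
  have "ip eF h (M (\<lambda>t. of_real (c k) * of_bool (t \<in> S k) + \<phi> t) h) =
      of_real (c k * measure (\<nu> h) (spec (S k)) + (\<Sum>k\<in>J. c k * measure (\<nu> h) (spec (S k))))"
    unfolding M_add_fun[OF bk b h] Mk
    using h M_in[OF bounded_of_bool h, of "S k"] M_in[OF b h] measure_spec(3)[OF h, of "S k"] i by simp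
  then show ?case unfolding eq using bs insert.hyps by simp
qed

text \<open>For step functions over arbitrary sets the formula holds with the internal sets
  \<open>spec (S k)\<close>, by \<open>measure_spec\<close>. A function in \<open>C0\<close> is
  uniformly close to a step function, and \<open>eigenvector_C0\<close> makes the corresponding
  functions on the basis equally close.\<close>

lemma M_int:
  assumes f: "C0 f" and h: "h \<in> car eF"
  shows "ip eF h (M (\<lambda>t. of_real (f t)) h) = of_real (\<integral>t. f t \<partial>spectral_measure h)"
proof -
  interpret finite_measure "\<nu> h" by (rule measure_spec(4)[OF h])
  define w where "w b = indicator Bfin b * f (val b)" for b
  have fm: "f \<in> borel_measurable borel" using f by (simp add: C0_def borel_measurable_continuous_onI)
  have fb: "bounded (range f)" by (rule C0_bounded[OF f])
  have fb': "bounded (range (\<lambda>t. complex_of_real (f t)))" using fb by (auto simp: bounded_iff)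
  obtain C where C: "\<And>t. \<bar>f t\<bar> \<le> C" using fb by (auto simp: bounded_iff)
  have "(\<lambda>b. f (val b)) \<in> borel_measurable (restrict_space (\<nu> h) Bfin)" by (rule measurable_compose[OF val_measurable[OF h] fm])
  then have wm: "w \<in> borel_measurable (\<nu> h)"
    unfolding borel_measurable_restrict_space_iff[OF Bfin_sets(2)[OF h]] by (simp only: w_def[abs_def] real_scaleR_def)
  have "norm (w b) \<le> C" for b using C[of "val b"] by (auto simp: w_def indicator_def)
  then have wi: "integrable (\<nu> h) w" by (intro integrable_const_bound[of _ C] wm AE_I2)
  have int: "(\<integral>t. f t \<partial>spectral_measure h) = (\<integral>b. w b \<partial>\<nu> h)"
    unfolding spectral_measure_def integral_distr[OF val_measurable[OF h] fm]
    using integral_restrict_space[OF Bfin_sets(2)[OF h], of "\<lambda>b. f (val b)"] by (simp add: set_lebesgue_integral_def w_def[abs_def])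
  \<comment> \<open>The two terms bound the two errors per unit of e: the mass on the side of the
    integral, the squared norm of h on the side of the operator.\<close>
  define I where "I = measure (\<nu> h) (space (\<nu> h)) + nrm eF h * nrm eF h"
  have I0: "I \<ge> 0" by (simp add: I_def h)
  have bound: "cmod (ip eF h (M (\<lambda>t. of_real (f t)) h) - of_real (\<integral>b. w b \<partial>\<nu> h)) \<le> e * I" if e: "e > 0" for e
  proof (rule level_approximation[OF fb e])
    fix f' :: "real \<Rightarrow> real" and J :: "int set" and c S
    assume s: "\<And>t. f' t = (\<Sum>k\<in>J. c k * of_bool (t \<in> S k))" "finite J" "\<And>t. \<bar>f t - f' t\<bar> \<le> e"
    define W where "W b = (\<Sum>k\<in>J. c k * indicator (spec (S k)) b)" for b
    have sp: "spec (S k) \<in> sets (\<nu> h)" for k using spec_loeb measure_spec(2)[OF h] by simp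
    have iW: "integrable (\<nu> h) W" unfolding W_def
      by (intro Bochner_Integration.integrable_sum integrable_mult_right integrable_real_indicator sp) (simp add: less_top[symmetric])
    have WI: "(\<integral>b. W b \<partial>\<nu> h) = (\<Sum>k\<in>J. c k * measure (\<nu> h) (spec (S k)))"
      unfolding W_def using sp sets.sets_into_space[OF sp]
      by (subst Bochner_Integration.integral_sum) (auto simp: less_top[symmetric] Int_absorb2)
    have d: "\<bar>w b - W b\<bar> \<le> e" if "b \<in> space (\<nu> h)" for b
      using eigenvector_C0[OF _ f s] that measure_spec(1)[OF h] by (simp add: w_def W_def)
    have "\<bar>(\<integral>b. w b \<partial>\<nu> h) - (\<integral>b. W b \<partial>\<nu> h)\<bar> = \<bar>\<integral>b. w b - W b \<partial>\<nu> h\<bar>"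
      by (simp add: Bochner_Integration.integral_diff[OF wi iW])
    also have "\<dots> \<le> (\<integral>b. \<bar>w b - W b\<bar> \<partial>\<nu> h)" by (rule integral_abs_bound)
    also have "\<dots> \<le> (\<integral>b. e \<partial>\<nu> h)"
      by (rule integral_mono) (use wi iW d in auto)
    finally have 1: "\<bar>(\<integral>b. w b \<partial>\<nu> h) - (\<integral>b. W b \<partial>\<nu> h)\<bar> \<le> e * measure (\<nu> h) (space (\<nu> h))" by (simp add: mult.commute)
    have F': "(\<lambda>t. complex_of_real (f' t)) = (\<lambda>t. \<Sum>k\<in>J. of_real (c k) * of_bool (t \<in> S k))"
      by (rule ext) (simp add: s(1) of_bool_def if_distrib cong: if_cong)
    have b': "bounded (range (\<lambda>t. complex_of_real (f' t)))"
      and i': "ip eF h (M (\<lambda>t. of_real (f' t)) h) = of_real (\<integral>b. W b \<partial>\<nu> h)"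
      unfolding F' WI using M_sum[OF h s(2), of c S] by blast+
    define g where "g t = complex_of_real (f t - f' t)" for t
    have g: "cmod (g t) \<le> e" for t using s(3)[of t] by (simp only: g_def norm_of_real)
    have bg: "bounded (range g)" using g by (auto simp: bounded_iff)
    have "M (\<lambda>t. of_real (f t)) h = add eF (M (\<lambda>t. of_real (f' t)) h) (M g h)"
      using M_add_fun[OF b' bg h] by (simp add: g_def)
    then have "ip eF h (M (\<lambda>t. of_real (f t)) h) = of_real (\<integral>b. W b \<partial>\<nu> h) + ip eF h (M g h)"
      using h M_in[OF b' h] M_in[OF bg h] i' by simp
    then have "ip eF h (M (\<lambda>t. of_real (f t)) h) - of_real (\<integral>b. w b \<partial>\<nu> h) =
        ip eF h (M g h) - of_real ((\<integral>b. w b \<partial>\<nu> h) - (\<integral>b. W b \<partial>\<nu> h))" by simp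
    then have "cmod (ip eF h (M (\<lambda>t. of_real (f t)) h) - of_real (\<integral>b. w b \<partial>\<nu> h))
        \<le> cmod (ip eF h (M g h)) + \<bar>(\<integral>b. w b \<partial>\<nu> h) - (\<integral>b. W b \<partial>\<nu> h)\<bar>"
      using norm_triangle_ineq4[of "ip eF h (M g h)" "of_real ((\<integral>b. w b \<partial>\<nu> h) - (\<integral>b. W b \<partial>\<nu> h))"] by (simp only: norm_of_real)
    moreover have "cmod (ip eF h (M g h)) \<le> e * (nrm eF h * nrm eF h)"
    proof -
      have "cmod (ip eF h (M g h)) \<le> nrm eF h * nrm eF (M g h)" by (rule eF.cauchy_schwarz[OF h M_in[OF bg h]])
      also have "\<dots> \<le> nrm eF h * (e * nrm eF h)" by (rule mult_left_mono[OF M_bound[OF g h]]) (simp add: h)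
      finally show ?thesis by (simp add: mult.left_commute)
    qed
    ultimately show "cmod (ip eF h (M (\<lambda>t. of_real (f t)) h) - of_real (\<integral>b. w b \<partial>\<nu> h)) \<le> e * I"
      using 1 by (simp add: I_def distrib_left)
  qed
  \<comment> \<open>Dividing by I + 1 instead of I covers the case I = 0.\<close>
  have small: "cmod (ip eF h (M (\<lambda>t. of_real (f t)) h) - of_real (\<integral>b. w b \<partial>\<nu> h)) \<le> e" if "e > 0" for e
  proof -
    have "e / (I + 1) * I \<le> e / (I + 1) * (I + 1)" using I0 \<open>e > 0\<close> by (intro mult_left_mono) simp_all
    also have "\<dots> = e" using I0 by simp
    finally show ?thesis using bound[of "e / (I + 1)"] I0 \<open>e > 0\<close> by (simp add: order_trans)
  qed
  have "cmod (ip eF h (M (\<lambda>t. of_real (f t)) h) - of_real (\<integral>b. w b \<partial>\<nu> h)) \<le> 0"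
    by (rule field_le_epsilon) (use small in simp)
  then show ?thesis unfolding int by simp
qed

lemma varpi:
  assumes "C \<in> loeb_sets N B"
  shows "orth_projector eF (varpi C)" "h \<in> car eF \<Longrightarrow> ip eF h (varpi C h) = of_real (measure (\<nu> h) C)"
  using loeb assms by (auto simp: loeb_spectral_measure_def)

lemma spectral_calculus:
  "spectral_calculus eF M \<Gamma> spectral_measure (\<lambda>r. varpi (eigen_sublevel N B \<Lambda> r)) (varpi Bfin)"
proof (rule spectral_calculus.intro)
  show "prehilbert eF" by (rule hull_prehilbert)
  show "ip eF h (varpi (eigen_sublevel N B \<Lambda> t) h) = of_real (measure (spectral_measure h) {..t})" if h: "h \<in> car eF" for t h
  proof -
    have "{b \<in> Bfin. val b \<in> {..t}} = eigen_sublevel N B \<Lambda> t" by (auto simp: Bfin_def val_def eigen_sublevel_def)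
    then show ?thesis using measure_spectral[OF h, of "{..t}"] varpi(2)[OF sublevel_loeb h] by simp
  qed
  show "ip eF h (varpi Bfin h) = of_real (measure (spectral_measure h) UNIV)" if h: "h \<in> car eF" for h
    using measure_spectral[OF h, of UNIV] varpi(2)[OF Bfin_loeb h] by simp
qed (fact M_in M_adj M_mult M_add_fun M_const M_bound spectral_measure_finite M_int \<Gamma>_sub \<Gamma>_M M_\<Gamma> \<Gamma>_complete
  | rule varpi(1) sublevel_loeb Bfin_loeb)+

lemma spectral_reduction:
  assumes "hilbert_completion G Gh j" "selfadjoint Gh (closure_graph Gh {(j x, j (u x)) |x. x \<in> car G})"
  shows "spectral_reduction eF M \<Gamma> spectral_measure (\<lambda>r. varpi (eigen_sublevel N B \<Lambda> r)) (varpi Bfin) G emb u Gh j"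
proof -
  interpret spectral_calculus eF M \<Gamma> spectral_measure "\<lambda>r. varpi (eigen_sublevel N B \<Lambda> r)" "varpi Bfin"
    by (rule spectral_calculus)
  show ?thesis
    by unfold_locales (fact G.prehilbert emb_linear emb_ip u_lin emb_\<Gamma> assms)+
qed

text \<open>The concrete \<open>hull_fin\<close>, \<open>assoc_op\<close> and
  \<open>hull_closure\<close> are identified with \<open>Hf\<close>, T and K of the abstract
  calculus; for the first, \<open>cayley_fixed\<close> replaces the Cayley condition by the kernel
  of the resolvent.\<close>

lemma conclusion:
  assumes c: "hilbert_completion G Gh j" "selfadjoint Gh (closure_graph Gh {(j x, j (u x)) |x. x \<in> car G})"
    and E: "\<forall>r. E r = varpi (eigen_sublevel N B \<Lambda> r)"
  shows
    "(\<forall>x\<in>car G. hull_embed N G F x \<in> Domain (assoc_op N G F v) \<and>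
        (\<forall>y. (hull_embed N G F x, y) \<in> assoc_op N G F v \<longrightarrow> y = hull_embed N G F (u x))) \<and>
     spectral_family (hull_fin N G F v) E (assoc_op N G F v) \<and>
     (\<forall>r. E r ` car (hull_closure N G F) \<subseteq> car (hull_closure N G F)) \<and>
     spectral_family (hull_closure N G F) E
       (closure_graph (hull_closure N G F) {(hull_embed N G F x, hull_embed N G F (u x)) |x. x \<in> car G})"
proof -
  have E': "E = (\<lambda>r. varpi (eigen_sublevel N B \<Lambda> r))" using E by blast
  interpret R: spectral_reduction eF M \<Gamma> spectral_measure E "varpi Bfin" G emb u Gh j
    unfolding E' by (rule spectral_reduction[OF c])
  have fin: "hull_fin N G F v = eF\<lparr>car := R.Hf\<rparr>"
    unfolding hull_fin_def R.Hf_def using cayley_fixed by (intro arg_cong[where f = "\<lambda>S. eF\<lparr>car := S\<rparr>"]) blast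
  have T: "assoc_op N G F v = R.T" unfolding assoc_op_def fin R.T_def by simp
  have K: "hull_closure N G F = eF\<lparr>car := R.K\<rparr>" by (simp add: hull_closure_def R.K_def)
  show ?thesis
  proof (intro conjI ballI allI impI)
    fix x assume x: "x \<in> car G"
    show "emb x \<in> Domain (assoc_op N G F v)" unfolding T using R.e_T[OF x] by blast
    show "y = emb (u x)" if "(emb x, y) \<in> assoc_op N G F v" for y
      using that R.e_T[OF x] unfolding T by (rule single_valuedD[OF R.T_single_valued])
  next
    show "spectral_family (hull_fin N G F v) E (assoc_op N G F v)" unfolding fin T by (rule R.spectral_family_T)
    show "E r ` car (hull_closure N G F) \<subseteq> car (hull_closure N G F)" for r unfolding K using R.E_K by auto
    show "spectral_family (hull_closure N G F) E
       (closure_graph (hull_closure N G F) {(hull_embed N G F x, hull_embed N G F (u x)) |x. x \<in> car G})"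
      unfolding K using R.spectral_family_S unfolding R.S_def .
  qed
qed

end

theorem proposition16:
  fixes N :: "'w universe"
    and G :: "'w ips" and \<tau> :: "'w topology" and p :: "'w \<Rightarrow> 'w \<Rightarrow> complex"
    and u :: "'w \<Rightarrow> 'w"
    and Gh :: "'c ips" and j :: "'w \<Rightarrow> 'c"
    and F B :: 'w and v \<Lambda> :: "'w \<Rightarrow> 'w"
    and \<nu> :: "'w set \<Rightarrow> 'w measure" and varpi :: "'w set \<Rightarrow> 'w set \<Rightarrow> 'w set"
    and E :: "real \<Rightarrow> 'w set \<Rightarrow> 'w set"
  assumes "nonstandard_universe N"
    and "space_in_universe N G" and "locally_convex G \<tau>"
    and "hermitian_product G (ip G)" and "continuous_form \<tau> (ip G)"
    and "linear_map G G u" and "continuous_map \<tau> \<tau> u"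
    and "\<forall>x\<in>car G. \<forall>y\<in>car G. ip G (u x) y = ip G x (u y)"
    and "hilbert_completion G Gh j"
    and "selfadjoint Gh (closure_graph Gh {(j x, j (u x)) |x. x \<in> car G})"
    and "hermitian_product G p" and "continuous_form \<tau> p" and "strongly_nuclear_rel G p (ip G)"
    and "internal_subspace N G F" and "hyperfinite_dim N G F"
    and "\<forall>g\<in>car G. star N g \<in> elts N F"
    and "v = compression N G F u"
    and "orthonormal_hyperbasis N G F B"
    and "\<forall>b\<in>elts N B. \<Lambda> b \<in> hreal N \<and> v b = vscl N G (\<Lambda> b) b"
    and "loeb_spectral_measure N G F B \<nu> varpi"
    and "\<forall>r. E r = varpi (eigen_sublevel N B \<Lambda> r)"
  shows
    "(\<forall>x\<in>car G. hull_embed N G F x \<in> Domain (assoc_op N G F v) \<and>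
        (\<forall>y. (hull_embed N G F x, y) \<in> assoc_op N G F v \<longrightarrow> y = hull_embed N G F (u x))) \<and>
     spectral_family (hull_fin N G F v) E (assoc_op N G F v) \<and>
     (\<forall>r. E r ` car (hull_closure N G F) \<subseteq> car (hull_closure N G F)) \<and>
     spectral_family (hull_closure N G F) E
       (closure_graph (hull_closure N G F) {(hull_embed N G F x, hull_embed N G F (u x)) |x. x \<in> car G})"
proof -
  interpret nonstandard_space N G using assms(1,2,4) by unfold_locales
  obtain A \<xi> SF SB where b: "generic A \<xi>" "elts N F = iset A \<xi> SF" "elts N B = iset A \<xi> SB"
    "\<And>a. a \<in> A \<Longrightarrow> subspace_of G (SF a)" "\<And>a. a \<in> A \<Longrightarrow> finite (SB a)" "\<And>a. a \<in> A \<Longrightarrow> SB a \<subseteq> SF a"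
    "\<And>a. a \<in> A \<Longrightarrow> G.orthonormal (SB a)"
    "\<And>a x. a \<in> A \<Longrightarrow> x \<in> SF a \<Longrightarrow> \<forall>b\<in>SB a. ip G b x = 0 \<Longrightarrow> x = zer G"
    using findim_base[OF assms(14,15,18)] by blast
  interpret C: compression_base N G u F B v \<Lambda> A \<xi> SF SB
    by unfold_locales (use assms(6,8,16,17,19) b in blast)+
  \<comment> \<open>The eigenvector property holds only eventually over A; over A' it holds at every
    index. F and B keep their representations.\<close>
  define A' where "A' = {a \<in> A. \<forall>b\<in>SB a. \<exists>r. C.compr a b = scl G (complex_of_real r) b}"
  have g: "generic A' \<xi>" unfolding A'_def by (rule generic_shrink(1)[OF b(1) C.eventually_eigen])
  have F: "elts N F = iset A' \<xi> SF"
    unfolding A'_def b(2) by (rule iset_shrink[OF b(1) C.eventually_eigen G_small C.SF_car, symmetric])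
  have B: "elts N B = iset A' \<xi> SB"
    unfolding A'_def b(3) by (rule iset_shrink[OF b(1) C.eventually_eigen G_small C.SB_car, symmetric])
  have sub: "a \<in> A" if "a \<in> A'" for a using that by (simp add: A'_def)
  \<comment> \<open>The same locale is interpreted again over the smaller index set. The sectional
    compression depends only on \<open>SB\<close> and u, so the property that defines A' is
    literally the one required next.\<close>
  interpret D: compression_base N G u F B v \<Lambda> A' \<xi> SF SB
    by unfold_locales (use assms(6,8,16,17,19) b(4-8) g F B sub in blast)+
  interpret loeb_spectral N G u F B v \<Lambda> A' \<xi> SF SB \<nu> varpi
    by unfold_locales (use assms(20) in \<open>auto simp: A'_def D.compr_def C.compr_def\<close>)
  show ?thesis by (rule conclusion[OF assms(9,10,21)])
qed

end
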